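(* Let $k$ be an algebraically closed field of characteristic zero and let $R$ be a finitely generated $k$-algebra of Krull dimension $d\ge 1$. Let $n\ge 1$ and let $R[Z_1,\dots,Z_n]$ be the polynomial ring in $n$ variables over $R$. Then every residual coordinate in $R[Z_1,\dots,Z_n]$ is an $r$-stable coordinate in $R[Z_1,\dots,Z_n]$, where $r=(2^d-1)n-2^{d-1}(n-1)=2^{d-1}(n+1)-n$.
   Context: All rings are commutative with unity. For a ring $R$ and a polynomial ring $A=R[X_1,\dots,X_n]$ in $n$ variables, an element $F\in A$ is called a coordinate in $A$ (over $R$) if there exist $F_2,\dots,F_n\in A$ such that $A=R[F,F_2,\dots,F_n]$. For $m\ge 0$, $F\in A$ is called an $m$-stable coordinate in $A$ if $F$ is a coordinate (over $R$) in the polynomial ring $A[T_1,\dots,T_m]=R[X_1,\dots,X_n,T_1,\dots,T_m]$ in $m$ further variables. $F\in A$ is called a residual coordinate in $A$ if for each prime ideal $\mathfrak p$ of $R$, with residue field $k(\mathfrak p)=R_{\mathfrak p}/\mathfrak pR_{\mathfrak p}$, the ring $A\otimes_R k(\mathfrak p)$ is a polynomial ring in $n-1$ variables over $k(\mathfrak p)[\overline F]$, where $\overline F$ is the image of $F$ in $A\otimes_R k(\mathfrak p)$; that is, $\overline F$ is a coordinate in $k(\mathfrak p)[X_1,\dots,X_n]$ over $k(\mathfrak p)$. *)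

theory Defs
  imports
    "HOL-Algebra.Algebraic_Closure"
    "HOL-Algebra.Generated_Rings"
    "HOL-Library.Extended_Nat"
begin

section \<open>Polynomial rings\<close>

text \<open>
  The library theory on indexed polynomials has the carrier (finitely supported functions from
  monomials, i.e. multisets of variables in \<open>I\<close>, to coefficients), constants and addition,
  but no product of two polynomials. Here the ring structure is completed by convolution. Note that
  the carrier for \<open>I\<close> is contained in the carrier for any larger index set, so that
  \<open>R[X\<^sub>1,\<dots>,X\<^sub>n] \<subseteq> R[X\<^sub>1,\<dots>,X\<^sub>n,T\<^sub>1,\<dots>,T\<^sub>m]\<close> holds literally.
\<close>

definition mpoly_mult ::
    "('a, 'm) ring_scheme \<Rightarrow> ('c multiset \<Rightarrow> 'a) \<Rightarrow> ('c multiset \<Rightarrow> 'a) \<Rightarrow> ('c multiset \<Rightarrow> 'a)"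
  where "mpoly_mult R P Q = (\<lambda>m. \<Oplus>\<^bsub>R\<^esub>a\<in>{a. a \<subseteq># m}. P a \<otimes>\<^bsub>R\<^esub> Q (m - a))"

definition mpoly_ring :: "('a, 'm) ring_scheme \<Rightarrow> 'c set \<Rightarrow> ('c multiset \<Rightarrow> 'a) ring"
  where "mpoly_ring R I =
    \<lparr>carrier = ring.indexed_pset R I (carrier R),
     monoid.mult = mpoly_mult R,
     one = ring.indexed_const R \<one>\<^bsub>R\<^esub>,
     zero = ring.indexed_const R \<zero>\<^bsub>R\<^esub>,
     add = ring.indexed_padd R\<rparr>"


section \<open>Localizations and residue fields\<close>

definition frac_rel :: "('a, 'm) ring_scheme \<Rightarrow> 'a set \<Rightarrow> (('a \<times> 'a) \<times> ('a \<times> 'a)) set"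
  where "frac_rel R S =
    {((a, s), (b, t)). a \<in> carrier R \<and> s \<in> S \<and> b \<in> carrier R \<and> t \<in> S \<and>
      (\<exists>u\<in>S. u \<otimes>\<^bsub>R\<^esub> (t \<otimes>\<^bsub>R\<^esub> a \<ominus>\<^bsub>R\<^esub> s \<otimes>\<^bsub>R\<^esub> b) = \<zero>\<^bsub>R\<^esub>)}"

definition fraction :: "('a, 'm) ring_scheme \<Rightarrow> 'a set \<Rightarrow> 'a \<Rightarrow> 'a \<Rightarrow> ('a \<times> 'a) set"
  where "fraction R S a s = frac_rel R S `` {(a, s)}"

definition localization :: "('a, 'm) ring_scheme \<Rightarrow> 'a set \<Rightarrow> ('a \<times> 'a) set ring"
  where "localization R S =
    \<lparr>carrier = (carrier R \<times> S) // frac_rel R S,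
     monoid.mult = (\<lambda>A B. \<Union>x\<in>A. \<Union>y\<in>B. fraction R S (fst x \<otimes>\<^bsub>R\<^esub> fst y) (snd x \<otimes>\<^bsub>R\<^esub> snd y)),
     one = fraction R S \<one>\<^bsub>R\<^esub> \<one>\<^bsub>R\<^esub>,
     zero = fraction R S \<zero>\<^bsub>R\<^esub> \<one>\<^bsub>R\<^esub>,
     add = (\<lambda>A B. \<Union>x\<in>A. \<Union>y\<in>B.
       fraction R S (snd y \<otimes>\<^bsub>R\<^esub> fst x \<oplus>\<^bsub>R\<^esub> snd x \<otimes>\<^bsub>R\<^esub> fst y) (snd x \<otimes>\<^bsub>R\<^esub> snd y))\<rparr>"

definition local_ring_at :: "('a, 'm) ring_scheme \<Rightarrow> 'a set \<Rightarrow> ('a \<times> 'a) set ring"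
  where "local_ring_at R P = localization R (carrier R - P)"

text \<open>The extension \<open>PR\<^sub>P\<close> of \<open>P\<close> along \<open>R \<rightarrow> R\<^sub>P\<close>:\<close>

definition extended_ideal :: "('a, 'm) ring_scheme \<Rightarrow> 'a set \<Rightarrow> ('a \<times> 'a) set set"
  where "extended_ideal R P =
    genideal (local_ring_at R P) ((\<lambda>a. fraction R (carrier R - P) a \<one>\<^bsub>R\<^esub>) ` P)"

definition residue_field :: "('a, 'm) ring_scheme \<Rightarrow> 'a set \<Rightarrow> ('a \<times> 'a) set set ring"
  where "residue_field R P = local_ring_at R P Quot extended_ideal R P"

definition residue_map :: "('a, 'm) ring_scheme \<Rightarrow> 'a set \<Rightarrow> 'a \<Rightarrow> ('a \<times> 'a) set set"
  where "residue_map R P a =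
    extended_ideal R P +>\<^bsub>local_ring_at R P\<^esub> fraction R (carrier R - P) a \<one>\<^bsub>R\<^esub>"


section \<open>Coordinates\<close>

text \<open>
  The polynomial ring in \<open>n\<close> variables is the one with index set \<open>{..<n}\<close>. The list \<open>Fs\<close> consists
  of \<open>F\<^sub>2, \<dots>, F\<^sub>n\<close>.
\<close>

definition coordinate :: "('a, 'm) ring_scheme \<Rightarrow> nat \<Rightarrow> (nat multiset \<Rightarrow> 'a) \<Rightarrow> bool"
  where "coordinate R n F \<longleftrightarrow>
    (\<exists>Fs. length (F # Fs) = n \<and>
      set (F # Fs) \<subseteq> carrier (mpoly_ring R {..<n}) \<and>
      carrier (mpoly_ring R {..<n}) =
        generate_ring (mpoly_ring R {..<n}) (ring.indexed_const R ` carrier R \<union> set (F # Fs)))"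

definition stable_coordinate :: "('a, 'm) ring_scheme \<Rightarrow> nat \<Rightarrow> nat \<Rightarrow> (nat multiset \<Rightarrow> 'a) \<Rightarrow> bool"
  where "stable_coordinate R n m F \<longleftrightarrow>
    F \<in> carrier (mpoly_ring R {..<n}) \<and> coordinate R (n + m) F"

text \<open>
  The base change of \<open>R[X\<^sub>1,\<dots>,X\<^sub>n]\<close> to the residue field \<open>k(P)\<close> is identified with
  \<open>k(P)[X\<^sub>1,\<dots>,X\<^sub>n]\<close>; the image of \<open>F\<close> is obtained by mapping its coefficients.
\<close>

definition residual_coordinate :: "('a, 'm) ring_scheme \<Rightarrow> nat \<Rightarrow> (nat multiset \<Rightarrow> 'a) \<Rightarrow> bool"
  where "residual_coordinate R n F \<longleftrightarrow>
    F \<in> carrier (mpoly_ring R {..<n}) \<and>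
    (\<forall>P. primeideal P R \<longrightarrow> coordinate (residue_field R P) n (residue_map R P \<circ> F))"


section \<open>Finitely generated algebras and Krull dimension\<close>

definition fin_gen_algebra :: "('k, 's) ring_scheme \<Rightarrow> ('k, 'a, 'm) module_scheme \<Rightarrow> bool"
  where "fin_gen_algebra k R \<longleftrightarrow> algebra k R \<and>
    (\<exists>S. finite S \<and> S \<subseteq> carrier R \<and>
      carrier R = generate_ring R ((\<lambda>c. c \<odot>\<^bsub>R\<^esub> \<one>\<^bsub>R\<^esub>) ` carrier k \<union> S))"

text \<open>The zero ring gets dimension \<open>0\<close> here, as the supremum of the empty set.\<close>

definition krull_dim :: "('a, 'm) ring_scheme \<Rightarrow> enat"
  where "krull_dim R =
    (SUP l\<in>{l. \<exists>p :: nat \<Rightarrow> 'a set. (\<forall>i\<le>l. primeideal (p i) R) \<and> (\<forall>i<l. p i \<subset> p (Suc i))}. enat l)"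


section \<open>The constructions yield rings and fields\<close>

subsection \<open>Polynomial rings\<close>

lemma finite_submultisets: "finite {a. a \<subseteq># (m :: 'c multiset)}"
proof -
  have "{a. a \<subseteq># m} \<subseteq> mset ` {xs. set xs \<subseteq> set_mset m \<and> length xs \<le> size m}"
  proof
    fix a assume "a \<in> {a. a \<subseteq># m}"
    then have a: "a \<subseteq># m" by simp
    obtain xs where "a = mset xs" by (metis ex_mset)
    with a show "a \<in> mset ` {xs. set xs \<subseteq> set_mset m \<and> length xs \<le> size m}"
      by (metis (mono_tags, lifting) imageI mem_Collect_eq set_mset_mono set_mset_mset
          size_mset size_mset_mono)
  qed
  moreover have "finite {xs. set xs \<subseteq> set_mset m \<and> length xs \<le> size m}"
    by (rule finite_lists_length_le) simp
  ultimately show ?thesis using finite_surj by blast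
qed

context cring
begin

lemma mpoly_mult_closed:
  assumes "carrier_coeff P" "carrier_coeff Q"
  shows "carrier_coeff (mpoly_mult R P Q)"
  using assms unfolding carrier_coeff_def mpoly_mult_def by (auto intro!: finsum_closed)

lemma mpoly_mult_comm:
  fixes P Q :: "'c multiset \<Rightarrow> 'a"
  assumes "carrier_coeff P" "carrier_coeff Q"
  shows "mpoly_mult R P Q = mpoly_mult R Q P"
proof
  fix m :: "'c multiset"
  have inj: "inj_on (\<lambda>a. m - a) {a. a \<subseteq># m}"
    by (rule inj_onI) (metis mem_Collect_eq subset_mset.add_diff_inverse add_right_cancel subset_mset.diff_add)
  have dbl: "m - (m - a) = a" if "a \<subseteq># m" for a
    using that by (simp add: multiset_eq_iff subseteq_mset_def)
  have im: "(\<lambda>a. m - a) ` {a. a \<subseteq># m} = {a. a \<subseteq># m}"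
  proof (intro equalityI subsetI)
    fix b assume "b \<in> {a. a \<subseteq># m}"
    then have "b = m - (m - b)" "m - b \<subseteq># m"
      by (simp_all add: multiset_eq_iff subseteq_mset_def)
    then show "b \<in> (\<lambda>a. m - a) ` {a. a \<subseteq># m}" by blast
  qed auto
  have "(\<Oplus>a\<in>{a. a \<subseteq># m}. P a \<otimes> Q (m - a)) =
      (\<Oplus>a\<in>(\<lambda>a. m - a) ` {a. a \<subseteq># m}. P a \<otimes> Q (m - a))"
    by (simp only: im)
  also have "\<dots> = (\<Oplus>a\<in>{a. a \<subseteq># m}. P (m - a) \<otimes> Q (m - (m - a)))"
    by (rule add.finprod_reindex[OF _ inj]) (use assms in \<open>auto simp: carrier_coeff_def\<close>)
  also have "\<dots> = (\<Oplus>a\<in>{a. a \<subseteq># m}. Q a \<otimes> P (m - a))"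
    by (rule finsum_cong')
      (use assms in \<open>auto simp: carrier_coeff_def m_comm dbl\<close>)
  finally show "mpoly_mult R P Q m = mpoly_mult R Q P m"
    by (simp add: mpoly_mult_def)
qed

lemma mpoly_mult_const:
  assumes "k \<in> carrier R" "carrier_coeff Q"
  shows "mpoly_mult R (indexed_const k) Q = (\<lambda>m. k \<otimes> Q m)"
proof
  fix m
  have "mpoly_mult R (indexed_const k) Q m =
      (\<Oplus>a\<in>{a. a \<subseteq># m}. if {#} = a then k \<otimes> Q (m - a) else \<zero>)"
    unfolding mpoly_mult_def indexed_const_def
    by (rule finsum_cong') (use assms in \<open>auto simp: carrier_coeff_def\<close>)
  also have "\<dots> = k \<otimes> Q (m - {#})"
    by (rule add.finprod_singleton[of "{#}" _ "\<lambda>a. k \<otimes> Q (m - a)"])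
      (use assms finite_submultisets in \<open>auto simp: carrier_coeff_def\<close>)
  finally show "mpoly_mult R (indexed_const k) Q m = k \<otimes> Q m" by simp
qed

lemma mpoly_mult_add:
  assumes "carrier_coeff P" "carrier_coeff P'" "carrier_coeff Q"
  shows "mpoly_mult R (P \<Oplus> P') Q = mpoly_mult R P Q \<Oplus> mpoly_mult R P' Q"
proof
  fix m
  have "(\<Oplus>a\<in>{a. a \<subseteq># m}. (P a \<oplus> P' a) \<otimes> Q (m - a)) =
      (\<Oplus>a\<in>{a. a \<subseteq># m}. P a \<otimes> Q (m - a) \<oplus> P' a \<otimes> Q (m - a))"
    by (rule finsum_cong') (use assms in \<open>auto simp: carrier_coeff_def l_distr\<close>)
  also have "\<dots> = (\<Oplus>a\<in>{a. a \<subseteq># m}. P a \<otimes> Q (m - a)) \<oplus> (\<Oplus>a\<in>{a. a \<subseteq># m}. P' a \<otimes> Q (m - a))"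
    by (rule finsum_addf) (use assms in \<open>auto simp: carrier_coeff_def\<close>)
  finally show "mpoly_mult R (P \<Oplus> P') Q m = (mpoly_mult R P Q \<Oplus> mpoly_mult R P' Q) m"
    by (simp add: mpoly_mult_def indexed_padd_def)
qed

lemma mpoly_mult_pmult:
  assumes "carrier_coeff P" "carrier_coeff Q"
  shows "mpoly_mult R (P \<Otimes> i) Q = mpoly_mult R P Q \<Otimes> i"
proof
  fix m
  show "mpoly_mult R (P \<Otimes> i) Q m = (mpoly_mult R P Q \<Otimes> i) m"
  proof (cases "i \<in># m")
    case False
    then have "i \<notin># a" if "a \<subseteq># m" for a using that by (meson mset_subset_eqD)
    then have "mpoly_mult R (P \<Otimes> i) Q m = (\<Oplus>a\<in>{a. a \<subseteq># m}. \<zero>)"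
      unfolding mpoly_mult_def indexed_pmult_def
      by (intro finsum_cong') (use assms in \<open>auto simp: carrier_coeff_def\<close>)
    with False show ?thesis by (simp add: indexed_pmult_def)
  next
    case True
    let ?A = "{a. a \<subseteq># m - {#i#}}"
    have sub: "add_mset i ` ?A \<subseteq> {a. a \<subseteq># m}"
    proof
      fix b assume "b \<in> add_mset i ` ?A"
      then obtain a where "b = add_mset i a" "a \<subseteq># m - {#i#}" by blast
      then show "b \<in> {a. a \<subseteq># m}"
        using True insert_subset_eq_iff[of i a m] by blast
    qed
    have zero: "(P \<Otimes> i) b = \<zero>" if "b \<in> {a. a \<subseteq># m} - add_mset i ` ?A" for b
    proof -
      have "i \<notin># b"
      proof
        assume i: "i \<in># b"
        then have "b = add_mset i (b - {#i#})" by simp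
        moreover have "b - {#i#} \<in> ?A"
          using that i True insert_subset_eq_iff[of i "b - {#i#}" m] by simp
        ultimately show False using that by blast
      qed
      then show ?thesis by (simp add: indexed_pmult_def)
    qed
    have "mpoly_mult R (P \<Otimes> i) Q m = (\<Oplus>a\<in>add_mset i ` ?A. (P \<Otimes> i) a \<otimes> Q (m - a))"
      unfolding mpoly_mult_def
      by (rule add.finprod_mono_neutral_cong_right)
        (use assms zero sub finite_submultisets in
          \<open>auto simp: carrier_coeff_def indexed_pmult_in_carrier[unfolded carrier_coeff_def]\<close>)
    also have "\<dots> = (\<Oplus>a\<in>?A. (P \<Otimes> i) (add_mset i a) \<otimes> Q (m - add_mset i a))"
      by (rule add.finprod_reindex)
        (use assms in \<open>auto simp: carrier_coeff_def
           indexed_pmult_in_carrier[unfolded carrier_coeff_def] intro: inj_onI\<close>)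
    also have "\<dots> = (\<Oplus>a\<in>?A. P a \<otimes> Q (m - {#i#} - a))"
      by (rule finsum_cong') (use assms in \<open>auto simp: carrier_coeff_def indexed_pmult_def\<close>)
    also have "\<dots> = (mpoly_mult R P Q \<Otimes> i) m"
      using True by (simp add: indexed_pmult_def mpoly_mult_def)
    finally show ?thesis .
  qed
qed

lemma pset_coeff: "P \<in> ((carrier R)[\<X>\<^bsub>I\<^esub>]) \<Longrightarrow> carrier_coeff P"
  by (rule indexed_pset_in_carrier[of "carrier R"]) auto

lemma const_coeff: "k \<in> carrier R \<Longrightarrow> carrier_coeff (indexed_const k)"
  by (simp add: carrier_coeff_def indexed_const_def)

lemma pset_scale:
  fixes Q :: "'c multiset \<Rightarrow> 'a"
  assumes "k \<in> carrier R" "Q \<in> ((carrier R)[\<X>\<^bsub>I\<^esub>])"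
  shows "(\<lambda>m. k \<otimes> Q m) \<in> ((carrier R)[\<X>\<^bsub>I\<^esub>])"
  using assms(2)
proof induction
  case (indexed_const l)
  have "(\<lambda>m :: 'c multiset. k \<otimes> indexed_const l m) = indexed_const (k \<otimes> l)"
    using assms(1) by (auto simp: Indexed_Polynomials.ring.indexed_const_def[OF ring_axioms])
  moreover have "indexed_const (k \<otimes> l) \<in> ((carrier R)[\<X>\<^bsub>I\<^esub>])"
    using assms(1) indexed_const by (intro indexed_pset.indexed_const) simp
  ultimately show ?case by simp
next
  case (indexed_padd P Q)
  have "(\<lambda>m. k \<otimes> (P \<Oplus> Q) m) = (\<lambda>m. k \<otimes> P m) \<Oplus> (\<lambda>m. k \<otimes> Q m)"
    using assms(1) pset_coeff[OF indexed_padd(1)] pset_coeff[OF indexed_padd(2)]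
    by (auto simp: indexed_padd_def carrier_coeff_def r_distr)
  then show ?case using indexed_padd by (simp add: indexed_pset.indexed_padd)
next
  case (indexed_pmult P i)
  have "(\<lambda>m. k \<otimes> (P \<Otimes> i) m) = (\<lambda>m. k \<otimes> P m) \<Otimes> i"
    using assms(1) by (auto simp: indexed_pmult_def)
  then show ?case using indexed_pmult by (simp add: indexed_pset.indexed_pmult)
qed

lemma pset_mult:
  assumes "P \<in> ((carrier R)[\<X>\<^bsub>I\<^esub>])" "Q \<in> ((carrier R)[\<X>\<^bsub>I\<^esub>])"
  shows "mpoly_mult R P Q \<in> ((carrier R)[\<X>\<^bsub>I\<^esub>])"
  using assms
proof (induction P)
  case (indexed_const l)
  then show ?case by (simp add: mpoly_mult_const pset_coeff pset_scale)
next
  case (indexed_padd P P')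
  then show ?case by (simp add: mpoly_mult_add pset_coeff indexed_pset.indexed_padd)
next
  case (indexed_pmult P i)
  then show ?case by (simp add: mpoly_mult_pmult pset_coeff indexed_pset.indexed_pmult)
qed

lemma pset_assoc:
  assumes "P \<in> ((carrier R)[\<X>\<^bsub>I\<^esub>])" "carrier_coeff Q" "carrier_coeff S"
  shows "mpoly_mult R (mpoly_mult R P Q) S = mpoly_mult R P (mpoly_mult R Q S)"
  using assms
proof (induction P)
  case (indexed_const l)
  have "carrier_coeff (\<lambda>m. l \<otimes> Q m)" using indexed_const by (simp add: carrier_coeff_def)
  have "(\<lambda>m. \<Oplus>a\<in>{a. a \<subseteq># m}. l \<otimes> Q a \<otimes> S (m - a)) =
      (\<lambda>m. l \<otimes> (\<Oplus>a\<in>{a. a \<subseteq># m}. Q a \<otimes> S (m - a)))"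
  proof
    fix m
    have "l \<otimes> (\<Oplus>a\<in>{a. a \<subseteq># m}. Q a \<otimes> S (m - a)) =
        (\<Oplus>a\<in>{a. a \<subseteq># m}. l \<otimes> (Q a \<otimes> S (m - a)))"
      by (rule finsum_rdistr)
        (use indexed_const finite_submultisets in \<open>auto simp: carrier_coeff_def\<close>)
    also have "\<dots> = (\<Oplus>a\<in>{a. a \<subseteq># m}. l \<otimes> Q a \<otimes> S (m - a))"
      by (rule finsum_cong') (use indexed_const in \<open>auto simp: carrier_coeff_def m_assoc\<close>)
    finally show "(\<Oplus>a\<in>{a. a \<subseteq># m}. l \<otimes> Q a \<otimes> S (m - a)) =
        l \<otimes> (\<Oplus>a\<in>{a. a \<subseteq># m}. Q a \<otimes> S (m - a))" by simp
  qed
  then show ?case using indexed_const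
    by (simp add: mpoly_mult_const mpoly_mult_closed) (simp add: mpoly_mult_def)
next
  case (indexed_padd P P')
  then show ?case by (simp add: mpoly_mult_add pset_coeff mpoly_mult_closed)
next
  case (indexed_pmult P i)
  then show ?case by (simp add: mpoly_mult_pmult pset_coeff mpoly_mult_closed)
qed

lemma mpoly_ring_cring: "cring (mpoly_ring R I)"
proof (rule cringI)
  show "abelian_group (mpoly_ring R I)"
  proof (rule abelian_groupI)
    fix P assume P: "P \<in> carrier (mpoly_ring R I)"
    let ?N = "\<lambda>m. \<ominus> \<one> \<otimes> P m"
    have "?N \<in> carrier (mpoly_ring R I)"
      using P by (simp add: mpoly_ring_def pset_scale)
    moreover have "?N \<oplus>\<^bsub>mpoly_ring R I\<^esub> P = \<zero>\<^bsub>mpoly_ring R I\<^esub>"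
      using carrier_coeffE[OF pset_coeff[of P I]] P
      by (auto simp: mpoly_ring_def indexed_padd_def indexed_zero_def l_minus l_neg)
    ultimately show "\<exists>Q\<in>carrier (mpoly_ring R I). Q \<oplus>\<^bsub>mpoly_ring R I\<^esub> P = \<zero>\<^bsub>mpoly_ring R I\<^esub>"
      by blast
  next
    show "\<zero>\<^bsub>mpoly_ring R I\<^esub> \<in> carrier (mpoly_ring R I)"
      by (simp add: mpoly_ring_def indexed_pset.indexed_const)
    fix P assume P: "P \<in> carrier (mpoly_ring R I)"
    then have P': "carrier_coeff P" by (simp add: mpoly_ring_def pset_coeff)
    show "\<zero>\<^bsub>mpoly_ring R I\<^esub> \<oplus>\<^bsub>mpoly_ring R I\<^esub> P = P"
      using indexed_padd_zero(2)[OF P'] by (simp add: mpoly_ring_def)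
    fix Q assume Q: "Q \<in> carrier (mpoly_ring R I)"
    then have Q': "carrier_coeff Q" by (simp add: mpoly_ring_def pset_coeff)
    show "P \<oplus>\<^bsub>mpoly_ring R I\<^esub> Q \<in> carrier (mpoly_ring R I)"
      using P Q by (simp add: mpoly_ring_def indexed_pset.indexed_padd)
    show "P \<oplus>\<^bsub>mpoly_ring R I\<^esub> Q = Q \<oplus>\<^bsub>mpoly_ring R I\<^esub> P"
      using carrier_coeffE[OF P'] carrier_coeffE[OF Q']
      by (simp add: mpoly_ring_def indexed_padd_def a_comm)
    fix S assume S: "S \<in> carrier (mpoly_ring R I)"
    then have S': "carrier_coeff S" by (simp add: mpoly_ring_def pset_coeff)
    show "P \<oplus>\<^bsub>mpoly_ring R I\<^esub> Q \<oplus>\<^bsub>mpoly_ring R I\<^esub> S = P \<oplus>\<^bsub>mpoly_ring R I\<^esub> (Q \<oplus>\<^bsub>mpoly_ring R I\<^esub> S)"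
      using carrier_coeffE[OF P'] carrier_coeffE[OF Q'] carrier_coeffE[OF S']
      by (simp add: mpoly_ring_def indexed_padd_def a_assoc)
  qed
  show "Group.comm_monoid (mpoly_ring R I)"
  proof (rule comm_monoidI)
    fix P assume "P \<in> carrier (mpoly_ring R I)"
    then show "\<one>\<^bsub>mpoly_ring R I\<^esub> \<otimes>\<^bsub>mpoly_ring R I\<^esub> P = P"
      by (auto simp: mpoly_ring_def mpoly_mult_const pset_coeff carrier_coeffE)
  qed (auto simp: mpoly_ring_def pset_mult pset_assoc pset_coeff
      intro: indexed_pset.indexed_const mpoly_mult_comm)
  fix P Q S
  assume "P \<in> carrier (mpoly_ring R I)" "Q \<in> carrier (mpoly_ring R I)" "S \<in> carrier (mpoly_ring R I)"
  then show "(P \<oplus>\<^bsub>mpoly_ring R I\<^esub> Q) \<otimes>\<^bsub>mpoly_ring R I\<^esub> S =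
      P \<otimes>\<^bsub>mpoly_ring R I\<^esub> S \<oplus>\<^bsub>mpoly_ring R I\<^esub> Q \<otimes>\<^bsub>mpoly_ring R I\<^esub> S"
    by (simp add: mpoly_ring_def mpoly_mult_add pset_coeff)
qed


subsection \<open>Localizations\<close>

lemma fraction_rel_equiv:
  assumes "submonoid S R"
  shows "equiv (carrier R \<times> S) (frac_rel R S)"
proof -
  interpret S: submonoid S R by fact
  have S: "s \<in> carrier R" if "s \<in> S" for s using that S.subset by blast
  show ?thesis
  proof (rule equivI)
    show "refl_on (carrier R \<times> S) (frac_rel R S)"
      using S by (auto simp: refl_on_def frac_rel_def r_right_minus_eq intro!: bexI[of _ \<one>])
    show "sym (frac_rel R S)"
    proof (rule symI, clarsimp simp: frac_rel_def)
      fix a s b t u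
      assume *: "a \<in> carrier R" "s \<in> S" "b \<in> carrier R" "t \<in> S" "u \<in> S"
        "u \<otimes> (t \<otimes> a \<ominus> s \<otimes> b) = \<zero>"
      have "u \<otimes> (s \<otimes> b \<ominus> t \<otimes> a) = \<ominus> (u \<otimes> (t \<otimes> a \<ominus> s \<otimes> b))"
        using *(1-5) S by algebra
      then show "\<exists>u\<in>S. u \<otimes> (s \<otimes> b \<ominus> t \<otimes> a) = \<zero>" using * by auto
    qed
    show "trans (frac_rel R S)"
    proof (rule transI, clarsimp simp: frac_rel_def)
      fix a s b t c r u v
      assume *: "a \<in> carrier R" "s \<in> S" "b \<in> carrier R" "t \<in> S" "c \<in> carrier R" "r \<in> S"
          "u \<in> S" "v \<in> S"
        and eqs: "u \<otimes> (t \<otimes> a \<ominus> s \<otimes> b) = \<zero>" "v \<otimes> (r \<otimes> b \<ominus> t \<otimes> c) = \<zero>"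
      have c: "s \<in> carrier R" "t \<in> carrier R" "r \<in> carrier R" "u \<in> carrier R" "v \<in> carrier R"
        using * S by auto
      have "(u \<otimes> v \<otimes> t) \<otimes> (r \<otimes> a \<ominus> s \<otimes> c) =
          v \<otimes> r \<otimes> (u \<otimes> (t \<otimes> a \<ominus> s \<otimes> b)) \<oplus> u \<otimes> s \<otimes> (v \<otimes> (r \<otimes> b \<ominus> t \<otimes> c))"
        using *(1,3,5) c by algebra
      also have "\<dots> = \<zero>" using eqs * c by simp
      finally show "\<exists>u\<in>S. u \<otimes> (r \<otimes> a \<ominus> s \<otimes> c) = \<zero>"
        using * by (intro bexI[of _ "u \<otimes> v \<otimes> t"]) auto
    qed
  qed (auto simp: frac_rel_def)
qed

lemma fraction_eq_iff:
  assumes "submonoid S R" "a \<in> carrier R" "s \<in> S" "b \<in> carrier R" "t \<in> S"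
  shows "fraction R S a s = fraction R S b t \<longleftrightarrow>
    (\<exists>u\<in>S. u \<otimes> (t \<otimes> a \<ominus> s \<otimes> b) = \<zero>)"
proof -
  have "fraction R S a s = fraction R S b t \<longleftrightarrow> ((a, s), (b, t)) \<in> frac_rel R S"
    unfolding fraction_def
    by (rule eq_equiv_class_iff[OF fraction_rel_equiv]) (use assms in auto)
  then show ?thesis using assms by (simp add: frac_rel_def)
qed

lemma localization_carrierE:
  assumes "A \<in> carrier (localization R S)"
  obtains a s where "a \<in> carrier R" "s \<in> S" "A = fraction R S a s"
  using assms by (auto simp: localization_def fraction_def quotient_def)

lemma fraction_closed:
  "a \<in> carrier R \<Longrightarrow> s \<in> S \<Longrightarrow> fraction R S a s \<in> carrier (localization R S)"
  by (auto simp: localization_def fraction_def quotient_def)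

lemma fraction_mult:
  assumes "submonoid S R" "a \<in> carrier R" "s \<in> S" "b \<in> carrier R" "t \<in> S"
  shows "fraction R S a s \<otimes>\<^bsub>localization R S\<^esub> fraction R S b t = fraction R S (a \<otimes> b) (s \<otimes> t)"
proof -
  interpret S: submonoid S R by fact
  have S: "s \<in> carrier R" if "s \<in> S" for s using that S.subset by blast
  have "congruent2 (frac_rel R S) (frac_rel R S)
      (\<lambda>x y. fraction R S (fst x \<otimes> fst y) (snd x \<otimes> snd y))"
  proof (rule congruent2I')
    fix x x' y y'
    assume "(x, x') \<in> frac_rel R S" "(y, y') \<in> frac_rel R S"
    then obtain a s b t u c p d q v where x: "x = (a, s)" "x' = (b, t)" "y = (c, p)" "y' = (d, q)"
      and car: "a \<in> carrier R" "b \<in> carrier R" "c \<in> carrier R" "d \<in> carrier R"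
        "s \<in> S" "t \<in> S" "p \<in> S" "q \<in> S" "u \<in> S" "v \<in> S"
      and eqs: "u \<otimes> (t \<otimes> a \<ominus> s \<otimes> b) = \<zero>" "v \<otimes> (q \<otimes> c \<ominus> p \<otimes> d) = \<zero>"
      unfolding frac_rel_def by blast
    note c = car(1-4) car(5-10)[THEN S]
    have "(u \<otimes> v) \<otimes> ((t \<otimes> q) \<otimes> (a \<otimes> c) \<ominus> (s \<otimes> p) \<otimes> (b \<otimes> d)) =
        (v \<otimes> q \<otimes> c) \<otimes> (u \<otimes> (t \<otimes> a \<ominus> s \<otimes> b)) \<oplus> (u \<otimes> s \<otimes> b) \<otimes> (v \<otimes> (q \<otimes> c \<ominus> p \<otimes> d))"
      using c by algebra
    also have "\<dots> = \<zero>" using eqs c by simp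
    finally have "fraction R S (a \<otimes> c) (s \<otimes> p) = fraction R S (b \<otimes> d) (t \<otimes> q)"
      using car by (subst fraction_eq_iff[OF assms(1)]) (auto intro!: bexI[of _ "u \<otimes> v"])
    then show "fraction R S (fst x \<otimes> fst y) (snd x \<otimes> snd y) =
        fraction R S (fst x' \<otimes> fst y') (snd x' \<otimes> snd y')"
      by (simp add: x)
  qed
  from UN_equiv_class2[OF fraction_rel_equiv[OF assms(1)] fraction_rel_equiv[OF assms(1)] this,
      of "(a, s)" "(b, t)"]
  have "(\<Union>x\<in>frac_rel R S `` {(a, s)}. \<Union>y\<in>frac_rel R S `` {(b, t)}.
      fraction R S (fst x \<otimes> fst y) (snd x \<otimes> snd y)) = fraction R S (a \<otimes> b) (s \<otimes> t)"
    using assms by simp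
  then show ?thesis by (simp add: localization_def fraction_def)
qed

lemma fraction_add:
  assumes "submonoid S R" "a \<in> carrier R" "s \<in> S" "b \<in> carrier R" "t \<in> S"
  shows "fraction R S a s \<oplus>\<^bsub>localization R S\<^esub> fraction R S b t =
    fraction R S (t \<otimes> a \<oplus> s \<otimes> b) (s \<otimes> t)"
proof -
  interpret S: submonoid S R by fact
  have S: "s \<in> carrier R" if "s \<in> S" for s using that S.subset by blast
  have "congruent2 (frac_rel R S) (frac_rel R S)
      (\<lambda>x y. fraction R S (snd y \<otimes> fst x \<oplus> snd x \<otimes> fst y) (snd x \<otimes> snd y))"
  proof (rule congruent2I')
    fix x x' y y'
    assume "(x, x') \<in> frac_rel R S" "(y, y') \<in> frac_rel R S"
    then obtain a s b t u c p d q v where x: "x = (a, s)" "x' = (b, t)" "y = (c, p)" "y' = (d, q)"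
      and car: "a \<in> carrier R" "b \<in> carrier R" "c \<in> carrier R" "d \<in> carrier R"
        "s \<in> S" "t \<in> S" "p \<in> S" "q \<in> S" "u \<in> S" "v \<in> S"
      and eqs: "u \<otimes> (t \<otimes> a \<ominus> s \<otimes> b) = \<zero>" "v \<otimes> (q \<otimes> c \<ominus> p \<otimes> d) = \<zero>"
      unfolding frac_rel_def by blast
    note c = car(1-4) car(5-10)[THEN S]
    have "(u \<otimes> v) \<otimes> ((t \<otimes> q) \<otimes> (p \<otimes> a \<oplus> s \<otimes> c) \<ominus> (s \<otimes> p) \<otimes> (q \<otimes> b \<oplus> t \<otimes> d)) =
        (v \<otimes> q \<otimes> p) \<otimes> (u \<otimes> (t \<otimes> a \<ominus> s \<otimes> b)) \<oplus> (u \<otimes> s \<otimes> t) \<otimes> (v \<otimes> (q \<otimes> c \<ominus> p \<otimes> d))"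
      using c by algebra
    also have "\<dots> = \<zero>" using eqs c by simp
    finally have "fraction R S (p \<otimes> a \<oplus> s \<otimes> c) (s \<otimes> p) =
        fraction R S (q \<otimes> b \<oplus> t \<otimes> d) (t \<otimes> q)"
      using car c by (subst fraction_eq_iff[OF assms(1)]) (auto intro!: bexI[of _ "u \<otimes> v"])
    then show "fraction R S (snd y \<otimes> fst x \<oplus> snd x \<otimes> fst y) (snd x \<otimes> snd y) =
        fraction R S (snd y' \<otimes> fst x' \<oplus> snd x' \<otimes> fst y') (snd x' \<otimes> snd y')"
      by (simp add: x)
  qed
  from UN_equiv_class2[OF fraction_rel_equiv[OF assms(1)] fraction_rel_equiv[OF assms(1)] this,
      of "(a, s)" "(b, t)"]
  have "(\<Union>x\<in>frac_rel R S `` {(a, s)}. \<Union>y\<in>frac_rel R S `` {(b, t)}.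
      fraction R S (snd y \<otimes> fst x \<oplus> snd x \<otimes> fst y) (snd x \<otimes> snd y)) =
      fraction R S (t \<otimes> a \<oplus> s \<otimes> b) (s \<otimes> t)"
    using assms by simp
  then show ?thesis by (simp add: localization_def fraction_def)
qed

lemma fraction_eqI:
  assumes "submonoid S R" "a \<in> carrier R" "s \<in> S" "b \<in> carrier R" "t \<in> S" "t \<otimes> a = s \<otimes> b"
  shows "fraction R S a s = fraction R S b t"
proof -
  interpret S: submonoid S R by fact
  have "t \<in> carrier R" using assms S.subset by blast
  then have "\<one> \<otimes> (t \<otimes> a \<ominus> s \<otimes> b) = \<zero>"
    using assms by (metis r_right_minus_eq m_closed r_null one_closed)
  then show ?thesis using fraction_eq_iff[OF assms(1-5)] S.one_closed by blast
qed

lemma localization_cring: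
  assumes "submonoid S R"
  shows "cring (localization R S)"
proof -
  interpret S: submonoid S R by fact
  have S: "s \<in> carrier R" if "s \<in> S" for s using that S.subset by blast
  let ?L = "localization R S"
  have one: "\<one>\<^bsub>?L\<^esub> = fraction R S \<one> \<one>" and zero: "\<zero>\<^bsub>?L\<^esub> = fraction R S \<zero> \<one>"
    by (simp_all add: localization_def)
  note simps = fraction_mult[OF assms] fraction_add[OF assms] one zero
  show ?thesis
  proof (rule cringI)
    show "abelian_group ?L"
    proof (rule abelian_groupI)
      show "\<zero>\<^bsub>?L\<^esub> \<in> carrier ?L" by (simp add: zero fraction_closed)
      fix x assume "x \<in> carrier ?L"
      then obtain a s where x: "a \<in> carrier R" "s \<in> S" "x = fraction R S a s"
        by (rule localization_carrierE)
      show "\<zero>\<^bsub>?L\<^esub> \<oplus>\<^bsub>?L\<^esub> x = x" using x S by (simp add: simps)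
      have "fraction R S (s \<otimes> \<ominus> a \<oplus> s \<otimes> a) (s \<otimes> s) = fraction R S \<zero> \<one>"
        by (rule fraction_eqI[OF assms]) (use x S in \<open>auto simp: r_minus l_neg\<close>)
      then have "fraction R S (\<ominus> a) s \<oplus>\<^bsub>?L\<^esub> x = \<zero>\<^bsub>?L\<^esub>"
        using x S by (simp add: simps)
      then show "\<exists>y\<in>carrier ?L. y \<oplus>\<^bsub>?L\<^esub> x = \<zero>\<^bsub>?L\<^esub>"
        using x fraction_closed a_inv_closed by blast
      fix y assume "y \<in> carrier ?L"
      then obtain b t where y: "b \<in> carrier R" "t \<in> S" "y = fraction R S b t"
        by (rule localization_carrierE)
      show "x \<oplus>\<^bsub>?L\<^esub> y \<in> carrier ?L" using x y S by (simp add: simps fraction_closed)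
      show "x \<oplus>\<^bsub>?L\<^esub> y = y \<oplus>\<^bsub>?L\<^esub> x"
        using x y S by (simp add: simps a_comm m_comm)
      fix z assume "z \<in> carrier ?L"
      then obtain c r where z: "c \<in> carrier R" "r \<in> S" "z = fraction R S c r"
        by (rule localization_carrierE)
      have "r \<otimes> (t \<otimes> a \<oplus> s \<otimes> b) \<oplus> s \<otimes> t \<otimes> c = t \<otimes> r \<otimes> a \<oplus> s \<otimes> (r \<otimes> b \<oplus> t \<otimes> c)"
        using x(1,2) y(1,2) z(1,2) S by algebra
      then show "x \<oplus>\<^bsub>?L\<^esub> y \<oplus>\<^bsub>?L\<^esub> z = x \<oplus>\<^bsub>?L\<^esub> (y \<oplus>\<^bsub>?L\<^esub> z)"
        using x y z S by (simp add: simps m_assoc)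
    qed
    show "Group.comm_monoid ?L"
    proof (rule comm_monoidI)
      show "\<one>\<^bsub>?L\<^esub> \<in> carrier ?L" by (simp add: one fraction_closed)
      fix x assume "x \<in> carrier ?L"
      then obtain a s where x: "a \<in> carrier R" "s \<in> S" "x = fraction R S a s"
        by (rule localization_carrierE)
      show "\<one>\<^bsub>?L\<^esub> \<otimes>\<^bsub>?L\<^esub> x = x" using x S by (simp add: simps)
      fix y assume "y \<in> carrier ?L"
      then obtain b t where y: "b \<in> carrier R" "t \<in> S" "y = fraction R S b t"
        by (rule localization_carrierE)
      show "x \<otimes>\<^bsub>?L\<^esub> y \<in> carrier ?L" using x y by (simp add: simps fraction_closed)
      show "x \<otimes>\<^bsub>?L\<^esub> y = y \<otimes>\<^bsub>?L\<^esub> x" using x y S by (simp add: simps m_comm)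
      fix z assume "z \<in> carrier ?L"
      then obtain c r where z: "c \<in> carrier R" "r \<in> S" "z = fraction R S c r"
        by (rule localization_carrierE)
      show "x \<otimes>\<^bsub>?L\<^esub> y \<otimes>\<^bsub>?L\<^esub> z = x \<otimes>\<^bsub>?L\<^esub> (y \<otimes>\<^bsub>?L\<^esub> z)"
        using x y z S by (simp add: simps m_assoc)
    qed
    fix x y z assume "x \<in> carrier ?L" "y \<in> carrier ?L" "z \<in> carrier ?L"
    then obtain a s b t c r where xyz: "a \<in> carrier R" "s \<in> S" "x = fraction R S a s"
      "b \<in> carrier R" "t \<in> S" "y = fraction R S b t" "c \<in> carrier R" "r \<in> S" "z = fraction R S c r"
      by (metis localization_carrierE)
    have "(s \<otimes> r) \<otimes> (t \<otimes> r) \<otimes> ((t \<otimes> a \<oplus> s \<otimes> b) \<otimes> c) =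
        (s \<otimes> t \<otimes> r) \<otimes> ((t \<otimes> r) \<otimes> (a \<otimes> c) \<oplus> (s \<otimes> r) \<otimes> (b \<otimes> c))"
      using xyz(1,2,4,5,7,8) S by algebra
    then show "(x \<oplus>\<^bsub>?L\<^esub> y) \<otimes>\<^bsub>?L\<^esub> z = x \<otimes>\<^bsub>?L\<^esub> z \<oplus>\<^bsub>?L\<^esub> y \<otimes>\<^bsub>?L\<^esub> z"
      using xyz S fraction_eqI[OF assms, of "(t \<otimes> a \<oplus> s \<otimes> b) \<otimes> c" "s \<otimes> t \<otimes> r"
          "(t \<otimes> r) \<otimes> (a \<otimes> c) \<oplus> (s \<otimes> r) \<otimes> (b \<otimes> c)" "(s \<otimes> r) \<otimes> (t \<otimes> r)"]
      by (simp add: simps)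
  qed
qed

subsection \<open>Residue fields\<close>

lemma prime_complement_submonoid:
  assumes "primeideal P R"
  shows "submonoid (carrier R - P) R"
proof -
  interpret P: primeideal P R by fact
  show ?thesis
    by (rule submonoid.intro) (use P.I_prime P.one_imp_carrier P.I_notcarr in auto)
qed

lemma extended_ideal_eq:
  assumes "primeideal P R"
  shows "extended_ideal R P = {fraction R (carrier R - P) a s |a s. a \<in> P \<and> s \<in> carrier R - P}"
    and "maximalideal (extended_ideal R P) (local_ring_at R P)"
proof -
  interpret P: primeideal P R by fact
  define S where "S = carrier R - P"
  let ?L = "localization R S"
  let ?E = "{fraction R S a s |a s. a \<in> P \<and> s \<in> S}"
  have subm: "submonoid S R" using prime_complement_submonoid[OF assms] by (simp add: S_def)
  interpret S: submonoid S R by fact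
  interpret L: cring ?L by (rule localization_cring[OF subm])
  have S: "s \<in> carrier R" if "s \<in> S" for s using that S.subset by blast
  have P: "a \<in> carrier R" if "a \<in> P" for a using that P.a_subset by blast
  have one: "\<one>\<^bsub>?L\<^esub> = fraction R S \<one> \<one>" and zero: "\<zero>\<^bsub>?L\<^esub> = fraction R S \<zero> \<one>"
    by (simp_all add: localization_def)
  note simps = fraction_mult[OF subm] fraction_add[OF subm] one zero
  have sub: "?E \<subseteq> carrier ?L" using P fraction_closed by blast
  have mult: "x \<otimes>\<^bsub>?L\<^esub> y \<in> ?E" if x: "x \<in> ?E" and y: "y \<in> carrier ?L" for x y
  proof -
    obtain a s where "a \<in> P" "s \<in> S" "x = fraction R S a s" using x by blast
    moreover obtain b t where "b \<in> carrier R" "t \<in> S" "y = fraction R S b t"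
      using y by (rule localization_carrierE)
    moreover have "a \<otimes> b \<in> P" using calculation P.I_r_closed by blast
    moreover have "s \<otimes> t \<in> S" using calculation by simp
    ultimately have "x \<otimes>\<^bsub>?L\<^esub> y = fraction R S (a \<otimes> b) (s \<otimes> t)" "a \<otimes> b \<in> P" "s \<otimes> t \<in> S"
      using P by (simp_all add: simps)
    then show ?thesis by blast
  qed
  have add: "x \<oplus>\<^bsub>?L\<^esub> y \<in> ?E" if xy: "x \<in> ?E" "y \<in> ?E" for x y
  proof -
    obtain a s b t where *: "a \<in> P" "s \<in> S" "x = fraction R S a s" "b \<in> P" "t \<in> S" "y = fraction R S b t"
      using xy by blast
    then have "t \<otimes> a \<oplus> s \<otimes> b \<in> P"
      using S by (intro P.a_closed P.I_l_closed) auto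
    moreover have "x \<oplus>\<^bsub>?L\<^esub> y = fraction R S (t \<otimes> a \<oplus> s \<otimes> b) (s \<otimes> t)" "s \<otimes> t \<in> S"
      using * P by (simp_all add: simps)
    ultimately show ?thesis by blast
  qed
  have E: "ideal ?E ?L"
  proof (rule idealI)
    show "ring ?L" by (rule L.ring_axioms)
    show "subgroup ?E (add_monoid ?L)"
    proof (rule L.add.subgroupI)
      show "?E \<subseteq> carrier ?L" by (rule sub)
      show "?E \<noteq> {}" using P.zero_closed S.one_closed by blast
      fix x assume x: "x \<in> ?E"
      then have "x \<otimes>\<^bsub>?L\<^esub> (\<ominus>\<^bsub>?L\<^esub> \<one>\<^bsub>?L\<^esub>) \<in> ?E" by (rule mult) simp
      moreover have "x \<otimes>\<^bsub>?L\<^esub> (\<ominus>\<^bsub>?L\<^esub> \<one>\<^bsub>?L\<^esub>) = \<ominus>\<^bsub>?L\<^esub> x"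
        using L.r_minus[OF subsetD[OF sub x] L.one_closed] L.r_one[OF subsetD[OF sub x]] by simp
      ultimately show "\<ominus>\<^bsub>?L\<^esub> x \<in> ?E" by (simp only:)
      show "x \<oplus>\<^bsub>?L\<^esub> y \<in> ?E" if "y \<in> ?E" for y using x that by (rule add)
    qed
    show "x \<otimes>\<^bsub>?L\<^esub> a \<in> ?E" if "a \<in> ?E" "x \<in> carrier ?L" for a x
      using mult[OF that] L.m_comm[OF that(2) subsetD[OF sub that(1)]] by (simp only:)
  qed (rule mult)
  have gen: "genideal ?L ((\<lambda>a. fraction R S a \<one>) ` P) = ?E"
  proof
    show "genideal ?L ((\<lambda>a. fraction R S a \<one>) ` P) \<subseteq> ?E"
      by (rule L.genideal_minimal[OF E]) (use S.one_closed in blast)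
    show "?E \<subseteq> genideal ?L ((\<lambda>a. fraction R S a \<one>) ` P)"
    proof
      fix x assume "x \<in> ?E"
      then obtain a s where x: "a \<in> P" "s \<in> S" "x = fraction R S a s" by blast
      have img: "(\<lambda>a. fraction R S a \<one>) ` P \<subseteq> carrier ?L"
        using P S.one_closed fraction_closed by blast
      interpret I: ideal "genideal ?L ((\<lambda>a. fraction R S a \<one>) ` P)" ?L
        by (rule L.genideal_ideal[OF img])
      have "fraction R S a \<one> \<in> genideal ?L ((\<lambda>a. fraction R S a \<one>) ` P)"
        using L.genideal_self[OF img] x by blast
      then have "fraction R S a \<one> \<otimes>\<^bsub>?L\<^esub> fraction R S \<one> s \<in> genideal ?L ((\<lambda>a. fraction R S a \<one>) ` P)"
        using x by (intro I.I_r_closed fraction_closed) auto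
      then show "x \<in> genideal ?L ((\<lambda>a. fraction R S a \<one>) ` P)"
        using x P S by (simp add: simps)
    qed
  qed
  have notP: "a \<notin> P" if a: "a \<in> carrier R" "s \<in> S" "fraction R S a s = \<one>\<^bsub>?L\<^esub>" for a s
  proof
    assume aP: "a \<in> P"
    obtain u where u: "u \<in> S" "u \<otimes> (\<one> \<otimes> a \<ominus> s \<otimes> \<one>) = \<zero>"
      using a fraction_eq_iff[OF subm a(1,2) one_closed S.one_closed] by (auto simp: one)
    have "u \<otimes> s = u \<otimes> a \<ominus> u \<otimes> (\<one> \<otimes> a \<ominus> s \<otimes> \<one>)"
      using a(1) S[OF u(1)] S[OF a(2)] by algebra
    also have "\<dots> = u \<otimes> a" using u a S by (simp add: minus_eq)
    also have "\<dots> \<in> P" using aP S[OF u(1)] by (rule P.I_l_closed)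
    finally have "u \<otimes> s \<in> P" .
    moreover have "u \<otimes> s \<in> S" using u a by simp
    ultimately show False by (simp add: S_def)
  qed
  have max: "maximalideal ?E ?L"
  proof (rule maximalidealI[OF E])
    show "carrier ?L \<noteq> ?E"
    proof
      assume "carrier ?L = ?E"
      then have "\<one>\<^bsub>?L\<^esub> \<in> ?E" using L.one_closed by simp
      then obtain a s where "a \<in> P" "s \<in> S" "\<one>\<^bsub>?L\<^esub> = fraction R S a s" by blast
      with notP[of a s] P show False by simp
    qed
    fix J assume J: "ideal J ?L" "?E \<subseteq> J" "J \<subseteq> carrier ?L"
    interpret J: ideal J ?L by fact
    show "J = ?E \<or> J = carrier ?L"
    proof (cases "J \<subseteq> ?E")
      case False
      then obtain x where x: "x \<in> J" "x \<notin> ?E" by blast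
      then have "x \<in> carrier ?L" using J by blast
      then obtain a s where as: "a \<in> carrier R" "s \<in> S" "x = fraction R S a s"
        by (rule localization_carrierE)
      have "a \<notin> P" using x(2) as(2,3) by blast
      then have aS: "a \<in> S" using as(1) by (simp add: S_def)
      have "x \<otimes>\<^bsub>?L\<^esub> fraction R S s a \<in> J"
        by (intro J.I_r_closed fraction_closed x(1) aS S[OF as(2)])
      moreover have "x \<otimes>\<^bsub>?L\<^esub> fraction R S s a = \<one>\<^bsub>?L\<^esub>"
      proof -
        have "fraction R S (a \<otimes> s) (s \<otimes> a) = fraction R S \<one> \<one>"
          by (rule fraction_eqI[OF subm]) (use as(1,2) aS S in \<open>simp_all add: m_comm\<close>)
        then show ?thesis using as aS S by (simp add: fraction_mult[OF subm] one)
      qed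
      ultimately show ?thesis using J.one_imp_carrier by metis
    next
      case True
      with J(2) show ?thesis by (intro disjI1 subset_antisym)
    qed
  qed
  show "extended_ideal R P = {fraction R (carrier R - P) a s |a s. a \<in> P \<and> s \<in> carrier R - P}"
    using gen by (simp add: extended_ideal_def local_ring_at_def S_def)
  show "maximalideal (extended_ideal R P) (local_ring_at R P)"
    using max gen by (simp add: extended_ideal_def local_ring_at_def S_def)
qed

lemma residue_field_field:
  assumes "primeideal P R"
  shows "field (residue_field R P)"
  unfolding residue_field_def
  by (rule maximalideal.quotient_is_field[OF extended_ideal_eq(2)[OF assms]])
    (simp add: local_ring_at_def localization_cring prime_complement_submonoid assms)

end

end

(*
  Over a domain S containing the rationals, let F be a coordinate over the fraction field, with
  components f and inverse g / s. Since g inverts f up to s, replacing f_0 = F by F + s T inside g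
  gives an automorphism of S[Z, T] over S[T], the identity at T = 0, which sends F to F + s T. Such
  "slides" can be rescaled and composed. So over a reduced ring with minimal primes P_1, ..., P_m
  there is a slide F -> F + t T with t in no P_i, and modulo t the dimension drops.

  If F is a coordinate in N variables modulo the nonzerodivisor t, with coordinate system sigma and
  inverse tau, then X_j -> sigma_j + t T_j, T_j -> (X_j - tau_j(sigma + t T)) / t is an automorphism, so
  F + t T_0 is a coordinate in 2 N variables, and by the slide so is F. Hence the total number of
  variables doubles with each dimension, and it suffices to reach n + 1 variables in dimension 1.

  In dimension 1 the locus t = 0 consists of finitely many rational points, by the Nullstellensatz. An
  automorphism at a point is joined to the identity by its dilations and by elementary matrices, and
  replacing the parameter by a function that is 1 at this point and 0 at the others yields one
  coordinate F' over the base that agrees with F at all points. Shears correct F' along nilpotents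
  when n > 1, so that F' = F + t H for some H. With X_0 + t T also F' + t T is a coordinate, hence so are
  F + t T, by the substitution T -> T - H, and F, by the slide.

  Being a coordinate lifts along nilpotents, and the case n = 1 of dimension 1 is a doubling of
  dimension 0.
*)

theory Submission
  imports Defs "HOL-Library.Poly_Mapping" "Jordan_Normal_Form.Determinant"
    "HOL-Computational_Algebra.Polynomial"
begin

section \<open>Ideals and congruences\<close>

text \<open>The form of the constant: doubling from \<open>n\<close> variables in dimension 0 would
  end with \<open>2 ^ d * n\<close> variables, that is \<open>(2 ^ d - 1) * n\<close> new ones.
  Reaching \<open>n + 1\<close> instead of \<open>2 * n\<close> variables in dimension 1 saves
  \<open>n - 1\<close>, and the later doublings turn this into the subtracted
  \<open>2 ^ (d - 1) * (n - 1)\<close>. The saving is where algebraic closedness enters. A residue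
  field equal to \<open>k\<close> means that an automorphism at a point has coefficients in
  \<open>k\<close>; it is then defined over the whole base and can be deformed there. In higher
  dimension the residue fields along \<open>t = 0\<close> offer nothing of the kind. Characteristic
  zero enters three times: vanishing derivatives force a polynomial to be constant, which makes a
  one-sided inverse over a fraction field two-sided; values at integers determine the coefficients,
  which generates the shears; and integers supply non-roots in the Nullstellensatz. The main
  argument never forms a quotient ring. One type-class ring presents the algebra, and restricting to
  a prime, to a point or to \<open>t = 0\<close> only enlarges an ideal.\<close>

definition is_ideal :: "'a::comm_ring_1 set \<Rightarrow> bool"
  where "is_ideal J \<longleftrightarrow> 0 \<in> J \<and> (\<forall>x\<in>J. \<forall>y\<in>J. x + y \<in> J) \<and> (\<forall>x\<in>J. \<forall>r. r * x \<in> J)"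

definition is_prime :: "'a::comm_ring_1 set \<Rightarrow> bool"
  where "is_prime P \<longleftrightarrow> is_ideal P \<and> 1 \<notin> P \<and> (\<forall>x y. x * y \<in> P \<longrightarrow> x \<in> P \<or> y \<in> P)"

definition adjoin :: "'a::comm_ring_1 set \<Rightarrow> 'a \<Rightarrow> 'a set"
  where "adjoin J a = {x + r * a |x r. x \<in> J}"

lemma ideal_zero: "is_ideal J \<Longrightarrow> 0 \<in> J"
  and ideal_add: "is_ideal J \<Longrightarrow> x \<in> J \<Longrightarrow> y \<in> J \<Longrightarrow> x + y \<in> J"
  and ideal_mult: "is_ideal J \<Longrightarrow> x \<in> J \<Longrightarrow> r * x \<in> J"
  by (auto simp: is_ideal_def)

lemma ideal_mult': "is_ideal J \<Longrightarrow> x \<in> J \<Longrightarrow> x * r \<in> J"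
  by (metis ideal_mult mult.commute)

lemma ideal_uminus: "is_ideal J \<Longrightarrow> x \<in> J \<Longrightarrow> - x \<in> J"
  using ideal_mult[of J x "-1"] by simp

lemma ideal_diff: "is_ideal J \<Longrightarrow> x \<in> J \<Longrightarrow> y \<in> J \<Longrightarrow> x - y \<in> J"
  using ideal_add[of J x "- y"] ideal_uminus[of J y] by simp

lemma ideal_sum: "is_ideal J \<Longrightarrow> (\<And>i. i \<in> A \<Longrightarrow> f i \<in> J) \<Longrightarrow> sum f A \<in> J"
  by (induction A rule: infinite_finite_induct) (auto intro: ideal_zero ideal_add)

lemma ideal_diff_commute: "is_ideal J \<Longrightarrow> x - y \<in> J \<Longrightarrow> y - x \<in> J"
  using ideal_uminus[of J "x - y"] by simp

lemma ideal_diff_trans: "is_ideal J \<Longrightarrow> x - y \<in> J \<Longrightarrow> y - z \<in> J \<Longrightarrow> x - z \<in> J"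
  using ideal_add[of J "x - y" "y - z"] by simp

lemma ideal_cong_add: "is_ideal J \<Longrightarrow> x - x' \<in> J \<Longrightarrow> y - y' \<in> J \<Longrightarrow> (x + y) - (x' + y') \<in> J"
  using ideal_add[of J "x - x'" "y - y'"] by (simp add: algebra_simps)

lemma ideal_cong_mult:
  assumes "is_ideal J" "x - x' \<in> J" "y - y' \<in> J"
  shows "x * y - x' * y' \<in> J"
proof -
  have "x * y - x' * y' = y * (x - x') + x' * (y - y')" by (simp add: algebra_simps)
  then show ?thesis using assms by (metis ideal_add ideal_mult)
qed

lemma ideal_cong_sum:
  "is_ideal J \<Longrightarrow> (\<And>i. i \<in> A \<Longrightarrow> f i - g i \<in> J) \<Longrightarrow> sum f A - sum g A \<in> J"
  using ideal_sum[of J A "\<lambda>i. f i - g i"] by (simp add: sum_subtractf)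

lemma ideal_cong_prod:
  "is_ideal J \<Longrightarrow> (\<And>i. i \<in> A \<Longrightarrow> f i - g i \<in> J) \<Longrightarrow> prod f A - prod g A \<in> J"
  by (induction A rule: infinite_finite_induct) (auto intro: ideal_zero ideal_cong_mult)

lemma ideal_cong_mem: "is_ideal J \<Longrightarrow> x - y \<in> J \<Longrightarrow> x \<in> J \<longleftrightarrow> y \<in> J"
  by (metis diff_add_cancel ideal_add ideal_diff_commute)

lemma ideal_one: "is_ideal J \<Longrightarrow> 1 \<in> J \<Longrightarrow> x \<in> J"
  using ideal_mult[of J 1 x] by simp

lemma prime_ideal: "is_prime P \<Longrightarrow> is_ideal P"
  by (simp add: is_prime_def)

lemma prime_mult: "is_prime P \<Longrightarrow> x * y \<in> P \<longleftrightarrow> x \<in> P \<or> y \<in> P"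
  by (metis ideal_mult is_prime_def mult.commute)

lemma prime_power: "is_prime P \<Longrightarrow> x ^ k \<in> P \<Longrightarrow> x \<in> P"
  by (induction k) (auto simp: is_prime_def)

lemma prime_prod: "finite A \<Longrightarrow> is_prime P \<Longrightarrow> prod f A \<in> P \<Longrightarrow> \<exists>i\<in>A. f i \<in> P"
  by (induction A rule: finite_induct) (auto simp: prime_mult, simp add: is_prime_def)

lemma adjoin_ideal:
  assumes "is_ideal J"
  shows "is_ideal (adjoin J a)"
  unfolding is_ideal_def
proof (intro conjI ballI allI)
  show "0 \<in> adjoin J a"
    unfolding adjoin_def using ideal_zero[OF assms] by (auto intro!: exI[of _ 0])
next
  fix x y assume "x \<in> adjoin J a" "y \<in> adjoin J a"
  then obtain u r v s where "u \<in> J" "v \<in> J" "x = u + r * a" "y = v + s * a"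
    unfolding adjoin_def by blast
  then have "x + y = (u + v) + (r + s) * a" "u + v \<in> J"
    using assms by (auto simp: algebra_simps ideal_add)
  then show "x + y \<in> adjoin J a" unfolding adjoin_def by blast
next
  fix x t assume "x \<in> adjoin J a"
  then obtain u r where "u \<in> J" "x = u + r * a" unfolding adjoin_def by blast
  then have "t * x = t * u + (t * r) * a" "t * u \<in> J"
    using assms by (auto simp: algebra_simps ideal_mult)
  then show "t * x \<in> adjoin J a" unfolding adjoin_def by blast
qed

lemma adjoin_super: "J \<subseteq> adjoin J a"
proof
  fix x assume "x \<in> J"
  then have "x = x + 0 * a \<and> x \<in> J" by simp
  then show "x \<in> adjoin J a" unfolding adjoin_def by blast
qed

lemma adjoin_self: "is_ideal J \<Longrightarrow> a \<in> adjoin J a"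
  unfolding adjoin_def using ideal_zero[of J] by (intro CollectI exI[of _ 0] exI[of _ 1]) simp

lemma adjoin_least: "is_ideal Q \<Longrightarrow> J \<subseteq> Q \<Longrightarrow> a \<in> Q \<Longrightarrow> adjoin J a \<subseteq> Q"
  unfolding adjoin_def by (auto intro!: ideal_add ideal_mult)

lemma ideal_Inter: "(\<And>P. P \<in> \<P> \<Longrightarrow> is_ideal P) \<Longrightarrow> is_ideal (\<Inter>\<P>)"
  unfolding is_ideal_def by auto

lemma principal_ideal: "is_ideal {c * q |q. True}"
  unfolding is_ideal_def
proof (intro conjI ballI allI)
  fix x y assume "x \<in> {c * q |q. True}" "y \<in> {c * q |q. True}"
  then obtain p q where "x = c * p" "y = c * q" by blast
  then show "x + y \<in> {c * q |q. True}" by (auto intro: exI[of _ "p + q"] simp: algebra_simps)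
next
  fix x r assume "x \<in> {c * q |q. True}"
  then obtain p where "x = c * p" by blast
  then show "r * x \<in> {c * q |q. True}" by (auto intro: exI[of _ "r * p"] simp: algebra_simps)
qed (auto intro: exI[of _ 0])

section \<open>Polynomials and substitutions\<close>

text \<open>Monomials are multisets, as in \<open>mpoly_ring\<close>, so that coefficients can be
  compared directly, while finitely supported maps on them form a ring of the type class.\<close>

type_synonym ('v, 'u) mpol = "'v multiset \<Rightarrow>\<^sub>0 'u"

definition Const :: "'u::comm_ring_1 \<Rightarrow> ('v, 'u) mpol"
  where "Const c = Poly_Mapping.single {#} c"

definition Var :: "'v \<Rightarrow> ('v, 'u::comm_ring_1) mpol"
  where "Var i = Poly_Mapping.single {#i#} 1"

definition psubst :: "('v \<Rightarrow> ('w, 'u::comm_ring_1) mpol) \<Rightarrow> ('v, 'u) mpol \<Rightarrow> ('w, 'u) mpol"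
  where "psubst \<sigma> p =
    (\<Sum>m\<in>Poly_Mapping.keys p. Const (Poly_Mapping.lookup p m) * (\<Prod>i\<in>#m. \<sigma> i))"

lemma single_empty [simp]: "Poly_Mapping.single {#} 1 = (1 :: ('v, 'u::comm_ring_1) mpol)"
  by (metis single_one empty_neutral(1) zero_multiset_def)

lemma Const_0 [simp]: "Const 0 = 0" by (simp add: Const_def)
lemma Const_1 [simp]: "Const 1 = 1" by (simp add: Const_def)
lemma Const_add: "Const (a + b) = Const a + Const b" by (simp add: Const_def single_add)
lemma Const_diff: "Const (a - b) = Const a - Const b" by (simp add: Const_def single_diff)
lemma Const_uminus: "Const (- a) = - Const a" by (simp add: Const_def single_uminus)
lemma Const_mult: "Const (a * b) = Const a * Const b" by (simp add: Const_def mult_single)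
lemma Const_power: "Const (a ^ k) = Const a ^ k" by (induction k) (simp_all add: Const_mult)

lemma Const_of_nat: "Const (of_nat k) = of_nat k"
  by (induction k) (simp_all add: Const_add)

lemma single_mult_Var:
  "Poly_Mapping.single (add_mset i m) c = Poly_Mapping.single m c * Var i"
  by (simp add: Var_def mult_single)

lemma mpol_sum_single:
  "p = (\<Sum>m\<in>Poly_Mapping.keys p. Poly_Mapping.single m (Poly_Mapping.lookup p m))"
proof (rule poly_mapping_eqI)
  fix k
  have "(\<Sum>m\<in>Poly_Mapping.keys p. Poly_Mapping.lookup (Poly_Mapping.single m (Poly_Mapping.lookup p m)) k) =
     (\<Sum>m\<in>Poly_Mapping.keys p. if m = k then Poly_Mapping.lookup p m else 0)"
    by (intro sum.cong) (auto simp: lookup_single when_def)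
  also have "\<dots> = Poly_Mapping.lookup p k"
    by (simp add: sum.delta' not_in_keys_iff_lookup_eq_zero)
  finally show "Poly_Mapping.lookup p k = Poly_Mapping.lookup (\<Sum>m\<in>Poly_Mapping.keys p. Poly_Mapping.single m (Poly_Mapping.lookup p m)) k"
    by (simp add: lookup_sum)
qed

lemma mpol_induct [case_names Const add Var]:
  fixes p :: "('v, 'u::comm_ring_1) mpol"
  assumes c: "\<And>c. Q (Const c)" and a: "\<And>p q. Q p \<Longrightarrow> Q q \<Longrightarrow> Q (p + q)"
    and v: "\<And>p i. Q p \<Longrightarrow> Q (p * Var i)"
  shows "Q p"
proof -
  have s: "Q (Poly_Mapping.single m c)" for m :: "'v multiset" and c :: 'u
  proof (induction m)
    case empty
    then show ?case using c[of c] by (simp add: Const_def)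
  next
    case (add i m)
    then show ?case using v by (simp add: single_mult_Var)
  qed
  have "finite A \<Longrightarrow> Q (\<Sum>m\<in>A. Poly_Mapping.single m (Poly_Mapping.lookup p m))" for A
    by (induction A rule: finite_induct) (use c[of 0] a s in auto)
  from this[OF finite_keys] show ?thesis using mpol_sum_single[of p] by metis
qed

lemma psubst_superset:
  assumes "finite A" "Poly_Mapping.keys p \<subseteq> A"
  shows "psubst \<sigma> p = (\<Sum>m\<in>A. Const (Poly_Mapping.lookup p m) * (\<Prod>i\<in>#m. \<sigma> i))"
  unfolding psubst_def
  by (rule sum.mono_neutral_left) (use assms in \<open>auto simp: not_in_keys_iff_lookup_eq_zero\<close>)

lemma psubst_add: "psubst \<sigma> (p + q) = psubst \<sigma> p + psubst \<sigma> q"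
proof -
  let ?A = "Poly_Mapping.keys p \<union> Poly_Mapping.keys q"
  have "finite ?A" "Poly_Mapping.keys (p + q) \<subseteq> ?A" by (auto simp: Poly_Mapping.keys_add)
  then show ?thesis
    using psubst_superset[of ?A "p + q" \<sigma>] psubst_superset[of ?A p \<sigma>] psubst_superset[of ?A q \<sigma>]
    by (simp add: lookup_add Const_add algebra_simps sum.distrib)
qed

lemma psubst_single: "psubst \<sigma> (Poly_Mapping.single m c) = Const c * (\<Prod>i\<in>#m. \<sigma> i)"
  by (simp add: psubst_def)

lemma psubst_Const [simp]: "psubst \<sigma> (Const c) = Const c"
  using psubst_single[of \<sigma> "{#}" c] by (simp add: Const_def)

lemma psubst_Var [simp]: "psubst \<sigma> (Var i) = \<sigma> i"
  by (simp add: Var_def psubst_single)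

lemma psubst_0 [simp]: "psubst \<sigma> 0 = 0"
  and psubst_1 [simp]: "psubst \<sigma> 1 = 1"
  using psubst_Const[of \<sigma> 0] psubst_Const[of \<sigma> 1] by simp_all

lemma psubst_mult_Var: "psubst \<sigma> (p * Var i) = psubst \<sigma> p * \<sigma> i"
proof -
  have "finite A \<Longrightarrow> psubst \<sigma> ((\<Sum>m\<in>A. Poly_Mapping.single m (f m)) * Var i) =
    psubst \<sigma> (\<Sum>m\<in>A. Poly_Mapping.single m (f m)) * \<sigma> i" for A f
  proof (induction A rule: finite_induct)
    case (insert m A)
    have "psubst \<sigma> (Poly_Mapping.single m c * Var i) = psubst \<sigma> (Poly_Mapping.single m c) * \<sigma> i" for c
      by (simp add: psubst_single flip: single_mult_Var)
    then show ?case using insert by (simp add: psubst_add distrib_right)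
  qed simp
  from this[OF finite_keys] show ?thesis using mpol_sum_single[of p] by metis
qed

lemma psubst_mult: "psubst \<sigma> (p * q) = psubst \<sigma> p * psubst \<sigma> q"
proof (induction q rule: mpol_induct)
  case (Const c)
  show ?case
  proof (induction p rule: mpol_induct)
    case (Const d)
    then show ?case by (simp flip: Const_mult)
  next
    case (add p q)
    then show ?case by (simp add: psubst_add distrib_right)
  next
    case (Var p i)
    have "p * Var i * Const c = p * Const c * Var i" by (simp add: mult_ac)
    then show ?case by (simp only: psubst_mult_Var Var) (simp add: mult_ac)
  qed
next
  case (add q r)
  then show ?case by (simp add: psubst_add distrib_left)
next
  case (Var q i)
  then show ?case by (simp add: psubst_mult_Var flip: mult.assoc)
qed

lemma psubst_uminus: "psubst \<sigma> (- p) = - psubst \<sigma> p"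
  using psubst_add[of \<sigma> p "- p"] by (simp add: eq_neg_iff_add_eq_0 add.commute)

lemma psubst_diff: "psubst \<sigma> (p - q) = psubst \<sigma> p - psubst \<sigma> q"
  using psubst_add[of \<sigma> p "- q"] by (simp add: psubst_uminus)

lemma psubst_sum: "psubst \<sigma> (sum f A) = (\<Sum>x\<in>A. psubst \<sigma> (f x))"
  by (induction A rule: infinite_finite_induct) (simp_all add: psubst_add)

lemma psubst_power: "psubst \<sigma> (p ^ k) = psubst \<sigma> p ^ k"
  by (induction k) (simp_all add: psubst_mult)

lemma psubst_psubst: "psubst \<sigma> (psubst \<tau> p) = psubst (\<lambda>i. psubst \<sigma> (\<tau> i)) p"
  by (induction p rule: mpol_induct) (simp_all add: psubst_add psubst_mult)

lemma psubst_ident [simp]: "psubst Var p = p"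
  by (induction p rule: mpol_induct) (simp_all add: psubst_add psubst_mult)

lemma psubst_cong:
  assumes "is_ideal J" "\<And>i. \<sigma> i - \<tau> i \<in> J"
  shows "psubst \<sigma> p - psubst \<tau> p \<in> J"
  by (induction p rule: mpol_induct)
    (use assms in \<open>auto simp: psubst_add psubst_mult intro: ideal_zero ideal_cong_add ideal_cong_mult\<close>)

subsection \<open>Polynomials with coefficients in an ideal\<close>

text \<open>Congruence modulo \<open>ext J\<close> stands for equality of polynomials over the quotient by \<open>J\<close>, so that
  passing to quotients changes an ideal and not the type of coefficients.\<close>

definition ext :: "'u::comm_ring_1 set \<Rightarrow> ('v, 'u) mpol set"
  where "ext J = {p. \<forall>m. Poly_Mapping.lookup p m \<in> J}"

lemma lookup_mult_Const: "Poly_Mapping.lookup (p * Const c) m = Poly_Mapping.lookup p m * c"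
proof -
  have "p * Const c = Poly_Mapping.map ((*) c) p"
    by (simp add: Const_def mult_map_scale_conv_mult mult.commute flip: zero_multiset_def)
  then show ?thesis by (simp add: Poly_Mapping.map.rep_eq when_def mult.commute)
qed

lemma lookup_single_mult:
  "Poly_Mapping.lookup (Poly_Mapping.single k c * q) m =
     (if k \<subseteq># m then c * Poly_Mapping.lookup q (m - k) else 0)"
proof -
  have "Poly_Mapping.lookup (Poly_Mapping.single k c * Poly_Mapping.single l d) m =
     (if k \<subseteq># m then c * Poly_Mapping.lookup (Poly_Mapping.single l d) (m - k) else 0)" for l d
    by (auto simp: mult_single lookup_single when_def mset_subset_eq_exists_conv
        dest: sym intro: arg_cong[where f = "(*) c"])
  note s = this
  have "finite A \<Longrightarrow> Poly_Mapping.lookup (Poly_Mapping.single k c * (\<Sum>m\<in>A. Poly_Mapping.single m (f m))) m =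
     (if k \<subseteq># m then c * Poly_Mapping.lookup (\<Sum>m\<in>A. Poly_Mapping.single m (f m)) (m - k) else 0)" for A f
    by (induction A rule: finite_induct) (auto simp: distrib_left lookup_add s)
  from this[OF finite_keys] show ?thesis using mpol_sum_single[of q] by metis
qed

lemma ext_single: "is_ideal J \<Longrightarrow> c \<in> J \<Longrightarrow> Poly_Mapping.single m c \<in> ext J"
  by (auto simp: ext_def lookup_single when_def ideal_zero)

lemma ext_ideal: 
  assumes J: "is_ideal J"
  shows "is_ideal (ext J :: ('v, 'u::comm_ring_1) mpol set)"
proof -
  have add: "p + q \<in> ext J" if "p \<in> ext J" "q \<in> ext J" for p q :: "('v, 'u) mpol"
    using that J by (auto simp: ext_def lookup_add ideal_add)
  have "r * p \<in> ext J" if "p \<in> ext J" for r p :: "('v, 'u) mpol"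
  proof -
    have "Poly_Mapping.single k c * p \<in> ext J" for k :: "'v multiset" and c :: 'u
      using that J by (auto simp: ext_def lookup_single_mult ideal_mult ideal_zero)
    note s = this
    have "finite A \<Longrightarrow> (\<Sum>m\<in>A. Poly_Mapping.single m (f m)) * p \<in> ext J" for A :: "'v multiset set" and f
      by (induction A rule: finite_induct) (auto simp: distrib_right add s, simp add: ext_def J ideal_zero)
    from this[OF finite_keys] show ?thesis using mpol_sum_single[of r] by metis
  qed
  with add J show ?thesis unfolding is_ideal_def[of "ext J"] by (auto simp: ext_def ideal_zero)
qed

lemma ext_mono: "I \<subseteq> J \<Longrightarrow> ext I \<subseteq> ext J"
  by (auto simp: ext_def)

lemma ext_Inter: "ext (\<Inter>\<P>) = \<Inter>(ext ` \<P>)"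
  by (auto simp: ext_def)

lemma ext_Int: "ext (P \<inter> Q) = ext P \<inter> ext Q"
  by (auto simp: ext_def)

lemma Const_ext: "is_ideal J \<Longrightarrow> Const c \<in> (ext J :: ('v, 'u::comm_ring_1) mpol set) \<longleftrightarrow> c \<in> J"
  by (auto simp: ext_def Const_def lookup_single when_def ideal_zero split: if_splits)

lemma psubst_ext:
  assumes "is_ideal J" "p \<in> ext J"
  shows "psubst \<sigma> p \<in> ext J"
  unfolding psubst_def
proof (intro ideal_sum ext_ideal assms(1) ideal_mult'[OF ext_ideal])
  fix m show "Const (Poly_Mapping.lookup p m) \<in> ext J" using assms by (simp add: Const_ext) (simp add: ext_def)
qed

lemma psubst_ext_cong:
  "is_ideal J \<Longrightarrow> p - q \<in> ext J \<Longrightarrow> psubst \<sigma> p - psubst \<sigma> q \<in> ext J"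
  using psubst_ext[of J "p - q" \<sigma>] by (simp add: psubst_diff)

lemma ext_cancel:
  assumes "\<And>x. t * x \<in> J \<Longrightarrow> x \<in> J" "Const t * p \<in> ext J"
  shows "p \<in> ext J"
  using assms by (auto simp: ext_def Const_def lookup_single_mult)

text \<open>Each coefficient is an element of \<open>J\<close> plus a multiple of \<open>a\<close>,
  and the multipliers are collected into one polynomial. This turns a congruence modulo
  \<open>adjoin J a\<close> into an explicit error term \<open>Const a * q\<close> modulo
  \<open>J\<close>.\<close>

lemma ext_adjoin:
  fixes p :: "('v, 'u::comm_ring_1) mpol"
  assumes J: "is_ideal J" and p: "p \<in> ext (adjoin J a)"
  shows "\<exists>q. p - Const a * q \<in> ext J"
proof -
  have "\<exists>q. (\<Sum>m\<in>A. Poly_Mapping.single m (Poly_Mapping.lookup p m)) - Const a * q \<in> ext J"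
    if "finite A" for A
    using that
  proof (induction A rule: finite_induct)
    case empty
    then show ?case using ideal_zero[OF ext_ideal[OF J]] by (intro exI[of _ 0]) auto
  next
    case (insert m A)
    then obtain q where q: "(\<Sum>m\<in>A. Poly_Mapping.single m (Poly_Mapping.lookup p m)) - Const a * q \<in> ext J"
      by blast
    obtain x r where x: "x \<in> J" "Poly_Mapping.lookup p m = x + r * a"
      using p unfolding ext_def adjoin_def by blast
    have "Poly_Mapping.single m (Poly_Mapping.lookup p m) = Poly_Mapping.single m x + Const a * Poly_Mapping.single m r"
      unfolding x(2) by (simp add: single_add Const_def mult_single mult.commute)
    then have "(\<Sum>m\<in>insert m A. Poly_Mapping.single m (Poly_Mapping.lookup p m)) - Const a * (q + Poly_Mapping.single m r)
      = Poly_Mapping.single m x + ((\<Sum>m\<in>A. Poly_Mapping.single m (Poly_Mapping.lookup p m)) - Const a * q)"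
      using insert by (simp add: algebra_simps)
    then show ?case using q ext_single[OF J x(1)] ideal_add[OF ext_ideal[OF J]] by metis
  qed
  from this[OF finite_keys] show ?thesis using mpol_sum_single[of p] by metis
qed

section \<open>Automorphisms and coordinates modulo an ideal\<close>

text \<open>An automorphism over the quotient by \<open>J\<close>, given by the images of the
  variables. The components may involve variables from \<open>n\<close> on; these are fixed and act
  as parameters, so the base is really a polynomial ring in the parameters.\<close>

definition inverse_pair ::
    "'u::comm_ring_1 set \<Rightarrow> nat \<Rightarrow> (nat \<Rightarrow> (nat, 'u) mpol) \<Rightarrow> (nat \<Rightarrow> (nat, 'u) mpol) \<Rightarrow> bool"
  where "inverse_pair J n \<sigma> \<tau> \<longleftrightarrow>
    (\<forall>i\<ge>n. \<sigma> i = Var i \<and> \<tau> i = Var i) \<and>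
    (\<forall>i. psubst \<sigma> (\<tau> i) - Var i \<in> ext J) \<and> (\<forall>i. psubst \<tau> (\<sigma> i) - Var i \<in> ext J)"

text \<open>The coordinate system may involve parameters; \<open>inverse_pair_below\<close> removes
  them when \<open>F\<close> has none.\<close>

definition coord :: "'u::comm_ring_1 set \<Rightarrow> nat \<Rightarrow> (nat, 'u) mpol \<Rightarrow> bool"
  where "coord J n F \<longleftrightarrow> 0 < n \<and> (\<exists>\<sigma> \<tau>. inverse_pair J n \<sigma> \<tau> \<and> \<sigma> 0 - F \<in> ext J)"

text \<open>Which variables occur is expressed by invariance under substitutions instead of by the
  support, so that closure properties follow by rewriting. \<open>only_below\<close> is in the same
  spirit: setting the variables from \<open>n\<close> on to zero changes nothing.\<close>

definition only_above :: "nat \<Rightarrow> (nat, 'u::comm_ring_1) mpol \<Rightarrow> bool"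
  where "only_above n p \<longleftrightarrow> (\<forall>\<sigma>. (\<forall>j\<ge>n. \<sigma> j = Var j) \<longrightarrow> psubst \<sigma> p = p)"

definition below :: "nat \<Rightarrow> nat \<Rightarrow> (nat, 'u::comm_ring_1) mpol"
  where "below n i = (if i < n then Var i else 0)"

definition only_below :: "nat \<Rightarrow> (nat, 'u::comm_ring_1) mpol \<Rightarrow> bool"
  where "only_below n p \<longleftrightarrow> psubst (below n) p = p"

lemma only_above_Var: "n \<le> i \<Longrightarrow> only_above n (Var i)"
  and only_above_Const: "only_above n (Const c)"
  and only_above_0: "only_above n 0"
  by (auto simp: only_above_def)

lemma only_above_mult: "only_above n p \<Longrightarrow> only_above n q \<Longrightarrow> only_above n (p * q)"
  by (auto simp: only_above_def psubst_mult)

lemma only_below_psubst: "only_below n p \<Longrightarrow> (\<And>i. i < n \<Longrightarrow> \<sigma> i = \<tau> i) \<Longrightarrow> psubst \<sigma> p = psubst \<tau> p"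
proof -
  assume p: "only_below n p" and eq: "\<And>i. i < n \<Longrightarrow> \<sigma> i = \<tau> i"
  have "(\<lambda>i. psubst \<sigma> (below n i)) = (\<lambda>i. psubst \<tau> (below n i))"
    using eq by (auto simp: below_def)
  then have "psubst \<sigma> (psubst (below n) p) = psubst \<tau> (psubst (below n) p)"
    by (simp add: psubst_psubst)
  with p show ?thesis by (simp add: only_below_def)
qed

lemma only_below_ident: "only_below n p \<Longrightarrow> (\<And>i. i < n \<Longrightarrow> \<sigma> i = Var i) \<Longrightarrow> psubst \<sigma> p = p"
  using only_below_psubst[of n p \<sigma> Var] by simp

lemma only_below_cong:
  assumes "is_ideal J" "only_below n p" "\<And>i. i < n \<Longrightarrow> \<sigma> i - \<tau> i \<in> J"
  shows "psubst \<sigma> p - psubst \<tau> p \<in> J"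
proof -
  have "psubst (\<lambda>i. if i < n then \<sigma> i else 0) p - psubst (\<lambda>i. if i < n then \<tau> i else 0) p \<in> J"
    using assms by (intro psubst_cong) (auto intro: ideal_zero)
  moreover have "psubst (\<lambda>i. if i < n then \<sigma> i else 0) p = psubst \<sigma> p"
    "psubst (\<lambda>i. if i < n then \<tau> i else 0) p = psubst \<tau> p"
    using assms(2) by (auto intro!: only_below_psubst)
  ultimately show ?thesis by simp
qed

lemma only_below_below: "only_below n (psubst (below n) p)"
proof -
  have "(\<lambda>i. psubst (below n) (below n i)) = below n" by (auto simp: below_def)
  then have "psubst (\<lambda>i. psubst (below n) (below n i)) p = psubst (below n) p" by (rule arg_cong)
  then show ?thesis by (simp only: only_below_def psubst_psubst)
qed

lemma only_below_mono: "only_below n p \<Longrightarrow> n \<le> N \<Longrightarrow> only_below N p"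
  unfolding only_below_def[of N] by (rule only_below_ident) (auto simp: below_def)

section \<open>Inverse pairs: composition, base change, modification of a component\<close>

lemma inverse_pair_ident: "is_ideal J \<Longrightarrow> inverse_pair J n Var Var"
  by (simp add: inverse_pair_def ideal_zero ext_ideal)

lemma inverse_pair_sym: "inverse_pair J n \<sigma> \<tau> \<Longrightarrow> inverse_pair J n \<tau> \<sigma>"
  by (simp add: inverse_pair_def)

lemma inverse_pair_apply:
  assumes "is_ideal J" "inverse_pair J n \<sigma> \<tau>"
  shows "psubst \<sigma> (psubst \<tau> p) - p \<in> ext J"
  using psubst_cong[OF ext_ideal[OF assms(1)], of "\<lambda>i. psubst \<sigma> (\<tau> i)" Var p] assms(2)
  by (simp add: inverse_pair_def psubst_psubst)

lemma inverse_pair_comp: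
  assumes J: "is_ideal J" and a: "inverse_pair J n \<sigma> \<tau>" "inverse_pair J n \<sigma>' \<tau>'"
  shows "inverse_pair J n (\<lambda>i. psubst \<sigma> (\<sigma>' i)) (\<lambda>i. psubst \<tau>' (\<tau> i))"
proof -
  have *: "psubst (\<lambda>i. psubst \<alpha> (\<alpha>' i)) (psubst \<beta>' (\<beta> i)) - Var i \<in> ext J"
    if "inverse_pair J n \<alpha> \<beta>" "inverse_pair J n \<alpha>' \<beta>'" for \<alpha> \<beta> \<alpha>' \<beta>' i
  proof -
    have "psubst \<alpha> (psubst \<alpha>' (psubst \<beta>' (\<beta> i))) - psubst \<alpha> (\<beta> i) \<in> ext J"
      by (intro psubst_ext_cong J inverse_pair_apply[OF J that(2)])
    moreover have "psubst \<alpha> (\<beta> i) - Var i \<in> ext J" using that(1) by (simp add: inverse_pair_def)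
    ultimately show ?thesis
      using ideal_diff_trans[OF ext_ideal[OF J]] by (simp add: psubst_psubst) blast
  qed
  show ?thesis
    using *[OF a] *[OF a(2)[THEN inverse_pair_sym] a(1)[THEN inverse_pair_sym]] a
    by (auto simp: inverse_pair_def)
qed

lemma inverse_pair_mono: "inverse_pair J n \<sigma> \<tau> \<Longrightarrow> J \<subseteq> J' \<Longrightarrow> inverse_pair J' n \<sigma> \<tau>"
  using ext_mono[of J J'] by (auto simp: inverse_pair_def)

lemma inverse_pair_le: "inverse_pair J n \<sigma> \<tau> \<Longrightarrow> n \<le> N \<Longrightarrow> inverse_pair J N \<sigma> \<tau>"
  by (auto simp: inverse_pair_def)

text \<open>Base change of an automorphism: \<open>\<psi>\<close> replaces the parameters by
  polynomials in the parameters. It is used to set a parameter to zero or to a constant, to rescale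
  it and to rename it. The second claim transports the effect of the automorphism on a given
  polynomial.\<close>

lemma inverse_pair_spec:
  assumes J: "is_ideal J" and a: "inverse_pair J n \<sigma> \<tau>"
    and \<psi>: "\<And>i. i < n \<Longrightarrow> \<psi> i = Var i" "\<And>i. n \<le> i \<Longrightarrow> only_above n (\<psi> i)"
  defines "\<sigma>' \<equiv> (\<lambda>i. if i < n then psubst \<psi> (\<sigma> i) else Var i)"
    and "\<tau>' \<equiv> (\<lambda>i. if i < n then psubst \<psi> (\<tau> i) else Var i)"
  shows "inverse_pair J n \<sigma>' \<tau>'" and "psubst \<sigma>' (psubst \<psi> p) = psubst \<psi> (psubst \<sigma> p)"
proof -
  have *: "psubst (\<lambda>i. if i < n then psubst \<psi> (\<alpha> i) else Var i) (psubst \<psi> p) = psubst \<psi> (psubst \<alpha> p)"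
    if "\<forall>i\<ge>n. \<alpha> i = Var i" for \<alpha> p
  proof -
    have "psubst (\<lambda>i. if i < n then psubst \<psi> (\<alpha> i) else Var i) (\<psi> i) = psubst \<psi> (\<alpha> i)" for i
    proof (cases "i < n")
      case False
      then have "only_above n (\<psi> i)" using \<psi>(2) by simp
      then show ?thesis using that False by (simp add: only_above_def)
    qed (simp add: \<psi>(1))
    then show ?thesis by (simp add: psubst_psubst)
  qed
  have f: "\<forall>i\<ge>n. \<sigma> i = Var i" "\<forall>i\<ge>n. \<tau> i = Var i" using a by (auto simp: inverse_pair_def)
  show "psubst \<sigma>' (psubst \<psi> p) = psubst \<psi> (psubst \<sigma> p)"
    unfolding \<sigma>'_def by (rule *[OF f(1)])
  have "psubst \<psi> (psubst \<sigma> (\<tau> i)) - Var i \<in> ext J" "psubst \<psi> (psubst \<tau> (\<sigma> i)) - Var i \<in> ext J" if "i < n" for i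
    using psubst_ext_cong[OF J, of "psubst \<sigma> (\<tau> i)" "Var i" \<psi>]
      psubst_ext_cong[OF J, of "psubst \<tau> (\<sigma> i)" "Var i" \<psi>] a that
    by (auto simp: inverse_pair_def \<psi>(1))
  then show "inverse_pair J n \<sigma>' \<tau>'"
    using *[OF f(1)] *[OF f(2)] ideal_zero[OF ext_ideal[OF J]]
    by (auto simp: inverse_pair_def \<sigma>'_def \<tau>'_def)
qed

text \<open>Setting all parameters to zero is a base change, and it fixes \<open>F\<close>.\<close>

lemma inverse_pair_below:
  assumes J: "is_ideal J" and a: "inverse_pair J n \<sigma> \<tau>" and F: "only_below n F" "\<sigma> 0 - F \<in> ext J" "0 < n"
  obtains \<sigma>' \<tau>' where "inverse_pair J n \<sigma>' \<tau>'" "\<And>i. i < n \<Longrightarrow> only_below n (\<sigma>' i)"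
    "\<And>i. i < n \<Longrightarrow> only_below n (\<tau>' i)" "\<sigma>' 0 - F \<in> ext J"
proof
  show "inverse_pair J n (\<lambda>i. if i < n then psubst (below n) (\<sigma> i) else Var i)
     (\<lambda>i. if i < n then psubst (below n) (\<tau> i) else Var i)"
    by (rule inverse_pair_spec[OF J a]) (auto simp: below_def only_above_0)
  show "(if 0 < n then psubst (below n) (\<sigma> 0) else Var 0) - F \<in> ext J"
    using psubst_ext_cong[OF J F(2), of "below n"] F(1,3) by (simp add: only_below_def)
qed (auto simp: only_below_below)

lemma inverse_pair_replace_0:
  assumes J: "is_ideal J" and st: "inverse_pair J n \<sigma> \<tau>" and F: "\<sigma> 0 - F \<in> ext J" and n: "0 < n"
  shows "inverse_pair J n (\<sigma>(0 := F)) \<tau>"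
  unfolding inverse_pair_def
proof (intro conjI allI)
  note E = ext_ideal[OF J, where ?'v = nat]
  have d: "(\<sigma>(0 := F)) i - \<sigma> i \<in> ext J" for i
    using F by (auto simp: ideal_zero[OF E] intro: ideal_diff_commute[OF E])
  fix i
  show "psubst (\<sigma>(0 := F)) (\<tau> i) - Var i \<in> ext J"
    using st by (intro ideal_diff_trans[OF E psubst_cong[OF E d]]) (auto simp: inverse_pair_def)
  show "psubst \<tau> ((\<sigma>(0 := F)) i) - Var i \<in> ext J"
    using st by (intro ideal_diff_trans[OF E psubst_ext_cong[OF J d]]) (auto simp: inverse_pair_def)
qed (use st n in \<open>auto simp: inverse_pair_def\<close>)

section \<open>Transport of coordinates along automorphisms\<close>

lemma coord_mono: "coord J n F \<Longrightarrow> J \<subseteq> J' \<Longrightarrow> coord J' n F"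
  unfolding coord_def using inverse_pair_mono ext_mono by blast

lemma coord_image:
  assumes J: "is_ideal J" and F: "coord J n F" and a: "inverse_pair J n \<rho> \<rho>'"
    and G: "psubst \<rho> F - G \<in> ext J"
  shows "coord J n G"
proof -
  obtain \<sigma> \<tau> where s: "inverse_pair J n \<sigma> \<tau>" "\<sigma> 0 - F \<in> ext J" "0 < n"
    using F by (auto simp: coord_def)
  have "psubst \<rho> (\<sigma> 0) - G \<in> ext J"
    using psubst_ext_cong[OF J s(2), of \<rho>] G ideal_diff_trans[OF ext_ideal[OF J]] by blast
  then show ?thesis using inverse_pair_comp[OF J a s(1)] s(3) unfolding coord_def by blast
qed

lemma coord_preimage:
  assumes J: "is_ideal J" and G: "coord J n G" and a: "inverse_pair J n \<rho> \<rho>'"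
    and F: "psubst \<rho> F - G \<in> ext J"
  shows "coord J n F"
proof (rule coord_image[OF J G inverse_pair_sym[OF a]])
  have "psubst \<rho>' (psubst \<rho> F) - F \<in> ext J"
    by (rule inverse_pair_apply[OF J inverse_pair_sym[OF a]])
  moreover have "psubst \<rho>' G - psubst \<rho>' (psubst \<rho> F) \<in> ext J"
    by (intro psubst_ext_cong J ideal_diff_commute[OF ext_ideal[OF J] F])
  ultimately show "psubst \<rho>' G - F \<in> ext J" using ideal_diff_trans[OF ext_ideal[OF J]] by blast
qed

lemma coord_Var: "is_ideal J \<Longrightarrow> 0 < n \<Longrightarrow> coord J n (Var 0)"
  unfolding coord_def using inverse_pair_ident ideal_zero[OF ext_ideal] by force

subsection \<open>Lifting along nilpotents\<close>

definition radical :: "'u::comm_ring_1 set \<Rightarrow> 'u set"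
  where "radical J = {x. \<exists>k. x ^ k \<in> J}"

lemma foldl_adjoin_ideal: "is_ideal J \<Longrightarrow> is_ideal (foldl adjoin J as)"
  by (induction as arbitrary: J) (simp_all add: adjoin_ideal)

lemma foldl_adjoin_super: "J \<subseteq> foldl adjoin J as"
  by (induction as arbitrary: J) (simp, metis adjoin_super foldl_Cons subset_trans)

lemma foldl_adjoin_mem: "is_ideal J \<Longrightarrow> a \<in> set as \<Longrightarrow> a \<in> foldl adjoin J as"
proof (induction as arbitrary: J)
  case (Cons b as)
  show ?case
  proof (cases "a = b")
    case True
    then show ?thesis using adjoin_self[OF Cons.prems(1), of b] foldl_adjoin_super[of "adjoin J b" as] by auto
  next
    case False
    then show ?thesis using Cons adjoin_ideal by auto
  qed
qed simp

text \<open>Adjoining \<open>a * a\<close> before \<open>a\<close> gives the same ideal as adjoining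
  \<open>a\<close>, so by repeated squaring the removal of a nilpotent generator breaks up into
  steps with \<open>a * a\<close> in the ideal. All ideals stay above \<open>I\<close>, which allows
  \<open>\<Phi>\<close> to speak of objects over \<open>I\<close>.\<close>

lemma nilpotent_descent:
  assumes step: "\<And>J a. is_ideal J \<Longrightarrow> I \<subseteq> J \<Longrightarrow> a * a \<in> J \<Longrightarrow> \<Phi> (adjoin J a) \<Longrightarrow> \<Phi> J"
    and "is_ideal J" "I \<subseteq> J" "set as \<subseteq> radical J" "\<Phi> (foldl adjoin J as)"
  shows "\<Phi> J"
proof -
  have one: "\<Phi> J" if "a ^ (2 ^ e) \<in> J" "is_ideal J" "I \<subseteq> J" "\<Phi> (adjoin J a)" for a e J
    using that
  proof (induction e arbitrary: a)
    case 0
    then have "adjoin J a \<subseteq> J" by (intro adjoin_least) auto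
    then have "adjoin J a = J" using adjoin_super[of J a] by simp
    with 0 show ?case by simp
  next
    case (Suc e)
    have "adjoin (adjoin J (a * a)) a = adjoin J a"
    proof
      have J': "is_ideal (adjoin J a)" by (rule adjoin_ideal) fact
      have a: "a \<in> adjoin J a" by (rule adjoin_self) fact
      show "adjoin (adjoin J (a * a)) a \<subseteq> adjoin J a"
        by (intro adjoin_least J' adjoin_super a ideal_mult[OF J' a])
      have J2: "is_ideal (adjoin (adjoin J (a * a)) a)" by (intro adjoin_ideal Suc.prems)
      show "adjoin J a \<subseteq> adjoin (adjoin J (a * a)) a"
        by (intro adjoin_least J2 adjoin_self adjoin_ideal Suc.prems) (meson adjoin_super subset_trans)
    qed
    then have "\<Phi> (adjoin J (a * a))"
      using step[of "adjoin J (a * a)" a] Suc.prems adjoin_ideal[of J "a * a"] adjoin_self[of J "a * a"]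
        adjoin_super[of J "a * a"] by auto
    moreover have "(a * a) ^ (2 ^ e) \<in> J"
      using Suc.prems(1) by (simp add: power_mult_distrib flip: power_add mult_2)
    ultimately show ?case using Suc.IH[of "a * a"] Suc.prems by blast
  qed
  show ?thesis
    using assms(4,5)
  proof (induction as rule: rev_induct)
    case (snoc a as)
    let ?J = "foldl adjoin J as"
    obtain k where k: "a ^ k \<in> J" using snoc.prems by (auto simp: radical_def)
    \<comment> \<open>The exponent is raised to a power of two to fit the repeated squaring.\<close>
    have "k \<le> 2 ^ k" by (simp add: less_imp_le)
    then have "a ^ (2 ^ k) = a ^ (2 ^ k - k) * a ^ k" by (simp flip: power_add)
    then have "a ^ (2 ^ k) \<in> J" using k assms(2) by (simp add: ideal_mult)
    then have "\<Phi> ?J"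
      using snoc.prems foldl_adjoin_ideal[OF assms(2), of as] foldl_adjoin_super[of J as] assms(3)
      by (intro one[of a k ?J]) auto
    with snoc show ?case by simp
  qed simp
qed

text \<open>The radical need not be finitely generated over \<open>J\<close>, but finitely many
  polynomials have only finitely many coefficients, and these are the elements to adjoin.\<close>

lemma ext_radical_finite:
  fixes ps :: "('v, 'u::comm_ring_1) mpol list"
  assumes J: "is_ideal J" and "set ps \<subseteq> ext (radical J)"
  obtains as where "set as \<subseteq> radical J" "set ps \<subseteq> ext (foldl adjoin J as)"
proof -
  let ?C = "\<Union>p\<in>set ps. Poly_Mapping.lookup p ` Poly_Mapping.keys p"
  have "finite ?C" by (intro finite_UN_I finite_set finite_imageI finite_keys)
  then obtain as where as: "set as = ?C" using finite_list[of ?C] by blast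
  have ps: "Poly_Mapping.lookup p m \<in> radical J" if "p \<in> set ps" for p m
    using assms(2) that unfolding ext_def by blast
  have "set as \<subseteq> radical J" unfolding as using ps by blast
  moreover have "Poly_Mapping.lookup p m \<in> foldl adjoin J as" if "p \<in> set ps" for p m
  proof (cases "m \<in> Poly_Mapping.keys p")
    case True
    then have "Poly_Mapping.lookup p m \<in> set as" unfolding as using that by blast
    then show ?thesis by (rule foldl_adjoin_mem[OF J])
  next
    case False
    then show ?thesis
      using ideal_zero[OF foldl_adjoin_ideal[OF J]] by (simp add: not_in_keys_iff_lookup_eq_zero)
  qed
  then have "set ps \<subseteq> ext (foldl adjoin J as)" unfolding ext_def by blast
  ultimately show thesis using that by blast
qed

lemma square_zero_ext:
  assumes J: "is_ideal J" and "a * a \<in> J" "p \<in> ext (adjoin J a)"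
  shows "Const a * p \<in> ext J"
proof -
  obtain q where q: "p - Const a * q \<in> ext J" using ext_adjoin[OF J assms(3)] by blast
  have "Const a * p = Const a * (p - Const a * q) + Const (a * a) * q"
    by (simp add: algebra_simps Const_mult)
  moreover have "Const (a * a) * q \<in> ext J"
    by (rule ideal_mult'[OF ext_ideal[OF J]]) (simp add: Const_ext J assms(2))
  ultimately show ?thesis using q by (simp add: ideal_add ideal_mult ext_ideal J)
qed

text \<open>Modulo \<open>J\<close> the map is \<open>X + a q\<close>, and \<open>X - a q\<close> is
  its inverse: either substitution changes \<open>q\<close> by a multiple of \<open>a\<close>, and
  the factor \<open>a\<close> in front of \<open>q\<close> kills that change.\<close>

lemma near_identity:
  assumes J: "is_ideal J" and a: "a * a \<in> J"
    and \<nu>: "\<And>i. \<nu> i - Var i \<in> ext (adjoin J a)" "\<And>i. n \<le> i \<Longrightarrow> \<nu> i = Var i"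
  shows "\<exists>\<nu>'. inverse_pair J n \<nu> \<nu>'"
proof -
  let ?E = "ext J :: (nat, 'a) mpol set"
  note E = ext_ideal[OF J, where ?'v = nat]
  have E': "is_ideal (ext (adjoin J a) :: (nat, 'a) mpol set)" by (intro ext_ideal adjoin_ideal J)
  have "\<forall>i. \<exists>q. \<nu> i - Var i - Const a * q \<in> ?E" using ext_adjoin[OF J \<nu>(1)] by blast
  then obtain q where q: "\<nu> i - Var i - Const a * q i \<in> ?E" for i by metis
  define \<nu>' where "\<nu>' i = (if i < n then Var i - Const a * q i else Var i)" for i
  have \<nu>': "\<nu>' i - Var i \<in> ext (adjoin J a)" for i
    using ideal_mult'[OF E', of "Const a" "- q i"]
    by (auto simp: \<nu>'_def Const_ext adjoin_ideal J adjoin_self ideal_zero[OF E'])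
  have near: "Const a * (p - psubst \<alpha> p) \<in> ?E" if "\<And>i. \<alpha> i - Var i \<in> ext (adjoin J a)" for \<alpha> p
    using psubst_cong[OF E', of \<alpha> Var p] that
    by (intro square_zero_ext J a) (auto intro: ideal_diff_commute[OF E'])
  have "psubst \<nu> (\<nu>' i) - Var i \<in> ?E" for i
  proof (cases "i < n")
    case True
    then have "psubst \<nu> (\<nu>' i) - Var i = (\<nu> i - Var i - Const a * q i) + Const a * (q i - psubst \<nu> (q i))"
      by (simp add: \<nu>'_def psubst_diff psubst_mult algebra_simps)
    then show ?thesis using ideal_add[OF E q near[OF \<nu>(1)]] by (simp only:)
  qed (simp add: \<nu>'_def \<nu>(2) ideal_zero[OF E])
  moreover have "psubst \<nu>' (\<nu> i) - Var i \<in> ?E" for i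
  proof (cases "i < n")
    case True
    have "psubst \<nu>' (\<nu> i - Var i - Const a * q i) \<in> ?E" by (rule psubst_ext[OF J q])
    moreover have "psubst \<nu>' (\<nu> i) - Var i = psubst \<nu>' (\<nu> i - Var i - Const a * q i)
        - Const a * (q i - psubst \<nu>' (q i))"
      using True by (simp add: psubst_diff psubst_mult algebra_simps) (simp add: \<nu>'_def psubst_add psubst_mult algebra_simps)
    ultimately show ?thesis using ideal_diff[OF E _ near[OF \<nu>']] by (simp only:)
  qed (simp add: \<nu>'_def \<nu>(2) ideal_zero[OF E])
  ultimately have "inverse_pair J n \<nu> \<nu>'" by (simp add: inverse_pair_def \<nu>(2) \<nu>'_def)
  then show ?thesis by blast
qed

text \<open>Both composites of \<open>\<sigma>\<close> and \<open>\<tau>\<close> are near the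
  identity, hence invertible modulo \<open>J\<close>. This provides inverses \<open>r\<close> and
  \<open>l\<close> of \<open>\<sigma>\<close> on the two sides, and these agree.\<close>

lemma inverse_pair_square_zero:
  assumes J: "is_ideal J" and a: "a * a \<in> J" and st: "inverse_pair (adjoin J a) n \<sigma> \<tau>"
  shows "\<exists>\<tau>'. inverse_pair J n \<sigma> \<tau>'"
proof -
  note E = ext_ideal[OF J, where ?'v = nat]
  obtain \<mu> where \<mu>: "inverse_pair J n (\<lambda>i. psubst \<sigma> (\<tau> i)) \<mu>"
    using near_identity[OF J a, of "\<lambda>i. psubst \<sigma> (\<tau> i)" n] st by (auto simp: inverse_pair_def)
  obtain \<nu> where \<nu>: "inverse_pair J n (\<lambda>i. psubst \<tau> (\<sigma> i)) \<nu>"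
    using near_identity[OF J a, of "\<lambda>i. psubst \<tau> (\<sigma> i)" n] st by (auto simp: inverse_pair_def)
  define r where "r i = psubst \<tau> (\<mu> i)" for i
  define l where "l i = psubst \<nu> (\<tau> i)" for i
  have r: "psubst \<sigma> (r i) - Var i \<in> ext J" for i
    using \<mu> by (simp add: r_def inverse_pair_def psubst_psubst)
  have l: "psubst l (\<sigma> i) - Var i \<in> ext J" for i
    using \<nu> psubst_psubst[of \<nu> \<tau> "\<sigma> i", symmetric] by (simp add: l_def[abs_def] inverse_pair_def)
  have lr: "r i - l i \<in> ext J" for i
  proof -
    have "psubst l (psubst \<sigma> (r i)) - l i \<in> ext J"
      using psubst_ext_cong[OF J r, of l i] by simp
    moreover have "psubst l (psubst \<sigma> (r i)) - r i \<in> ext J"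
      using psubst_cong[OF E, of "\<lambda>i. psubst l (\<sigma> i)" Var "r i"] l by (simp add: psubst_psubst)
    ultimately show ?thesis using ideal_diff_trans[OF E] ideal_diff_commute[OF E] by blast
  qed
  have "psubst r (\<sigma> i) - Var i \<in> ext J" for i
    using ideal_diff_trans[OF E psubst_cong[OF E, of r l] l] lr by blast
  with r have "inverse_pair J n \<sigma> r"
    using st \<mu> by (auto simp: inverse_pair_def r_def)
  then show ?thesis by blast
qed

lemma inverse_pair_radical:
  assumes J: "is_ideal J" and st: "inverse_pair (radical J) n \<sigma> \<tau>"
  shows "\<exists>\<tau>'. inverse_pair J n \<sigma> \<tau>'"
proof -
  let ?ps = "map (\<lambda>i. psubst \<sigma> (\<tau> i) - Var i) [0..<n] @ map (\<lambda>i. psubst \<tau> (\<sigma> i) - Var i) [0..<n]"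
  have "set ?ps \<subseteq> ext (radical J)" using st by (auto simp: inverse_pair_def)
  then obtain as where as: "set as \<subseteq> radical J" "set ?ps \<subseteq> ext (foldl adjoin J as)"
    using ext_radical_finite[OF J] by blast
  have z: "0 \<in> (ext (foldl adjoin J as) :: (nat, 'a) mpol set)"
    by (intro ideal_zero ext_ideal foldl_adjoin_ideal J)
  have "inverse_pair (foldl adjoin J as) n \<sigma> \<tau>"
    unfolding inverse_pair_def
  proof (intro conjI allI)
    fix i
    show "psubst \<sigma> (\<tau> i) - Var i \<in> ext (foldl adjoin J as)"
      by (cases "i < n") (use as(2) z st in \<open>auto simp: inverse_pair_def\<close>)
    show "psubst \<tau> (\<sigma> i) - Var i \<in> ext (foldl adjoin J as)"
      by (cases "i < n") (use as(2) z st in \<open>auto simp: inverse_pair_def\<close>)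
  qed (use st in \<open>auto simp: inverse_pair_def\<close>)
  then show ?thesis
    using nilpotent_descent[of J "\<lambda>J. \<exists>\<tau>'. inverse_pair J n \<sigma> \<tau>'" J as, OF _ J _ as(1)]
      inverse_pair_square_zero by blast
qed

text \<open>In each square-zero step the component \<open>\<sigma> 0\<close> is overwritten by
  \<open>F\<close>. Modulo the larger ideal this changes nothing, so the new system is invertible
  there, and invertibility lifts whatever lifts of the components are taken.\<close>

lemma coord_radical:
  assumes J: "is_ideal J" and F: "coord (radical J) n F"
  shows "coord J n F"
proof -
  obtain \<sigma> \<tau> where s: "inverse_pair (radical J) n \<sigma> \<tau>" "\<sigma> 0 - F \<in> ext (radical J)" "0 < n"
    using F by (auto simp: coord_def)
  obtain as where as: "set as \<subseteq> radical J" "set [\<sigma> 0 - F] \<subseteq> ext (foldl adjoin J as)"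
    using ext_radical_finite[OF J, of "[\<sigma> 0 - F]"] s(2) by auto
  obtain \<tau>' where t: "inverse_pair J n \<sigma> \<tau>'" using inverse_pair_radical[OF J s(1)] by blast
  have step: "\<exists>\<sigma>. (\<exists>\<tau>. inverse_pair J' n \<sigma> \<tau>) \<and> \<sigma> 0 - F \<in> ext J'"
    if J': "is_ideal J'" and a: "a * a \<in> J'"
      and ex: "\<exists>\<sigma>. (\<exists>\<tau>. inverse_pair (adjoin J' a) n \<sigma> \<tau>) \<and> \<sigma> 0 - F \<in> ext (adjoin J' a)" for J' a
  proof -
    obtain \<sigma> \<tau> where s': "inverse_pair (adjoin J' a) n \<sigma> \<tau>" "\<sigma> 0 - F \<in> ext (adjoin J' a)"
      using ex by blast
    define \<sigma>' where "\<sigma>' = \<sigma>(0 := F)"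
    have "inverse_pair (adjoin J' a) n \<sigma>' \<tau>"
      unfolding \<sigma>'_def by (intro inverse_pair_replace_0 adjoin_ideal J' s' s(3))
    then have "\<exists>\<tau>. inverse_pair J' n \<sigma>' \<tau>" by (rule inverse_pair_square_zero[OF J' a])
    moreover have "\<sigma>' 0 - F \<in> ext J'" by (simp add: \<sigma>'_def ideal_zero ext_ideal J')
    ultimately show ?thesis by blast
  qed
  have "\<exists>\<sigma>. (\<exists>\<tau>. inverse_pair (foldl adjoin J as) n \<sigma> \<tau>) \<and> \<sigma> 0 - F \<in> ext (foldl adjoin J as)"
    using inverse_pair_mono[OF t foldl_adjoin_super] as(2) by auto
  then have "\<exists>\<sigma>. (\<exists>\<tau>. inverse_pair J n \<sigma> \<tau>) \<and> \<sigma> 0 - F \<in> ext J"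
    using nilpotent_descent[of J "\<lambda>J. \<exists>\<sigma>. (\<exists>\<tau>. inverse_pair J n \<sigma> \<tau>) \<and> \<sigma> 0 - F \<in> ext J" J as, OF _ J _ as(1)]
      step by blast
  with s(3) show ?thesis unfolding coord_def by blast
qed

subsection \<open>Doubling the variables\<close>

lemma doubling:
  assumes I: "is_ideal I" and t: "\<And>x. t * x \<in> I \<Longrightarrow> x \<in> I"
    and F: "coord (adjoin I t) N F" "only_below N F"
  shows "coord I (2 * N) (F + Const t * Var N)"
proof -
  note E = ext_ideal[OF I, where ?'v = nat]
  have E': "is_ideal (ext (adjoin I t) :: (nat, 'a) mpol set)" by (intro ext_ideal adjoin_ideal I)
  have N: "0 < N" using F by (simp add: coord_def)
  obtain \<sigma> \<tau> where st: "inverse_pair (adjoin I t) N \<sigma> \<tau>" "\<sigma> 0 - F \<in> ext (adjoin I t)"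
    and "\<And>i. i < N \<Longrightarrow> only_below N (\<sigma> i)" and b\<tau>: "\<And>i. i < N \<Longrightarrow> only_below N (\<tau> i)"
    using F N inverse_pair_below[OF adjoin_ideal[OF I]] unfolding coord_def by metis
  define \<sigma>' where "\<sigma>' = \<sigma>(0 := F)"
  have b\<sigma>: "only_below N (\<sigma>' i)" if "i < N" for i
    using that F(2) \<open>\<And>i. i < N \<Longrightarrow> only_below N (\<sigma> i)\<close> by (auto simp: \<sigma>'_def)
  have st': "inverse_pair (adjoin I t) N \<sigma>' \<tau>"
    unfolding \<sigma>'_def by (intro inverse_pair_replace_0 adjoin_ideal I st N)
  \<comment> \<open>The new variable belonging to \<open>X\<^sub>i\<close> is
    \<open>Var (N + i)\<close>.\<close>
  define shift where "shift \<alpha> i = (\<alpha> i + Const t * Var (N + i) :: (nat, 'a) mpol)" for \<alpha> i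
  \<comment> \<open>Modulo \<open>t\<close> the shift disappears and \<open>\<alpha>\<close>,
    \<open>\<beta>\<close> are inverse to each other, so the difference is divisible by
    \<open>t\<close>, with quotient \<open>u\<close>.\<close>
  have U: "\<exists>u. Var j - psubst (shift \<alpha>) (\<beta> j) - Const t * u \<in> ext I"
    if "inverse_pair (adjoin I t) N \<alpha> \<beta>" for \<alpha> \<beta> and j :: nat
  proof -
    have "shift \<alpha> i - \<alpha> i \<in> ext (adjoin I t)" for i
      by (simp add: shift_def, rule ideal_mult'[OF E'])
        (simp add: Const_ext adjoin_ideal I adjoin_self)
    then have "psubst (shift \<alpha>) (\<beta> j) - psubst \<alpha> (\<beta> j) \<in> ext (adjoin I t)"
      by (rule psubst_cong[OF E'])
    moreover have "psubst \<alpha> (\<beta> j) - Var j \<in> ext (adjoin I t)"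
      using that by (simp add: inverse_pair_def)
    ultimately have "psubst (shift \<alpha>) (\<beta> j) - Var j \<in> ext (adjoin I t)"
      by (rule ideal_diff_trans[OF E'])
    then have "Var j - psubst (shift \<alpha>) (\<beta> j) \<in> ext (adjoin I t)" by (rule ideal_diff_commute[OF E'])
    then show ?thesis using ext_adjoin[OF I] by blast
  qed
  obtain u where u: "Var j - psubst (shift \<sigma>') (\<tau> j) - Const t * u j \<in> ext I" for j
    using U[OF st'] by metis
  obtain v where v: "Var j - psubst (shift \<tau>) (\<sigma>' j) - Const t * v j \<in> ext I" for j
    using U[OF inverse_pair_sym[OF st']] by metis
  \<comment> \<open>The construction is symmetric: exchanging \<open>\<sigma>'\<close>,
    \<open>u\<close> with \<open>\<tau>\<close>, \<open>v\<close> gives the inverse, so the single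
    computation \<open>inv\<close> serves both composites.\<close>
  define dbl where "dbl \<alpha> w i = (if i < N then shift \<alpha> i else if i < 2 * N then w (i - N) else Var i)"
    for \<alpha> and w :: "nat \<Rightarrow> (nat, 'a) mpol" and i
  have inv: "psubst (dbl \<alpha> w) (dbl \<beta> z i) - Var i \<in> ext I"
    if b: "\<And>i. i < N \<Longrightarrow> only_below N (\<alpha> i)" "\<And>i. i < N \<Longrightarrow> only_below N (\<beta> i)"
      and w: "\<And>j. Var j - psubst (shift \<alpha>) (\<beta> j) - Const t * w j \<in> ext I"
      and z: "\<And>j. Var j - psubst (shift \<beta>) (\<alpha> j) - Const t * z j \<in> ext I"
    for \<alpha> \<beta> w z i
  proof -
    have base: "psubst (dbl \<alpha> w) (shift \<beta> i) - Var i \<in> ext I" if "i < N" for i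
    proof -
      have "psubst (dbl \<alpha> w) (\<beta> i) = psubst (shift \<alpha>) (\<beta> i)"
        using b(2) that by (intro only_below_psubst) (auto simp: dbl_def)
      then have "psubst (dbl \<alpha> w) (shift \<beta> i) - Var i = - (Var i - psubst (shift \<alpha>) (\<beta> i) - Const t * w i)"
        using that by (simp add: shift_def psubst_add psubst_mult) (simp add: dbl_def)
      then show ?thesis using ideal_uminus[OF E w[of i]] by (simp only:)
    qed
    consider "i < N" | "N \<le> i" "i < 2 * N" | "2 * N \<le> i" by linarith
    then show ?thesis
    proof cases
      case 1
      then show ?thesis using base by (simp add: dbl_def[of \<beta>])
    next
      case 2
      define j where "j = i - N"
      have j: "j < N" "i = N + j" using 2 by (auto simp: j_def)
      have "psubst (\<lambda>i. psubst (dbl \<alpha> w) (shift \<beta> i)) (\<alpha> j) - psubst Var (\<alpha> j) \<in> ext I"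
        using base by (intro only_below_cong[OF E b(1)[OF j(1)]]) auto
      then have "psubst (dbl \<alpha> w) (psubst (shift \<beta>) (\<alpha> j)) - \<alpha> j \<in> ext I"
        by (simp add: psubst_psubst)
      moreover have "psubst (dbl \<alpha> w) (Var j - psubst (shift \<beta>) (\<alpha> j) - Const t * z j) \<in> ext I"
        by (rule psubst_ext[OF I z])
      \<comment> \<open>Only the multiple of \<open>z j\<close> by \<open>t\<close> is known
        explicitly; since \<open>t\<close> is a nonzerodivisor modulo \<open>I\<close>, the identity
        may be checked after multiplication by \<open>t\<close>.\<close>
      moreover have "Const t * (psubst (dbl \<alpha> w) (z j) - Var i) =
          - psubst (dbl \<alpha> w) (Var j - psubst (shift \<beta>) (\<alpha> j) - Const t * z j)
          - (psubst (dbl \<alpha> w) (psubst (shift \<beta>) (\<alpha> j)) - \<alpha> j)"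
        using j by (simp add: psubst_diff psubst_add psubst_mult algebra_simps) (simp add: dbl_def shift_def)
      ultimately have "Const t * (psubst (dbl \<alpha> w) (z j) - Var i) \<in> ext I"
        by (simp only: ideal_diff[OF E ideal_uminus[OF E]])
      then have "psubst (dbl \<alpha> w) (z j) - Var i \<in> ext I" using ext_cancel[OF t] by blast
      with j show ?thesis by (simp add: dbl_def[of \<beta>])
    next
      case 3
      then show ?thesis by (simp add: dbl_def ideal_zero[OF E])
    qed
  qed
  have "inverse_pair I (2 * N) (dbl \<sigma>' u) (dbl \<tau> v)"
    unfolding inverse_pair_def
    using inv[OF b\<sigma> b\<tau> u v] inv[OF b\<tau> b\<sigma> v u] by (simp add: dbl_def)
  moreover have "dbl \<sigma>' u 0 = F + Const t * Var N" using N by (simp add: dbl_def shift_def \<sigma>'_def)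
  ultimately show ?thesis
    unfolding coord_def using N ideal_zero[OF E]
    by (intro conjI exI[of _ "dbl \<sigma>' u"] exI[of _ "dbl \<tau> v"]) simp_all
qed

subsection \<open>Slides\<close>

text \<open>The automorphisms here fix the extra variable \<open>X\<^sub>n\<close> and are the identity for \<open>X\<^sub>n = 0\<close>, which
  makes it possible to rescale and to glue them.\<close>

definition slide :: "'u::comm_ring_1 set \<Rightarrow> nat \<Rightarrow> (nat, 'u) mpol \<Rightarrow> 'u \<Rightarrow> bool"
  where "slide J n F a \<longleftrightarrow> (\<exists>\<sigma> \<tau>. inverse_pair J n \<sigma> \<tau> \<and>
    (\<forall>i<n. \<exists>q. \<sigma> i = Var i + Var n * q) \<and> (\<forall>i<n. \<exists>q. \<tau> i = Var i + Var n * q) \<and>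
    psubst \<sigma> F - (F + Const a * Var n) \<in> ext J)"

lemma slide_0: "is_ideal J \<Longrightarrow> slide J n F 0"
  unfolding slide_def
  by (intro exI[of _ Var]) (auto intro!: exI[of _ 0] simp: inverse_pair_ident ideal_zero ext_ideal)

text \<open>Slides fix \<open>X\<^sub>n\<close>, so the multiples of \<open>X\<^sub>n\<close> that
  \<open>F\<close> picks up add under composition.\<close>

lemma slide_add:
  assumes J: "is_ideal J" and "slide J n F a" "slide J n F b"
  shows "slide J n F (a + b)"
proof -
  obtain \<sigma> \<tau> where s: "inverse_pair J n \<sigma> \<tau>" "\<forall>i<n. \<exists>q. \<sigma> i = Var i + Var n * q"
    "\<forall>i<n. \<exists>q. \<tau> i = Var i + Var n * q" "psubst \<sigma> F - (F + Const a * Var n) \<in> ext J"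
    using assms(2) unfolding slide_def by blast
  obtain \<sigma>' \<tau>' where s': "inverse_pair J n \<sigma>' \<tau>'" "\<forall>i<n. \<exists>q. \<sigma>' i = Var i + Var n * q"
    "\<forall>i<n. \<exists>q. \<tau>' i = Var i + Var n * q" "psubst \<sigma>' F - (F + Const b * Var n) \<in> ext J"
    using assms(3) unfolding slide_def by blast
  have comp: "\<exists>q. psubst \<alpha> (\<beta> i) = Var i + Var n * q"
    if i: "i < n" and \<alpha>: "\<forall>i<n. \<exists>q. \<alpha> i = Var i + Var n * q" "\<forall>i\<ge>n. \<alpha> i = Var i"
      and \<beta>: "\<forall>i<n. \<exists>q. \<beta> i = Var i + Var n * q"
    for \<alpha> \<beta> :: "nat \<Rightarrow> (nat, 'a) mpol" and i
  proof -
    obtain p where "\<alpha> i = Var i + Var n * p" using \<alpha>(1) i by blast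
    moreover obtain q where "\<beta> i = Var i + Var n * q" using \<beta> i by blast
    ultimately have "psubst \<alpha> (\<beta> i) = Var i + Var n * (p + psubst \<alpha> q)"
      using \<alpha>(2) by (simp add: psubst_add psubst_mult algebra_simps)
    then show ?thesis by blast
  qed
  have "psubst \<sigma> (psubst \<sigma>' F) - psubst \<sigma> (F + Const b * Var n) \<in> ext J"
    by (rule psubst_ext_cong[OF J s'(4)])
  then have "psubst \<sigma> (psubst \<sigma>' F) - (psubst \<sigma> F + Const b * Var n) \<in> ext J"
    using s(1) by (simp add: psubst_add psubst_mult inverse_pair_def)
  from ideal_add[OF ext_ideal[OF J] this s(4)]
  have "psubst (\<lambda>i. psubst \<sigma> (\<sigma>' i)) F - (F + Const (a + b) * Var n) \<in> ext J"
    by (simp add: psubst_psubst algebra_simps Const_add)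
  then show ?thesis
    unfolding slide_def
    using inverse_pair_comp[OF J s(1) s'(1)] comp[of _ \<sigma> \<sigma>'] comp[of _ \<tau>' \<tau>] s s'
    by (intro exI[of _ "\<lambda>i. psubst \<sigma> (\<sigma>' i)"] exI[of _ "\<lambda>i. psubst \<tau>' (\<tau> i)"])
      (simp add: inverse_pair_def)
qed

lemma slide_sum: "is_ideal J \<Longrightarrow> (\<And>x. x \<in> A \<Longrightarrow> slide J n F (f x)) \<Longrightarrow> slide J n F (sum f A)"
  by (induction A rule: infinite_finite_induct) (auto intro: slide_0 slide_add)

text \<open>Replacing \<open>X\<^sub>n\<close> by \<open>e X\<^sub>n\<close> keeps a slide modulo
  \<open>P\<close>, with \<open>a e\<close> for \<open>a\<close>. As a slide is the identity at
  \<open>X\<^sub>n = 0\<close> and \<open>e\<close> lies in \<open>J\<close>, the new pair is also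
  the identity modulo \<open>J\<close>, hence invertible modulo both ideals.\<close>

lemma slide_Int:
  assumes P: "is_ideal P" and J: "is_ideal J" and F: "only_below n F" and s: "slide P n F a" and e: "e \<in> J"
  shows "slide (P \<inter> J) n F (a * e)"
proof -
  obtain \<sigma> \<tau> where st: "inverse_pair P n \<sigma> \<tau>" "\<forall>i<n. \<exists>q. \<sigma> i = Var i + Var n * q"
    "\<forall>i<n. \<exists>q. \<tau> i = Var i + Var n * q" "psubst \<sigma> F - (F + Const a * Var n) \<in> ext P"
    using s unfolding slide_def by blast
  define \<psi> where "\<psi> i = (if i = n then Const e * Var n else Var i)" for i :: nat
  define \<sigma>' where "\<sigma>' i = (if i < n then psubst \<psi> (\<sigma> i) else Var i)" for i
  define \<tau>' where "\<tau>' i = (if i < n then psubst \<psi> (\<tau> i) else Var i)" for i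
  have \<psi>: "\<And>i. i < n \<Longrightarrow> \<psi> i = Var i" "\<And>i. n \<le> i \<Longrightarrow> only_above n (\<psi> i)"
    by (auto simp: \<psi>_def only_above_Var only_above_mult only_above_Const)
  have P': "inverse_pair P n \<sigma>' \<tau>'"
    unfolding \<sigma>'_def \<tau>'_def by (rule inverse_pair_spec[OF P st(1) \<psi>])
  note E = ext_ideal[OF J, where ?'v = nat]
  have form: "\<exists>q. (if i < n then psubst \<psi> (\<alpha> i) else Var i) = Var i + Var n * (Const e * q)"
    if \<alpha>: "\<forall>i<n. \<exists>q. \<alpha> i = Var i + Var n * q" for \<alpha> i
  proof (cases "i < n")
    case True
    then obtain q where "\<alpha> i = Var i + Var n * q" using \<alpha> by blast
    then have "psubst \<psi> (\<alpha> i) = Var i + Var n * (Const e * psubst \<psi> q)"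
      using True by (simp add: psubst_add psubst_mult) (simp add: \<psi>_def mult_ac)
    with True show ?thesis by auto
  qed (auto intro: exI[of _ 0])
  have near: "(if i < n then psubst \<psi> (\<alpha> i) else Var i) - Var i \<in> ext J"
    if \<alpha>: "\<forall>i<n. \<exists>q. \<alpha> i = Var i + Var n * q" for \<alpha> i
  proof -
    obtain q where q: "(if i < n then psubst \<psi> (\<alpha> i) else Var i) = Var i + Var n * (Const e * q)"
      using form[OF \<alpha>] by blast
    have "Const e * q \<in> ext J" by (rule ideal_mult'[OF E]) (simp add: Const_ext J e)
    then show ?thesis using q ideal_mult[OF E] by simp
  qed
  have near': "\<sigma>' i - Var i \<in> ext J" "\<tau>' i - Var i \<in> ext J" for i
    using near[OF st(2)] near[OF st(3)] by (simp_all add: \<sigma>'_def \<tau>'_def)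
  have J': "psubst \<alpha> (\<beta> i) - Var i \<in> ext J"
    if "\<And>i. \<alpha> i - Var i \<in> ext J" "\<And>i. \<beta> i - Var i \<in> ext J" for \<alpha> \<beta> and i :: nat
    using ideal_diff_trans[OF E psubst_cong[OF E that(1), where p = "\<beta> i"]] that(2) by simp
  have "inverse_pair (P \<inter> J) n \<sigma>' \<tau>'"
    using P' J'[OF near'] J'[OF near'(2) near'(1)] by (auto simp: inverse_pair_def ext_Int)
  moreover have "psubst \<sigma>' F - (F + Const (a * e) * Var n) \<in> ext (P \<inter> J)"
  proof -
    have \<psi>F: "psubst \<psi> F = F" using F \<psi>(1) by (rule only_below_ident)
    have "psubst \<sigma>' (psubst \<psi> F) = psubst \<psi> (psubst \<sigma> F)"
      unfolding \<sigma>'_def by (rule inverse_pair_spec[OF P st(1) \<psi>])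
    moreover have "psubst \<psi> (psubst \<sigma> F) - psubst \<psi> (F + Const a * Var n) \<in> ext P"
      by (rule psubst_ext_cong[OF P st(4)])
    ultimately have "psubst \<sigma>' F - (F + Const (a * e) * Var n) \<in> ext P"
      by (simp add: \<psi>F psubst_add psubst_mult Const_mult mult.assoc) (simp add: \<psi>_def)
    moreover have "psubst \<sigma>' F - F \<in> ext J"
      using psubst_cong[OF E, of \<sigma>' Var F] near'(1) by simp
    moreover have "Const (a * e) * Var n \<in> ext J"
      by (rule ideal_mult'[OF E]) (simp add: Const_ext J e ideal_mult)
    ultimately show ?thesis
      using ideal_diff[OF E, of "psubst \<sigma>' F - F" "Const (a * e) * Var n"] by (simp add: ext_Int diff_diff_eq)
  qed
  moreover have "\<forall>i<n. \<exists>q. \<sigma>' i = Var i + Var n * q" "\<forall>i<n. \<exists>q. \<tau>' i = Var i + Var n * q"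
    using form[OF st(2)] form[OF st(3)] unfolding \<sigma>'_def \<tau>'_def by blast+
  ultimately show ?thesis unfolding slide_def by blast
qed

text \<open>With its parameter renamed to \<open>Var N\<close>, the slide is an automorphism that
  sends \<open>F\<close> to \<open>F + Const a * Var N\<close>, so \<open>F\<close> is the preimage
  of a coordinate.\<close>

lemma coord_slide:
  assumes J: "is_ideal J" and F: "only_below n F" and s: "slide J n F a"
    and N: "n \<le> N" "n \<le> M" and c: "coord J M (F + Const a * Var N)"
  shows "coord J M F"
proof -
  obtain \<sigma> \<tau> where st: "inverse_pair J n \<sigma> \<tau>" "psubst \<sigma> F - (F + Const a * Var n) \<in> ext J"
    using s unfolding slide_def by blast
  define \<psi> where "\<psi> i = (if i = n then Var N else Var i :: (nat, 'a) mpol)" for i :: nat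
  have \<psi>: "\<And>i. i < n \<Longrightarrow> \<psi> i = Var i" "\<And>i. n \<le> i \<Longrightarrow> only_above n (\<psi> i)"
    using N by (auto simp: \<psi>_def only_above_Var)
  have \<psi>F: "psubst \<psi> F = F" using F \<psi>(1) by (rule only_below_ident)
  note spec = inverse_pair_spec[OF J st(1) \<psi>]
  have "psubst \<psi> (psubst \<sigma> F) - psubst \<psi> (F + Const a * Var n) \<in> ext J"
    by (rule psubst_ext_cong[OF J st(2)])
  then have "psubst (\<lambda>i. if i < n then psubst \<psi> (\<sigma> i) else Var i) F - (F + Const a * Var N) \<in> ext J"
    using spec(2)[of F] by (simp add: \<psi>F psubst_add psubst_mult) (simp add: \<psi>_def)
  then show ?thesis
    using coord_preimage[OF J c inverse_pair_le[OF spec(1) N(2)]] by blast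
qed

section \<open>Generic coordinates\<close>

subsection \<open>Partial derivatives\<close>

definition pdiff :: "'v \<Rightarrow> ('v, 'u::comm_ring_1) mpol \<Rightarrow> ('v, 'u) mpol"
  where "pdiff i p = (\<Sum>m\<in>Poly_Mapping.keys p.
    Poly_Mapping.single (m - {#i#}) (of_nat (count m i) * Poly_Mapping.lookup p m))"

lemma lookup_pdiff:
  "Poly_Mapping.lookup (pdiff i p) m = of_nat (Suc (count m i)) * Poly_Mapping.lookup p (add_mset i m)"
proof -
  have "Poly_Mapping.lookup (Poly_Mapping.single (k - {#i#}) (of_nat (count k i) * Poly_Mapping.lookup p k)) m
    = (if k = add_mset i m then of_nat (Suc (count m i)) * Poly_Mapping.lookup p (add_mset i m) else 0)" for k
  proof (cases "i \<in># k")
    case True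
    then obtain l where "k = add_mset i l" by (meson mset_add)
    then show ?thesis by (auto simp: lookup_single when_def)
  next
    case False
    then have "count k i = 0" "k \<noteq> add_mset i m" by (auto simp: not_in_iff)
    then show ?thesis by simp
  qed
  then have "Poly_Mapping.lookup (pdiff i p) m = (\<Sum>k\<in>Poly_Mapping.keys p.
      if k = add_mset i m then of_nat (Suc (count m i)) * Poly_Mapping.lookup p (add_mset i m) else 0)"
    unfolding pdiff_def lookup_sum by (rule sum.cong[OF refl])
  also have "\<dots> = of_nat (Suc (count m i)) * Poly_Mapping.lookup p (add_mset i m)"
    by (simp add: not_in_keys_iff_lookup_eq_zero del: of_nat_Suc)
  finally show ?thesis .
qed

lemma pdiff_add: "pdiff i (p + q) = pdiff i p + pdiff i q"
  by (rule poly_mapping_eqI) (simp add: lookup_pdiff lookup_add distrib_left del: of_nat_Suc)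

lemma pdiff_Const [simp]: "pdiff i (Const c) = 0"
  by (rule poly_mapping_eqI) (simp add: lookup_pdiff Const_def lookup_single)

lemma lookup_mult_Var:
  "Poly_Mapping.lookup (p * Var j) m = (if j \<in># m then Poly_Mapping.lookup p (m - {#j#}) else 0)"
  using lookup_single_mult[of "{#j#}" 1 p m] by (simp add: Var_def mult.commute)

lemma pdiff_mult_Var: "pdiff i (p * Var j) = pdiff i p * Var j + (if i = j then p else 0)"
proof (rule poly_mapping_eqI)
  fix m
  show "Poly_Mapping.lookup (pdiff i (p * Var j)) m =
      Poly_Mapping.lookup (pdiff i p * Var j + (if i = j then p else 0)) m"
  proof (cases "j \<in># m")
    case True
    then obtain l where "m = add_mset j l" by (meson mset_add)
    then show ?thesis
      by (auto simp: lookup_add lookup_mult_Var lookup_pdiff ring_distribs add_mset_commute)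
  next
    case False
    then have "count m j = 0" by (simp add: not_in_iff)
    with False show ?thesis by (auto simp: lookup_add lookup_mult_Var lookup_pdiff)
  qed
qed

lemma pdiff_mult: "pdiff i (p * q) = pdiff i p * q + p * pdiff i q"
proof (induction q rule: mpol_induct)
  case (Const c)
  show ?case by (rule poly_mapping_eqI) (simp add: lookup_pdiff lookup_mult_Const mult.assoc del: of_nat_Suc)
next
  case (add q r)
  then show ?case by (simp add: distrib_left pdiff_add)
next
  case (Var q j)
  have "pdiff i (p * (q * Var j)) = pdiff i (p * q) * Var j + (if i = j then p * q else 0)"
    using pdiff_mult_Var[of i "p * q" j] by (simp only: mult.assoc)
  then show ?case by (simp add: Var pdiff_mult_Var algebra_simps)
qed

lemma pdiff_1 [simp]: "pdiff i 1 = 0"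
  using pdiff_Const[of i 1] by (simp only: Const_1)

lemma pdiff_Var: "pdiff i (Var j) = (if i = j then 1 else 0)"
  using pdiff_mult_Var[of i 1 j] by simp

lemma pdiff_sub: "pdiff i (p - q) = pdiff i p - pdiff i q"
  using pdiff_add[of i "p - q" q] by (simp add: algebra_simps)

lemma pdiff_ext: "is_ideal J \<Longrightarrow> p \<in> ext J \<Longrightarrow> pdiff i p \<in> ext J"
  by (simp add: ext_def lookup_pdiff ideal_mult del: of_nat_Suc)

text \<open>The chain rule. Variables from \<open>n\<close> on are fixed and have derivative zero
  with respect to \<open>i < n\<close>, so the sum stops at \<open>n\<close>.\<close>

lemma pdiff_psubst:
  fixes n :: nat
  assumes "\<And>j. n \<le> j \<Longrightarrow> \<sigma> j = Var j" and i: "i < n"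
  shows "pdiff i (psubst \<sigma> p) = (\<Sum>j<n. psubst \<sigma> (pdiff j p) * pdiff i (\<sigma> j))"
proof (induction p rule: mpol_induct)
  case (add p q)
  then show ?case by (simp add: psubst_add pdiff_add distrib_right sum.distrib)
next
  case (Var p k)
  have k: "(\<Sum>j<n. (if j = k then psubst \<sigma> p * pdiff i (\<sigma> j) else 0)) = psubst \<sigma> p * pdiff i (\<sigma> k)"
  proof (cases "k < n")
    case False
    then have "\<sigma> k = Var k" "i \<noteq> k" using assms(1)[of k] i by simp_all
    then have "pdiff i (\<sigma> k) = 0" by (simp add: pdiff_Var)
    moreover have "j \<noteq> k" if "j \<in> {..<n}" for j using that False by auto
    ultimately show ?thesis by simp
  qed simp
  have "(\<Sum>j<n. psubst \<sigma> (pdiff j (p * Var k)) * pdiff i (\<sigma> j)) =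
      (\<Sum>j<n. psubst \<sigma> (pdiff j p) * pdiff i (\<sigma> j) * \<sigma> k + (if j = k then psubst \<sigma> p * pdiff i (\<sigma> j) else 0))"
    by (intro sum.cong) (auto simp: pdiff_mult_Var psubst_add psubst_mult algebra_simps)
  then show ?case
    by (simp add: sum.distrib k psubst_mult pdiff_mult Var flip: sum_distrib_right)
qed simp

lemma det_cong_ideal:
  fixes A B :: "'b::comm_ring_1 mat"
  assumes J: "is_ideal J" and A: "A \<in> carrier_mat n n" and B: "B \<in> carrier_mat n n"
    and AB: "\<And>i j. i < n \<Longrightarrow> j < n \<Longrightarrow> A $$ (i, j) - B $$ (i, j) \<in> J"
  shows "det A - det B \<in> J"
proof -
  have "signof p * (\<Prod>i = 0..<n. A $$ (i, p i)) - signof p * (\<Prod>i = 0..<n. B $$ (i, p i)) \<in> J"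
    if "p permutes {0..<n}" for p
    unfolding right_diff_distrib[symmetric] using permutes_in_image[OF that] AB
    by (intro ideal_mult[OF J] ideal_cong_prod[OF J]) auto
  then show ?thesis
    unfolding det_def'[OF A] det_def'[OF B] by (intro ideal_cong_sum[OF J]) auto
qed

subsection \<open>Injectivity\<close>

text \<open>\<open>g\<close> is a left inverse of \<open>f\<close> over the fraction field of the quotient by \<open>P\<close>, multiplied by a
  denominator \<open>s\<close>. Injectivity below makes it two-sided.\<close>

definition gen_inverse ::
    "'u::comm_ring_1 set \<Rightarrow> nat \<Rightarrow> 'u \<Rightarrow> (nat \<Rightarrow> (nat, 'u) mpol) \<Rightarrow> (nat \<Rightarrow> (nat, 'u) mpol) \<Rightarrow> bool"
  where "gen_inverse P n s f g \<longleftrightarrow> s \<notin> P \<and>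
    (\<forall>i<n. only_below n (f i) \<and> only_below n (g i) \<and> psubst f (g i) - Const s * Var i \<in> ext P) \<and>
    (\<forall>i\<ge>n. f i = Var i \<and> g i = Const s * Var i)"

definition gen_coord :: "'u::comm_ring_1 set \<Rightarrow> nat \<Rightarrow> (nat, 'u) mpol \<Rightarrow> bool"
  where "gen_coord P n F \<longleftrightarrow> 0 < n \<and> (\<exists>s f g. gen_inverse P n s f g \<and> f 0 - F \<in> ext P)"

definition nat_units :: "'u::comm_ring_1 set \<Rightarrow> bool"
  where "nat_units I \<longleftrightarrow> (\<forall>m>0. \<exists>u. of_nat m * u - 1 \<in> I)"

lemma nat_units_prime:
  assumes "nat_units I" "I \<subseteq> P" "is_prime P" "0 < m"
  shows "of_nat m \<notin> P"
proof
  assume m: "of_nat m \<in> P"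
  obtain u where u: "of_nat m * u - 1 \<in> I" using assms(1,4) by (auto simp: nat_units_def)
  have "of_nat m * u \<in> P" using ideal_mult'[OF prime_ideal[OF assms(3)] m] .
  moreover have "of_nat m * u - 1 \<in> P" using u assms(2) by blast
  ultimately have "of_nat m * u - (of_nat m * u - 1) \<in> P"
    by (rule ideal_diff[OF prime_ideal[OF assms(3)]])
  then show False using assms(3) by (simp add: is_prime_def)
qed

lemma gen_inverse_all: "is_ideal P \<Longrightarrow> gen_inverse P n s f g \<Longrightarrow> psubst f (g i) - Const s * Var i \<in> ext P"
  by (cases "i < n") (auto simp: gen_inverse_def psubst_mult ideal_zero ext_ideal)

lemma lookup_only_below:
  assumes "only_below n p" "i \<in># m" "n \<le> i"
  shows "Poly_Mapping.lookup p m = 0"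
proof -
  have "i \<in># m \<Longrightarrow> Poly_Mapping.lookup (psubst (below n) q) m = 0" for q m
  proof (induction q arbitrary: m rule: mpol_induct)
    case (Const c)
    then show ?case by (subst psubst_Const) (auto simp: Const_def lookup_single when_def)
  next
    case (add p q)
    then show ?case by (simp add: psubst_add lookup_add)
  next
    case (Var p k)
    show ?case
    proof (cases "k < n")
      case True
      then have "i \<in># m - {#k#}" if "k \<in># m" using assms(3) Var.prems by (simp add: in_diff_count)
      with True Var.IH show ?thesis by (simp add: psubst_mult below_def lookup_mult_Var)
    qed (simp add: psubst_mult below_def)
  qed
  from this[OF assms(2)] show ?thesis using assms(1) unfolding only_below_def by metis
qed

text \<open>Differentiating \<open>g(f) = s X\<close> shows that the Jacobian matrix of
  \<open>f\<close> has nonzero determinant modulo \<open>P\<close>. If \<open>h(f)\<close> vanishes,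
  so does the gradient of \<open>h\<close> at \<open>f\<close> times this matrix, hence each partial
  derivative of \<open>h\<close> satisfies the assumption on \<open>h\<close> in lower degree. By
  induction all derivatives vanish; in characteristic zero \<open>h\<close> is then constant, and
  equal to \<open>h(f)\<close>.\<close>

lemma gen_inverse_inj:
  assumes P: "is_prime P" and char: "\<And>m. 0 < m \<Longrightarrow> of_nat m \<notin> P"
    and fg: "gen_inverse P n s f g"
    and h: "only_below n h" "psubst f h \<in> ext P"
  shows "h \<in> ext P"
proof -
  note I = prime_ideal[OF P]
  note E = ext_ideal[OF I, where ?'v = nat]
  have f: "n \<le> i \<Longrightarrow> f i = Var i" for i using fg by (auto simp: gen_inverse_def)
  define A where "A = mat n n (\<lambda>(i, j). psubst f (pdiff j (g i)))"
  define B where "B = mat n n (\<lambda>(j, k). pdiff k (f j))"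
  have A: "A \<in> carrier_mat n n" and B: "B \<in> carrier_mat n n" by (simp_all add: A_def B_def)
  have AB: "(A * B) $$ (i, k) - (Const s \<cdot>\<^sub>m 1\<^sub>m n) $$ (i, k) \<in> ext P" if "i < n" "k < n" for i k
  proof -
    have "(A * B) $$ (i, k) = pdiff k (psubst f (g i))"
      using that by (simp add: A_def B_def times_mat_def scalar_prod_def pdiff_psubst[OF f]
          atLeast0LessThan)
    moreover have "pdiff k (Const s * Var i) = (Const s \<cdot>\<^sub>m 1\<^sub>m n) $$ (i, k)"
      using that by (auto simp: pdiff_mult pdiff_Var)
    moreover have "pdiff k (psubst f (g i) - Const s * Var i) \<in> ext P"
      by (intro pdiff_ext I gen_inverse_all[OF I fg])
    ultimately show ?thesis by (simp add: pdiff_sub)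
  qed
  have "det (A * B) - det (Const s \<cdot>\<^sub>m 1\<^sub>m n) \<in> ext P"
    by (rule det_cong_ideal[OF E _ _ AB]) (use A B in auto)
  then have det: "det A * det B - Const s ^ n \<in> ext P"
    using det_mult[OF A B] by simp
  \<comment> \<open>A row vector killed by \<open>B\<close> is zero: the adjugate yields
    \<open>v j * det B\<close>, and \<open>det A * det B\<close> is a power of \<open>s\<close>,
    which can be cancelled modulo the prime \<open>P\<close>.\<close>
  have zero: "v j \<in> ext P"
    if v: "\<And>k. k < n \<Longrightarrow> (\<Sum>l<n. v l * B $$ (l, k)) \<in> ext P" and j: "j < n" for v j
  proof -
    have adj: "(B * adj_mat B) $$ (l, j) = (if l = j then det B else 0)" if "l < n" for l
      using adj_mat(2)[OF B] that j by simp
    have sum: "(B * adj_mat B) $$ (l, j) = (\<Sum>k<n. B $$ (l, k) * adj_mat B $$ (k, j))" if "l < n" for l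
      using that j B adj_mat(1)[OF B] by (simp add: times_mat_def scalar_prod_def atLeast0LessThan)
    have "(\<Sum>k<n. (\<Sum>l<n. v l * B $$ (l, k)) * adj_mat B $$ (k, j)) =
        (\<Sum>l<n. \<Sum>k<n. v l * (B $$ (l, k) * adj_mat B $$ (k, j)))"
      by (subst sum.swap) (simp add: sum_distrib_right mult.assoc)
    also have "\<dots> = (\<Sum>l<n. v l * (B * adj_mat B) $$ (l, j))"
      by (intro sum.cong) (simp_all add: sum sum_distrib_left)
    also have "\<dots> = (\<Sum>l<n. if l = j then v l * det B else 0)"
      by (intro sum.cong) (simp_all add: adj)
    also have "\<dots> = v j * det B" using j by simp
    finally have "v j * det B \<in> ext P"
      using v by (metis (no_types, lifting) E ideal_mult' ideal_sum lessThan_iff)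
    from ideal_diff[OF E ideal_mult[OF E this, of "det A"] ideal_mult[OF E det, of "v j"]]
    have "det A * (v j * det B) - v j * (det A * det B - Const s ^ n) \<in> ext P" .
    then have "Const (s ^ n) * v j \<in> ext P" by (simp add: Const_power algebra_simps)
    moreover have "s ^ n * x \<in> P \<Longrightarrow> x \<in> P" for x
      using fg P prime_power[OF P] by (auto simp: prime_mult gen_inverse_def)
    ultimately show ?thesis using ext_cancel by blast
  qed
  have "h \<in> ext P"
    if "\<And>m. d < size m \<Longrightarrow> Poly_Mapping.lookup h m = 0" "\<And>m i. i \<in># m \<Longrightarrow> n \<le> i \<Longrightarrow> Poly_Mapping.lookup h m = 0"
      "psubst f h \<in> ext P" for d h
    using that
  proof (induction d arbitrary: h)
    case (Suc d)
    have D: "pdiff j h \<in> ext P" if "j < n" for j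
    proof (rule Suc.IH)
      show "Poly_Mapping.lookup (pdiff j h) m = 0" if "d < size m" for m
        using Suc.prems(1)[of "add_mset j m"] that by (simp add: lookup_pdiff)
      show "Poly_Mapping.lookup (pdiff j h) m = 0" if "i \<in># m" "n \<le> i" for m i
        using Suc.prems(2)[of i "add_mset j m"] that by (simp add: lookup_pdiff)
      show "psubst f (pdiff j h) \<in> ext P"
      proof (rule zero[where v = "\<lambda>j. psubst f (pdiff j h)", OF _ \<open>j < n\<close>])
        fix k assume k: "k < n"
        have "(\<Sum>l<n. psubst f (pdiff l h) * B $$ (l, k)) = pdiff k (psubst f h)"
          using k by (simp add: B_def pdiff_psubst[OF f])
        then show "(\<Sum>l<n. psubst f (pdiff l h) * B $$ (l, k)) \<in> ext P"
          using pdiff_ext[OF I Suc.prems(3)] by simp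
      qed
    qed
    \<comment> \<open>A nonconstant coefficient times a positive exponent is a coefficient of a
      derivative, and the exponent is not in \<open>P\<close>.\<close>
    have L: "Poly_Mapping.lookup h m \<in> P" if nz: "m \<noteq> {#}" for m
    proof -
      obtain i l where m: "m = add_mset i l" using nz by (meson multiset_nonemptyE mset_add)
      show ?thesis
      proof (cases "i < n")
        case True
        then have "of_nat (Suc (count l i)) * Poly_Mapping.lookup h m \<in> P"
          using D[OF True] unfolding ext_def m by (simp add: lookup_pdiff del: of_nat_Suc)
        then show ?thesis using P char[of "Suc (count l i)"] by (simp only: prime_mult) blast
      next
        case False
        then show ?thesis using Suc.prems(2)[of i m] m ideal_zero[OF I] by simp
      qed
    qed
    have c: "h - Const (Poly_Mapping.lookup h {#}) \<in> ext P"
      unfolding ext_def using L ideal_zero[OF I]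
      by (auto simp: lookup_minus Const_def lookup_single when_def)
    have "psubst f h - Const (Poly_Mapping.lookup h {#}) \<in> ext P"
      using psubst_ext[OF I c, of f] by (simp add: psubst_diff)
    then have "Const (Poly_Mapping.lookup h {#}) \<in> (ext P :: (nat, 'a) mpol set)"
      using Suc.prems(3) ideal_cong_mem[OF E] by blast
    then show ?case using c ideal_cong_mem[OF E] by blast
  next
    case 0
    have c: "h = Const (Poly_Mapping.lookup h {#})"
      by (rule poly_mapping_eqI) (use 0 in \<open>auto simp: Const_def lookup_single when_def\<close>)
    have "psubst f h = h" by (subst (1 2) c) (rule psubst_Const)
    with 0 show ?case by simp
  qed
  note main = this
  let ?d = "Max (insert 0 (size ` Poly_Mapping.keys h))"
  show ?thesis
  proof (rule main[of ?d h])
    fix m :: "nat multiset"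
    assume m: "?d < size m"
    show "Poly_Mapping.lookup h m = 0"
    proof (rule ccontr)
      assume "Poly_Mapping.lookup h m \<noteq> 0"
      then have "size m \<le> ?d" by (intro Max_ge) (auto simp: in_keys_iff)
      with m show False using leD by blast
    qed
  qed (use h lookup_only_below in auto)
qed

text \<open>If the quotient by \<open>P\<close> is a field, \<open>g / s\<close> makes sense and
  inverts \<open>f\<close> on one side; injectivity of the substitution \<open>f\<close> gives the
  other side.\<close>

lemma gen_coord_unit:
  assumes P: "is_prime P" and char: "\<And>m. 0 < m \<Longrightarrow> of_nat m \<notin> P"
    and F: "gen_coord P n F" and inv: "\<And>s. s \<notin> P \<Longrightarrow> \<exists>u. s * u - 1 \<in> P"
  shows "coord P n F"
proof -
  note I = prime_ideal[OF P]
  note E = ext_ideal[OF I, where ?'v = nat]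
  obtain s f g where fg: "gen_inverse P n s f g" and F0: "f 0 - F \<in> ext P" "0 < n"
    using F by (auto simp: gen_coord_def)
  have "s \<notin> P" using fg by (simp add: gen_inverse_def)
  then obtain u where u: "s * u - 1 \<in> P" using inv by blast
  define \<tau> where "\<tau> i = (if i < n then Const u * g i else Var i)" for i
  have f\<tau>: "psubst f (\<tau> i) - Var i \<in> ext P" for i
  proof (cases "i < n")
    case True
    have "psubst f (\<tau> i) - Var i = Const u * (psubst f (g i) - Const s * Var i) + Const (s * u - 1) * Var i"
      using True by (simp add: \<tau>_def psubst_mult Const_diff Const_mult algebra_simps)
    moreover have "Const (s * u - 1) * Var i \<in> (ext P :: (nat, 'a) mpol set)"
      by (rule ideal_mult'[OF E]) (simp add: Const_ext I u)
    ultimately show ?thesis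
      using gen_inverse_all[OF I fg] by (simp add: ideal_add ideal_mult E)
  qed (use fg in \<open>auto simp: \<tau>_def gen_inverse_def ideal_zero[OF E]\<close>)
  have "psubst \<tau> (f i) - Var i \<in> ext P" for i
  proof (cases "i < n")
    case True
    have b: "only_below n (f i)" using fg True by (simp add: gen_inverse_def)
    show ?thesis
    proof (rule gen_inverse_inj[OF P char fg])
      have "psubst (below n) (psubst \<tau> (f i)) = psubst \<tau> (f i)"
        unfolding psubst_psubst using fg
        by (intro only_below_psubst[OF b]) (auto simp: \<tau>_def gen_inverse_def psubst_mult only_below_def)
      then show "only_below n (psubst \<tau> (f i) - Var i)"
        using True by (simp add: only_below_def psubst_diff below_def)
      have "psubst (\<lambda>i. psubst f (\<tau> i)) (f i) - psubst Var (f i) \<in> ext P"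
        by (rule psubst_cong[OF E f\<tau>])
      then show "psubst f (psubst \<tau> (f i) - Var i) \<in> ext P"
        by (simp add: psubst_psubst psubst_diff)
    qed
  qed (use fg in \<open>auto simp: \<tau>_def gen_inverse_def ideal_zero[OF E]\<close>)
  then have "inverse_pair P n f \<tau>"
    using f\<tau> fg by (auto simp: inverse_pair_def \<tau>_def gen_inverse_def)
  with F0 show ?thesis unfolding coord_def by blast
qed

subsection \<open>Existence of slides\<close>

text \<open>\<open>q\<close> is \<open>s ^ D * p(X / s)\<close>. It allows \<open>p\<close> to be
  evaluated at \<open>g / s\<close> inside the ring, up to a power of \<open>s\<close>.\<close>

lemma homogenize:
  fixes p :: "(nat, 'u::comm_ring_1) mpol"
  assumes "only_below n p"
  shows "\<exists>D q. only_below n q \<and> psubst (\<lambda>i. Const s * Var i) q = Const s ^ D * p"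
proof -
  have "\<exists>D q. psubst (\<lambda>i. Const s * Var i) q = Const s ^ D * p"
  proof (induction p rule: mpol_induct)
    case (Const c)
    show ?case by (intro exI[of _ 0] exI[of _ "Const c"]) simp
  next
    case (add p q)
    then obtain D p' E q' where *: "psubst (\<lambda>i. Const s * Var i) p' = Const s ^ D * p"
      "psubst (\<lambda>i. Const s * Var i) q' = Const s ^ E * q" by blast
    have c: "psubst \<sigma> (Const s ^ k) = Const s ^ k" for \<sigma> :: "nat \<Rightarrow> (nat, 'u) mpol" and k
      by (simp add: psubst_power)
    show ?case
      by (intro exI[of _ "D + E"] exI[of _ "Const s ^ E * p' + Const s ^ D * q'"])
        (simp add: * psubst_add psubst_mult c power_add algebra_simps)
  next
    case (Var p i)
    then obtain D p' where *: "psubst (\<lambda>i. Const s * Var i) p' = Const s ^ D * p" by blast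
    show ?case
      by (intro exI[of _ "Suc D"] exI[of _ "p' * Var i"]) (simp add: * psubst_mult mult_ac)
  qed
  then obtain D q where q: "psubst (\<lambda>i. Const s * Var i) q = Const s ^ D * p" by blast
  have "(\<lambda>i. psubst (\<lambda>i. Const s * Var i) (below n i)) = (\<lambda>i. psubst (below n) (Const s * Var i))"
    by (auto simp: below_def psubst_mult)
  then have "psubst (\<lambda>i. Const s * Var i) (psubst (below n) q) =
      psubst (below n) (psubst (\<lambda>i. Const s * Var i) q)"
    by (simp only: psubst_psubst)
  also have "\<dots> = Const s ^ D * p"
    using assms by (simp add: q psubst_mult psubst_power only_below_def)
  finally show ?thesis using only_below_below by blast
qed

lemma gen_coord_slide:
  assumes P: "is_prime P" and char: "\<And>m. 0 < m \<Longrightarrow> of_nat m \<notin> P"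
    and F: "gen_coord P n F"
  shows "\<exists>s. s \<notin> P \<and> slide P n F s"
proof -
  note I = prime_ideal[OF P]
  note E = ext_ideal[OF I, where ?'v = nat]
  obtain s f g where fg: "gen_inverse P n s f g" and F0: "f 0 - F \<in> ext P" "0 < n"
    using F by (auto simp: gen_coord_def)
  have s: "s \<notin> P" using fg by (simp add: gen_inverse_def)
  have cancel: "p \<in> ext P" if "Const s ^ D * p \<in> ext P" for p :: "(nat, 'a) mpol" and D
  proof (rule ext_cancel)
    show "Const (s ^ D) * p \<in> ext P" using that by (simp add: Const_power)
  qed (use P s prime_power[OF P] in \<open>auto simp: prime_mult\<close>)
  have bf: "only_below n (f i)" and bg: "only_below n (g i)" if "i < n" for i
    using fg that by (auto simp: gen_inverse_def)
  \<comment> \<open>The shift carries a factor \<open>s\<close> of its own, so that the change it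
    causes in \<open>g\<close> is divisible by \<open>s\<close>.\<close>
  define y where "y c i = f i + (if i = 0 then Const (c * s) * Var n else 0)" for c i
  have "\<exists>q. psubst (y c) (g i) = psubst f (g i) + Const s * Var n * q" for c i
  proof -
    have "psubst (y c) (g i) - psubst f (g i) \<in> {Const s * Var n * q |q. True}"
    proof (rule psubst_cong[OF principal_ideal])
      fix i
      have "y c i - f i = Const s * Var n * (if i = 0 then Const c else 0)"
        by (simp add: y_def Const_mult mult_ac)
      then show "y c i - f i \<in> {Const s * Var n * q |q. True}" by blast
    qed
    then show ?thesis by (auto simp: algebra_simps)
  qed
  then obtain q where q: "psubst (y c) (g i) = psubst f (g i) + Const s * Var n * q c i" for c i
    by metis
  \<comment> \<open>This is \<open>g(y c) / s\<close> modulo \<open>P\<close>, obtained without a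
    division.\<close>
  define \<sigma> where "\<sigma> c i = (if i < n then Var i + Var n * q c i else Var i)" for c i
  have s\<sigma>: "psubst (y c) (g i) - Const s * \<sigma> c i \<in> ext P" if "i < n" for c i
    using gen_inverse_all[OF I fg, of i] that by (simp add: q \<sigma>_def algebra_simps)
  \<comment> \<open>The reason is that \<open>f\<close> and \<open>g / s\<close> are inverse over
    the fraction field. In the ring, \<open>f j\<close> is homogenized to \<open>f'\<close>,
    injectivity gives \<open>f'(g) = s ^ D X\<^sub>j\<close>, and evaluation at \<open>y c\<close>
    yields the claim times a power of \<open>s\<close>.\<close>
  have \<sigma>f: "psubst (\<sigma> c) (f j) - y c j \<in> ext P" if j: "j < n" for c j
  proof -
    obtain D f' where f': "only_below n f'" "psubst (\<lambda>i. Const s * Var i) f' = Const s ^ D * f j"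
      using homogenize[OF bf[OF j]] by blast
    have dual: "psubst g f' - Const s ^ D * Var j \<in> ext P"
    proof (rule gen_inverse_inj[OF P char fg])
      have "psubst (below n) (psubst g f') = psubst g f'"
        unfolding psubst_psubst using bg
        by (intro only_below_psubst[OF f'(1)]) (auto simp: only_below_def)
      then show "only_below n (psubst g f' - Const s ^ D * Var j)"
        using j by (simp add: only_below_def psubst_diff psubst_mult psubst_power below_def)
      have "psubst (\<lambda>i. psubst f (g i)) f' - psubst (\<lambda>i. Const s * Var i) f' \<in> ext P"
        by (rule psubst_cong[OF E gen_inverse_all[OF I fg]])
      then show "psubst f (psubst g f' - Const s ^ D * Var j) \<in> ext P"
        by (simp add: f' psubst_psubst psubst_diff psubst_mult psubst_power)
    qed
    have 1: "psubst (\<lambda>i. psubst (y c) (g i)) f' - Const s ^ D * y c j \<in> ext P"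
      using psubst_ext[OF I dual, of "y c"]
      by (simp add: psubst_diff psubst_mult psubst_power psubst_psubst)
    have 2: "psubst (\<lambda>i. psubst (y c) (g i)) f' - psubst (\<lambda>i. Const s * \<sigma> c i) f' \<in> ext P"
      by (rule only_below_cong[OF E f'(1) s\<sigma>])
    have 3: "psubst (\<lambda>i. Const s * \<sigma> c i) f' = Const s ^ D * psubst (\<sigma> c) (f j)"
    proof -
      have "(\<lambda>i. psubst (\<sigma> c) (Const s * Var i)) = (\<lambda>i. Const s * \<sigma> c i)"
        by (simp add: psubst_mult)
      then have "psubst (\<lambda>i. Const s * \<sigma> c i) f' = psubst (\<sigma> c) (psubst (\<lambda>i. Const s * Var i) f')"
        by (simp only: psubst_psubst)
      also have "\<dots> = psubst (\<sigma> c) (Const s ^ D) * psubst (\<sigma> c) (f j)"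
        unfolding f'(2) by (rule psubst_mult)
      finally show ?thesis by (simp only: psubst_power psubst_Const)
    qed
    have "Const s ^ D * psubst (\<sigma> c) (f j) - Const s ^ D * y c j \<in> ext P"
      using ideal_diff_trans[OF E ideal_diff_commute[OF E 2] 1] unfolding 3 .
    then have "Const s ^ D * (psubst (\<sigma> c) (f j) - y c j) \<in> ext P"
      by (simp only: right_diff_distrib)
    then show ?thesis by (rule cancel)
  qed
  \<comment> \<open>\<open>\<sigma> c\<close> takes \<open>y (- c)\<close> back to \<open>f\<close>,
    so shifting by \<open>- c\<close> undoes shifting by \<open>c\<close>.\<close>
  have inv: "psubst (\<sigma> c) (\<sigma> (- c) i) - Var i \<in> ext P" for c i
  proof (cases "i < n")
    case True
    have "psubst (\<sigma> c) (psubst (y (- c)) (g i)) - psubst (\<sigma> c) (Const s * \<sigma> (- c) i) \<in> ext P"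
      by (intro psubst_ext_cong I s\<sigma> True)
    then have 1: "Const s * psubst (\<sigma> c) (\<sigma> (- c) i) - psubst (\<sigma> c) (psubst (y (- c)) (g i)) \<in> ext P"
      by (simp add: psubst_mult ideal_diff_commute[OF E])
    have "psubst (\<sigma> c) (y (- c) j) - f j \<in> ext P" if "j < n" for j
    proof -
      have "psubst (\<sigma> c) (y (- c) j) - f j = psubst (\<sigma> c) (f j) - y c j"
        by (simp add: y_def psubst_add psubst_mult psubst_uminus Const_uminus) (simp add: \<sigma>_def)
      then show ?thesis using \<sigma>f[OF that] by simp
    qed
    then have "psubst (\<lambda>j. psubst (\<sigma> c) (y (- c) j)) (g i) - psubst f (g i) \<in> ext P"
      by (rule only_below_cong[OF E bg[OF True]])
    then have 2: "psubst (\<sigma> c) (psubst (y (- c)) (g i)) - psubst f (g i) \<in> ext P"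
      by (simp add: psubst_psubst)
    have "Const s * psubst (\<sigma> c) (\<sigma> (- c) i) - Const s * Var i \<in> ext P"
      by (rule ideal_diff_trans[OF E ideal_diff_trans[OF E 1 2] gen_inverse_all[OF I fg]])
    then have "Const s ^ 1 * (psubst (\<sigma> c) (\<sigma> (- c) i) - Var i) \<in> ext P"
      by (simp only: right_diff_distrib power_one_right)
    then show ?thesis by (rule cancel)
  qed (simp add: \<sigma>_def ideal_zero[OF E])
  have "inverse_pair P n (\<sigma> 1) (\<sigma> (- 1))"
    using inv[of 1] inv[of "- 1"] by (simp add: inverse_pair_def) (simp add: \<sigma>_def)
  moreover have "psubst (\<sigma> 1) F - (F + Const s * Var n) \<in> ext P"
  proof -
    have "psubst (\<sigma> 1) F - psubst (\<sigma> 1) (f 0) \<in> ext P"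
      by (intro psubst_ext_cong I ideal_diff_commute[OF E F0(1)])
    moreover have "psubst (\<sigma> 1) (f 0) - (f 0 + Const s * Var n) \<in> ext P"
      using \<sigma>f[OF F0(2), of 1] by (simp add: y_def)
    moreover have "(f 0 + Const s * Var n) - (F + Const s * Var n) \<in> ext P"
      using F0(1) by simp
    ultimately show ?thesis using ideal_diff_trans[OF E] by blast
  qed
  moreover have "\<forall>i<n. \<exists>r. \<sigma> c i = Var i + Var n * r" for c by (auto simp: \<sigma>_def)
  ultimately show ?thesis unfolding slide_def using s by blast
qed

section \<open>Gluing over finitely many primes\<close>

definition antichain :: "'u set set \<Rightarrow> bool"
  where "antichain \<P> \<longleftrightarrow> (\<forall>P\<in>\<P>. \<forall>Q\<in>\<P>. P \<subseteq> Q \<longrightarrow> P = Q)"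

text \<open>\<open>e\<close> is a product of elements, one from each other prime, all chosen outside
  \<open>P\<close>.\<close>

lemma prime_separation:
  assumes fin: "finite \<P>" and prime: "\<And>P. P \<in> \<P> \<Longrightarrow> is_prime P" and anti: "antichain \<P>" and P: "P \<in> \<P>"
  shows "\<exists>e. e \<notin> P \<and> (\<forall>Q\<in>\<P> - {P}. e \<in> Q)"
proof -
  have "\<exists>x. x \<in> Q \<and> x \<notin> P" if "Q \<in> \<P> - {P}" for Q
    using anti P that unfolding antichain_def by blast
  then obtain x where x: "x Q \<in> Q" "x Q \<notin> P" if "Q \<in> \<P> - {P}" for Q by metis
  have "prod x (\<P> - {P}) \<notin> P"
    using prime_prod[of "\<P> - {P}" P x] fin prime[OF P] x(2) by blast
  moreover have "prod x (\<P> - {P}) \<in> Q" if "Q \<in> \<P> - {P}" for Q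
  proof -
    have "prod x (\<P> - {P}) = x Q * prod x (\<P> - {P} - {Q})"
      using fin that by (simp add: prod.remove)
    then show ?thesis using prime_ideal[OF prime[of Q]] x(1)[OF that] that by (simp add: ideal_mult')
  qed
  ultimately show ?thesis by blast
qed

text \<open>For \<open>e P\<close> outside \<open>P\<close> but in all other primes, the slide
  modulo \<open>P\<close> rescales to one modulo the whole intersection. The sum of the resulting
  multiples avoids every prime \<open>Q\<close>, because modulo \<open>Q\<close> only the term of
  \<open>Q\<close> is left.\<close>

lemma slide_Inter:
  assumes fin: "finite \<P>" and prime: "\<And>P. P \<in> \<P> \<Longrightarrow> is_prime P" and anti: "antichain \<P>"
    and char: "\<And>P m. P \<in> \<P> \<Longrightarrow> 0 < m \<Longrightarrow> of_nat m \<notin> P"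
    and F: "only_below n F" "\<And>P. P \<in> \<P> \<Longrightarrow> gen_coord P n F"
  shows "\<exists>t. (\<forall>P\<in>\<P>. t \<notin> P) \<and> slide (\<Inter>\<P>) n F t"
proof -
  have ideal: "is_ideal P" if "P \<in> \<P>" for P using prime[OF that] by (rule prime_ideal)
  have "\<exists>s. s \<notin> P \<and> slide P n F s" if "P \<in> \<P>" for P
    using that by (intro gen_coord_slide prime char F(2))
  then obtain s where s: "\<And>P. P \<in> \<P> \<Longrightarrow> s P \<notin> P" "\<And>P. P \<in> \<P> \<Longrightarrow> slide P n F (s P)" by metis
  have "\<exists>e. e \<notin> P \<and> (\<forall>Q\<in>\<P> - {P}. e \<in> Q)" if "P \<in> \<P>" for P
    by (rule prime_separation[OF fin prime anti that])
  then obtain e where e: "\<And>P. P \<in> \<P> \<Longrightarrow> e P \<notin> P" "\<And>P Q. P \<in> \<P> \<Longrightarrow> Q \<in> \<P> - {P} \<Longrightarrow> e P \<in> Q"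
    by metis
  have I: "is_ideal (\<Inter>\<P>)" using ideal by (rule ideal_Inter)
  have "slide (\<Inter>\<P>) n F (s P * e P)" if P: "P \<in> \<P>" for P
  proof -
    have "slide (P \<inter> \<Inter>(\<P> - {P})) n F (s P * e P)"
    proof (rule slide_Int[OF ideal[OF P] _ F(1) s(2)[OF P]])
      show "is_ideal (\<Inter>(\<P> - {P}))" using ideal by (intro ideal_Inter) auto
    qed (use e(2)[OF P] in auto)
    moreover have "P \<inter> \<Inter>(\<P> - {P}) = \<Inter>\<P>" using P by blast
    ultimately show ?thesis by simp
  qed
  then have "slide (\<Inter>\<P>) n F (\<Sum>P\<in>\<P>. s P * e P)" by (rule slide_sum[OF I])
  moreover have "(\<Sum>P\<in>\<P>. s P * e P) \<notin> Q" if Q: "Q \<in> \<P>" for Q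
  proof
    assume *: "(\<Sum>P\<in>\<P>. s P * e P) \<in> Q"
    have "(\<Sum>P\<in>\<P> - {Q}. s P * e P) \<in> Q"
      using e(2) Q by (intro ideal_sum ideal ideal_mult) auto
    with * have "(\<Sum>P\<in>\<P>. s P * e P) - (\<Sum>P\<in>\<P> - {Q}. s P * e P) \<in> Q"
      by (rule ideal_diff[OF ideal[OF Q]])
    then have "s Q * e Q \<in> Q" using fin Q by (simp add: sum.remove)
    then show False using prime_mult[OF prime[OF Q]] s(1)[OF Q] e(1)[OF Q] by blast
  qed
  ultimately show ?thesis by blast
qed

text \<open>Chinese remainder: modulo \<open>Q\<close> the combination with weights
  \<open>c P\<close> is the system belonging to \<open>Q\<close>, and being inverse modulo the
  intersection can be tested modulo each \<open>Q\<close>.\<close>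

lemma coord_Inter:
  assumes fin: "finite \<P>" and ideal: "\<And>P. P \<in> \<P> \<Longrightarrow> is_ideal P" and n: "0 < n"
    and c: "\<And>P. P \<in> \<P> \<Longrightarrow> c P - 1 \<in> P" "\<And>P Q. P \<in> \<P> \<Longrightarrow> Q \<in> \<P> \<Longrightarrow> P \<noteq> Q \<Longrightarrow> c P \<in> Q"
    and F: "\<And>P. P \<in> \<P> \<Longrightarrow> coord P n F"
  shows "coord (\<Inter>\<P>) n F"
proof -
  have "\<exists>\<sigma> \<tau>. inverse_pair P n \<sigma> \<tau> \<and> \<sigma> 0 - F \<in> ext P" if "P \<in> \<P>" for P
    using F[OF that] by (auto simp: coord_def)
  then obtain S T where ST: "inverse_pair P n (S P) (T P)" "S P 0 - F \<in> ext P" if "P \<in> \<P>" for P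
    by metis
  define glue where "glue V i = (if i < n then \<Sum>P\<in>\<P>. Const (c P) * V P i else Var i)"
    for V :: "'a set \<Rightarrow> nat \<Rightarrow> (nat, 'a) mpol" and i
  have glue: "glue V i - V Q i \<in> ext Q" if Q: "Q \<in> \<P>" and V: "\<And>i. n \<le> i \<Longrightarrow> V Q i = Var i" for V Q i
  proof (cases "i < n")
    case True
    note E = ext_ideal[OF ideal[OF Q], where ?'v = nat]
    have "glue V i - V Q i = (\<Sum>P\<in>\<P> - {Q}. Const (c P) * V P i) + Const (c Q - 1) * V Q i"
      using True fin Q by (simp add: glue_def sum.remove Const_diff algebra_simps)
    moreover have "(\<Sum>P\<in>\<P> - {Q}. Const (c P) * V P i) \<in> ext Q"
      using c(2) Q by (intro ideal_sum[OF E] ideal_mult'[OF E]) (auto simp: Const_ext ideal)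
    moreover have "Const (c Q - 1) * V Q i \<in> ext Q"
      using c(1) Q by (intro ideal_mult'[OF E]) (auto simp: Const_ext ideal)
    ultimately show ?thesis by (simp add: ideal_add[OF E])
  qed (simp add: glue_def V ideal_zero ext_ideal ideal Q)
  have inv: "psubst (glue V) (glue W i) - Var i \<in> ext Q"
    if Q: "Q \<in> \<P>" and VW: "inverse_pair Q n (V Q) (W Q)" for V W Q i
  proof -
    note E = ext_ideal[OF ideal[OF Q], where ?'v = nat]
    have fx: "\<And>i. n \<le> i \<Longrightarrow> V Q i = Var i" "\<And>i. n \<le> i \<Longrightarrow> W Q i = Var i"
      using VW by (auto simp: inverse_pair_def)
    have "psubst (glue V) (glue W i) - psubst (glue V) (W Q i) \<in> ext Q"
      by (intro psubst_ext_cong ideal Q glue fx)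
    moreover have "psubst (glue V) (W Q i) - psubst (V Q) (W Q i) \<in> ext Q"
      by (intro psubst_cong[OF E] glue Q fx)
    moreover have "psubst (V Q) (W Q i) - Var i \<in> ext Q" using VW by (simp add: inverse_pair_def)
    ultimately show ?thesis using ideal_diff_trans[OF E] by blast
  qed
  have "inverse_pair (\<Inter>\<P>) n (glue S) (glue T)"
    unfolding inverse_pair_def
  proof (intro conjI allI)
    fix i
    show "psubst (glue S) (glue T i) - Var i \<in> ext (\<Inter>\<P>)"
      using inv[of _ S T] ST(1) by (auto simp: ext_Inter)
    show "psubst (glue T) (glue S i) - Var i \<in> ext (\<Inter>\<P>)"
      using inv[of _ T S] inverse_pair_sym[OF ST(1)] by (auto simp: ext_Inter)
  qed (simp add: glue_def)
  moreover have "glue S 0 - F \<in> ext (\<Inter>\<P>)"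
  proof -
    have "glue S 0 - F \<in> ext Q" if Q: "Q \<in> \<P>" for Q
    proof -
      have "glue S 0 - S Q 0 \<in> ext Q"
        using ST(1)[OF Q] by (intro glue Q) (simp add: inverse_pair_def)
      then show ?thesis using ST(2)[OF Q] by (rule ideal_diff_trans[OF ext_ideal[OF ideal[OF Q]]])
    qed
    then show ?thesis by (auto simp: ext_Inter)
  qed
  ultimately show ?thesis using n unfolding coord_def by blast
qed

section \<open>Lifting coordinates of two or more variables along nilpotents\<close>

text \<open>Replacing \<open>q\<close> by \<open>2q\<close> and subtracting \<open>2\<^sup>d\<close> times the original sum removes the top coefficient.\<close>

lemma coefficients_mem:
  fixes v :: "nat \<Rightarrow> 'b::comm_ring_1"
  assumes add: "\<And>x y. x \<in> G \<Longrightarrow> y \<in> G \<Longrightarrow> x - y \<in> G"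
    and A: "\<And>k x. x \<in> A \<Longrightarrow> of_nat k * x \<in> A"
    and div: "\<And>k x. x \<in> A \<Longrightarrow> 0 < k \<Longrightarrow> of_nat k * x \<in> G \<Longrightarrow> x \<in> G"
    and "\<And>q::nat. (\<Sum>i\<le>d. of_nat q ^ i * v i) \<in> G" "i \<le> d" "\<And>i. v i \<in> A"
  shows "v i \<in> G"
  using assms(4-6)
proof (induction d arbitrary: v i)
  case 0
  from "0.prems"(1)[of 1] "0.prems"(2) show ?case by simp
next
  case (Suc d)
  have z: "0 \<in> G" using add[OF Suc.prems(1) Suc.prems(1)] by (metis diff_self)
  have neg: "- x \<in> G" if "x \<in> G" for x using add[OF z that] by simp
  have add': "x + y \<in> G" if "x \<in> G" "y \<in> G" for x y using add[OF that(1) neg[OF that(2)]] by simp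
  have nat: "of_nat k * x \<in> G" if "x \<in> G" for k x
    by (induction k) (use that z add' in \<open>auto simp: distrib_right\<close>)
  have low: "v i \<in> G" if i: "i \<le> d" for i
  proof -
    have "(\<Sum>i\<le>d. of_nat q ^ i * (of_nat (2 ^ Suc d - 2 ^ i) * v i)) \<in> G" for q :: nat
    proof -
      let ?p = "\<lambda>q::nat. \<Sum>i\<le>Suc d. of_nat q ^ i * v i"
      have "of_nat (2 ^ Suc d - 2 ^ i) = (2 ^ Suc d - 2 ^ i :: 'b)" if "i \<le> Suc d" for i
        using that by (subst of_nat_diff) (auto intro: power_increasing simp del: power_Suc)
      then have "(\<Sum>i\<le>Suc d. of_nat q ^ i * (of_nat (2 ^ Suc d - 2 ^ i) * v i)) =
          of_nat (2 ^ Suc d) * ?p q - ?p (2 * q)"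
        unfolding sum_distrib_left sum_subtractf[symmetric]
        by (intro sum.cong) (simp_all add: power_mult_distrib algebra_simps del: power_Suc)
      moreover have "of_nat (2 ^ Suc d) * ?p q - ?p (2 * q) \<in> G"
        by (intro add nat Suc.prems(1))
      ultimately show ?thesis by simp
    qed
    then have "of_nat (2 ^ Suc d - 2 ^ i) * v i \<in> G" by (rule Suc.IH[OF _ i]) (intro A Suc.prems(3))
    moreover have "(2::nat) ^ i < 2 ^ Suc d" using i by (intro power_strict_increasing) auto
    ultimately show ?thesis using div[of "v i" "2 ^ Suc d - 2 ^ i"] Suc.prems(3)[of i] by simp
  qed
  show ?case
  proof (cases "i \<le> d")
    case False
    have s: "(\<Sum>i\<le>e. v i) \<in> G" if "e \<le> d" for e
      using that by (induction e) (auto intro: low add')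
    have "v (Suc d) = (\<Sum>i\<le>Suc d. of_nat 1 ^ i * v i) - (\<Sum>i\<le>d. v i)" by simp
    then have "v (Suc d) \<in> G" using add[OF Suc.prems(1)[of 1] s[OF order_refl]] by (simp only:)
    moreover have "i = Suc d" using False Suc.prems(2) by simp
    ultimately show ?thesis by simp
  qed (rule low)
qed

section \<open>Elementary automorphisms, shears and the passage to one extra variable\<close>

lemma elementary_pair:
  assumes J: "is_ideal J" and a: "a < n" and g: "\<And>q. psubst (Var(a := q)) g = g"
  shows "inverse_pair J n (Var(a := Var a + g)) (Var(a := Var a - g))"
  using a ideal_zero[OF ext_ideal[OF J]]
  by (auto simp: inverse_pair_def psubst_add psubst_diff g)

text \<open>Since \<open>a * a\<close> vanishes modulo \<open>J\<close>, composing maps of the form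
  \<open>X\<^sub>0 + a H\<close> adds the \<open>H\<close>, so a generating set of \<open>H\<close>
  is enough. Those free of \<open>X\<^sub>0\<close> come from elementary automorphisms. Conjugating
  with \<open>X\<^sub>1 + q X\<^sub>0\<close>, which fixes \<open>X\<^sub>0\<close>, yields
  \<open>r (X\<^sub>1 + q X\<^sub>0) ^ d\<close> for all natural \<open>q\<close>, and as positive
  integers are invertible these give all monomials. The result is an automorphism over
  \<open>I\<close>; only its shape is controlled modulo \<open>J\<close>.\<close>

lemma shear:
  assumes I: "is_ideal I" "nat_units I" and J: "is_ideal J" "I \<subseteq> J" and a: "a * a \<in> J" and n: "2 \<le> n"
  shows "\<exists>\<rho> \<rho>'. inverse_pair I n \<rho> \<rho>' \<and> \<rho> 0 - (Var 0 + Const a * H) \<in> ext J"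
proof -
  note E = ext_ideal[OF J(1), where ?'v = nat]
  have E': "is_ideal (ext (adjoin J a) :: (nat, 'a) mpol set)" by (intro ext_ideal adjoin_ideal J)
  have sub: "ext J \<subseteq> (ext (adjoin J a) :: (nat, 'a) mpol set)" by (intro ext_mono adjoin_super)
  have aE: "Const a * p \<in> (ext (adjoin J a) :: (nat, 'a) mpol set)" for p
    by (rule ideal_mult'[OF E']) (simp add: Const_ext adjoin_ideal J adjoin_self)
  \<comment> \<open>The last clause keeps the whole map congruent to the identity modulo
    \<open>a\<close>, so that composing with it changes the other \<open>H\<close> only by a
    multiple of \<open>a\<close>.\<close>
  define S where "S H \<longleftrightarrow> (\<exists>\<rho> \<rho>'. inverse_pair I n \<rho> \<rho>' \<and> \<rho> 0 - (Var 0 + Const a * H) \<in> ext J \<and>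
    (\<forall>i. \<rho> i - Var i \<in> ext (adjoin J a)))" for H :: "(nat, 'a) mpol"
  have S_cong: "S H'" if SH: "S H" and HH': "H - H' \<in> ext J" for H H'
  proof -
    obtain \<rho> \<rho>' where r: "inverse_pair I n \<rho> \<rho>'" "\<rho> 0 - (Var 0 + Const a * H) \<in> ext J"
      "\<forall>i. \<rho> i - Var i \<in> ext (adjoin J a)" using SH unfolding S_def by blast
    have "Const a * (H - H') \<in> ext J" by (rule ideal_mult[OF E HH'])
    then have "(Var 0 + Const a * H) - (Var 0 + Const a * H') \<in> ext J" by (simp add: algebra_simps)
    from ideal_diff_trans[OF E r(2) this] r show ?thesis unfolding S_def by blast
  qed
  have S_add: "S (H + H')" if SH: "S H" and SH': "S H'" for H H'
  proof -
    obtain \<rho> \<rho>' where r: "inverse_pair I n \<rho> \<rho>'" "\<rho> 0 - (Var 0 + Const a * H) \<in> ext J"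
      "\<forall>i. \<rho> i - Var i \<in> ext (adjoin J a)" using SH unfolding S_def by blast
    obtain \<mu> \<mu>' where m: "inverse_pair I n \<mu> \<mu>'" "\<mu> 0 - (Var 0 + Const a * H') \<in> ext J"
      "\<forall>i. \<mu> i - Var i \<in> ext (adjoin J a)" using SH' unfolding S_def by blast
    have near: "psubst \<rho> p - p \<in> ext (adjoin J a)" for p
      using psubst_cong[OF E', of \<rho> Var p] r(3) by simp
    have "psubst \<rho> (\<mu> 0) - psubst \<rho> (Var 0 + Const a * H') \<in> ext J"
      by (rule psubst_ext_cong[OF J(1) m(2)])
    then have 1: "psubst \<rho> (\<mu> 0) - (\<rho> 0 + Const a * psubst \<rho> H') \<in> ext J"
      by (simp add: psubst_add psubst_mult)
    have 2: "(\<rho> 0 + Const a * psubst \<rho> H') - (Var 0 + Const a * H + Const a * H') \<in> ext J"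
      using ideal_add[OF E r(2) square_zero_ext[OF J(1) a near, of H']] by (simp add: algebra_simps)
    have "psubst \<rho> (\<mu> 0) - (Var 0 + Const a * (H + H')) \<in> ext J"
      using ideal_diff_trans[OF E 1 2] by (simp add: algebra_simps)
    moreover have "psubst \<rho> (\<mu> i) - Var i \<in> ext (adjoin J a)" for i
      by (rule ideal_diff_trans[OF E' near]) (use m(3) in blast)
    ultimately show ?thesis using inverse_pair_comp[OF I(1) r(1) m(1)] unfolding S_def by blast
  qed
  have S_base: "S H" if "\<And>q. psubst (Var(0 := q)) H = H" for H
  proof -
    have "inverse_pair I n (Var(0 := Var 0 + Const a * H)) (Var(0 := Var 0 - Const a * H))"
      using n that by (intro elementary_pair I) (auto simp: psubst_mult)
    then show ?thesis
      unfolding S_def using aE[of H] ideal_zero[OF E] ideal_zero[OF E']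
      by (intro exI[of _ "Var(0 := Var 0 + Const a * H)"] exI[of _ "Var(0 := Var 0 - Const a * H)"]) auto
  qed
  have S_conj: "S (psubst \<phi> H)" if SH: "S H" and \<phi>: "inverse_pair I n \<phi> \<phi>'" "\<phi> 0 = Var 0" "\<phi>' 0 = Var 0" for H \<phi> \<phi>'
  proof -
    obtain \<rho> \<rho>' where r: "inverse_pair I n \<rho> \<rho>'" "\<rho> 0 - (Var 0 + Const a * H) \<in> ext J"
      "\<forall>i. \<rho> i - Var i \<in> ext (adjoin J a)" using SH unfolding S_def by blast
    have "inverse_pair I n (\<lambda>i. psubst (\<lambda>i. psubst \<phi> (\<rho> i)) (\<phi>' i)) (\<lambda>i. psubst \<phi> (psubst \<rho>' (\<phi>' i)))"
      using inverse_pair_comp[OF I(1) inverse_pair_comp[OF I(1) \<phi>(1) r(1)] inverse_pair_sym[OF \<phi>(1)]] .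
    moreover have "psubst (\<lambda>i. psubst \<phi> (\<rho> i)) (\<phi>' 0) - (Var 0 + Const a * psubst \<phi> H) \<in> ext J"
      using psubst_ext_cong[OF J(1) r(2), of \<phi>] \<phi>(2,3) by (simp add: psubst_add psubst_mult)
    moreover have "psubst (\<lambda>i. psubst \<phi> (\<rho> i)) (\<phi>' i) - Var i \<in> ext (adjoin J a)" for i
    proof -
      have "psubst \<rho> (\<phi>' i) - psubst Var (\<phi>' i) \<in> ext (adjoin J a)"
        by (rule psubst_cong[OF E']) (use r(3) in blast)
      then have "psubst \<phi> (psubst \<rho> (\<phi>' i)) - psubst \<phi> (psubst Var (\<phi>' i)) \<in> ext (adjoin J a)"
        by (intro psubst_ext_cong adjoin_ideal J)
      moreover have "psubst \<phi> (\<phi>' i) - Var i \<in> ext (adjoin J a)"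
        using \<phi>(1) ext_mono[OF J(2)] sub unfolding inverse_pair_def by blast
      ultimately show ?thesis using ideal_diff_trans[OF E'] by (simp add: psubst_psubst)
    qed
    ultimately show ?thesis unfolding S_def by blast
  qed
  \<comment> \<open>Closure of \<open>S\<close> under scaling is not evident. Asking for all
    constant multiples at once produces a module, in which division by integers is possible.\<close>
  define S' where "S' = {H. \<forall>b. S (Const b * H)}"
  have S'_cong: "H' \<in> S'" if "H \<in> S'" "H - H' \<in> ext J" for H H'
  proof -
    have "S (Const b * H')" for b
    proof (rule S_cong)
      show "S (Const b * H)" using that(1) by (simp add: S'_def)
      show "Const b * H - Const b * H' \<in> ext J"
        using ideal_mult[OF E that(2), of "Const b"] by (simp add: right_diff_distrib)
    qed
    then show ?thesis by (simp add: S'_def)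
  qed
  have S'_scale: "Const b * H \<in> S'" if "H \<in> S'" for b H
  proof -
    have "S (Const c * (Const b * H))" for c
    proof -
      have "S (Const (c * b) * H)" using that unfolding S'_def by blast
      then show ?thesis by (simp only: Const_mult mult.assoc)
    qed
    then show ?thesis by (simp add: S'_def)
  qed
  have S'_diff: "H - H' \<in> S'" if "H \<in> S'" "H' \<in> S'" for H H'
  proof -
    have "S (Const b * (H - H'))" for b
    proof -
      have "S (Const b * H)" "S (Const (- b) * H')" using that unfolding S'_def by blast+
      then have "S (Const b * H + Const (- b) * H')" by (rule S_add)
      moreover have "Const b * H + Const (- b) * H' = Const b * (H - H')"
        by (simp add: Const_uminus right_diff_distrib)
      ultimately show ?thesis by simp
    qed
    then show ?thesis by (simp add: S'_def)
  qed
  have S'_div: "H \<in> S'" if k: "0 < k" and H: "of_nat k * H \<in> S'" for k :: nat and H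
  proof -
    obtain u where u: "of_nat k * u - 1 \<in> I" using I(2) k by (auto simp: nat_units_def)
    have "Const (of_nat k * u - 1) * H \<in> ext J"
      by (rule ideal_mult'[OF E]) (use u J in \<open>auto simp: Const_ext\<close>)
    then have "Const u * (of_nat k * H) - H \<in> ext J"
      by (simp add: Const_diff Const_mult Const_of_nat algebra_simps)
    then show ?thesis using S'_cong S'_scale[OF H] by blast
  qed
  have mono: "r * Var 0 ^ i * Var 1 ^ j \<in> S'"
    if r: "\<And>p q. psubst (Var(0 := p, 1 := q)) r = r" for r i j
  proof -
    let ?d = "i + j"
    have r0: "psubst (Var(0 := p)) r = r" and r1: "psubst (Var(1 := p)) r = r" for p
      using r[of p "Var 1"] r[of "Var 0" p] by (simp_all add: fun_upd_idem)
    \<comment> \<open>The coefficient of \<open>q ^ l\<close> in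
      \<open>r * (X\<^sub>1 + q X\<^sub>0) ^ (i + j)\<close>; for \<open>l = i\<close> it is a
      binomial coefficient times the wanted monomial.\<close>
    define v where "v l = of_nat (?d choose l) * (r * Var 0 ^ l * Var 1 ^ (?d - l))" for l
    have "(\<Sum>l\<le>?d. of_nat q ^ l * v l) \<in> S'" for q :: nat
    proof -
      let ?\<phi> = "Var(1 := Var 1 + of_nat q * Var 0) :: nat \<Rightarrow> (nat, 'a) mpol"
      have c: "psubst \<sigma> (of_nat q) = of_nat q" for \<sigma> :: "nat \<Rightarrow> (nat, 'a) mpol"
        using psubst_Const[of \<sigma> "of_nat q"] by (simp add: Const_of_nat)
      have \<phi>: "inverse_pair I n ?\<phi> (Var(1 := Var 1 - of_nat q * Var 0))"
        using n by (intro elementary_pair I) (auto simp: psubst_mult c)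
      have "S (Const b * (r * (Var 1 + of_nat q * Var 0) ^ ?d))" for b
      proof -
        have "S (Const b * (r * Var 1 ^ ?d))"
          by (rule S_base) (simp add: psubst_mult psubst_power r0)
        from S_conj[OF this \<phi>] show ?thesis
          by (simp add: psubst_mult psubst_power r1 del: One_nat_def)
      qed
      then have *: "r * (Var 1 + of_nat q * Var 0) ^ ?d \<in> S'" by (simp add: S'_def)
      have "(Var 1 + of_nat q * Var 0) ^ ?d = (of_nat q * Var 0 + Var 1 :: (nat, 'a) mpol) ^ ?d"
        by (simp add: add.commute)
      also have "\<dots> = (\<Sum>l\<le>?d. of_nat (?d choose l) * (of_nat q * Var 0) ^ l * Var 1 ^ (?d - l))"
        by (rule binomial_ring)
      finally have "r * (Var 1 + of_nat q * Var 0) ^ ?d = (\<Sum>l\<le>?d. of_nat q ^ l * v l)"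
        by (simp add: v_def sum_distrib_left power_mult_distrib mult_ac)
      with * show ?thesis by simp
    qed
    note sums = this
    have "v i \<in> S'"
    proof (rule coefficients_mem[where G = S' and d = "i + j" and A = UNIV])
      show "(\<Sum>l\<le>i + j. of_nat q ^ l * v l) \<in> S'" for q :: nat by (rule sums)
    qed (use S'_diff S'_div in auto)
    then show ?thesis using S'_div[of "?d choose i"] by (simp add: v_def)
  qed
  \<comment> \<open>The generalization lets the variables of \<open>H\<close> be peeled off:
    \<open>X\<^sub>0\<close> and \<open>X\<^sub>1\<close> go into the exponents, all others into
    \<open>r\<close>.\<close>
  have "\<forall>r. (\<forall>p q. psubst (Var(0 := p, 1 := q)) r = r) \<longrightarrow> (\<forall>i j. S (H * r * Var 0 ^ i * Var 1 ^ j))"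
  proof (induction H rule: mpol_induct)
    case (Const c)
    show ?case
    proof (intro allI impI)
      fix r :: "(nat, 'a) mpol" and i j assume "\<forall>p q. psubst (Var(0 := p, 1 := q)) r = r"
      then have "r * Var 0 ^ i * Var 1 ^ j \<in> S'" by (intro mono) blast
      then have "S (Const c * (r * Var 0 ^ i * Var 1 ^ j))" unfolding S'_def by blast
      then show "S (Const c * r * Var 0 ^ i * Var 1 ^ j)" by (simp only: mult.assoc)
    qed
  next
    case (add p q)
    then show ?case using S_add by (simp add: distrib_right)
  next
    case (Var p k)
    show ?case
    proof (intro allI impI)
      fix r :: "(nat, 'a) mpol" and i j assume r: "\<forall>p q. psubst (Var(0 := p, 1 := q)) r = r"
      consider "k = 0" | "k = 1" | "1 < k" by linarith
      then show "S (p * Var k * r * Var 0 ^ i * Var 1 ^ j)"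
      proof cases
        case 1
        then show ?thesis using Var[rule_format, OF r[rule_format], of "Suc i" j] by (simp add: mult_ac)
      next
        case 2
        then show ?thesis using Var[rule_format, OF r[rule_format], of i "Suc j"] by (simp add: mult_ac)
      next
        case 3
        then have "\<forall>p q. psubst (Var(0 := p, 1 := q)) (Var k * r) = Var k * r"
          using r by (simp add: psubst_mult)
        then show ?thesis using Var[rule_format, of "Var k * r" i j] by (simp add: mult_ac)
      qed
    qed
  qed
  from this[rule_format, of 1 0 0] have "S H" by simp
  then show ?thesis unfolding S_def by blast
qed

text \<open>Here the automorphism has to remain one over \<open>I\<close>, so
  \<open>\<sigma> 0\<close> cannot simply be overwritten by \<open>F\<close>. Seen in the
  coordinates of \<open>\<sigma>\<close>, the polynomial \<open>F\<close> is
  \<open>X\<^sub>0 + a H\<close> modulo the next ideal, and a shear over \<open>I\<close> produces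
  this.\<close>

lemma coord_lift_radical:
  assumes I: "is_ideal I" "nat_units I" and J: "is_ideal J" "I \<subseteq> J" and n: "2 \<le> n"
    and st: "inverse_pair I n \<sigma> \<tau>" "\<sigma> 0 - F \<in> ext (radical J)"
  shows "\<exists>\<sigma> \<tau>. inverse_pair I n \<sigma> \<tau> \<and> \<sigma> 0 - F \<in> ext J"
proof -
  obtain as where as: "set as \<subseteq> radical J" "set [\<sigma> 0 - F] \<subseteq> ext (foldl adjoin J as)"
    using ext_radical_finite[OF J(1), of "[\<sigma> 0 - F]"] st(2) by auto
  have step: "\<exists>\<sigma> \<tau>. inverse_pair I n \<sigma> \<tau> \<and> \<sigma> 0 - F \<in> ext J'"
    if J': "is_ideal J'" "I \<subseteq> J'" and a: "a * a \<in> J'"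
      and ex: "\<exists>\<sigma> \<tau>. inverse_pair I n \<sigma> \<tau> \<and> \<sigma> 0 - F \<in> ext (adjoin J' a)" for J' a
  proof -
    note E = ext_ideal[OF J'(1), where ?'v = nat]
    note A = adjoin_ideal[OF J'(1), of a]
    note E' = ext_ideal[OF A, where ?'v = nat]
    obtain \<sigma> \<tau> where s: "inverse_pair I n \<sigma> \<tau>" "\<sigma> 0 - F \<in> ext (adjoin J' a)" using ex by blast
    have \<tau>\<sigma>: "psubst \<tau> (\<sigma> 0) - Var 0 \<in> ext J'" and \<sigma>\<tau>: "psubst \<sigma> (psubst \<tau> F) - F \<in> ext J'"
      using s(1) ext_mono[OF J'(2)] inverse_pair_apply[OF I(1) s(1)] unfolding inverse_pair_def by blast+
    have "psubst \<tau> F - psubst \<tau> (\<sigma> 0) \<in> ext (adjoin J' a)"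
      by (intro psubst_ext_cong A ideal_diff_commute[OF E' s(2)])
    moreover have "psubst \<tau> (\<sigma> 0) - Var 0 \<in> ext (adjoin J' a)"
      using \<tau>\<sigma> ext_mono[OF adjoin_super] by blast
    ultimately have "psubst \<tau> F - Var 0 \<in> ext (adjoin J' a)" by (rule ideal_diff_trans[OF E'])
    then obtain H where H: "psubst \<tau> F - Var 0 - Const a * H \<in> ext J'" using ext_adjoin[OF J'(1)] by blast
    obtain \<rho> \<rho>' where r: "inverse_pair I n \<rho> \<rho>'" "\<rho> 0 - (Var 0 + Const a * H) \<in> ext J'"
      using shear[OF I J' a n] by blast
    have "\<rho> 0 - psubst \<tau> F \<in> ext J'" using ideal_diff[OF E r(2) H] by (simp add: algebra_simps)
    then have "psubst \<sigma> (\<rho> 0) - psubst \<sigma> (psubst \<tau> F) \<in> ext J'" by (rule psubst_ext_cong[OF J'(1)])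
    then have "psubst \<sigma> (\<rho> 0) - F \<in> ext J'" using \<sigma>\<tau> by (rule ideal_diff_trans[OF E])
    then show ?thesis using inverse_pair_comp[OF I(1) s(1) r(1)] by blast
  qed
  have "\<exists>\<sigma> \<tau>. inverse_pair I n \<sigma> \<tau> \<and> \<sigma> 0 - F \<in> ext (foldl adjoin J as)" using st(1) as(2) by auto
  then show ?thesis
    using nilpotent_descent[of I "\<lambda>J. \<exists>\<sigma> \<tau>. inverse_pair I n \<sigma> \<tau> \<and> \<sigma> 0 - F \<in> ext J" J as, OF step J as(1)]
    by (simp only:)
qed

lemma coord_extra_variable:
  assumes I: "is_ideal I" and F: "only_below n F" "slide I n F t"
    and st: "inverse_pair I n \<sigma> \<tau>" "\<sigma> 0 - F \<in> ext (adjoin I t)" and n: "0 < n"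
  shows "coord I (Suc n) F"
proof -
  note E = ext_ideal[OF I, where ?'v = nat]
  define \<kappa> where "\<kappa> i = (if i < n then psubst (below n) (\<sigma> i) else Var i)" for i
  obtain \<kappa>' where \<kappa>: "inverse_pair I n \<kappa> \<kappa>'"
    unfolding \<kappa>_def using inverse_pair_spec(1)[OF I st(1), of "below n"]
    by (auto simp: below_def only_above_0)
  have b: "only_below n (\<kappa> 0)" using n by (simp add: \<kappa>_def only_below_below)
  have "psubst (below n) (\<sigma> 0 - F) \<in> ext (adjoin I t)" by (intro psubst_ext adjoin_ideal I st(2))
  then have "\<kappa> 0 - F \<in> ext (adjoin I t)"
    using F(1) n by (simp add: \<kappa>_def psubst_diff only_below_def)
  then obtain H where H: "\<kappa> 0 - F - Const t * H \<in> ext I" using ext_adjoin[OF I] by blast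
  \<comment> \<open>As \<open>H'\<close> does not involve \<open>X\<^sub>n\<close>, replacing
    \<open>X\<^sub>n\<close> by \<open>X\<^sub>n - H'\<close> is elementary.\<close>
  define H' where "H' = psubst (below n) H"
  have "psubst (below n) (\<kappa> 0 - F - Const t * H) \<in> ext I" by (rule psubst_ext[OF I H])
  then have H': "\<kappa> 0 - F - Const t * H' \<in> ext I"
    using F(1) b by (simp add: H'_def psubst_diff psubst_mult only_below_def)
  have "coord I (Suc n) (Var 0 + Const t * Var n)"
  proof (rule coord_image[OF I coord_Var[OF I]])
    show "inverse_pair I (Suc n) (Var(0 := Var 0 + Const t * Var n)) (Var(0 := Var 0 - Const t * Var n))"
      using n by (intro elementary_pair I) (auto simp: psubst_mult)
  qed (simp_all add: ideal_zero[OF E])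
  then have "coord I (Suc n) (\<kappa> 0 + Const t * Var n)"
    using \<kappa> by (rule coord_image[OF I _ inverse_pair_le])
      (use \<kappa> in \<open>simp_all add: psubst_add psubst_mult inverse_pair_def ideal_zero[OF E]\<close>)
  moreover have "inverse_pair I (Suc n) (Var(n := Var n + (- H'))) (Var(n := Var n - (- H')))"
  proof (rule elementary_pair[OF I])
    show "psubst (Var(n := q)) (- H') = - H'" for q
      unfolding psubst_uminus by (rule arg_cong[where f = uminus], rule only_below_ident[where n = n])
        (auto simp: H'_def intro: only_below_below)
  qed simp
  moreover have "psubst (Var(n := Var n + (- H'))) (\<kappa> 0 + Const t * Var n) - (F + Const t * Var n) \<in> ext I"
  proof -
    have "psubst (Var(n := Var n + (- H'))) (\<kappa> 0) = \<kappa> 0" by (rule only_below_ident[OF b]) auto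
    then show ?thesis using H' by (simp add: psubst_add psubst_mult algebra_simps)
  qed
  ultimately have "coord I (Suc n) (F + Const t * Var n)" by (rule coord_image[OF I])
  then show ?thesis by (intro coord_slide[OF I F, of n]) simp_all
qed

section \<open>Interpolating coordinates at finitely many rational points\<close>

subsection \<open>Polynomials with coefficients in a subring\<close>

definition is_subring :: "'u::comm_ring_1 set \<Rightarrow> bool"
  where "is_subring K \<longleftrightarrow> 0 \<in> K \<and> 1 \<in> K \<and> (\<forall>x\<in>K. \<forall>y\<in>K. x - y \<in> K \<and> x * y \<in> K)"

lemma subring_add: "is_subring K \<Longrightarrow> x \<in> K \<Longrightarrow> y \<in> K \<Longrightarrow> x + y \<in> K"
  unfolding is_subring_def by (metis diff_0 diff_minus_eq_add)

lemma subring_mult: "is_subring K \<Longrightarrow> x \<in> K \<Longrightarrow> y \<in> K \<Longrightarrow> x * y \<in> K"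
  and subring_diff: "is_subring K \<Longrightarrow> x \<in> K \<Longrightarrow> y \<in> K \<Longrightarrow> x - y \<in> K"
  and subring_0: "is_subring K \<Longrightarrow> 0 \<in> K"
  and subring_1: "is_subring K \<Longrightarrow> 1 \<in> K"
  unfolding is_subring_def by auto

lemma subring_uminus: "is_subring K \<Longrightarrow> x \<in> K \<Longrightarrow> - x \<in> K"
  using subring_diff[of K 0 x] by (simp add: subring_0)

lemma subring_sum: "is_subring K \<Longrightarrow> (\<And>i. i \<in> A \<Longrightarrow> f i \<in> K) \<Longrightarrow> sum f A \<in> K"
  by (induction A rule: infinite_finite_induct) (auto intro: subring_0 subring_add)

lemma subring_power: "is_subring K \<Longrightarrow> x \<in> K \<Longrightarrow> x ^ k \<in> K"
  by (induction k) (auto intro: subring_1 subring_mult)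

lemma subring_of_nat: "is_subring K \<Longrightarrow> of_nat k \<in> K"
  by (induction k) (auto intro: subring_0 subring_1 subring_add)

lemma ext_subring:
  assumes K: "is_subring K"
  shows "is_subring (ext K :: ('v, 'u::comm_ring_1) mpol set)"
proof -
  have diff: "p - q \<in> ext K" if "p \<in> ext K" "q \<in> ext K" for p q :: "('v, 'u) mpol"
    using that by (auto simp: ext_def lookup_minus subring_diff[OF K])
  have zero: "0 \<in> (ext K :: ('v, 'u) mpol set)" by (auto simp: ext_def subring_0[OF K])
  have add: "p + q \<in> ext K" if "p \<in> ext K" "q \<in> ext K" for p q :: "('v, 'u) mpol"
    using that by (auto simp: ext_def lookup_add subring_add[OF K])
  have "p * q \<in> ext K" if "p \<in> ext K" "q \<in> ext K" for p q :: "('v, 'u) mpol"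
  proof -
    have s: "Poly_Mapping.single m (Poly_Mapping.lookup p m) * q \<in> ext K" for m
      using that by (auto simp: ext_def lookup_single_mult subring_mult[OF K] subring_0[OF K])
    have "finite A \<Longrightarrow> (\<Sum>m\<in>A. Poly_Mapping.single m (Poly_Mapping.lookup p m)) * q \<in> ext K" for A
      by (induction A rule: finite_induct) (auto simp: distrib_right zero intro: add s)
    from this[OF finite_keys] show ?thesis using mpol_sum_single[of p] by metis
  qed
  moreover have "1 \<in> (ext K :: ('v, 'u) mpol set)"
    using K by (auto simp: ext_def lookup_one when_def subring_0 subring_1)
  ultimately show ?thesis using diff zero unfolding is_subring_def[of "ext K"] by blast
qed

lemma Const_ext_subring: "is_subring K \<Longrightarrow> c \<in> K \<Longrightarrow> Const c \<in> ext K"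
  by (auto simp: ext_def Const_def lookup_single when_def subring_0)

lemma Var_ext_subring: "is_subring K \<Longrightarrow> Var i \<in> ext K"
  by (auto simp: ext_def Var_def lookup_single when_def subring_0 subring_1)

lemma psubst_ext_subring:
  assumes K: "is_subring K" and p: "p \<in> ext K" and s: "\<And>i. \<sigma> i \<in> ext K"
  shows "psubst \<sigma> p \<in> ext K"
  unfolding psubst_def
proof (intro subring_sum ext_subring K subring_mult[OF ext_subring[OF K]] Const_ext_subring)
  fix m
  show "Poly_Mapping.lookup p m \<in> K" using p by (simp add: ext_def)
  show "(\<Prod>i\<in>#m. \<sigma> i) \<in> ext K"
    by (induction m) (use s ext_subring[OF K] in \<open>auto intro: subring_1 subring_mult\<close>)
qed

lemma coefficients_in_subring:
  assumes K: "is_subring K" and m: "is_ideal M" and KM: "\<And>u. \<exists>c\<in>K. u - c \<in> M"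
  shows "\<exists>q\<in>ext K. p - q \<in> ext M"
proof (induction p rule: mpol_induct)
  case (Const u)
  obtain c where "c \<in> K" "u - c \<in> M" using KM by blast
  then show ?case using Const_ext[OF m, of "u - c"]
    by (intro bexI[of _ "Const c"]) (auto simp: Const_diff intro: Const_ext_subring K)
next
  case (add p q)
  then show ?case by (meson ideal_cong_add[OF ext_ideal[OF m]] subring_add[OF ext_subring[OF K]])
next
  case (Var p i)
  then obtain q where q: "q \<in> ext K" "p - q \<in> ext M" by blast
  have "p * Var i - q * Var i \<in> ext M"
    using ideal_mult'[OF ext_ideal[OF m] q(2), of "Var i"] by (simp add: left_diff_distrib)
  moreover have "q * Var i \<in> ext K"
    by (intro subring_mult[OF ext_subring[OF K]] q(1) Var_ext_subring K)
  ultimately show ?case by blast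
qed

text \<open>\<open>K\<close> maps onto the quotient by \<open>M\<close>, with kernel inside
  \<open>I\<close>. If all coefficients are chosen in \<open>K\<close>, the errors in the defining
  identities have coefficients in both \<open>K\<close> and \<open>M\<close>, hence in
  \<open>I\<close>: an automorphism at a rational point is defined over the constants, and so over
  the base.\<close>

lemma inverse_pair_descend:
  assumes K: "is_subring K" and M: "is_ideal M" and I: "is_ideal I"
    and KM: "\<And>u. \<exists>c\<in>K. u - c \<in> M" "K \<inter> M \<subseteq> I"
    and st: "inverse_pair M n \<sigma> \<tau>" and n: "0 < n"
  shows "\<exists>\<sigma>' \<tau>'. inverse_pair I n \<sigma>' \<tau>' \<and> \<sigma>' 0 - \<sigma> 0 \<in> ext M"
proof -
  note E = ext_ideal[OF M, where ?'v = nat]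
  have ex: "\<exists>\<alpha>'. (\<forall>i. \<alpha>' i \<in> ext K \<and> \<alpha> i - \<alpha>' i \<in> ext M) \<and> (\<forall>i\<ge>n. \<alpha>' i = Var i)"
    if \<alpha>: "\<forall>i\<ge>n. \<alpha> i = Var i" for \<alpha>
  proof -
    have "\<forall>i. \<exists>q. q \<in> ext K \<and> \<alpha> i - q \<in> ext M"
      using coefficients_in_subring[OF K M KM(1)] by blast
    then obtain q where q: "\<forall>i. q i \<in> ext K \<and> \<alpha> i - q i \<in> ext M" by metis
    show ?thesis
      by (rule exI[of _ "\<lambda>i. if i < n then q i else Var i"])
        (use q \<alpha> Var_ext_subring[OF K] ideal_zero[OF E] in auto)
  qed
  obtain \<sigma>' where \<sigma>': "\<forall>i. \<sigma>' i \<in> ext K \<and> \<sigma> i - \<sigma>' i \<in> ext M" "\<forall>i\<ge>n. \<sigma>' i = Var i"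
    using ex[of \<sigma>] st unfolding inverse_pair_def by blast
  obtain \<tau>' where \<tau>': "\<forall>i. \<tau>' i \<in> ext K \<and> \<tau> i - \<tau>' i \<in> ext M" "\<forall>i\<ge>n. \<tau>' i = Var i"
    using ex[of \<tau>] st unfolding inverse_pair_def by blast
  have inv: "psubst \<alpha>' (\<beta>' i) - Var i \<in> ext I"
    if "inverse_pair M n \<alpha> \<beta>" "\<forall>i. \<alpha>' i \<in> ext K \<and> \<alpha> i - \<alpha>' i \<in> ext M"
      "\<forall>i. \<beta>' i \<in> ext K \<and> \<beta> i - \<beta>' i \<in> ext M" for \<alpha> \<beta> \<alpha>' \<beta>' i
  proof -
    have 1: "psubst \<alpha>' (\<beta>' i) - psubst \<alpha>' (\<beta> i) \<in> ext M"
      by (rule psubst_ext_cong[OF M], rule ideal_diff_commute[OF E]) (use that(3) in blast)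
    have 2: "psubst \<alpha>' (\<beta> i) - psubst \<alpha> (\<beta> i) \<in> ext M"
      by (rule psubst_cong[OF E], rule ideal_diff_commute[OF E]) (use that(2) in blast)
    have 3: "psubst \<alpha> (\<beta> i) - Var i \<in> ext M" using that(1) by (simp add: inverse_pair_def)
    have "psubst \<alpha>' (\<beta>' i) - Var i \<in> ext M"
      by (rule ideal_diff_trans[OF E 1 ideal_diff_trans[OF E 2 3]])
    moreover have "psubst \<alpha>' (\<beta>' i) - Var i \<in> ext K"
      by (intro subring_diff[OF ext_subring[OF K]] psubst_ext_subring K Var_ext_subring)
        (use that in blast)+
    moreover have "ext (K \<inter> M) \<subseteq> (ext I :: (nat, 'a) mpol set)" by (rule ext_mono[OF KM(2)])
    ultimately show ?thesis unfolding ext_Int by blast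
  qed
  have "inverse_pair I n \<sigma>' \<tau>'"
    using inv[OF st \<sigma>'(1) \<tau>'(1)] inv[OF inverse_pair_sym[OF st] \<tau>'(1) \<sigma>'(1)] \<sigma>'(2) \<tau>'(2)
    by (simp add: inverse_pair_def)
  then show ?thesis using \<sigma>'(1) ideal_diff_commute[OF E] by blast
qed

subsection \<open>Deformation to the linear part\<close>

lemma only_below_decomposition:
  assumes "only_below n p"
  shows "\<exists>b q. (\<forall>j<n. only_below n (q j)) \<and> p = Const b + (\<Sum>j<n. Var j * q j)"
proof -
  have "\<exists>b q. (\<forall>j<n. only_below n (q j)) \<and> psubst (below n) p = Const b + (\<Sum>j<n. Var j * q j)"
  proof (induction p rule: mpol_induct)
    case (Const c)
    show ?case by (intro exI[of _ c] exI[of _ "\<lambda>_. 0"]) (simp add: only_below_def)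
  next
    case (add p q)
    then obtain b f c g where "\<forall>j<n. only_below n (f j)" "psubst (below n) p = Const b + (\<Sum>j<n. Var j * f j)"
      "\<forall>j<n. only_below n (g j)" "psubst (below n) q = Const c + (\<Sum>j<n. Var j * g j)" by blast
    then show ?case
      by (intro exI[of _ "b + c"] exI[of _ "\<lambda>j. f j + g j"])
        (auto simp: psubst_add only_below_def Const_add distrib_left sum.distrib)
  next
    case (Var p i)
    show ?case
    proof (cases "i < n")
      case True
      have i: "below n i = Var i" using True by (simp add: below_def)
      have "(\<Sum>j<n. Var j * (if j = i then psubst (below n) p else 0)) =
          (\<Sum>j<n. if j = i then Var j * psubst (below n) p else 0)"
        by (intro sum.cong) auto
      also have "\<dots> = psubst (below n) p * Var i" using True by (simp add: mult.commute)
      finally show ?thesis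
        using True only_below_below[of n p]
        by (intro exI[of _ 0] exI[of _ "\<lambda>j. if j = i then psubst (below n) p else 0"])
          (auto simp: psubst_mult i only_below_def)
    next
      case False
      then show ?thesis
        by (intro exI[of _ 0] exI[of _ "\<lambda>_. 0"]) (simp add: psubst_mult below_def only_below_def)
    qed
  qed
  with assms show ?thesis by (simp add: only_below_def)
qed

lemma psubst_zero_Const: "\<exists>c. psubst (\<lambda>_. 0) p = (Const c :: ('w, 'u::comm_ring_1) mpol)"
proof (induction p rule: mpol_induct)
  case (Const c)
  show ?case by auto
next
  case (add p q)
  then show ?case by (auto simp: psubst_add simp flip: Const_add)
next
  case (Var p i)
  show ?case by (auto simp: psubst_mult intro: exI[of _ 0])
qed

text \<open>For \<open>\<sigma>\<close> without constant terms, \<open>dil e\<close> is \<open>e\<^sup>-\<^sup>1 \<sigma>(e X)\<close>, a polynomial family joining the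
  linear part of \<open>\<sigma>\<close> at \<open>e = 0\<close> to \<open>\<sigma>\<close> at \<open>e = 1\<close>.\<close>

lemma dilation_family:
  assumes I: "is_ideal I" and st: "inverse_pair I n \<sigma> \<tau>"
    and b: "\<And>i. i < n \<Longrightarrow> only_below n (\<sigma> i)" "\<And>i. i < n \<Longrightarrow> only_below n (\<tau> i)"
    and z: "\<And>i. i < n \<Longrightarrow> psubst (\<lambda>_. 0) (\<sigma> i) \<in> (ext I :: (nat, 'u::comm_ring_1) mpol set)"
  shows "\<exists>S T l. (\<forall>e::'u. inverse_pair I n (S e) (T e)) \<and>
    (\<forall>e e' i. \<exists>q. S e i - S e' i = Const (e - e') * q) \<and>
    (\<forall>i. S 1 i - \<sigma> i \<in> ext I) \<and>
    (\<forall>i<n. S 0 i = (\<Sum>j<n. Const (l i j) * Var j))"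
proof -
  note E = ext_ideal[OF I, where ?'v = nat]
  have cut: "psubst (\<lambda>_. 0) p - psubst (\<lambda>_. 0) q \<in> ext I"
    if "p - q \<in> ext I" for p q :: "(nat, 'u) mpol" by (rule psubst_ext_cong[OF I that])
  \<comment> \<open>\<open>\<sigma>\<close> fixes the origin modulo \<open>I\<close>, hence so does
    its inverse.\<close>
  have z': "psubst (\<lambda>_. 0) (\<tau> i) \<in> (ext I :: (nat, 'u) mpol set)" if i: "i < n" for i
  proof -
    have "psubst (\<lambda>_. 0) (\<tau> i) - psubst (\<lambda>j. psubst (\<lambda>_. 0) (\<sigma> j)) (\<tau> i) \<in> (ext I :: (nat, 'u) mpol set)"
      using z by (intro only_below_cong[OF E b(2)[OF i]]) (simp add: ideal_uminus[OF E])
    moreover have "psubst (\<lambda>_. 0) (psubst \<sigma> (\<tau> i)) - psubst (\<lambda>_. 0) (Var i) \<in> (ext I :: (nat, 'u) mpol set)"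
      using st by (intro cut) (simp add: inverse_pair_def)
    ultimately show ?thesis using ideal_cong_mem[OF E] by (simp add: psubst_psubst)
  qed
  \<comment> \<open>\<open>X\<^sub>n\<close> stands for the dilation factor until it is specialized
    to \<open>e\<close> at the end.\<close>
  define D where "D i = (if i < n then Var n * Var i else Var i :: (nat, 'u) mpol)" for i
  have ex: "\<exists>q b. (\<forall>i j. i < n \<longrightarrow> j < n \<longrightarrow> only_below n (q i j)) \<and>
      (\<forall>i<n. \<alpha> i = Const (b i) + (\<Sum>j<n. Var j * q i j))"
    if \<alpha>: "\<And>i. i < n \<Longrightarrow> only_below n (\<alpha> i)" for \<alpha>
  proof -
    have "\<forall>i. \<exists>q b. i < n \<longrightarrow> (\<forall>j<n. only_below n (q j)) \<and> \<alpha> i = Const b + (\<Sum>j<n. Var j * q j)"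
      using only_below_decomposition[OF \<alpha>] by blast
    then obtain q b where "\<forall>i. i < n \<longrightarrow> (\<forall>j<n. only_below n (q i j)) \<and> \<alpha> i = Const (b i) + (\<Sum>j<n. Var j * q i j)"
      by metis
    then show ?thesis by blast
  qed
  obtain q c where q: "\<And>i j. i < n \<Longrightarrow> j < n \<Longrightarrow> only_below n (q i j)"
    "\<And>i. i < n \<Longrightarrow> \<sigma> i = Const (c i) + (\<Sum>j<n. Var j * q i j)" using ex[of \<sigma>] b(1) by blast
  obtain r d where r: "\<And>i j. i < n \<Longrightarrow> j < n \<Longrightarrow> only_below n (r i j)"
    "\<And>i. i < n \<Longrightarrow> \<tau> i = Const (d i) + (\<Sum>j<n. Var j * r i j)" using ex[of \<tau>] b(2) by blast
  have "psubst (\<lambda>_. 0) (Const e + (\<Sum>j<n. Var j * f j)) = (Const e :: (nat, 'u) mpol)" for e f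
    by (simp add: psubst_add psubst_sum psubst_mult)
  then have c: "c i \<in> I" and d: "d i \<in> I" if "i < n" for i
    using z[OF that] z'[OF that] q(2)[OF that] r(2)[OF that] Const_ext[OF I, where ?'v = nat] by simp_all
  \<comment> \<open>Division by \<open>X\<^sub>n\<close>: under \<open>D\<close> each term
    \<open>X\<^sub>j q\<^sub>j\<close> acquires a factor \<open>X\<^sub>n\<close> from its first
    factor, and this one is left out.\<close>
  define dil where "dil q i = (if i < n then \<Sum>j<n. Var j * psubst D (q i j) else Var i)"
    for q :: "nat \<Rightarrow> nat \<Rightarrow> (nat, 'u) mpol" and i
  have dil: "psubst D (\<alpha> i) - Var n * dil q i \<in> ext I"
    if "\<alpha> i = Const (c i) + (\<Sum>j<n. Var j * q i j)" "c i \<in> I" "i < n" for \<alpha> c q i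
  proof -
    have "psubst D (\<alpha> i) = Const (c i) + Var n * dil q i"
      using that by (simp add: psubst_add psubst_sum psubst_mult dil_def sum_distrib_left D_def mult.assoc)
    then show ?thesis using that(2) by (simp add: Const_ext I)
  qed
  note dil\<sigma> = dil[of \<sigma> _ c q, OF q(2) c] and dil\<tau> = dil[of \<tau> _ d r, OF r(2) d]
  have inv: "psubst (dil q) (dil r i) - Var i \<in> ext I"
    if i: "i < n" and ab: "inverse_pair I n \<alpha> \<beta>" and b: "only_below n (\<beta> i)"
      and q: "\<And>i. i < n \<Longrightarrow> psubst D (\<alpha> i) - Var n * dil q i \<in> ext I"
      and r: "psubst D (\<beta> i) - Var n * dil r i \<in> ext I" for \<alpha> \<beta> q r i
  proof -
    have 1: "psubst (dil q) (Var n * dil r i) - psubst (dil q) (psubst D (\<beta> i)) \<in> ext I"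
      by (intro psubst_ext_cong I ideal_diff_commute[OF E r])
    have "psubst (\<lambda>i. psubst (dil q) (D i)) (\<beta> i) - psubst (\<lambda>i. psubst D (\<alpha> i)) (\<beta> i) \<in> ext I"
    proof (rule only_below_cong[OF E b])
      fix i assume i: "i < n"
      have "psubst (dil q) (D i) = Var n * dil q i"
        using i by (simp add: D_def psubst_mult) (simp add: dil_def)
      then show "psubst (dil q) (D i) - psubst D (\<alpha> i) \<in> ext I"
        using ideal_diff_commute[OF E q[OF i]] by simp
    qed
    then have 2: "psubst (dil q) (psubst D (\<beta> i)) - psubst D (psubst \<alpha> (\<beta> i)) \<in> ext I"
      by (simp add: psubst_psubst)
    have 3: "psubst D (psubst \<alpha> (\<beta> i)) - psubst D (Var i) \<in> ext I"
      using ab by (intro psubst_ext_cong I) (simp add: inverse_pair_def)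
    have "psubst (dil q) (Var n * dil r i) - psubst D (Var i) \<in> ext I"
      by (rule ideal_diff_trans[OF E 1 ideal_diff_trans[OF E 2 3]])
    then have "(psubst (dil q) (dil r i) - Var i) * Var n \<in> ext I"
      using i by (simp add: psubst_mult D_def algebra_simps) (simp add: dil_def algebra_simps)
    \<comment> \<open>Cancelling \<open>X\<^sub>n\<close> means reading off the coefficients of the
      monomials that contain it.\<close>
    then have "\<forall>m. Poly_Mapping.lookup ((psubst (dil q) (dil r i) - Var i) * Var n) (add_mset n m) \<in> I"
      by (simp add: ext_def)
    then show ?thesis by (simp add: ext_def lookup_mult_Var)
  qed
  have pair: "inverse_pair I n (dil q) (dil r)"
    unfolding inverse_pair_def
  proof (intro conjI allI)
    fix i
    show "psubst (dil q) (dil r i) - Var i \<in> ext I"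
    proof (cases "i < n")
      case True
      then show ?thesis by (intro inv[OF True st b(2)[OF True] dil\<sigma> dil\<tau>])
    qed (simp add: dil_def ideal_zero[OF E])
    show "psubst (dil r) (dil q i) - Var i \<in> ext I"
    proof (cases "i < n")
      case True
      then show ?thesis by (intro inv[OF True inverse_pair_sym[OF st] b(1)[OF True] dil\<tau> dil\<sigma>])
    qed (simp add: dil_def ideal_zero[OF E])
  qed (simp add: dil_def)
  define \<psi> where "\<psi> e i = (if i = n then Const e else Var i :: (nat, 'u) mpol)" for e i
  define S where "S e i = (if i < n then psubst (\<psi> e) (dil q i) else Var i)" for e i
  define T where "T e i = (if i < n then psubst (\<psi> e) (dil r i) else Var i)" for e i
  have "inverse_pair I n (S e) (T e)" for e
    unfolding S_def T_def
    by (rule inverse_pair_spec[OF I pair]) (auto simp: \<psi>_def only_above_Var only_above_Const)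
  moreover have "\<exists>p. S e i - S e' i = Const (e - e') * p" for e e' i
  proof (cases "i < n")
    case True
    have "psubst (\<psi> e) (dil q i) - psubst (\<psi> e') (dil q i) \<in> {Const (e - e') * p |p. True}"
    proof (rule psubst_cong[OF principal_ideal])
      fix j
      have "\<psi> e j - \<psi> e' j = Const (e - e') * (if j = n then 1 else 0)"
        by (simp add: \<psi>_def Const_diff)
      then show "\<psi> e j - \<psi> e' j \<in> {Const (e - e') * p |p. True}" by blast
    qed
    with True show ?thesis by (auto simp: S_def)
  qed (auto simp: S_def intro: exI[of _ 0])
  moreover have "S 1 i - \<sigma> i \<in> ext I" for i
  proof (cases "i < n")
    case True
    have "psubst (\<psi> 1) (psubst D (\<sigma> i) - Var n * dil q i) \<in> ext I"
      by (intro psubst_ext I dil\<sigma> True)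
    moreover have "psubst (\<psi> 1) (psubst D (\<sigma> i)) = \<sigma> i"
      unfolding psubst_psubst
      by (rule only_below_ident[OF b(1)[OF True]]) (simp add: D_def psubst_mult \<psi>_def)
    moreover have "psubst (\<psi> 1) (Var n) = 1" by (simp add: \<psi>_def)
    ultimately have "\<sigma> i - S 1 i \<in> ext I" using True by (simp add: psubst_diff psubst_mult S_def)
    then show ?thesis by (rule ideal_diff_commute[OF E])
  qed (use st in \<open>auto simp: S_def inverse_pair_def ideal_zero[OF E]\<close>)
  moreover have "\<exists>l. \<forall>i<n. S 0 i = (\<Sum>j<n. Const (l i j) * Var j)"
  proof -
    have "\<exists>c. psubst (\<psi> 0) (psubst D (q i j)) = Const c" if "i < n" "j < n" for i j
    proof -
      have "psubst (\<psi> 0) (psubst D (q i j)) = psubst (\<lambda>_. 0) (q i j)"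
        unfolding psubst_psubst
        by (rule only_below_psubst[OF q(1)[OF that]]) (simp add: D_def psubst_mult \<psi>_def)
      then show ?thesis using psubst_zero_Const by metis
    qed
    then obtain l where l: "\<And>i j. i < n \<Longrightarrow> j < n \<Longrightarrow> psubst (\<psi> 0) (psubst D (q i j)) = Const (l i j)"
      by metis
    have "S 0 i = (\<Sum>j<n. Const (l i j) * Var j)" if "i < n" for i
    proof -
      have "S 0 i = (\<Sum>j<n. psubst (\<psi> 0) (Var j) * psubst (\<psi> 0) (psubst D (q i j)))"
        using that by (simp add: S_def dil_def psubst_sum psubst_mult)
      also have "\<dots> = (\<Sum>j<n. Const (l i j) * Var j)"
        using l that by (intro sum.cong) (auto simp: \<psi>_def mult.commute)
      finally show ?thesis .
    qed
    then show ?thesis by blast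
  qed
  ultimately show ?thesis by blast
qed

subsection \<open>Interpolation\<close>

text \<open>With \<open>c\<close> congruent to \<open>1\<close> at one point and to \<open>0\<close> at the others, \<open>reachable\<close> polynomials are those
  that agree at the first point with a coordinate which is \<open>X\<^sub>0\<close> at the others.\<close>

definition deform :: "'u::comm_ring_1 set \<Rightarrow> nat \<Rightarrow> 'u \<Rightarrow> (nat \<Rightarrow> (nat, 'u) mpol) \<Rightarrow> bool"
  where "deform I n c \<phi> \<longleftrightarrow> (\<exists>\<phi>'. inverse_pair I n \<phi> \<phi>') \<and> (\<forall>i. \<phi> i - Var i \<in> ext (adjoin I c))"

definition reachable :: "'u::comm_ring_1 set \<Rightarrow> nat \<Rightarrow> 'u \<Rightarrow> 'u set \<Rightarrow> (nat, 'u) mpol \<Rightarrow> bool"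
  where "reachable I n c M f \<longleftrightarrow> (\<exists>\<phi>. deform I n c \<phi> \<and> \<phi> 0 - f \<in> ext M)"

lemma reachable_cong: "is_ideal M \<Longrightarrow> reachable I n c M f \<Longrightarrow> f - g \<in> ext M \<Longrightarrow> reachable I n c M g"
  unfolding reachable_def using ideal_diff_trans[OF ext_ideal] by blast

text \<open>Composition with a deformation whose value at \<open>M\<close> is
  \<open>\<theta>\<close> applies \<open>\<theta>\<close> to the polynomial that is reached at
  \<open>M\<close>.\<close>

lemma reachable_image:
  assumes I: "is_ideal I" and M: "is_ideal M" and f: "reachable I n c M f"
    and \<psi>: "deform I n c \<psi>" "\<And>i. \<psi> i - \<theta> i \<in> ext M"
  shows "reachable I n c M (psubst \<theta> f)"
proof -
  obtain \<phi> \<phi>' where \<phi>: "inverse_pair I n \<phi> \<phi>'" "\<forall>i. \<phi> i - Var i \<in> ext (adjoin I c)" "\<phi> 0 - f \<in> ext M"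
    using f unfolding reachable_def deform_def by blast
  obtain \<psi>' where \<psi>': "inverse_pair I n \<psi> \<psi>'" "\<forall>i. \<psi> i - Var i \<in> ext (adjoin I c)"
    using \<psi>(1) unfolding deform_def by blast
  note E = ext_ideal[OF M, where ?'v = nat]
  note A = adjoin_ideal[OF I, of c]
  note E' = ext_ideal[OF A, where ?'v = nat]
  have "psubst \<psi> (\<phi> i) - Var i \<in> ext (adjoin I c)" for i
  proof (rule ideal_diff_trans[OF E'])
    show "psubst \<psi> (\<phi> i) - psubst \<psi> (Var i) \<in> ext (adjoin I c)"
      by (rule psubst_ext_cong[OF A]) (use \<phi>(2) in blast)
    show "psubst \<psi> (Var i) - Var i \<in> ext (adjoin I c)" using \<psi>'(2) by simp
  qed
  then have "deform I n c (\<lambda>i. psubst \<psi> (\<phi> i))"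
    using inverse_pair_comp[OF I \<psi>'(1) \<phi>(1)] unfolding deform_def by blast
  moreover have "psubst \<psi> (\<phi> 0) - psubst \<theta> f \<in> ext M"
    by (rule ideal_diff_trans[OF E psubst_ext_cong[OF M \<phi>(3)] psubst_cong[OF E \<psi>(2)]])
  ultimately show ?thesis unfolding reachable_def by blast
qed

text \<open>With \<open>c g\<close> in place of \<open>g\<close> the substitution is unchanged at
  \<open>M\<close>, where \<open>c\<close> is 1, and becomes the identity where \<open>c\<close>
  vanishes.\<close>

lemma reachable_elementary:
  assumes I: "is_ideal I" and M: "is_ideal M" and c: "c - 1 \<in> M" and f: "reachable I n c M f"
    and a: "a < n" "\<And>q. psubst (Var(a := q)) g = g"
  shows "reachable I n c M (psubst (Var(a := Var a + g)) f)"
proof (rule reachable_image[OF I M f])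
  note E' = ext_ideal[OF adjoin_ideal[OF I, of c], where ?'v = nat]
  have "inverse_pair I n (Var(a := Var a + Const c * g)) (Var(a := Var a - Const c * g))"
    using a by (intro elementary_pair I) (auto simp: psubst_mult)
  moreover have "Const c * g \<in> ext (adjoin I c)"
    by (rule ideal_mult'[OF E']) (simp add: Const_ext adjoin_ideal I adjoin_self)
  ultimately show "deform I n c (Var(a := Var a + Const c * g))"
    unfolding deform_def by (auto simp: ideal_zero[OF E'])
  fix i
  have "Const (c - 1) * g \<in> ext M"
    by (rule ideal_mult'[OF ext_ideal[OF M]]) (simp add: Const_ext M c)
  then show "(Var(a := Var a + Const c * g)) i - (Var(a := Var a + g)) i \<in> ext M"
    by (auto simp: Const_diff algebra_simps ideal_zero[OF ext_ideal[OF M]])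
qed

text \<open>Over a field, elementary operations turn \<open>X\<^sub>0\<close> into any affine form
  whose linear part is nonzero. Rescaling one variable is not elementary; the coefficient
  \<open>l 0\<close> is produced with the help of \<open>X\<^sub>1\<close>, which is where
  \<open>2 \<le> n\<close> enters.\<close>

lemma reachable_affine:
  assumes I: "is_ideal I" and M: "is_prime M" and c: "c - 1 \<in> M" and n: "2 \<le> n"
    and units: "\<And>u. u \<notin> M \<Longrightarrow> \<exists>v. u * v - 1 \<in> M"
    and l: "j < n" "l j \<notin> M"
  shows "reachable I n c M ((\<Sum>i<n. Const (l i) * Var i) + Const b)"
proof -
  note M' = prime_ideal[OF M]
  note E = ext_ideal[OF M', where ?'v = nat]
  note elem = reachable_elementary[OF I M' c]
  have main: "reachable I n c M ((\<Sum>i<n. Const (l i) * Var i) + Const b)" if l0: "l 0 \<notin> M" for l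
  proof -
    obtain u where u: "l 0 * u - 1 \<in> M" using units[OF l0] by blast
    have "inverse_pair I n Var Var" by (rule inverse_pair_ident[OF I])
    then have "reachable I n c M (Var 0)"
      unfolding reachable_def deform_def
      using ideal_zero[OF E] ideal_zero[OF ext_ideal[OF adjoin_ideal[OF I]]]
      by (intro exI[of _ Var]) auto
    then have "reachable I n c M (psubst (Var(0 := Var 0 + Const b)) (Var 0))"
      by (rule elem) (use n in auto)
    then have "reachable I n c M (psubst (Var(0 := Var 0 + Var 1)) (Var 0 + Const b))"
      by (intro elem) (use n in auto)
    then have "reachable I n c M (psubst (Var(1 := Var 1 + Const (l 0 - 1) * Var 0)) (Var 0 + Var 1 + Const b))"
      by (intro elem) (use n in \<open>auto simp: psubst_mult psubst_add\<close>)
    moreover have "psubst (Var(1 := Var 1 + Const (l 0 - 1) * Var 0)) (Var 0 + Var 1 + Const b) =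
        (Const (l 0) * Var 0 + Var 1 + Const b :: (nat, 'a) mpol)"
      by (simp add: psubst_add Const_diff algebra_simps)
    ultimately have 1: "reachable I n c M (Const (l 0) * Var 0 + Var 1 + Const b)" by simp
    \<comment> \<open>\<open>X\<^sub>1\<close> already has coefficient 1 at this stage, so only
      \<open>l 1 - 1\<close> remains to be added.\<close>
    define \<delta> where "\<delta> i = l i - (if i = 1 then 1 else 0)" for i
    define g where "g = (\<Sum>i\<in>{1..<n}. Const (\<delta> i) * Var i :: (nat, 'a) mpol)"
    have g: "psubst (Var(0 := q)) g = g" for q
      unfolding g_def psubst_sum by (intro sum.cong) (auto simp: psubst_mult)
    \<comment> \<open>Because \<open>l 0 * u\<close> is 1 modulo \<open>M\<close>, this substitution
      adds exactly \<open>g\<close> at \<open>M\<close>.\<close>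
    have 2: "reachable I n c M (psubst (Var(0 := Var 0 + Const u * g)) (Const (l 0) * Var 0 + Var 1 + Const b))"
      using n by (intro elem 1) (auto simp: psubst_mult g)
    have "psubst (Var(0 := Var 0 + Const u * g)) (Const (l 0) * Var 0 + Var 1 + Const b)
        - ((\<Sum>i<n. Const (l i) * Var i) + Const b) = Const (l 0 * u - 1) * g"
    proof -
      have s: "{..<n} = insert 0 {1..<n}" using n by auto
      have "(\<Sum>i\<in>{1..<n}. Const (if i = 1 then 1 else 0) * Var i) =
          (\<Sum>i\<in>{1..<n}. if i = 1 then Var i else 0 :: (nat, 'a) mpol)"
        by (intro sum.cong) auto
      also have "\<dots> = Var 1" using n by simp
      finally have "(\<Sum>i<n. Const (l i) * Var i) = Const (l 0) * Var 0 + g + Var 1"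
        unfolding s g_def \<delta>_def by (simp add: Const_diff left_diff_distrib sum_subtractf)
      then show ?thesis by (simp add: psubst_add psubst_mult Const_diff Const_mult algebra_simps)
    qed
    moreover have "Const (l 0 * u - 1) * g \<in> ext M"
      by (rule ideal_mult'[OF E]) (simp add: Const_ext M' u)
    ultimately have "psubst (Var(0 := Var 0 + Const u * g)) (Const (l 0) * Var 0 + Var 1 + Const b)
        - ((\<Sum>i<n. Const (l i) * Var i) + Const b) \<in> ext M" by simp
    from reachable_cong[OF M' 2 this] show ?thesis .
  qed
  show ?thesis
  proof (cases "l 0 \<in> M")
    case False
    then show ?thesis by (rule main)
  next
    case True
    have j: "j \<noteq> 0" using True l(2) by metis
    \<comment> \<open>If \<open>l 0\<close> vanishes at \<open>M\<close>, the form with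
      \<open>l 0 + l j\<close> as coefficient of \<open>X\<^sub>0\<close> is reached first;
      replacing \<open>X\<^sub>j\<close> by \<open>X\<^sub>j - X\<^sub>0\<close> then removes the
      surplus.\<close>
    define l' where "l' = l(0 := l 0 + l j)"
    have "l' 0 \<notin> M"
      using True l(2) ideal_diff[OF M', of "l 0 + l j" "l 0"] by (auto simp: l'_def)
    then have "reachable I n c M ((\<Sum>i<n. Const (l' i) * Var i) + Const b)" by (rule main)
    then have "reachable I n c M (psubst (Var(j := Var j + (- Var 0))) ((\<Sum>i<n. Const (l' i) * Var i) + Const b))"
      by (rule elem) (use l j in \<open>auto simp: psubst_uminus\<close>)
    moreover have "psubst (Var(j := Var j + (- Var 0))) ((\<Sum>i<n. Const (l' i) * Var i) + Const b) =
        (\<Sum>i<n. Const (l i) * Var i) + Const b"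
    proof -
      have "psubst (Var(j := Var j + (- Var 0))) (\<Sum>i<n. Const (l' i) * Var i) =
          (\<Sum>i<n. Const (l i) * Var i + ((if i = 0 then Const (l j) * Var 0 else 0)
            - (if i = j then Const (l j) * Var 0 else 0)))"
        unfolding psubst_sum using j
        by (intro sum.cong) (auto simp: psubst_mult l'_def Const_add algebra_simps)
      also have "\<dots> = (\<Sum>i<n. Const (l i) * Var i)"
        using n l(1) by (simp add: sum.distrib sum_subtractf)
      finally show ?thesis by (simp add: psubst_add)
    qed
    ultimately show ?thesis by simp
  qed
qed

text \<open>A translation removes the constant terms of \<open>\<sigma>\<close>, and
  \<open>S\<close> joins its linear part \<open>S 0\<close> to it. Undoing the linear part,
  \<open>S c\<close> after \<open>T 0\<close> is the identity where \<open>c\<close> is 0, while at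
  \<open>M\<close> it turns the linear part into \<open>\<sigma>\<close>. Applied to the affine form
  \<open>S 0 0 + Const (d 0)\<close>, which elementary operations reach, it gives
  \<open>\<sigma> 0\<close>.\<close>

lemma reachable_coordinate:
  assumes I: "is_ideal I" and M: "is_prime M" "I \<subseteq> M" and c: "c - 1 \<in> M" and n: "2 \<le> n"
    and units: "\<And>u. u \<notin> M \<Longrightarrow> \<exists>v. u * v - 1 \<in> M"
    and st: "inverse_pair I n \<sigma> \<tau>" and b: "\<And>i. i < n \<Longrightarrow> only_below n (\<sigma> i)" "\<And>i. i < n \<Longrightarrow> only_below n (\<tau> i)"
  shows "reachable I n c M (\<sigma> 0)"
proof -
  note M' = prime_ideal[OF M(1)]
  note E = ext_ideal[OF M', where ?'v = nat]
  note E\<^sub>I = ext_ideal[OF I, where ?'v = nat]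
  have "\<forall>i. \<exists>d. psubst (\<lambda>_. 0) (\<sigma> i) = (Const d :: (nat, 'a) mpol)" using psubst_zero_Const by blast
  then obtain d where d: "\<And>i. psubst (\<lambda>_. 0) (\<sigma> i) = (Const (d i) :: (nat, 'a) mpol)" by metis
  define t where "t i = (if i < n then Var i + Const (d i) else Var i)" for i
  define t' where "t' i = (if i < n then Var i - Const (d i) else Var i)" for i
  have tt: "inverse_pair I n t' t"
    by (auto simp: inverse_pair_def t_def t'_def psubst_add psubst_diff ideal_zero[OF E\<^sub>I])
  define \<sigma>0 where "\<sigma>0 i = psubst \<sigma> (t' i)" for i
  define \<tau>0 where "\<tau>0 i = psubst t (\<tau> i)" for i
  have st0: "inverse_pair I n \<sigma>0 \<tau>0"
    unfolding \<sigma>0_def \<tau>0_def by (rule inverse_pair_comp[OF I st tt])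
  have \<sigma>0: "\<sigma>0 i = \<sigma> i - Const (d i)" if "i < n" for i
    using that by (simp add: \<sigma>0_def t'_def psubst_diff)
  have b0: "only_below n (\<sigma>0 i)" "only_below n (\<tau>0 i)" if "i < n" for i
  proof -
    show "only_below n (\<sigma>0 i)" using b(1)[OF that] by (simp add: \<sigma>0[OF that] only_below_def psubst_diff)
    have "psubst (\<lambda>i. psubst (below n) (t i)) (\<tau> i) = psubst t (\<tau> i)"
      by (rule only_below_psubst[OF b(2)[OF that]]) (simp add: t_def psubst_add below_def)
    then show "only_below n (\<tau>0 i)" by (simp add: \<tau>0_def only_below_def psubst_psubst)
  qed
  have z0: "psubst (\<lambda>_. 0) (\<sigma>0 i) \<in> (ext I :: (nat, 'a) mpol set)" if "i < n" for i
    by (simp add: \<sigma>0[OF that] psubst_diff d ideal_zero[OF E\<^sub>I])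
  obtain S T l where "\<forall>e::'a. inverse_pair I n (S e) (T e)"
    "\<forall>e e' i. \<exists>q. S e i - S e' i = Const (e - e') * q" "\<forall>i. S 1 i - \<sigma>0 i \<in> ext I"
    "\<forall>i<n. S 0 i = (\<Sum>j<n. Const (l i j) * Var j)"
    using dilation_family[OF I st0 b0 z0] by blast
  note S = this[rule_format]
  have S_cong: "S e i - S e' i \<in> ext Q" if Q: "is_ideal Q" "e - e' \<in> Q" for e e' i Q
  proof -
    obtain q where "S e i - S e' i = Const (e - e') * q" using S(2) by blast
    moreover have "Const (e - e') * q \<in> ext Q"
      by (rule ideal_mult'[OF ext_ideal[OF Q(1)]]) (simp add: Const_ext Q)
    ultimately show ?thesis by simp
  qed
  \<comment> \<open>Otherwise \<open>S 0 0\<close> vanishes modulo \<open>M\<close>, and so does its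
    image \<open>X\<^sub>0\<close> under the inverse.\<close>
  have "\<exists>j<n. l 0 j \<notin> M"
  proof (rule ccontr)
    assume "\<not> (\<exists>j<n. l 0 j \<notin> M)"
    then have "S 0 0 \<in> ext M"
      using n S(4)[of 0] by (auto intro!: ideal_sum[OF E] ideal_mult'[OF E] simp: Const_ext M')
    then have "psubst (T 0) (S 0 0) \<in> ext M" by (rule psubst_ext[OF M'])
    moreover have "psubst (T 0) (S 0 0) - Var 0 \<in> ext M"
      using S(1)[of 0] ext_mono[OF M(2)] unfolding inverse_pair_def by blast
    ultimately have "Var 0 \<in> (ext M :: (nat, 'a) mpol set)" using ideal_cong_mem[OF E] by blast
    then have "Poly_Mapping.lookup (Var 0 :: (nat, 'a) mpol) {#0#} \<in> M" unfolding ext_def by blast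
    then have "1 \<in> M" by (simp add: Var_def)
    with M(1) show False by (simp add: is_prime_def)
  qed
  then obtain j where j: "j < n" "l 0 j \<notin> M" by blast
  have "reachable I n c M ((\<Sum>i<n. Const (l 0 i) * Var i) + Const (d 0))"
    by (rule reachable_affine[where l = "l 0", OF I M(1) c n units j])
  then have r: "reachable I n c M (S 0 0 + Const (d 0))" using S(4)[of 0] n by simp
  have "reachable I n c M (psubst (\<lambda>i. psubst \<sigma>0 (T 0 i)) (S 0 0 + Const (d 0)))"
  proof (rule reachable_image[OF I M' r])
    note A = adjoin_ideal[OF I, of c]
    note E' = ext_ideal[OF A, where ?'v = nat]
    have "psubst (S c) (T 0 i) - psubst (S 0) (T 0 i) \<in> ext (adjoin I c)" for i
      by (intro psubst_cong[OF E'] S_cong A) (simp add: adjoin_self I)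
    moreover have "psubst (S 0) (T 0 i) - Var i \<in> ext (adjoin I c)" for i
      using S(1)[of 0] ext_mono[OF adjoin_super] unfolding inverse_pair_def by blast
    ultimately have "psubst (S c) (T 0 i) - Var i \<in> ext (adjoin I c)" for i
      by (rule ideal_diff_trans[OF E'])
    then show "deform I n c (\<lambda>i. psubst (S c) (T 0 i))"
      using inverse_pair_comp[OF I S(1)[of c] inverse_pair_sym[OF S(1)[of 0]]]
      unfolding deform_def by blast
    fix i
    have "S c j - \<sigma>0 j \<in> ext M" for j
    proof (rule ideal_diff_trans[OF E S_cong[OF M' c]])
      show "S 1 j - \<sigma>0 j \<in> ext M" using S(3) ext_mono[OF M(2)] by blast
    qed
    then show "psubst (S c) (T 0 i) - psubst \<sigma>0 (T 0 i) \<in> ext M" by (rule psubst_cong[OF E])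
  qed
  moreover have "psubst (\<lambda>i. psubst \<sigma>0 (T 0 i)) (S 0 0 + Const (d 0)) - \<sigma> 0 \<in> ext M"
  proof -
    have "psubst (T 0) (S 0 0) - Var 0 \<in> ext M"
      using S(1)[of 0] ext_mono[OF M(2)] unfolding inverse_pair_def by blast
    then have "psubst \<sigma>0 (psubst (T 0) (S 0 0)) - psubst \<sigma>0 (Var 0) \<in> ext M"
      by (rule psubst_ext_cong[OF M'])
    then show ?thesis using n by (simp add: psubst_add psubst_psubst \<sigma>0 diff_diff_eq2)
  qed
  ultimately show ?thesis by (rule reachable_cong[OF M'])
qed

text \<open>The points are treated one at a time: the deformation for a new point is the identity at
  all others, and the automorphism built so far is the identity at the new point, so composing
  disturbs nothing.\<close>

lemma coord_interpolation:
  assumes I: "is_ideal I" and fin: "finite \<M>" and M: "\<And>M. M \<in> \<M> \<Longrightarrow> is_prime M" "\<And>M. M \<in> \<M> \<Longrightarrow> I \<subseteq> M"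
    and n: "2 \<le> n"
    and c: "\<And>M. M \<in> \<M> \<Longrightarrow> c M - 1 \<in> M" "\<And>M N. M \<in> \<M> \<Longrightarrow> N \<in> \<M> \<Longrightarrow> M \<noteq> N \<Longrightarrow> c M \<in> N"
    and units: "\<And>M u. M \<in> \<M> \<Longrightarrow> u \<notin> M \<Longrightarrow> \<exists>v. u * v - 1 \<in> M"
    and K: "is_subring K" "\<And>M u. M \<in> \<M> \<Longrightarrow> \<exists>c\<in>K. u - c \<in> M" "\<And>M. M \<in> \<M> \<Longrightarrow> K \<inter> M \<subseteq> I"
    and F: "only_below n F" "\<And>M. M \<in> \<M> \<Longrightarrow> coord M n F"
  shows "\<exists>\<sigma> \<tau>. inverse_pair I n \<sigma> \<tau> \<and> \<sigma> 0 - F \<in> ext (\<Inter>\<M>)"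
proof -
  have n0: "0 < n" using n by simp
  have reach: "reachable I n (c M) M F" if MM: "M \<in> \<M>" for M
  proof -
    note M' = prime_ideal[OF M(1)[OF MM]]
    note E = ext_ideal[OF M', where ?'v = nat]
    obtain \<sigma> \<tau> where st: "inverse_pair M n \<sigma> \<tau>" "\<sigma> 0 - F \<in> ext M"
      using F(2)[OF MM] by (auto simp: coord_def)
    obtain \<sigma>' \<tau>' where st': "inverse_pair I n \<sigma>' \<tau>'" "\<sigma>' 0 - \<sigma> 0 \<in> ext M"
      using inverse_pair_descend[OF K(1) M' I K(2)[OF MM] K(3)[OF MM] st(1) n0] by blast
    have F': "\<sigma>' 0 - F \<in> ext M" by (rule ideal_diff_trans[OF E st'(2) st(2)])
    define \<kappa> where "\<kappa> \<alpha> i = (if i < n then psubst (below n) (\<alpha> i) else Var i)"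
      for \<alpha> :: "nat \<Rightarrow> (nat, 'a) mpol" and i
    have k: "inverse_pair I n (\<kappa> \<sigma>') (\<kappa> \<tau>')"
      unfolding \<kappa>_def by (rule inverse_pair_spec[OF I st'(1)]) (auto simp: below_def only_above_0)
    have "reachable I n (c M) M (\<kappa> \<sigma>' 0)"
      by (rule reachable_coordinate[OF I M(1)[OF MM] M(2)[OF MM] c(1)[OF MM] n units[OF MM] k])
        (auto simp: \<kappa>_def only_below_below)
    moreover have "\<kappa> \<sigma>' 0 - F \<in> ext M"
      using psubst_ext[OF M' F', of "below n"] F(1) n0 by (simp add: \<kappa>_def psubst_diff only_below_def)
    ultimately show ?thesis by (rule reachable_cong[OF M'])
  qed
  have "\<exists>\<phi> \<phi>'. inverse_pair I n \<phi> \<phi>' \<and> (\<forall>M\<in>\<N>. \<phi> 0 - F \<in> ext M) \<and> (\<forall>M\<in>\<M> - \<N>. \<forall>i. \<phi> i - Var i \<in> ext M)"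
    if "finite \<N>" "\<N> \<subseteq> \<M>" for \<N>
    using that
  proof (induction \<N> rule: finite_induct)
    case empty
    have "\<forall>M\<in>\<M>. 0 \<in> (ext M :: (nat, 'a) mpol set)" using M(1) by (auto intro: ideal_zero ext_ideal prime_ideal)
    then show ?case using inverse_pair_ident[OF I] by (intro exI[of _ Var]) auto
  next
    case (insert M \<N>)
    then obtain \<phi> \<phi>' where \<phi>: "inverse_pair I n \<phi> \<phi>'" "\<forall>M\<in>\<N>. \<phi> 0 - F \<in> ext M"
      "\<forall>M\<in>\<M> - \<N>. \<forall>i. \<phi> i - Var i \<in> ext M" by blast
    have MM: "M \<in> \<M>" using insert.prems by simp
    obtain \<psi> \<psi>' where \<psi>: "inverse_pair I n \<psi> \<psi>'" "\<forall>i. \<psi> i - Var i \<in> ext (adjoin I (c M))" "\<psi> 0 - F \<in> ext M"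
      using reach[OF MM] unfolding reachable_def deform_def by blast
    have near: "psubst \<psi> p - p \<in> ext N" if N: "N \<in> \<M>" "N \<noteq> M" for N p
    proof -
      note N' = prime_ideal[OF M(1)[OF N(1)]]
      have "adjoin I (c M) \<subseteq> N" using c(2)[OF MM N(1)] N M(2)[OF N(1)] by (intro adjoin_least N') auto
      then have "\<psi> i - Var i \<in> ext N" for i using \<psi>(2) ext_mono by blast
      then show ?thesis using psubst_cong[OF ext_ideal[OF N'], of \<psi> Var p] by simp
    qed
    have "psubst \<psi> (\<phi> 0) - F \<in> ext N" if N: "N \<in> insert M \<N>" for N
    proof (cases "N = M")
      case True
      note M' = prime_ideal[OF M(1)[OF MM]]
      have "\<phi> 0 - Var 0 \<in> ext M" using \<phi>(3) MM insert.hyps by blast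
      then have "psubst \<psi> (\<phi> 0) - psubst \<psi> (Var 0) \<in> ext M" by (rule psubst_ext_cong[OF M'])
      then show ?thesis using \<psi>(3) ideal_diff_trans[OF ext_ideal[OF M']] True by simp
    next
      case False
      then have N': "N \<in> \<N>" "N \<in> \<M>" using N insert.prems by auto
      show ?thesis
        using ideal_diff_trans[OF ext_ideal[OF prime_ideal[OF M(1)[OF N'(2)]]] near[OF N'(2) False]] \<phi>(2) N'(1)
        by blast
    qed
    moreover have "psubst \<psi> (\<phi> i) - Var i \<in> ext N" if N: "N \<in> \<M> - insert M \<N>" for N i
      using ideal_diff_trans[OF ext_ideal[OF prime_ideal[OF M(1)]] near[of N]] \<phi>(3) N by blast
    ultimately show ?case using inverse_pair_comp[OF I \<psi>(1) \<phi>(1)] by blast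
  qed
  from this[OF fin order_refl] show ?thesis by (auto simp: ext_Inter)
qed

section \<open>Finitely generated algebras over an algebraically closed field\<close>

subsection \<open>Hilbert's basis theorem\<close>

definition polys_over :: "'u::comm_ring_1 set \<Rightarrow> 'u poly set"
  where "polys_over A = {p. \<forall>i. Polynomial.coeff p i \<in> A}"

definition poly_ext :: "'u::comm_ring_1 set \<Rightarrow> 'u \<Rightarrow> 'u set"
  where "poly_ext A t = (\<lambda>p. poly p t) ` polys_over A"

definition combs :: "'u::comm_ring_1 set \<Rightarrow> 'u set \<Rightarrow> (nat \<Rightarrow> 'u) \<Rightarrow> nat \<Rightarrow> 'u set"
  where "combs A I x k = {y + (\<Sum>i<k. u i * x i) |y u. y \<in> I \<and> (\<forall>i. u i \<in> A)}"

text \<open>Noetherianity of \<open>A\<close> modulo \<open>I\<close>, in terms of sequences.\<close>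

definition noeth :: "'u::comm_ring_1 set \<Rightarrow> 'u set \<Rightarrow> bool"
  where "noeth A I \<longleftrightarrow> (\<forall>x. (\<forall>i. x i \<in> A) \<longrightarrow> (\<exists>k. x k \<in> combs A I x k))"

lemma polys_over_diff: "is_subring A \<Longrightarrow> p \<in> polys_over A \<Longrightarrow> q \<in> polys_over A \<Longrightarrow> p - q \<in> polys_over A"
  by (auto simp: polys_over_def subring_diff)

lemma polys_over_add: "is_subring A \<Longrightarrow> p \<in> polys_over A \<Longrightarrow> q \<in> polys_over A \<Longrightarrow> p + q \<in> polys_over A"
  by (auto simp: polys_over_def subring_add)

lemma polys_over_mult: "is_subring A \<Longrightarrow> p \<in> polys_over A \<Longrightarrow> q \<in> polys_over A \<Longrightarrow> p * q \<in> polys_over A"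
  by (auto simp: polys_over_def coeff_mult intro!: subring_sum subring_mult)

lemma polys_over_sum:
  "is_subring A \<Longrightarrow> (\<And>i. i \<in> S \<Longrightarrow> f i \<in> polys_over A) \<Longrightarrow> sum f S \<in> polys_over A"
  by (auto simp: polys_over_def coeff_sum intro!: subring_sum)

lemma polys_over_monom: "is_subring A \<Longrightarrow> c \<in> A \<Longrightarrow> Polynomial.monom c i \<in> polys_over A"
  by (auto simp: polys_over_def coeff_monom subring_0)

lemma polys_over_smult: "is_subring A \<Longrightarrow> c \<in> A \<Longrightarrow> p \<in> polys_over A \<Longrightarrow> Polynomial.smult c p \<in> polys_over A"
  by (auto simp: polys_over_def subring_mult)

lemma polys_over_const: "is_subring A \<Longrightarrow> c \<in> A \<Longrightarrow> [:c:] \<in> polys_over A"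
  using polys_over_monom[of A c 0] by (simp add: monom_0)

lemma poly_extI: "p \<in> polys_over A \<Longrightarrow> poly p t \<in> poly_ext A t"
  by (simp add: poly_ext_def)

lemma poly_ext_subring:
  assumes A: "is_subring A"
  shows "is_subring (poly_ext A t)"
  unfolding is_subring_def
proof (intro conjI ballI)
  show "0 \<in> poly_ext A t" using poly_extI[OF polys_over_const[OF A subring_0[OF A]], of t] by simp
  show "1 \<in> poly_ext A t" using poly_extI[OF polys_over_const[OF A subring_1[OF A]], of t] by simp
  fix x y assume "x \<in> poly_ext A t" "y \<in> poly_ext A t"
  then obtain p q where "p \<in> polys_over A" "x = poly p t" "q \<in> polys_over A" "y = poly q t"
    by (auto simp: poly_ext_def)
  then show "x - y \<in> poly_ext A t" "x * y \<in> poly_ext A t"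
    using poly_extI[OF polys_over_diff[OF A, of p q], of t] poly_extI[OF polys_over_mult[OF A, of p q], of t]
    by simp_all
qed

lemma poly_ext_super: "is_subring A \<Longrightarrow> A \<subseteq> poly_ext A t"
  using poly_extI[OF polys_over_const, of A _ t] by auto

lemma poly_ext_self: "is_subring A \<Longrightarrow> t \<in> poly_ext A t"
  using poly_extI[OF polys_over_monom[of A 1 1], of t] by (simp add: subring_1 poly_monom)

lemma combsI: "y \<in> I \<Longrightarrow> \<forall>i. u i \<in> A \<Longrightarrow> a = y + (\<Sum>i<k. u i * x i) \<Longrightarrow> a \<in> combs A I x k"
  unfolding combs_def by blast

lemma combs_super: "is_subring A \<Longrightarrow> I \<subseteq> combs A I x k"
  unfolding combs_def by (auto intro!: exI[of _ "\<lambda>_. 0"] subring_0)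

lemma combs_add:
  assumes "is_ideal I" "is_subring A" "a \<in> combs A I x k" "b \<in> combs A I x k"
  shows "a + b \<in> combs A I x k"
proof -
  obtain y u where "a = y + (\<Sum>i<k. u i * x i)" "y \<in> I" "\<forall>i. u i \<in> A"
    using assms(3) unfolding combs_def by blast
  moreover obtain z v where "b = z + (\<Sum>i<k. v i * x i)" "z \<in> I" "\<forall>i. v i \<in> A"
    using assms(4) unfolding combs_def by blast
  ultimately show ?thesis
    using assms by (intro combsI[of "y + z" I "\<lambda>i. u i + v i"])
      (auto simp: distrib_right sum.distrib ideal_add subring_add)
qed

lemma combs_mult:
  assumes "is_ideal I" "is_subring A" "a \<in> combs A I x k" "c \<in> A"
  shows "c * a \<in> combs A I x k"
proof -
  obtain y u where "a = y + (\<Sum>i<k. u i * x i)" "y \<in> I" "\<forall>i. u i \<in> A"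
    using assms(3) unfolding combs_def by blast
  then show ?thesis
    using assms by (intro combsI[of "c * y" I "\<lambda>i. c * u i"])
      (auto simp: distrib_left sum_distrib_left mult.assoc ideal_mult subring_mult)
qed

lemma combs_mono:
  assumes "is_subring A" "k \<le> l"
  shows "combs A I x k \<subseteq> combs A I x l"
proof
  fix a assume "a \<in> combs A I x k"
  then obtain y u where a: "a = y + (\<Sum>i<k. u i * x i)" "y \<in> I" "\<forall>i. u i \<in> A"
    unfolding combs_def by blast
  have "(\<Sum>i<l. (if i < k then u i else 0) * x i) = (\<Sum>i<k. (if i < k then u i else 0) * x i)"
    using assms(2) by (intro sum.mono_neutral_right) auto
  also have "\<dots> = (\<Sum>i<k. u i * x i)" by (intro sum.cong) auto
  finally have "a = y + (\<Sum>i<l. (if i < k then u i else 0) * x i)" using a by simp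
  moreover have "\<forall>i. (if i < k then u i else 0) \<in> A" using a(3) subring_0[OF assms(1)] by simp
  ultimately show "a \<in> combs A I x l"
    by (intro combsI[OF a(2), of "\<lambda>i. if i < k then u i else 0"])
qed

lemma combs_self:
  assumes "is_ideal I" "is_subring A" "i < k"
  shows "x i \<in> combs A I x k"
proof -
  have "(\<Sum>j<k. (if j = i then 1 else 0) * x j) = (\<Sum>j<k. if j = i then x j else 0)"
    by (intro sum.cong) auto
  then have "x i = 0 + (\<Sum>j<k. (if j = i then 1 else 0) * x j)" using assms(3) by simp
  moreover have "\<forall>j. (if j = i then 1 else 0) \<in> A" using assms(2) by (simp add: subring_0 subring_1)
  ultimately show ?thesis
    by (intro combsI[OF ideal_zero[OF assms(1)], of "\<lambda>j. if j = i then 1 else 0"])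
qed

lemma combs_least:
  assumes J: "\<And>x y. x \<in> J \<Longrightarrow> y \<in> J \<Longrightarrow> x + y \<in> J" "\<And>a x. a \<in> A \<Longrightarrow> x \<in> J \<Longrightarrow> a * x \<in> J"
    and I: "is_ideal I" "I \<subseteq> J" and x: "\<And>i. i < k \<Longrightarrow> x i \<in> J"
  shows "combs A I x k \<subseteq> J"
proof
  fix a assume "a \<in> combs A I x k"
  then obtain y u where a: "a = y + (\<Sum>i<k. u i * x i)" "y \<in> I" "\<forall>i. u i \<in> A"
    unfolding combs_def by blast
  have "(\<Sum>i<l. u i * x i) \<in> J" if "l \<le> k" for l
    using that
  proof (induction l)
    case 0
    then show ?case using ideal_zero[OF I(1)] I(2) by auto
  next
    case (Suc l)
    then show ?case using J(1) J(2)[of "u l" "x l"] a(3) x by simp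
  qed
  then show "a \<in> J" using a(1,2) I(2) J(1) by auto
qed

text \<open>The argument by minimal degrees, with polynomials as representatives of elements of
  \<open>A[t]\<close>, since \<open>t\<close> need not be transcendental. Each \<open>f k\<close>
  has least degree among representatives of elements not generated by the earlier ones, and a
  relation between leading coefficients yields a competitor \<open>g\<close> of smaller degree.
  Working modulo \<open>I\<close> adds the term \<open>y\<close> to that relation.\<close>

lemma hilbert_basis:
  assumes I: "is_ideal I" "I \<subseteq> A" and A: "is_subring A" "noeth A I"
  shows "noeth (poly_ext A t) I"
proof (rule ccontr)
  let ?B = "poly_ext A t"
  note B = poly_ext_subring[OF A(1), of t]
  note IB = order_trans[OF I(2) poly_ext_super[OF A(1), of t]]
  assume "\<not> noeth ?B I"
  then obtain b where b: "\<And>i. b i \<in> ?B" "\<And>k. b k \<notin> combs ?B I b k" unfolding noeth_def by blast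
  define J where "J = (\<Union>k. combs ?B I b k)"
  have J_add: "x + y \<in> J" if xy: "x \<in> J" "y \<in> J" for x y
  proof -
    obtain k l where "x \<in> combs ?B I b k" "y \<in> combs ?B I b l" using xy unfolding J_def by blast
    then have "x \<in> combs ?B I b (max k l)" "y \<in> combs ?B I b (max k l)"
      using combs_mono[OF B, of k "max k l" I b] combs_mono[OF B, of l "max k l" I b] by auto
    then show ?thesis unfolding J_def using combs_add[OF I(1) B] by blast
  qed
  have J_mult: "a * x \<in> J" if "a \<in> ?B" "x \<in> J" for a x
    using that combs_mult[OF I(1) B] unfolding J_def by blast
  have J_I: "I \<subseteq> J" using combs_super[OF B, of I b 0] unfolding J_def by blast
  have J_B: "J \<subseteq> ?B"
    unfolding J_def using combs_least[of ?B ?B I _ b] subring_add[OF B] subring_mult[OF B] I(1) IB b(1) by blast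
  have J_fg: "\<exists>z\<in>J. z \<notin> combs ?B I x k" if x: "\<And>i. i < k \<Longrightarrow> x i \<in> J" for x k
  proof -
    have "\<exists>l. x i \<in> combs ?B I b l" if "i < k" for i using x[OF that] unfolding J_def by blast
    then obtain l where l: "\<And>i. i < k \<Longrightarrow> x i \<in> combs ?B I b (l i)" by metis
    let ?L = "\<Sum>i<k. l i"
    have "x i \<in> combs ?B I b ?L" if "i < k" for i
      using combs_mono[OF B, of "l i" ?L I b] l[OF that] member_le_sum[of i "{..<k}" l] that by auto
    then have "combs ?B I x k \<subseteq> combs ?B I b ?L"
      using combs_add[OF I(1) B] combs_mult[OF I(1) B] combs_super[OF B] I(1) by (intro combs_least) auto
    then have "b ?L \<notin> combs ?B I x k" using b(2) by blast
    moreover have "b ?L \<in> J" unfolding J_def using combs_self[OF I(1) B, of ?L "Suc ?L" b] by blast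
    ultimately show ?thesis by blast
  qed
  define cand where "cand f k r \<longleftrightarrow> r \<in> polys_over A \<and> poly r t \<in> J \<and> poly r t \<notin> combs ?B I (\<lambda>i. poly (f i) t) k"
    for f :: "nat \<Rightarrow> 'a poly" and k r
  \<comment> \<open>The premise makes the requirement satisfiable for an arbitrary beginning of the
    sequence, as dependent choice demands; \<open>fJ\<close> discharges it afterwards.\<close>
  define P where "P f k r \<longleftrightarrow> (\<forall>i<k. poly (f i) t \<in> J) \<longrightarrow>
      cand f k r \<and> (\<forall>r'. cand f k r' \<longrightarrow> Polynomial.degree r \<le> Polynomial.degree r')" for f k r
  have "\<exists>f. \<forall>k. P f k (f k)"
  proof (rule dependent_wellorder_choice)
    fix r k and f g :: "nat \<Rightarrow> 'a poly"
    assume eq: "\<And>j. j < k \<Longrightarrow> f j = g j"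
    have "combs ?B I (\<lambda>i. poly (f i) t) k = combs ?B I (\<lambda>i. poly (g i) t) k"
      unfolding combs_def using eq by auto
    then show "P f k r = P g k r" unfolding P_def cand_def using eq by auto
  next
    fix k and f :: "nat \<Rightarrow> 'a poly"
    show "\<exists>r. P f k r"
    proof (cases "\<forall>i<k. poly (f i) t \<in> J")
      case True
      then obtain z where z: "z \<in> J" "z \<notin> combs ?B I (\<lambda>i. poly (f i) t) k"
        using J_fg[of k "\<lambda>i. poly (f i) t"] by blast
      then obtain p where "p \<in> polys_over A" "z = poly p t" using J_B by (auto simp: poly_ext_def)
      then have "cand f k p" using z by (simp add: cand_def)
      then obtain r where "cand f k r \<and> (\<forall>r'. cand f k r' \<longrightarrow> Polynomial.degree r \<le> Polynomial.degree r')"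
        using ex_has_least_nat[of "cand f k" p Polynomial.degree] by blast
      then show ?thesis unfolding P_def by blast
    qed (auto simp: P_def)
  qed
  then obtain f where f: "\<And>k. P f k (f k)" by blast
  have fJ: "poly (f k) t \<in> J" for k
    by (induction k rule: less_induct) (use f in \<open>auto simp: P_def cand_def\<close>)
  have fc: "cand f k (f k)" and fmin: "\<And>r'. cand f k r' \<Longrightarrow> Polynomial.degree (f k) \<le> Polynomial.degree r'" for k
    using f[of k] fJ unfolding P_def by auto
  let ?S = "\<lambda>k. combs ?B I (\<lambda>i. poly (f i) t) k"
  have deg: "Polynomial.degree (f i) \<le> Polynomial.degree (f k)" if "i \<le> k" for i k
    using fc[of k] combs_mono[OF B that, of I "\<lambda>i. poly (f i) t"]
    by (intro fmin) (auto simp: cand_def)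
  let ?d = "\<lambda>k. Polynomial.degree (f k)"
  let ?a = "\<lambda>k. Polynomial.coeff (f k) (?d k)"
  have fA: "f k \<in> polys_over A" for k using fc[of k] by (simp add: cand_def)
  then have "\<forall>k. ?a k \<in> A" by (simp add: polys_over_def)
  then obtain k where "?a k \<in> combs A I ?a k"
    using A(2)[unfolded noeth_def, rule_format, of ?a] by blast
  then obtain y u where yu: "?a k = y + (\<Sum>i<k. u i * ?a i)" "y \<in> I" "\<And>i. u i \<in> A"
    unfolding combs_def by blast
  define g where "g = f k - (\<Sum>i<k. Polynomial.monom (u i) (?d k - ?d i) * f i) - Polynomial.monom y (?d k)"
  have gA: "g \<in> polys_over A"
    unfolding g_def
    by (intro polys_over_diff polys_over_sum polys_over_mult polys_over_monom fA A(1) yu(3) subsetD[OF I(2)] yu(2))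
  have gt: "poly g t = poly (f k) t - ((\<Sum>i<k. (u i * t ^ (?d k - ?d i)) * poly (f i) t) + y * t ^ ?d k)"
    by (simp add: g_def poly_sum poly_monom algebra_simps)
  have comb: "(\<Sum>i<k. (u i * t ^ (?d k - ?d i)) * poly (f i) t) + y * t ^ ?d k \<in> ?S k"
  proof -
    have "u i * t ^ (?d k - ?d i) \<in> ?B" for i
      using subring_mult[OF B subsetD[OF poly_ext_super[OF A(1)] yu(3)] subring_power[OF B poly_ext_self[OF A(1)]]] .
    moreover have "y * t ^ ?d k \<in> I" using ideal_mult'[OF I(1) yu(2)] .
    ultimately show ?thesis
      by (intro combsI[of "y * t ^ ?d k" I "\<lambda>i. u i * t ^ (?d k - ?d i)"]) (simp_all add: add.commute)
  qed
  have neg: "- x \<in> ?S k" if "x \<in> ?S k" for x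
    using combs_mult[OF I(1) B that, of "- 1"] subring_uminus[OF B subring_1[OF B]] by simp
  have "?S k \<subseteq> J" using J_add J_mult J_I I(1) fJ by (intro combs_least) auto
  then have "- ((\<Sum>i<k. (u i * t ^ (?d k - ?d i)) * poly (f i) t) + y * t ^ ?d k) \<in> J"
    using neg[OF comb] by (rule subsetD)
  from J_add[OF fJ[of k] this] have "poly g t \<in> J" by (simp only: gt diff_conv_add_uminus)
  moreover have gS: "poly g t \<notin> ?S k"
  proof
    assume "poly g t \<in> ?S k"
    from combs_add[OF I(1) B this comb] have "poly (f k) t \<in> ?S k" by (simp add: gt)
    with fc[of k] show False by (simp add: cand_def)
  qed
  ultimately have le: "?d k \<le> Polynomial.degree g" using gA by (intro fmin) (simp add: cand_def)
  \<comment> \<open>The coefficients from the degree of \<open>f k\<close> on cancel, whereas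
    minimality puts the degree of \<open>g\<close> at least there; only \<open>g = 0\<close> is
    left.\<close>
  have "Polynomial.coeff g j = 0" if "?d k \<le> j" for j
  proof -
    have di: "?d i \<le> ?d k" if "i < k" for i using deg that by simp
    have "Polynomial.coeff (Polynomial.monom (u i) (?d k - ?d i) * f i) j = (if j = ?d k then u i * ?a i else 0)"
      if "i < k" for i
    proof (cases "j = ?d k")
      case True
      then show ?thesis using di[OF that] by (simp add: coeff_monom_mult)
    next
      case False
      then have "?d i < j - (?d k - ?d i)" using di[OF that] \<open>?d k \<le> j\<close> by linarith
      then show ?thesis using False by (simp add: coeff_monom_mult coeff_eq_0)
    qed
    then have "Polynomial.coeff (\<Sum>i<k. Polynomial.monom (u i) (?d k - ?d i) * f i) j =
        (\<Sum>i<k. if j = ?d k then u i * ?a i else 0)"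
      unfolding coeff_sum by (intro sum.cong) auto
    then show ?thesis
      using \<open>?d k \<le> j\<close> yu(1) by (auto simp: g_def coeff_eq_0)
  qed
  then have "Polynomial.coeff g (Polynomial.degree g) = 0" using le by blast
  then have "g = 0" by simp
  then show False using gS combs_super[OF B, of I] ideal_zero[OF I(1)] by auto
qed

lemma noeth_foldl:
  assumes "is_ideal I" "I \<subseteq> A" "is_subring A" "noeth A I"
  shows "noeth (foldl poly_ext A ts) I"
  using assms(2-4)
proof (induction ts arbitrary: A)
  case (Cons t ts)
  show ?case
    using Cons.IH[OF order_trans[OF Cons.prems(1) poly_ext_super[OF Cons.prems(2)]]
        poly_ext_subring[OF Cons.prems(2)] hilbert_basis[OF assms(1) Cons.prems]] by simp
qed simp

subsection \<open>Decomposition into primes\<close>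

text \<open>Noetherian induction through an infinite chain. An ideal without decomposition is not
  prime, so it contains a product of two elements outside it, and adjoining one of them again gives
  an ideal without decomposition: decompositions for both would combine, as powers of
  \<open>x\<close> in the two larger ideals multiply into \<open>J\<close>.\<close>

lemma prime_decomposition:
  assumes N: "noeth UNIV I" and I: "is_ideal I" and J: "is_ideal J" "I \<subseteq> J"
  shows "\<exists>\<P>. finite \<P> \<and> (\<forall>P\<in>\<P>. is_prime P \<and> J \<subseteq> P) \<and> \<Inter>\<P> \<subseteq> radical J"
proof (rule ccontr)
  define good where "good J \<longleftrightarrow> (\<exists>\<P>. finite \<P> \<and> (\<forall>P\<in>\<P>. is_prime P \<and> J \<subseteq> P) \<and> \<Inter>\<P> \<subseteq> radical J)"
    for J :: "'a set"
  assume "\<not> (\<exists>\<P>. finite \<P> \<and> (\<forall>P\<in>\<P>. is_prime P \<and> J \<subseteq> P) \<and> \<Inter>\<P> \<subseteq> radical J)"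
  then have bad: "is_ideal J \<and> I \<subseteq> J \<and> \<not> good J" using J by (simp add: good_def)
  have step: "\<exists>a. a \<notin> J \<and> \<not> good (adjoin J a)" if J: "is_ideal J" "\<not> good J" for J
  proof -
    have "1 \<notin> J"
    proof
      assume "1 \<in> J"
      \<comment> \<open>The unit ideal is decomposed by the empty family, whose intersection is
        everything.\<close>
      then have "good J" unfolding good_def using ideal_one[OF J(1)]
        by (intro exI[of _ "{}"]) (auto simp: radical_def)
      with J show False by blast
    qed
    moreover have "\<not> is_prime J"
    proof
      assume "is_prime J"
      then have "good J" unfolding good_def
        by (intro exI[of _ "{J}"]) (auto simp: radical_def intro: exI[of _ 1])
      with J show False by blast
    qed
    ultimately obtain a b where ab: "a * b \<in> J" "a \<notin> J" "b \<notin> J" using J(1) unfolding is_prime_def by blast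
    have "\<not> (good (adjoin J a) \<and> good (adjoin J b))"
    proof
      assume "good (adjoin J a) \<and> good (adjoin J b)"
      then obtain \<P> \<Q> where P: "finite \<P>" "\<forall>P\<in>\<P>. is_prime P \<and> adjoin J a \<subseteq> P" "\<Inter>\<P> \<subseteq> radical (adjoin J a)"
        and Q: "finite \<Q>" "\<forall>P\<in>\<Q>. is_prime P \<and> adjoin J b \<subseteq> P" "\<Inter>\<Q> \<subseteq> radical (adjoin J b)"
        unfolding good_def by blast
      have "\<Inter>(\<P> \<union> \<Q>) \<subseteq> radical J"
      proof
        fix x assume "x \<in> \<Inter>(\<P> \<union> \<Q>)"
        then obtain k l where "x ^ k \<in> adjoin J a" "x ^ l \<in> adjoin J b" using P(3) Q(3) unfolding radical_def by blast
        then obtain y r z s where *: "x ^ k = y + r * a" "x ^ l = z + s * b" "y \<in> J" "z \<in> J" unfolding adjoin_def by blast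
        have "x ^ (k + l) = (z + s * b) * y + (r * a) * z + (r * s) * (a * b)"
          by (simp add: power_add * algebra_simps)
        then have "x ^ (k + l) \<in> J" using * ab(1) J(1) by (simp add: ideal_add ideal_mult)
        then show "x \<in> radical J" unfolding radical_def by blast
      qed
      then have "good J" unfolding good_def
        using P Q adjoin_super[of J a] adjoin_super[of J b] by (intro exI[of _ "\<P> \<union> \<Q>"]) blast
      with J show False by blast
    qed
    with ab show ?thesis by blast
  qed
  have "\<exists>f :: nat \<Rightarrow> 'a set \<times> 'a. \<forall>k.
      ((is_ideal (fst (f k)) \<and> I \<subseteq> fst (f k)) \<and> snd (f k) \<notin> fst (f k) \<and> \<not> good (adjoin (fst (f k)) (snd (f k)))) \<and>
      fst (f (Suc k)) = adjoin (fst (f k)) (snd (f k))"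
  proof (rule dependent_nat_choice)
    obtain a where "a \<notin> J" "\<not> good (adjoin J a)" using step bad by blast
    with bad show "\<exists>x. (is_ideal (fst x) \<and> I \<subseteq> fst x) \<and> snd x \<notin> fst x \<and> \<not> good (adjoin (fst x) (snd x))"
      by (intro exI[of _ "(J, a)"]) auto
  next
    fix x :: "'a set \<times> 'a"
    assume x: "(is_ideal (fst x) \<and> I \<subseteq> fst x) \<and> snd x \<notin> fst x \<and> \<not> good (adjoin (fst x) (snd x))"
    then obtain a where "a \<notin> adjoin (fst x) (snd x)" "\<not> good (adjoin (adjoin (fst x) (snd x)) a)"
      using step adjoin_ideal by blast
    with x show "\<exists>y. ((is_ideal (fst y) \<and> I \<subseteq> fst y) \<and> snd y \<notin> fst y \<and> \<not> good (adjoin (fst y) (snd y))) \<and>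
        fst y = adjoin (fst x) (snd x)"
      using adjoin_super[of "fst x" "snd x"]
      by (intro exI[of _ "(adjoin (fst x) (snd x), a)"]) (auto intro: adjoin_ideal)
  qed
  then obtain f :: "nat \<Rightarrow> 'a set \<times> 'a" where f: "\<And>k. is_ideal (fst (f k)) \<and> I \<subseteq> fst (f k)" "\<And>k. snd (f k) \<notin> fst (f k)"
    "\<And>k. fst (f (Suc k)) = adjoin (fst (f k)) (snd (f k))" by blast
  obtain k where "snd (f k) \<in> combs UNIV I (\<lambda>i. snd (f i)) k"
    using N[unfolded noeth_def, rule_format, of "\<lambda>i. snd (f i)"] by auto
  then obtain y u where yu: "snd (f k) = y + (\<Sum>i<k. u i * snd (f i))" "y \<in> I" unfolding combs_def by blast
  have mono: "fst (f i) \<subseteq> fst (f j)" if "i \<le> j" for i j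
  proof (rule lift_Suc_mono_le[OF _ that])
    show "fst (f k) \<subseteq> fst (f (Suc k))" for k unfolding f(3) by (rule adjoin_super)
  qed
  have "snd (f i) \<in> fst (f k)" if "i < k" for i
    using mono[of "Suc i" k] that f(3)[of i] adjoin_self f(1)[of i] by auto
  then have "y + (\<Sum>i<k. u i * snd (f i)) \<in> fst (f k)"
    using f(1)[of k] yu(2) by (intro ideal_add ideal_sum ideal_mult) auto
  with yu f(2)[of k] show False by simp
qed

text \<open>Otherwise elements of each \<open>P\<close> outside \<open>Q\<close> have a product
  lying in all \<open>P\<close>; a power of it is in \<open>J\<close>, hence in
  \<open>Q\<close>.\<close>

lemma prime_contains_component:
  assumes fin: "finite \<P>" and rad: "\<Inter>\<P> \<subseteq> radical J" and ideal: "\<And>P. P \<in> \<P> \<Longrightarrow> is_ideal P"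
    and Q: "is_prime Q" "J \<subseteq> Q"
  shows "\<exists>P\<in>\<P>. P \<subseteq> Q"
proof (rule ccontr)
  assume "\<not> (\<exists>P\<in>\<P>. P \<subseteq> Q)"
  then have "\<forall>P\<in>\<P>. \<exists>x. x \<in> P \<and> x \<notin> Q" by blast
  then obtain x where x: "\<And>P. P \<in> \<P> \<Longrightarrow> x P \<in> P \<and> x P \<notin> Q" by metis
  have "prod x \<P> \<in> P" if P: "P \<in> \<P>" for P
    using prod.remove[OF fin P, of x] ideal_mult'[OF ideal[OF P]] x[OF P] by simp
  then obtain k where "prod x \<P> ^ k \<in> J" using rad unfolding radical_def by blast
  then have "prod x \<P> \<in> Q" using prime_power[OF Q(1)] Q(2) by blast
  then show False using prime_prod[OF fin Q(1), of x] x by blast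
qed

lemma minimal_primes:
  assumes N: "noeth UNIV I" and I: "is_ideal I" and J: "is_ideal J" "I \<subseteq> J"
  obtains \<P> where "finite \<P>" "antichain \<P>" "\<And>P. P \<in> \<P> \<Longrightarrow> is_prime P" "\<And>P. P \<in> \<P> \<Longrightarrow> J \<subseteq> P"
    "\<Inter>\<P> \<subseteq> radical J"
proof -
  obtain \<P> where P: "finite \<P>" "\<forall>P\<in>\<P>. is_prime P \<and> J \<subseteq> P" "\<Inter>\<P> \<subseteq> radical J"
    using prime_decomposition[OF assms] by blast
  define \<Q> where "\<Q> = {P \<in> \<P>. \<forall>Q\<in>\<P>. Q \<subseteq> P \<longrightarrow> Q = P}"
  have "\<exists>Q\<in>\<Q>. Q \<subseteq> P" if PP: "P \<in> \<P>" for P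
  proof -
    obtain Q where "Q \<in> \<P>" "Q \<subseteq> P" "\<forall>R\<in>\<P>. R \<subseteq> Q \<longrightarrow> Q = R"
      using finite_has_minimal2[OF P(1) PP] by blast
    then show ?thesis unfolding \<Q>_def by blast
  qed
  then have "\<Inter>\<Q> \<subseteq> \<Inter>\<P>" by blast
  then show thesis
    using P by (intro that[of \<Q>]) (auto simp: \<Q>_def antichain_def)
qed

subsection \<open>The weak Nullstellensatz\<close>

text \<open>Instead of inverting the leading coefficient, each step multiplies \<open>f\<close> by
  it. \<open>n\<close> is only a formal degree of \<open>g\<close>, and \<open>m\<close> bounds the
  number of steps.\<close>

lemma pseudo_division:
  assumes A: "is_subring A" and fg: "f \<in> polys_over A" "g \<in> polys_over A"
    and g: "\<And>i. n < i \<Longrightarrow> Polynomial.coeff g i = 0"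
    and f: "\<And>i. m + n \<le> i \<Longrightarrow> Polynomial.coeff f i = 0"
  shows "\<exists>e q r. q \<in> polys_over A \<and> r \<in> polys_over A \<and>
    Polynomial.smult (Polynomial.coeff g n ^ e) f = g * q + r \<and>
    (\<forall>i\<ge>m. Polynomial.coeff q i = 0) \<and> (\<forall>i\<ge>n. Polynomial.coeff r i = 0)"
  using fg(1) f
proof (induction m arbitrary: f)
  case 0
  then show ?case
    by (intro exI[of _ 0] exI[of _ 0] exI[of _ f]) (auto simp: polys_over_def subring_0[OF A])
next
  case (Suc m)
  let ?l = "Polynomial.coeff g n"
  let ?c = "Polynomial.coeff f (m + n)"
  define f' where "f' = Polynomial.smult ?l f - Polynomial.monom ?c m * g"
  have l: "?l \<in> A" and c: "?c \<in> A" using fg(2) Suc.prems(1) by (auto simp: polys_over_def)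
  have "f' \<in> polys_over A" unfolding f'_def
    by (intro polys_over_diff polys_over_smult polys_over_mult polys_over_monom A l c fg(2) Suc.prems(1))
  moreover have "Polynomial.coeff f' i = 0" if "m + n \<le> i" for i
    using Suc.prems(2)[of i] g[of "i - m"] that
    by (cases "i = m + n") (auto simp: f'_def coeff_monom_mult)
  ultimately obtain e q r where IH: "q \<in> polys_over A" "r \<in> polys_over A" "Polynomial.smult (?l ^ e) f' = g * q + r"
    "\<forall>i\<ge>m. Polynomial.coeff q i = 0" "\<forall>i\<ge>n. Polynomial.coeff r i = 0" using Suc.IH[of f'] by blast
  define q' where "q' = q + Polynomial.monom (?l ^ e * ?c) m"
  have "q' \<in> polys_over A" unfolding q'_def
    by (intro polys_over_add polys_over_monom A IH(1) subring_mult[OF A] subring_power[OF A] l c)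
  moreover have "Polynomial.smult (?l ^ Suc e) f = g * q' + r"
  proof -
    have "Polynomial.smult (?l ^ Suc e) f = Polynomial.smult (?l ^ e) (f' + Polynomial.monom ?c m * g)"
      by (simp add: f'_def mult.commute)
    also have "\<dots> = g * q + r + Polynomial.smult (?l ^ e) (Polynomial.monom ?c m) * g"
      by (simp add: smult_add_right IH(3))
    also have "\<dots> = g * q' + r" by (simp add: q'_def smult_monom algebra_simps)
    finally show ?thesis .
  qed
  moreover have "\<forall>i\<ge>Suc m. Polynomial.coeff q' i = 0" using IH(4) by (simp add: q'_def)
  ultimately show ?case using IH(2,5) by blast
qed

lemma poly_mem_ideal:
  assumes "is_ideal M" "\<And>i. Polynomial.coeff p i \<in> M"
  shows "poly p x \<in> M"
  unfolding poly_altdef using assms by (intro ideal_sum ideal_mult') auto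

text \<open>The quotient of \<open>K\<close> by \<open>I\<close> is an algebraically closed field of
  characteristic zero. \<open>K\<close> is thought of as the full preimage of the scalars in the
  ring presenting the algebra, which is why it contains \<open>I\<close>.\<close>

locale field_mod =
  fixes K I :: "'u::comm_ring_1 set"
  assumes K: "is_subring K" and I: "is_ideal I" and IK: "I \<subseteq> K" and I1: "1 \<notin> I"
    and inv: "\<And>c. c \<in> K \<Longrightarrow> c \<notin> I \<Longrightarrow> \<exists>c'\<in>K. c * c' - 1 \<in> I"
    and char: "\<And>m. 0 < m \<Longrightarrow> of_nat m \<notin> I"
    and root: "\<And>f. f \<in> polys_over K \<Longrightarrow> 0 < Polynomial.degree f \<Longrightarrow>
      Polynomial.coeff f (Polynomial.degree f) \<notin> I \<Longrightarrow> \<exists>x\<in>K. poly f x \<in> I"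
begin

text \<open>The ideal \<open>q\<close> of a \<open>K\<close>-rational point, over the subring
  \<open>A\<close>, of the closed set cut out by \<open>M\<close>.\<close>

definition point :: "'u set \<Rightarrow> 'u set \<Rightarrow> 'u set \<Rightarrow> bool"
  where "point M A q \<longleftrightarrow> q \<subseteq> A \<and> A \<inter> M \<subseteq> q \<and> 1 \<notin> q \<and> (\<forall>x\<in>q. \<forall>y\<in>q. x + y \<in> q) \<and>
    (\<forall>a\<in>A. \<forall>x\<in>q. a * x \<in> q) \<and> (\<forall>a\<in>A. \<exists>c\<in>K. a - c \<in> q)"

lemma K_prime: "is_prime M \<Longrightarrow> I \<subseteq> M \<Longrightarrow> K \<inter> M \<subseteq> I"
proof
  fix c assume M: "is_prime M" "I \<subseteq> M" and c: "c \<in> K \<inter> M"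
  show "c \<in> I"
  proof (rule ccontr)
    assume "c \<notin> I"
    then obtain c' where "c * c' - 1 \<in> I" using inv c by blast
    then have "c * c' - 1 \<in> M" using M(2) by blast
    moreover have "c * c' \<in> M" using c by (intro ideal_mult' prime_ideal[OF M(1)]) blast
    ultimately have "c * c' - (c * c' - 1) \<in> M" using ideal_diff[OF prime_ideal[OF M(1)]] by blast
    with M(1) show False by (simp add: is_prime_def)
  qed
qed

lemma noeth_K: "noeth K I"
  unfolding noeth_def
proof (intro allI impI)
  fix x :: "nat \<Rightarrow> 'u" assume x: "\<forall>i. x i \<in> K"
  show "\<exists>k. x k \<in> combs K I x k"
  proof (cases "x 0 \<in> I")
    case True
    then show ?thesis using combs_super[OF K, of I x 0] by blast
  next
    case False
    then obtain v where v: "v \<in> K" "x 0 * v - 1 \<in> I" using inv x by blast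
    have "x 1 = - (x 1 * (x 0 * v - 1)) + (\<Sum>i<1. (x 1 * v) * x i)" by (simp add: algebra_simps)
    moreover have "- (x 1 * (x 0 * v - 1)) \<in> I" by (intro ideal_uminus ideal_mult I v)
    moreover have "x 1 * v \<in> K" using x v by (simp add: subring_mult[OF K])
    ultimately have "x 1 \<in> combs K I x 1" by (intro combsI[of _ I "\<lambda>_. x 1 * v"]) auto
    then show ?thesis by blast
  qed
qed

lemma point_diff: "K \<subseteq> A \<Longrightarrow> point M A q \<Longrightarrow> x \<in> q \<Longrightarrow> y \<in> q \<Longrightarrow> x - y \<in> q"
  using subring_uminus[OF K subring_1[OF K]] unfolding point_def by (metis diff_conv_add_uminus mult_minus1 subsetD)

lemma point_sum: "is_subring A \<Longrightarrow> point M A q \<Longrightarrow> (\<And>i. i \<in> S \<Longrightarrow> f i \<in> q) \<Longrightarrow> sum f S \<in> q"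
proof -
  assume A: "is_subring A" "point M A q" "\<And>i. i \<in> S \<Longrightarrow> f i \<in> q"
  obtain c where "c \<in> K" "1 - c \<in> q" using A subring_1[OF A(1)] unfolding point_def by blast
  then have "0 * (1 - c) \<in> q" using A subring_0[OF A(1)] unfolding point_def by blast
  then have "0 \<in> q" by simp
  then show "sum f S \<in> q"
    using A by (induction S rule: infinite_finite_induct) (auto simp: point_def)
qed

lemma point_inv:
  assumes A: "is_subring A" "K \<subseteq> A" and M: "is_ideal M" "I \<subseteq> M" and q: "point M A q" and a: "a \<in> A" "a \<notin> q"
  shows "\<exists>b\<in>A. a * b - 1 \<in> q"
proof -
  obtain c where c: "c \<in> K" "a - c \<in> q" using q a unfolding point_def by blast
  have Iq: "I \<subseteq> q" using IK A M q unfolding point_def by blast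
  have "c \<notin> I"
  proof
    assume "c \<in> I"
    then have "(a - c) + c \<in> q" using c Iq q unfolding point_def by blast
    with a show False by simp
  qed
  then obtain c' where c': "c' \<in> K" "c * c' - 1 \<in> I" using inv c by blast
  have "c' * (a - c) + (c * c' - 1) \<in> q" using c c' Iq q A unfolding point_def by blast
  then have "a * c' - 1 \<in> q" by (simp add: algebra_simps)
  with c' A show ?thesis by blast
qed

lemma point_cancel:
  assumes A: "is_subring A" "K \<subseteq> A" and M: "is_ideal M" "I \<subseteq> M" and q: "point M A q" and a: "a \<in> A" "a \<notin> q"
    and x: "x \<in> A" "a ^ e * x \<in> q"
  shows "x \<in> q"
  using x
proof (induction e)
  case (Suc e)
  obtain b where b: "b \<in> A" "a * b - 1 \<in> q" using point_inv[OF A M q a] by blast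
  have "a ^ e * x \<in> A" using A a Suc by (intro subring_mult subring_power)
  then have "(a ^ e * x) * (a * b - 1) \<in> q" "b * (a ^ Suc e * x) \<in> q"
    using b q Suc unfolding point_def by blast+
  then have "b * (a ^ Suc e * x) - (a ^ e * x) * (a * b - 1) \<in> q" using point_diff[OF A(2) q] by blast
  then have "a ^ e * x \<in> q" by (simp add: algebra_simps)
  then show ?case using Suc by blast
qed simp

text \<open>Extending a point of \<open>A\<close> to \<open>A[t]\<close> by sending \<open>t\<close> to \<open>x\<close>, once all relations are respected.\<close>

lemma point_extend:
  assumes A: "is_subring A" "K \<subseteq> A" and M: "is_ideal M" and q: "point M A q" and x: "x \<in> K"
    and rel: "\<And>p. p \<in> polys_over A \<Longrightarrow> poly p t \<in> M \<Longrightarrow> poly p x \<in> q"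
  defines "q' \<equiv> {poly p t |p. p \<in> polys_over A \<and> poly p x \<in> q}"
  shows "point M (poly_ext A t) q'" and "\<And>p. p \<in> polys_over A \<Longrightarrow> poly p t \<in> q' \<Longrightarrow> poly p x \<in> q"
proof -
  have xA: "x \<in> A" using x A by blast
  have ev: "poly p x \<in> A" if "p \<in> polys_over A" for p
    unfolding poly_altdef using that A xA
    by (intro subring_sum subring_mult subring_power) (auto simp: polys_over_def)
  show evaluate: "poly p x \<in> q" if p: "p \<in> polys_over A" "poly p t \<in> q'" for p
  proof -
    obtain p' where p': "p' \<in> polys_over A" "poly p' x \<in> q" "poly p t = poly p' t"
      using p(2) unfolding q'_def by blast
    have "poly (p - p') x \<in> q"
      using p p' ideal_zero[OF M] by (intro rel polys_over_diff A) auto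
    then have "poly (p - p') x + poly p' x \<in> q" using p'(2) q unfolding point_def by blast
    then show ?thesis by simp
  qed
  have memI: "poly p t \<in> q'" if "p \<in> polys_over A" "poly p x \<in> q" for p using that unfolding q'_def by blast
  show "point M (poly_ext A t) q'"
    unfolding point_def
  proof (intro conjI ballI)
    show "q' \<subseteq> poly_ext A t" unfolding q'_def poly_ext_def by blast
    show "poly_ext A t \<inter> M \<subseteq> q'" using rel memI unfolding poly_ext_def by blast
    show "1 \<notin> q'"
      using evaluate[of "[:1:]"] q polys_over_const[OF A(1) subring_1[OF A(1)]] by (auto simp: point_def)
    fix y z assume "y \<in> q'" "z \<in> q'"
    then obtain p p' where p: "p \<in> polys_over A" "poly p x \<in> q" "y = poly p t"
      "p' \<in> polys_over A" "poly p' x \<in> q" "z = poly p' t" unfolding q'_def by blast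
    have "poly (p + p') x \<in> q" using p q unfolding point_def poly_add by blast
    then show "y + z \<in> q'" using memI[OF polys_over_add[OF A(1) p(1,4)]] p by simp
  next
    fix a y assume "a \<in> poly_ext A t" "y \<in> q'"
    then obtain p p' where p: "p \<in> polys_over A" "a = poly p t"
      "p' \<in> polys_over A" "poly p' x \<in> q" "y = poly p' t" unfolding q'_def poly_ext_def by blast
    have "poly (p * p') x \<in> q" using p ev[OF p(1)] q unfolding point_def poly_mult by blast
    then show "a * y \<in> q'" using memI[OF polys_over_mult[OF A(1) p(1,3)]] p by simp
  next
    fix a assume "a \<in> poly_ext A t"
    then obtain p where p: "p \<in> polys_over A" "a = poly p t" unfolding poly_ext_def by blast
    obtain c where c: "c \<in> K" "poly p x - c \<in> q" using ev[OF p(1)] q unfolding point_def by blast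
    have "poly (p - [:c:]) t \<in> q'"
      using c p A by (intro memI polys_over_diff polys_over_const) auto
    then show "\<exists>c\<in>K. a - c \<in> q'" using c p by auto
  qed
qed

text \<open>If \<open>t\<close> is transcendental over \<open>A\<close> modulo \<open>M\<close>, a
  coefficient of \<open>b\<close> serves as \<open>a\<close>, and \<open>t\<close> is sent to a
  non-root. If it is algebraic, \<open>a\<close> is the leading coefficient of a minimal relation
  times a nonzero multiple of \<open>b\<close> that lies in \<open>A\<close>, and \<open>t\<close>
  is sent to a root of the relation. Thus points extend generically along each generator.\<close>

lemma point_step:
  assumes A: "is_subring A" "K \<subseteq> A" and M: "is_prime M" "I \<subseteq> M" and b: "b \<in> poly_ext A t" "b \<notin> M"
  shows "\<exists>a\<in>A. a \<notin> M \<and> (\<forall>q. point M A q \<and> a \<notin> q \<longrightarrow> (\<exists>q'. point M (poly_ext A t) q' \<and> b \<notin> q'))"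
proof -
  note M' = prime_ideal[OF M(1)]
  note B = poly_ext_subring[OF A(1), of t]
  \<comment> \<open>Relations for \<open>t\<close> of formal degree \<open>d\<close> whose leading
    coefficient survives modulo \<open>M\<close>.\<close>
  define rel where "rel d f \<longleftrightarrow> f \<in> polys_over A \<and> poly f t \<in> M \<and> Polynomial.coeff f d \<notin> M \<and>
      (\<forall>i>d. Polynomial.coeff f i = 0)" for d f
  obtain pb where pb: "pb \<in> polys_over A" "b = poly pb t" using b by (auto simp: poly_ext_def)
  \<comment> \<open>Top coefficients in \<open>M\<close> are dropped until one outside
    \<open>M\<close> appears.\<close>
  have trunc: "\<exists>d f. d < D \<and> rel d f"
    if p: "p \<in> polys_over A" "poly p t \<in> M" "Polynomial.coeff p j \<notin> M" and D: "\<And>i. D \<le> i \<Longrightarrow> Polynomial.coeff p i = 0" for p j D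
    using p D
  proof (induction D arbitrary: p)
    case 0
    then show ?case using ideal_zero[OF M'] by auto
  next
    case (Suc D)
    show ?case
    proof (cases "Polynomial.coeff p D \<in> M")
      case False
      then have "rel D p" using Suc.prems by (simp add: rel_def)
      then show ?thesis by blast
    next
      case True
      let ?p = "p - Polynomial.monom (Polynomial.coeff p D) D"
      have "?p \<in> polys_over A"
        using Suc.prems(1) by (intro polys_over_diff polys_over_monom A) (auto simp: polys_over_def)
      moreover have "poly ?p t \<in> M"
        using Suc.prems(2) ideal_mult'[OF M' True] by (auto simp: poly_monom intro: ideal_diff[OF M'])
      moreover have "Polynomial.coeff ?p j \<notin> M" using Suc.prems(3) True by auto
      moreover have "Polynomial.coeff ?p i = 0" if "D \<le> i" for i
        using Suc.prems(4)[of i] that by (cases "i = D") auto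
      ultimately show ?thesis using Suc.IH[of ?p] less_Suc_eq by blast
    qed
  qed
  have Mq: "x \<in> q" if "x \<in> A" "x \<in> M" "point M A q" for x q using that unfolding point_def by blast
  have evq: "poly p x \<in> q" if "point M A q" "\<And>i. Polynomial.coeff p i \<in> q" "x \<in> A" for p x q
  proof -
    have "Polynomial.coeff p i * x ^ i \<in> q" for i
      using that subring_power[OF A(1) that(3), of i] unfolding point_def by (metis mult.commute)
    then show ?thesis unfolding poly_altdef by (intro point_sum[OF A(1) that(1)])
  qed
  show ?thesis
  proof (cases "\<exists>d f. rel d f")
    case False
    then have all: "\<And>p i. p \<in> polys_over A \<Longrightarrow> poly p t \<in> M \<Longrightarrow> Polynomial.coeff p i \<in> M"
      using trunc[where D = "Suc (Polynomial.degree _)"] by (meson coeff_eq_0 le_imp_less_Suc less_Suc_eq_le not_less_eq_eq Suc_le_eq)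
    have "\<exists>i. Polynomial.coeff pb i \<notin> M" using b(2) pb(2) poly_mem_ideal[OF M', of pb t] by blast
    then obtain i where i: "Polynomial.coeff pb i \<notin> M" by blast
    show ?thesis
    proof (intro bexI[of _ "Polynomial.coeff pb i"] conjI allI impI i)
      show iA: "Polynomial.coeff pb i \<in> A" using pb by (simp add: polys_over_def)
      fix q assume q: "point M A q \<and> Polynomial.coeff pb i \<notin> q"
      then have q1: "point M A q" by blast
      \<comment> \<open>A natural number will do: if all values at natural numbers lie in
        \<open>q\<close>, then so do all coefficients.\<close>
      have "\<exists>x\<in>K. poly pb x \<notin> q"
      proof (rule ccontr)
        assume "\<not> (\<exists>x\<in>K. poly pb x \<notin> q)"
        then have ev: "poly pb (of_nat n) \<in> q" for n using subring_of_nat[OF K] by blast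
        have "Polynomial.coeff pb i \<in> q"
        proof (cases "i \<le> Polynomial.degree pb")
          case True
          show ?thesis
          proof (rule coefficients_mem[where G = q and A = A and d = "Polynomial.degree pb"])
            show "x - y \<in> q" if "x \<in> q" "y \<in> q" for x y using point_diff[OF A(2) q1 that] .
            show "of_nat k * x \<in> A" if "x \<in> A" for k x
              using that subring_of_nat[OF A(1)] by (intro subring_mult A)
            show "x \<in> q" if x: "x \<in> A" "0 < k" "of_nat k * x \<in> q" for k x
            proof -
              have "of_nat k \<in> K" by (rule subring_of_nat[OF K])
              moreover have "of_nat k \<notin> q"
              proof
                assume kq: "of_nat k \<in> q"
                obtain u where u: "u \<in> K" "of_nat k * u - 1 \<in> I" using inv[OF \<open>of_nat k \<in> K\<close> char[OF x(2)]] by blast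
                have "u * of_nat k \<in> q" using kq u A q1 unfolding point_def by blast
                moreover have "of_nat k * u - 1 \<in> q" using u IK A M q1 unfolding point_def by blast
                ultimately have "u * of_nat k - (of_nat k * u - 1) \<in> q" using point_diff[OF A(2) q1] by blast
                then show False using q1 by (simp add: point_def algebra_simps)
              qed
              ultimately show ?thesis using point_cancel[OF A M' M(2) q1, of "of_nat k" x 1] x A(2) by auto
            qed
            show "(\<Sum>i\<le>Polynomial.degree pb. of_nat n ^ i * Polynomial.coeff pb i) \<in> q" for n
              using ev[of n] by (simp add: poly_altdef mult.commute)
            show "Polynomial.coeff pb i \<in> A" for i using pb by (simp add: polys_over_def)
          qed (rule True)
        next
          case False
          then have "Polynomial.coeff pb i = 0" by (simp add: coeff_eq_0)
          then show ?thesis using point_diff[OF A(2) q1 ev[of 0] ev[of 0]] by simp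
        qed
        with q show False by blast
      qed
      then obtain x where x: "x \<in> K" "poly pb x \<notin> q" by blast
      have r: "poly p x \<in> q" if p: "p \<in> polys_over A" "poly p t \<in> M" for p
      proof (rule evq[OF q1])
        show "Polynomial.coeff p i \<in> q" for i
          using p(1) by (intro Mq[OF _ all[OF p] q1]) (simp add: polys_over_def)
      qed (use x A in blast)
      let ?q' = "{poly p t |p. p \<in> polys_over A \<and> poly p x \<in> q}"
      have "point M (poly_ext A t) ?q'" by (rule point_extend(1)[OF A M' q1 x(1)]) (use r in blast)
      moreover have "poly pb x \<in> q" if "poly pb t \<in> ?q'"
        by (rule point_extend(2)[OF A M' q1 x(1) _ pb(1) that]) (use r in blast)
      ultimately show "\<exists>q'. point M (poly_ext A t) q' \<and> b \<notin> q'" using x(2) pb(2) by blast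
    qed
  next
    case True
    then obtain d0 f0 where "rel d0 f0" by blast
    then obtain d where d: "\<exists>f. rel d f" and dmin: "\<And>d'. d' < d \<Longrightarrow> \<not> (\<exists>f. rel d' f)"
      using exists_least_iff[of "\<lambda>d. \<exists>f. rel d f"] by blast
    obtain f where f: "f \<in> polys_over A" "poly f t \<in> M" "Polynomial.coeff f d \<notin> M"
      "\<And>i. d < i \<Longrightarrow> Polynomial.coeff f i = 0" using d unfolding rel_def by blast
    let ?l = "Polynomial.coeff f d"
    have lA: "?l \<in> A" using f by (simp add: polys_over_def)
    have low: "Polynomial.coeff p j \<in> M"
      if "p \<in> polys_over A" "poly p t \<in> M" "\<And>i. d \<le> i \<Longrightarrow> Polynomial.coeff p i = 0" for p j
      using trunc[OF that(1,2) _ that(3), of j d] dmin by blast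
    have dpos: "0 < d"
    proof (rule ccontr)
      assume "\<not> 0 < d"
      then have "f = [:?l:]" using f(4) by (intro poly_eqI) (auto simp: coeff_pCons split: nat.split)
      then have "poly f t = ?l" by (metis mult_zero_right add.right_neutral poly_0 poly_pCons)
      with f show False by simp
    qed
    \<comment> \<open>Multiples of \<open>b\<close> that are nonzero modulo \<open>M\<close>,
      represented with formal degree \<open>n\<close>. The least such \<open>n\<close> turns out to
      be 0, which yields an element of \<open>A\<close>.\<close>
    define red where "red n r \<longleftrightarrow> r \<in> polys_over A \<and> poly r t \<notin> M \<and> (\<exists>c\<in>poly_ext A t. poly r t - b * c \<in> M) \<and>
        (\<forall>i>n. Polynomial.coeff r i = 0)" for n r
    have "red (Polynomial.degree pb) pb"
      using pb b subring_1[OF B] ideal_zero[OF M'] unfolding red_def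
      by (auto simp: coeff_eq_0 intro!: bexI[of _ 1])
    then obtain n where n: "\<exists>r. red n r" and nmin: "\<And>n'. n' < n \<Longrightarrow> \<not> (\<exists>r. red n' r)"
      using exists_least_iff[of "\<lambda>d. \<exists>r. red d r"] by blast
    obtain r c where r: "r \<in> polys_over A" "poly r t \<notin> M" "c \<in> poly_ext A t" "poly r t - b * c \<in> M"
      "\<And>i. n < i \<Longrightarrow> Polynomial.coeff r i = 0" using n unfolding red_def by blast
    have lower: "poly r' t \<in> M"
      if "r' \<in> polys_over A" "a \<in> poly_ext A t" "poly r' t - a * poly r t \<in> M" "\<And>i. n \<le> i \<Longrightarrow> Polynomial.coeff r' i = 0"
        "0 < n" for r' a
    proof (rule ccontr)
      assume "poly r' t \<notin> M"
      moreover have "poly r' t - b * (a * c) \<in> M"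
        using ideal_add[OF M' that(3) ideal_mult[OF M' r(4), of a]] by (simp add: algebra_simps)
      ultimately have "red (n - 1) r'"
        unfolding red_def using that subring_mult[OF B that(2) r(3)] by auto
      with nmin[of "n - 1"] that(5) show False by auto
    qed
    have n0: "n = 0"
    proof (rule ccontr)
      assume "n \<noteq> 0"
      then have npos: "0 < n" by simp
      let ?k = "Polynomial.coeff r n"
      have kA: "?k \<in> A" using r by (simp add: polys_over_def)
      have k: "?k \<notin> M"
      proof
        assume kM: "?k \<in> M"
        let ?r = "r - Polynomial.monom ?k n"
        have "poly ?r t - 1 * poly r t \<in> M"
          using ideal_uminus[OF M' ideal_mult'[OF M' kM, of "t ^ n"]] by (simp add: poly_monom)
        moreover have "?r \<in> polys_over A" by (intro polys_over_diff polys_over_monom A r kA)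
        moreover have "Polynomial.coeff ?r i = 0" if "n \<le> i" for i using r(5)[of i] that by (cases "i = n") auto
        ultimately have "poly ?r t \<in> M" using lower[of ?r 1] subring_1[OF B] npos by blast
        then have "poly ?r t + ?k * t ^ n \<in> M" using ideal_add[OF M'] ideal_mult'[OF M' kM] by blast
        with r(2) show False by (simp add: poly_monom)
      qed
      \<comment> \<open>If \<open>d < n\<close>, the relation \<open>f\<close> reduces
        \<open>r\<close> further. Otherwise dividing \<open>f\<close> by \<open>r\<close> leaves a
        multiple of \<open>b\<close> of degree below \<open>n\<close>, which must vanish; then the
        quotient is a relation of degree below \<open>d\<close>, so its coefficients lie in
        \<open>M\<close>, contradicting the leading term of \<open>f\<close>.\<close>
      show False
      proof (cases "d < n")
        case True
        have "\<And>i. Suc (n - d) + d \<le> i \<Longrightarrow> Polynomial.coeff r i = 0" using r(5) True by simp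
        then obtain e q r' where qr: "q \<in> polys_over A" "r' \<in> polys_over A" "Polynomial.smult (?l ^ e) r = f * q + r'"
          "\<forall>i\<ge>d. Polynomial.coeff r' i = 0" using pseudo_division[OF A(1) r(1) f(1) f(4)] by blast
        have "poly r' t = ?l ^ e * poly r t - poly f t * poly q t"
          using arg_cong[OF qr(3), of "\<lambda>p. poly p t"] by simp
        then have eq: "poly r' t - ?l ^ e * poly r t \<in> M"
          using ideal_uminus[OF M' ideal_mult'[OF M' f(2)]] by simp
        have "?l ^ e \<in> poly_ext A t"
          using subring_power[OF A(1) lA] poly_ext_super[OF A(1)] by blast
        then have "poly r' t \<in> M" using lower[of r' "?l ^ e"] eq qr True npos by auto
        then have "?l ^ e * poly r t \<in> M" using ideal_cong_mem[OF M' eq] by blast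
        then show False using prime_mult[OF M(1)] prime_power[OF M(1)] f(3) r(2) by blast
      next
        case False
        have "\<And>i. Suc d - n + n \<le> i \<Longrightarrow> Polynomial.coeff f i = 0" using f(4) by simp
        then obtain e q r' where qr: "q \<in> polys_over A" "r' \<in> polys_over A" "Polynomial.smult (?k ^ e) f = r * q + r'"
          "\<forall>i\<ge>Suc d - n. Polynomial.coeff q i = 0" "\<forall>i\<ge>n. Polynomial.coeff r' i = 0"
          using pseudo_division[OF A(1) f(1) r(1) r(5)] by blast
        have r't: "poly r' t = ?k ^ e * poly f t - poly r t * poly q t"
          using arg_cong[OF qr(3), of "\<lambda>p. poly p t"] by simp
        have "poly r' t - (- poly q t) * poly r t \<in> M"
          unfolding r't using ideal_mult[OF M' f(2), of "?k ^ e"] by (simp add: algebra_simps)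
        moreover have "- poly q t \<in> poly_ext A t" using subring_uminus[OF B poly_extI[OF qr(1)]] .
        ultimately have r'M: "poly r' t \<in> M" using lower[of r' "- poly q t"] qr npos by blast
        have "?k ^ e * poly f t - poly r' t \<in> M" by (intro ideal_diff[OF M'] ideal_mult[OF M'] f r'M)
        then have "poly r t * poly q t \<in> M" by (simp add: r't)
        then have qM: "poly q t \<in> M" using prime_mult[OF M(1)] r(2) by blast
        have qc: "Polynomial.coeff q j \<in> M" for j
          using low[OF qr(1) qM] qr(4) npos by auto
        have "Polynomial.coeff (r * q) d \<in> M"
          unfolding coeff_mult by (intro ideal_sum[OF M'] ideal_mult[OF M'] qc)
        moreover have "Polynomial.coeff r' d = 0" using qr(5) False by simp
        ultimately have "?k ^ e * ?l \<in> M" using arg_cong[OF qr(3), of "\<lambda>p. Polynomial.coeff p d"] by simp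
        then show False using prime_mult[OF M(1)] prime_power[OF M(1)] f(3) k by blast
      qed
    qed
    define a where "a = Polynomial.coeff r 0"
    have aA: "a \<in> A" using r by (simp add: a_def polys_over_def)
    have "r = [:a:]" using r(5) n0 by (intro poly_eqI) (auto simp: coeff_pCons a_def split: nat.split)
    then have ra: "poly r t = a" by simp
    have aM: "a \<notin> M" using r(2) ra by simp
    show ?thesis
    proof (intro bexI[of _ "?l * a"] conjI allI impI)
      show "?l * a \<in> A" using subring_mult[OF A(1) lA aA] .
      show "?l * a \<notin> M" using prime_mult[OF M(1)] f(3) aM by blast
      fix q assume qa: "point M A q \<and> ?l * a \<notin> q"
      then have q: "point M A q" by blast
      have lq: "?l \<notin> q" and aq: "a \<notin> q" using qa lA aA unfolding point_def by (metis mult.commute)+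
      have Iq: "I \<subseteq> q" using IK A M q unfolding point_def by blast
      have "\<exists>x\<in>K. poly f x \<in> q"
      proof -
        \<comment> \<open>The coefficients of \<open>f\<close> are replaced by their values at the
          point; the leading one stays nonzero because \<open>?l\<close> is not in
          \<open>q\<close>.\<close>
        have "\<forall>i. \<exists>c\<in>K. Polynomial.coeff f i - c \<in> q"
          using q f(1) unfolding point_def polys_over_def by blast
        then obtain k where k: "\<And>i. k i \<in> K" "\<And>i. Polynomial.coeff f i - k i \<in> q" by metis
        define g where "g = (\<Sum>i\<le>d. Polynomial.monom (k i) i)"
        have gc: "Polynomial.coeff g i = (if i \<le> d then k i else 0)" for i
          by (simp add: g_def coeff_sum)
        have kd: "k d \<notin> I"
        proof
          assume "k d \<in> I"
          then have "(?l - k d) + k d \<in> q" using k(2)[of d] Iq q unfolding point_def by blast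
          with lq show False by simp
        qed
        then have "k d \<noteq> 0" using ideal_zero[OF I] by metis
        then have gd: "Polynomial.degree g = d"
          by (intro antisym degree_le le_degree) (auto simp: gc)
        have "g \<in> polys_over K" using k(1) subring_0[OF K] by (auto simp: polys_over_def gc)
        then obtain x where x: "x \<in> K" "poly g x \<in> I" using root[of g] gd dpos kd by (auto simp: gc)
        have "poly (f - g) x \<in> q"
        proof (rule evq[OF q])
          have "0 \<in> q" using Iq ideal_zero[OF I] by blast
          then show "Polynomial.coeff (f - g) i \<in> q" for i using k(2)[of i] f(4)[of i] by (auto simp: gc)
        qed (use x A in blast)
        then have "poly (f - g) x + poly g x \<in> q" using x Iq q unfolding point_def by blast
        then show ?thesis using x by auto
      qed
      then obtain x where x: "x \<in> K" "poly f x \<in> q" by blast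
      have xA: "x \<in> A" using x A by blast
      have ev: "poly p x \<in> A" if "p \<in> polys_over A" for p
        unfolding poly_altdef using that A xA
        by (intro subring_sum subring_mult subring_power) (auto simp: polys_over_def)
      \<comment> \<open>Division by the minimal relation leaves a remainder with coefficients in
        \<open>M\<close>, so each relation satisfied by \<open>t\<close> holds at
        \<open>x\<close>.\<close>
      have rl: "poly p x \<in> q" if p: "p \<in> polys_over A" "poly p t \<in> M" for p
      proof -
        have "\<And>i. Suc (Polynomial.degree p) + d \<le> i \<Longrightarrow> Polynomial.coeff p i = 0" by (simp add: coeff_eq_0)
        then obtain e u r' where qr: "u \<in> polys_over A" "r' \<in> polys_over A" "Polynomial.smult (?l ^ e) p = f * u + r'"
          "\<forall>i\<ge>d. Polynomial.coeff r' i = 0" using pseudo_division[OF A(1) p(1) f(1) f(4)] by blast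
        have "poly r' t = ?l ^ e * poly p t - poly f t * poly u t"
          using arg_cong[OF qr(3), of "\<lambda>p. poly p t"] by simp
        then have "poly r' t \<in> M" using ideal_diff[OF M' ideal_mult[OF M' p(2)] ideal_mult'[OF M' f(2)]] by simp
        then have r'M: "Polynomial.coeff r' i \<in> M" for i using low[OF qr(2)] qr(4) by blast
        have "poly r' x \<in> q"
        proof (rule evq[OF q _ xA])
          show "Polynomial.coeff r' i \<in> q" for i
            using qr(2) by (intro Mq[OF _ r'M q]) (simp add: polys_over_def)
        qed
        moreover have "poly u x * poly f x \<in> q" using x ev[OF qr(1)] q unfolding point_def by blast
        ultimately have "poly u x * poly f x + poly r' x \<in> q" using q unfolding point_def by blast
        then have "?l ^ e * poly p x \<in> q"
          using arg_cong[OF qr(3), of "\<lambda>p. poly p x"] by (simp add: mult.commute)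
        then show ?thesis using point_cancel[OF A M' M(2) q lA lq ev[OF p(1)]] by blast
      qed
      let ?q' = "{poly p t |p. p \<in> polys_over A \<and> poly p x \<in> q}"
      have q': "point M (poly_ext A t) ?q'" by (rule point_extend(1)[OF A M' q x(1)]) (use rl in blast)
      have "b \<notin> ?q'"
      proof
        assume "b \<in> ?q'"
        \<comment> \<open>\<open>a\<close> is a multiple of \<open>b\<close> modulo
          \<open>M\<close>, so \<open>b\<close> in the new ideal would force \<open>a\<close> into
          \<open>q\<close>.\<close>
        then have "c * b \<in> ?q'" using r(3) q' unfolding point_def by blast
        moreover have "poly r t - b * c \<in> poly_ext A t"
          using subring_diff[OF B poly_extI[OF r(1)] subring_mult[OF B b(1) r(3)]] .
        then have "poly r t - b * c \<in> ?q'" using r(4) q' unfolding point_def by blast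
        ultimately have "c * b + (poly r t - b * c) \<in> ?q'" using q' unfolding point_def by blast
        then have "poly r t \<in> ?q'" by (simp add: mult.commute)
        then have rq': "poly r t \<in> ?q'" .
        have "poly r x \<in> q" by (rule point_extend(2)[OF A M' q x(1) _ r(1) rq']) (use rl in blast)
        with aq \<open>r = [:a:]\<close> show False by simp
      qed
      with q' show "\<exists>q'. point M (poly_ext A t) q' \<and> b \<notin> q'" by blast
    qed
  qed
qed

lemma point_foldl:
  assumes A: "is_subring A" "K \<subseteq> A" and M: "is_prime M" "I \<subseteq> M" and b: "b \<in> foldl poly_ext A ts" "b \<notin> M"
  shows "\<exists>a\<in>A. a \<notin> M \<and> (\<forall>q. point M A q \<and> a \<notin> q \<longrightarrow> (\<exists>q'. point M (foldl poly_ext A ts) q' \<and> b \<notin> q'))"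
  using A b
proof (induction ts arbitrary: A)
  case (Cons t ts)
  obtain a where a: "a \<in> poly_ext A t" "a \<notin> M"
    "\<forall>q. point M (poly_ext A t) q \<and> a \<notin> q \<longrightarrow> (\<exists>q'. point M (foldl poly_ext A (t # ts)) q' \<and> b \<notin> q')"
    using Cons.IH[of "poly_ext A t"] Cons.prems poly_ext_subring[OF Cons.prems(1), of t]
      poly_ext_super[OF Cons.prems(1), of t] by auto
  from point_step[OF Cons.prems(1,2) M a(1,2)] a(3) show ?case by blast
qed auto

text \<open>With \<open>b = 1\<close> the extension result lifts the point of \<open>K\<close>
  itself to a point \<open>q\<close> of the whole ring, which contains \<open>M\<close>. By
  \<open>max\<close> the two ideals coincide, and residues modulo \<open>q\<close> come from
  \<open>K\<close>.\<close>

lemma nullstellensatz: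
  assumes gen: "foldl poly_ext K ts = UNIV" and M: "is_prime M" "I \<subseteq> M"
    and max: "\<And>u. u \<notin> M \<Longrightarrow> \<exists>v. u * v - 1 \<in> M"
  shows "\<exists>c\<in>K. u - c \<in> M"
proof -
  have M1: "1 \<notin> M" using M(1) by (simp add: is_prime_def)
  obtain a where a: "a \<in> K" "a \<notin> M" "\<forall>q. point M K q \<and> a \<notin> q \<longrightarrow> (\<exists>q'. point M UNIV q' \<and> 1 \<notin> q')"
    using point_foldl[OF K order_refl M, of 1 ts] gen M1 by auto
  note M' = prime_ideal[OF M(1)]
  have "point M K (K \<inter> M)"
    unfolding point_def using M1 K M'
    by (auto intro: subring_add subring_mult ideal_add ideal_mult intro!: bexI simp: ideal_zero subring_0)
  then obtain q where q: "point M UNIV q" using a by blast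
  have "q \<subseteq> M"
  proof
    fix x assume x: "x \<in> q"
    show "x \<in> M"
    proof (rule ccontr)
      assume "x \<notin> M"
      then obtain v where "x * v - 1 \<in> M" using max by blast
      then have "x * v - 1 \<in> q" "v * x \<in> q" using q x unfolding point_def by blast+
      then have "v * x - (x * v - 1) \<in> q" using point_diff[OF subset_UNIV q] by blast
      then show False using q by (simp add: point_def mult.commute)
    qed
  qed
  then show ?thesis using q unfolding point_def by blast
qed

end

section \<open>Induction on the dimension\<close>

text \<open>\<open>\<not> prime_chain J (Suc d)\<close> says that the quotient by \<open>J\<close>
  has dimension at most \<open>d\<close>.\<close>

definition prime_chain :: "'u::comm_ring_1 set \<Rightarrow> nat \<Rightarrow> bool"
  where "prime_chain J l \<longleftrightarrow> (\<exists>p :: nat \<Rightarrow> 'u set.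
    (\<forall>i\<le>l. is_prime (p i) \<and> J \<subseteq> p i) \<and> (\<forall>i<l. p i \<subset> p (Suc i)))"

text \<open>The bottom prime of the given chain contains some \<open>P\<close>. It contains
  \<open>t\<close> and \<open>P\<close> does not, so \<open>P\<close> prolongs the chain
  downwards.\<close>

lemma prime_chain_adjoin:
  assumes fin: "finite \<P>" and P: "\<And>P. P \<in> \<P> \<Longrightarrow> is_prime P" "\<And>P. P \<in> \<P> \<Longrightarrow> J \<subseteq> P"
    and rad: "\<Inter>\<P> \<subseteq> radical J" and t: "\<And>P. P \<in> \<P> \<Longrightarrow> t \<notin> P"
    and c: "prime_chain (adjoin (\<Inter>\<P>) t) d"
  shows "prime_chain J (Suc d)"
proof -
  obtain p where p: "\<And>i. i \<le> d \<Longrightarrow> is_prime (p i)" "\<And>i. i \<le> d \<Longrightarrow> adjoin (\<Inter>\<P>) t \<subseteq> p i"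
    "\<And>i. i < d \<Longrightarrow> p i \<subset> p (Suc i)" using c unfolding prime_chain_def by blast
  have "is_ideal (\<Inter>\<P>)" using P(1) by (intro ideal_Inter prime_ideal)
  then have t0: "t \<in> p i" if "i \<le> d" for i using adjoin_self[of "\<Inter>\<P>" t] p(2)[OF that] by blast
  have "J \<subseteq> adjoin (\<Inter>\<P>) t" using P(2) adjoin_super[of "\<Inter>\<P>" t] by blast
  then have J: "J \<subseteq> p i" if "i \<le> d" for i using p(2)[OF that] by blast
  obtain P where P0: "P \<in> \<P>" "P \<subseteq> p 0"
    using prime_contains_component[OF fin rad _ p(1)[of 0] J[of 0]] prime_ideal[OF P(1)] by blast
  define q where "q i = (case i of 0 \<Rightarrow> P | Suc k \<Rightarrow> p k)" for i
  have "is_prime (q i) \<and> J \<subseteq> q i" if "i \<le> Suc d" for i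
    using that P P0 p(1) J by (cases i) (auto simp: q_def)
  moreover have "q i \<subset> q (Suc i)" if "i < Suc d" for i
    using that P0 t[OF P0(1)] t0[of 0] p(3) by (cases i) (auto simp: q_def)
  ultimately show ?thesis unfolding prime_chain_def by blast
qed

locale affine_mod = field_mod +
  fixes ts
  assumes gen: "foldl poly_ext K ts = UNIV"
begin

lemma noeth_UNIV: "noeth UNIV I"
  using noeth_foldl[OF I IK K noeth_K, of ts] gen by simp

lemma nat_units_I: "nat_units I"
  unfolding nat_units_def using inv[OF subring_of_nat[OF K] char] by blast

lemma prime_char: "is_prime P \<Longrightarrow> I \<subseteq> P \<Longrightarrow> 0 < m \<Longrightarrow> of_nat m \<notin> P"
  using nat_units_prime[OF nat_units_I] by blast

text \<open>If \<open>u\<close> is not invertible modulo \<open>P\<close>, some prime contains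
  \<open>adjoin P u\<close> and makes a chain with \<open>P\<close>. It is taken from the finite
  decomposition, which is nonempty because 1 is not in the radical.\<close>

lemma prime_units:
  assumes J: "I \<subseteq> J" "\<not> prime_chain J 1" and P: "is_prime P" "J \<subseteq> P" and u: "u \<notin> P"
  shows "\<exists>v. u * v - 1 \<in> P"
proof (rule ccontr)
  assume no: "\<not> (\<exists>v. u * v - 1 \<in> P)"
  note P' = prime_ideal[OF P(1)]
  have 1: "1 \<notin> adjoin P u"
  proof
    assume "1 \<in> adjoin P u"
    then obtain x r where "x \<in> P" and x: "1 = x + r * u" unfolding adjoin_def by blast
    have "r * u = 1 - x" using x by (metis add_diff_cancel_left')
    then have "u * r - 1 = - x" by (simp add: mult.commute)
    then have "u * r - 1 \<in> P" using ideal_uminus[OF P' \<open>x \<in> P\<close>] by (simp only:)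
    with no show False by blast
  qed
  have IP: "I \<subseteq> adjoin P u" using J(1) P(2) adjoin_super[of P u] by blast
  obtain \<P> where \<P>: "\<forall>Q\<in>\<P>. is_prime Q \<and> adjoin P u \<subseteq> Q" "\<Inter>\<P> \<subseteq> radical (adjoin P u)"
    using prime_decomposition[OF noeth_UNIV I adjoin_ideal[OF P', of u] IP] by blast
  have "\<P> \<noteq> {}"
  proof
    assume "\<P> = {}"
    then have "1 \<in> radical (adjoin P u)" using \<P>(2) by auto
    with 1 show False by (simp add: radical_def)
  qed
  then obtain Q where Q: "is_prime Q" "adjoin P u \<subseteq> Q" using \<P>(1) by blast
  then have "P \<subset> Q" using adjoin_super[of P u] adjoin_self[OF P', of u] u by blast
  then have "prime_chain J 1"
    unfolding prime_chain_def using P Q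
    by (intro exI[of _ "\<lambda>i. if i = 0 then P else Q"]) auto
  with J(2) show False by blast
qed

lemma zero_dim_idempotents:
  assumes J: "I \<subseteq> J" "\<not> prime_chain J 1"
    and \<P>: "finite \<P>" "antichain \<P>" "\<And>P. P \<in> \<P> \<Longrightarrow> is_prime P" "\<And>P. P \<in> \<P> \<Longrightarrow> J \<subseteq> P"
  obtains c where "\<And>P. P \<in> \<P> \<Longrightarrow> c P - 1 \<in> P" "\<And>P Q. P \<in> \<P> \<Longrightarrow> Q \<in> \<P> \<Longrightarrow> P \<noteq> Q \<Longrightarrow> c P \<in> Q"
proof -
  have "\<exists>c. c - 1 \<in> P \<and> (\<forall>Q\<in>\<P>. P \<noteq> Q \<longrightarrow> c \<in> Q)" if P: "P \<in> \<P>" for P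
  proof -
    obtain e where e: "e \<notin> P" "\<forall>Q\<in>\<P> - {P}. e \<in> Q"
      using prime_separation[OF \<P>(1,3,2) P] by blast
    obtain v where "e * v - 1 \<in> P" using prime_units[OF J \<P>(3)[OF P] \<P>(4)[OF P] e(1)] by blast
    moreover have "e * v \<in> Q" if "Q \<in> \<P>" "P \<noteq> Q" for Q
      using e(2) that by (intro ideal_mult' prime_ideal \<P>(3)) auto
    ultimately show ?thesis by blast
  qed
  then obtain c where "\<forall>P\<in>\<P>. c P - 1 \<in> P \<and> (\<forall>Q\<in>\<P>. P \<noteq> Q \<longrightarrow> c P \<in> Q)" by metis
  then show thesis using that by blast
qed

section \<open>The induction on the dimension for a fixed residual coordinate\<close>

context
  fixes n :: nat and F :: "(nat, 'a) mpol"
  assumes n: "0 < n" and F: "only_below n F"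
    and residual: "\<And>P. is_prime P \<Longrightarrow> I \<subseteq> P \<Longrightarrow> gen_coord P n F"
begin

text \<open>\<open>F\<close> is a coordinate over the residue field of each of the finitely many
  points; gluing by idempotents and lifting along nilpotents use no new variable.\<close>

lemma coord_dim_0:
  assumes J: "is_ideal J" "I \<subseteq> J" "\<not> prime_chain J 1"
  shows "coord J n F"
proof -
  obtain \<P> where \<P>: "finite \<P>" "antichain \<P>" "\<And>P. P \<in> \<P> \<Longrightarrow> is_prime P" "\<And>P. P \<in> \<P> \<Longrightarrow> J \<subseteq> P"
    "\<Inter>\<P> \<subseteq> radical J" using minimal_primes[OF noeth_UNIV I J(1,2)] by blast
  obtain c where c: "\<And>P. P \<in> \<P> \<Longrightarrow> c P - 1 \<in> P" "\<And>P Q. P \<in> \<P> \<Longrightarrow> Q \<in> \<P> \<Longrightarrow> P \<noteq> Q \<Longrightarrow> c P \<in> Q"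
    using zero_dim_idempotents[OF J(2,3) \<P>(1-4)] by blast
  have IP: "I \<subseteq> P" if "P \<in> \<P>" for P using J(2) \<P>(4)[OF that] by blast
  have "coord P n F" if P: "P \<in> \<P>" for P
    using prime_units[OF J(2,3) \<P>(3)[OF P] \<P>(4)[OF P]]
    by (intro gen_coord_unit[OF \<P>(3)[OF P] prime_char[OF \<P>(3)[OF P] IP[OF P]] residual[OF \<P>(3)[OF P] IP[OF P]]])
  then have "coord (\<Inter>\<P>) n F"
    by (intro coord_Inter[OF \<P>(1) prime_ideal[OF \<P>(3)] n c])
  then have "coord (radical J) n F" using \<P>(5) by (rule coord_mono)
  then show ?thesis by (rule coord_radical[OF J(1)])
qed

lemma minimal_slide:
  assumes J: "is_ideal J" "I \<subseteq> J"
  obtains \<P> t where "finite \<P>" "\<And>P. P \<in> \<P> \<Longrightarrow> is_prime P" "\<And>P. P \<in> \<P> \<Longrightarrow> J \<subseteq> P"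
    "\<Inter>\<P> \<subseteq> radical J" "\<And>P. P \<in> \<P> \<Longrightarrow> t \<notin> P" "slide (\<Inter>\<P>) n F t"
proof -
  obtain \<P> where \<P>: "finite \<P>" "antichain \<P>" "\<And>P. P \<in> \<P> \<Longrightarrow> is_prime P" "\<And>P. P \<in> \<P> \<Longrightarrow> J \<subseteq> P"
    "\<Inter>\<P> \<subseteq> radical J" using minimal_primes[OF noeth_UNIV I J] by blast
  have IP: "I \<subseteq> P" if "P \<in> \<P>" for P using J(2) \<P>(4)[OF that] by blast
  obtain t where "\<forall>P\<in>\<P>. t \<notin> P" "slide (\<Inter>\<P>) n F t"
    using slide_Inter[OF \<P>(1,3,2) prime_char[OF \<P>(3) IP] F residual[OF \<P>(3) IP]] by blast
  with \<P> that show thesis by blast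
qed

text \<open>The slide is available modulo the intersection of the minimal primes, so doubling and
  sliding back happen over this reduced ring, and the nilpotents come last.\<close>

lemma coord_dim_Suc:
  assumes J: "is_ideal J" "I \<subseteq> J" "\<not> prime_chain J (Suc (Suc d))"
    and IH: "\<And>J. is_ideal J \<Longrightarrow> I \<subseteq> J \<Longrightarrow> \<not> prime_chain J (Suc d) \<Longrightarrow> coord J N F" and N: "n \<le> N"
  shows "coord J (2 * N) F"
proof -
  obtain \<P> t where \<P>: "finite \<P>" "\<And>P. P \<in> \<P> \<Longrightarrow> is_prime P" "\<And>P. P \<in> \<P> \<Longrightarrow> J \<subseteq> P"
    "\<Inter>\<P> \<subseteq> radical J" and t: "\<And>P. P \<in> \<P> \<Longrightarrow> t \<notin> P" "slide (\<Inter>\<P>) n F t"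
    using minimal_slide[OF J(1,2)] by metis
  have R: "is_ideal (\<Inter>\<P>)" using \<P>(2) by (intro ideal_Inter prime_ideal)
  have "coord (adjoin (\<Inter>\<P>) t) N F"
  proof (rule IH)
    show "is_ideal (adjoin (\<Inter>\<P>) t)" by (rule adjoin_ideal[OF R])
    show "I \<subseteq> adjoin (\<Inter>\<P>) t" using J(2) \<P>(3) adjoin_super[of "\<Inter>\<P>" t] by blast
    show "\<not> prime_chain (adjoin (\<Inter>\<P>) t) (Suc d)"
      using prime_chain_adjoin[OF \<P> t(1)] J(3) by blast
  qed
  moreover have "x \<in> \<Inter>\<P>" if "t * x \<in> \<Inter>\<P>" for x
    using that prime_mult[OF \<P>(2)] t(1) by blast
  ultimately have "coord (\<Inter>\<P>) (2 * N) (F + Const t * Var N)"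
    by (intro doubling R only_below_mono[OF F N])
  then have "coord (\<Inter>\<P>) (2 * N) F" using N by (intro coord_slide[OF R F t(2), of N]) auto
  then have "coord (radical J) (2 * N) F" using \<P>(4) by (rule coord_mono)
  then show ?thesis by (rule coord_radical[OF J(1)])
qed

text \<open>The locus \<open>t = 0\<close> may be nonreduced. Interpolation meets \<open>F\<close>
  only modulo the intersection of its points, and shears improve this to a congruence modulo
  \<open>?A\<close>. Both keep an automorphism over the reduced ring \<open>?R\<close>, as the extra
  variable requires.\<close>

lemma coord_dim_1:
  assumes J: "is_ideal J" "I \<subseteq> J" "\<not> prime_chain J (Suc (Suc 0))" and n2: "2 \<le> n"
  shows "coord J (Suc n) F"
proof -
  obtain \<P> t where \<P>: "finite \<P>" "\<And>P. P \<in> \<P> \<Longrightarrow> is_prime P" "\<And>P. P \<in> \<P> \<Longrightarrow> J \<subseteq> P"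
    "\<Inter>\<P> \<subseteq> radical J" and t: "\<And>P. P \<in> \<P> \<Longrightarrow> t \<notin> P" "slide (\<Inter>\<P>) n F t"
    using minimal_slide[OF J(1,2)] by metis
  let ?R = "\<Inter>\<P>" and ?A = "adjoin (\<Inter>\<P>) t"
  have R: "is_ideal ?R" using \<P>(2) by (intro ideal_Inter prime_ideal)
  have IR: "I \<subseteq> ?R" using J(2) \<P>(3) by blast
  have A: "is_ideal ?A" by (rule adjoin_ideal[OF R])
  have RA: "?R \<subseteq> ?A" by (rule adjoin_super)
  have dim: "\<not> prime_chain ?A 1" using prime_chain_adjoin[OF \<P> t(1), of 1] J(3) by auto
  have IA: "I \<subseteq> ?A" using IR RA by (rule subset_trans)
  obtain \<M> where \<M>: "finite \<M>" "antichain \<M>" "\<And>M. M \<in> \<M> \<Longrightarrow> is_prime M" "\<And>M. M \<in> \<M> \<Longrightarrow> ?A \<subseteq> M"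
    "\<Inter>\<M> \<subseteq> radical ?A" using minimal_primes[OF noeth_UNIV I A IA] by blast
  obtain c where c: "\<And>M. M \<in> \<M> \<Longrightarrow> c M - 1 \<in> M" "\<And>M N. M \<in> \<M> \<Longrightarrow> N \<in> \<M> \<Longrightarrow> M \<noteq> N \<Longrightarrow> c M \<in> N"
    using zero_dim_idempotents[OF IA dim \<M>(1-4)] by blast
  have IM: "I \<subseteq> M" if "M \<in> \<M>" for M using IA \<M>(4)[OF that] by blast
  have units: "\<exists>v. u * v - 1 \<in> M" if "M \<in> \<M>" "u \<notin> M" for M u
    using prime_units[OF IA dim \<M>(3)[OF that(1)] \<M>(4)[OF that(1)] that(2)] .
  have cM: "coord M n F" if M: "M \<in> \<M>" for M
    by (rule gen_coord_unit[OF \<M>(3)[OF M] prime_char[OF \<M>(3)[OF M] IM[OF M]] residual[OF \<M>(3)[OF M] IM[OF M]] units[OF M]])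
  have KM: "\<exists>c\<in>K. u - c \<in> M" if "M \<in> \<M>" for M u
    by (rule nullstellensatz[OF gen \<M>(3)[OF that] IM[OF that] units[OF that]])
  have KI: "K \<inter> M \<subseteq> ?R" if "M \<in> \<M>" for M
    using K_prime[OF \<M>(3)[OF that] IM[OF that]] IR by blast
  have RM: "?R \<subseteq> M" if "M \<in> \<M>" for M using RA \<M>(4)[OF that] by blast
  obtain \<sigma> \<tau> where st: "inverse_pair ?R n \<sigma> \<tau>" "\<sigma> 0 - F \<in> ext (\<Inter>\<M>)"
    using coord_interpolation[OF R \<M>(1,3) RM n2 c units K KM KI F cM] by blast
  have "\<sigma> 0 - F \<in> ext (radical ?A)" using st(2) ext_mono[OF \<M>(5)] by blast
  moreover have "nat_units ?R" using nat_units_I IR unfolding nat_units_def by blast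
  ultimately obtain \<sigma> \<tau> where st: "inverse_pair ?R n \<sigma> \<tau>" "\<sigma> 0 - F \<in> ext ?A"
    using coord_lift_radical[OF R _ A RA n2 st(1)] by blast
  have "coord ?R (Suc n) F" by (rule coord_extra_variable[OF R F t(2) st n])
  then have "coord (radical J) (Suc n) F" using \<P>(4) by (rule coord_mono)
  then show ?thesis by (rule coord_radical[OF J(1)])
qed

lemma coord_dim:
  assumes "is_ideal J" "I \<subseteq> J" "\<not> prime_chain J (Suc (Suc d))"
  shows "coord J (2 ^ d * Suc n) F"
  using assms
proof (induction d arbitrary: J)
  case 0
  show ?case
  proof (cases "2 \<le> n")
    case True
    with coord_dim_1[OF 0] show ?thesis by simp
  next
    case False
    then have "n = 1" using n by simp
    \<comment> \<open>For \<open>n = 1\<close> the doubled number of variables is already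
      \<open>n + 1\<close>.\<close>
    moreover have "coord J (2 * n) F"
    proof (rule coord_dim_Suc[OF 0])
      show "coord J' n F" if "is_ideal J'" "I \<subseteq> J'" "\<not> prime_chain J' (Suc 0)" for J'
        using coord_dim_0 that by simp
    qed simp
    ultimately show ?thesis by (simp add: numeral_2_eq_2)
  qed
next
  case (Suc d)
  have "n \<le> 2 ^ d * Suc n" using mult_le_mono[of 1 "2 ^ d" n "Suc n"] by simp
  then have "coord J (2 * (2 ^ d * Suc n)) F"
    by (intro coord_dim_Suc[OF Suc.prems _ \<open>n \<le> 2 ^ d * Suc n\<close>]) (rule Suc.IH)
  then show ?case by (simp only: power_Suc mult.assoc)
qed

end

end

section \<open>Polynomial rings in the carrier setting\<close>

text \<open>The bridge from type-class rings to carrier rings: \<open>h\<close> will present the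
  algebra as a quotient, and map to its residue fields with every element a fraction of
  values.\<close>

locale class_hom = cring R for R (structure) +
  fixes h :: "'u::comm_ring_1 \<Rightarrow> 'a"
  assumes h_closed [simp]: "h u \<in> carrier R"
    and h_add: "h (u + v) = h u \<oplus> h v"
    and h_mult: "h (u * v) = h u \<otimes> h v"
    and h_1: "h 1 = \<one>"
begin

lemma h_0: "h 0 = \<zero>"
  using h_add[of 0 0] h_closed[of 0] by (metis add.r_cancel_one add_0)

lemma h_uminus: "h (- u) = \<ominus> h u"
  using h_add[of "- u" u] h_0 by (simp add: minus_equality)

lemma h_diff_0: "h (u - v) = \<zero> \<longleftrightarrow> h u = h v"
  using h_add[of u "- v"] r_right_minus_eq[of "h u" "h v"] by (simp add: h_uminus a_minus_def)

lemma kernel_ideal: "is_ideal {u. h u = \<zero>}"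
  by (auto simp: is_ideal_def h_0 h_add h_mult)

definition hpoly :: "('v, 'u) mpol \<Rightarrow> 'v multiset \<Rightarrow> 'a"
  where "hpoly p = (\<lambda>m. h (Poly_Mapping.lookup p m))"

lemma hpoly_coeff: "carrier_coeff (hpoly p)"
  by (simp add: carrier_coeff_def hpoly_def)

lemma hpoly_Const: "hpoly (Const c) = indexed_const (h c)"
  by (auto simp: hpoly_def Const_def lookup_single when_def indexed_const_def h_0)

lemma hpoly_add: "hpoly (p + q) = hpoly p \<Oplus> hpoly q"
  by (auto simp: hpoly_def lookup_add h_add indexed_padd_def)

lemma hpoly_mult_Var: "hpoly (p * Var i) = hpoly p \<Otimes> i"
  by (auto simp: hpoly_def lookup_mult_Var indexed_pmult_def h_0)

lemma hpoly_mult: "hpoly (p * q) = mpoly_mult R (hpoly p) (hpoly q)"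
proof (induction p rule: mpol_induct)
  case (Const c)
  have "hpoly (Const c * q) = (\<lambda>m. h c \<otimes> hpoly q m)"
    by (simp add: hpoly_def mult.commute[of "Const c"] lookup_mult_Const h_mult m_comm)
  then show ?case by (simp add: hpoly_Const mpoly_mult_const hpoly_coeff)
next
  case (add p p')
  then show ?case by (simp add: distrib_right hpoly_add mpoly_mult_add hpoly_coeff)
next
  case (Var p i)
  have "hpoly (p * Var i * q) = hpoly (p * q) \<Otimes> i"
    by (simp add: mult_ac flip: hpoly_mult_Var)
  then show ?case by (simp add: Var hpoly_mult_Var mpoly_mult_pmult hpoly_coeff)
qed

lemma hpoly_eq_iff: "hpoly p = hpoly q \<longleftrightarrow> p - q \<in> ext {u. h u = \<zero>}"
  by (auto simp: hpoly_def ext_def lookup_minus h_diff_0 fun_eq_iff)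

lemma hpoly_below: "hpoly (psubst (below n) p) \<in> (carrier R [\<X>\<^bsub>{..<n}\<^esub>])"
proof (induction p rule: mpol_induct)
  case (Const c)
  show ?case by (simp add: hpoly_Const indexed_pset.indexed_const)
next
  case (add p q)
  then show ?case by (simp add: psubst_add hpoly_add indexed_pset.indexed_padd)
next
  case (Var p i)
  show ?case
  proof (cases "i < n")
    case True
    then have "below n i = Var i" by (simp add: below_def)
    then have "psubst (below n) (p * Var i) = psubst (below n) p * Var i" using psubst_mult psubst_Var by metis
    with Var True show ?thesis by (simp only: hpoly_mult_Var) (simp add: indexed_pset.indexed_pmult)
  next
    case False
    then have "psubst (below n) (p * Var i) = Const 0" by (simp add: psubst_mult below_def)
    then show ?thesis by (simp only: hpoly_Const) (simp add: indexed_pset.indexed_const)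
  qed
qed

lemma hpoly_carrier: "only_below n p \<Longrightarrow> hpoly p \<in> carrier (mpoly_ring R {..<n})"
  using hpoly_below[of n p] by (simp add: mpoly_ring_def only_below_def)

lemma mpoly_ring_hpoly:
  "hpoly (p + q) = hpoly p \<oplus>\<^bsub>mpoly_ring R J\<^esub> hpoly q"
  "hpoly (p * q) = hpoly p \<otimes>\<^bsub>mpoly_ring R J\<^esub> hpoly q"
  "hpoly 1 = \<one>\<^bsub>mpoly_ring R J\<^esub>" "hpoly 0 = \<zero>\<^bsub>mpoly_ring R J\<^esub>"
  using hpoly_Const[of 1] hpoly_Const[of 0]
  by (simp_all add: mpoly_ring_def hpoly_add hpoly_mult h_1 h_0)

section \<open>Between coordinates in the carrier sense and coordinates modulo an ideal\<close>

lemma only_below_add: "only_below n p \<Longrightarrow> only_below n q \<Longrightarrow> only_below n (p + q)"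
  and only_below_mult: "only_below n p \<Longrightarrow> only_below n q \<Longrightarrow> only_below n (p * q)"
  and only_below_Const: "only_below n (Const c)"
  and only_below_Var: "i < n \<Longrightarrow> only_below n (Var i)"
  by (auto simp: only_below_def psubst_add psubst_mult below_def)

text \<open>Denominators are multiplied along the construction of the polynomial. With
  \<open>S = {1}\<close> this becomes the surjectivity of \<open>hpoly\<close>.\<close>

lemma clear_denominators:
  assumes frac: "\<And>x. x \<in> carrier R \<Longrightarrow> \<exists>s u. s \<in> S \<and> h s \<otimes> x = h u"
    and S: "1 \<in> S" "\<And>s t. s \<in> S \<Longrightarrow> t \<in> S \<Longrightarrow> s * t \<in> S"
    and P: "P \<in> carrier (mpoly_ring R {..<n})"
  shows "\<exists>s p. s \<in> S \<and> only_below n p \<and> hpoly p = hpoly (Const s) \<otimes>\<^bsub>mpoly_ring R {..<n}\<^esub> P"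
proof -
  have eq: "hpoly (Const s) \<otimes>\<^bsub>mpoly_ring R {..<n}\<^esub> P = (\<lambda>m. h s \<otimes> P m)" if "carrier_coeff P" for s and P :: "nat multiset \<Rightarrow> 'a"
    using that by (simp add: mpoly_ring_def hpoly_Const mpoly_mult_const)
  have "P \<in> (carrier R [\<X>\<^bsub>{..<n}\<^esub>])" using P by (simp add: mpoly_ring_def)
  then have "\<exists>s p. s \<in> S \<and> only_below n p \<and> hpoly p = (\<lambda>m. h s \<otimes> P m)"
  proof induction
    case (indexed_const x)
    then obtain s u where su: "s \<in> S" "h s \<otimes> x = h u" using frac by blast
    have "hpoly (Const u) = (\<lambda>m. h s \<otimes> indexed_const x m)"
      by (auto simp: hpoly_Const indexed_const_def su(2))
    then show ?case using su(1) only_below_Const by blast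
  next
    case (indexed_padd P Q)
    note c = pset_coeff[OF indexed_padd(1)] pset_coeff[OF indexed_padd(2)]
    obtain s p t q where *: "s \<in> S" "only_below n p" "hpoly p = (\<lambda>m. h s \<otimes> P m)"
      "t \<in> S" "only_below n q" "hpoly q = (\<lambda>m. h t \<otimes> Q m)" using indexed_padd.IH by blast
    have "hpoly (Const t * p + Const s * q) m = h (s * t) \<otimes> (P \<Oplus> Q) m" for m
    proof -
      have "hpoly (Const t * p + Const s * q) m = h t \<otimes> (h s \<otimes> P m) \<oplus> h s \<otimes> (h t \<otimes> Q m)"
        by (simp add: hpoly_add indexed_padd_def hpoly_mult hpoly_Const mpoly_mult_const
            hpoly_coeff) (simp add: *)
      also have "\<dots> = h (s * t) \<otimes> (P m \<oplus> Q m)"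
        using carrier_coeffE[OF c(1), of m] carrier_coeffE[OF c(2), of m]
        by (simp add: h_mult r_distr m_assoc m_lcomm)
      finally show ?thesis by (simp add: indexed_padd_def)
    qed
    then have "hpoly (Const t * p + Const s * q) = (\<lambda>m. h (s * t) \<otimes> (P \<Oplus> Q) m)" by blast
    moreover have "only_below n (Const t * p + Const s * q)"
      by (intro only_below_add only_below_mult only_below_Const *)
    ultimately show ?case using S(2)[OF *(1,4)] by blast
  next
    case (indexed_pmult P i)
    then obtain s p where *: "s \<in> S" "only_below n p" "hpoly p = (\<lambda>m. h s \<otimes> P m)" by blast
    have "hpoly (p * Var i) = (\<lambda>m. h s \<otimes> (P \<Otimes> i) m)"
      by (auto simp: hpoly_mult_Var indexed_pmult_def *(3))
    moreover have "only_below n (p * Var i)"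
      using indexed_pmult(2) by (intro only_below_mult only_below_Var *) simp
    ultimately show ?case using *(1) by blast
  qed
  moreover have "carrier_coeff P" using P by (intro pset_coeff) (simp add: mpoly_ring_def)
  ultimately show ?thesis by (simp add: eq)
qed

lemma hpoly_surj:
  assumes "h ` UNIV = carrier R" and P: "P \<in> carrier (mpoly_ring R {..<n})"
  shows "\<exists>p. only_below n p \<and> hpoly p = P"
proof -
  have "\<exists>s u. s \<in> {1} \<and> h s \<otimes> x = h u" if "x \<in> carrier R" for x
  proof -
    from that assms(1) obtain u where "x = h u" by blast
    then show ?thesis by (auto simp: h_1)
  qed
  from clear_denominators[OF this _ _ P] obtain p where p: "only_below n p"
    "hpoly p = hpoly (Const 1) \<otimes>\<^bsub>mpoly_ring R {..<n}\<^esub> P" by auto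
  interpret M: cring "mpoly_ring R {..<n}" by (rule mpoly_ring_cring)
  have "hpoly p = P" using P p(2) by (simp add: mpoly_ring_hpoly(3)[of "{..<n}"])
  with p show ?thesis by blast
qed

text \<open>Multiplying the generators over the field by denominators gives \<open>f'\<close>. Each
  variable times a denominator is then a polynomial in \<open>f'\<close>, and these polynomials form
  the left inverse that \<open>gen_inverse\<close> asks for.\<close>

lemma gen_coord_of_coordinate:
  assumes ker: "\<And>u. h u = \<zero> \<longleftrightarrow> u \<in> Q" and Q: "is_prime Q"
    and frac: "\<And>x. x \<in> carrier R \<Longrightarrow> \<exists>s u. s \<notin> Q \<and> h s \<otimes> x = h u"
    and F: "only_below n F" and c: "coordinate R n (hpoly F)"
  shows "gen_coord Q n F"
proof -
  let ?M = "mpoly_ring R {..<n}"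
  interpret M: cring ?M by (rule mpoly_ring_cring)
  let ?S = "- Q"
  have S: "1 \<in> ?S" "\<And>s t. s \<in> ?S \<Longrightarrow> t \<in> ?S \<Longrightarrow> s * t \<in> ?S"
    using Q by (auto simp: is_prime_def)
  have frac': "\<exists>s u. s \<in> ?S \<and> h s \<otimes> x = h u" if "x \<in> carrier R" for x using frac[OF that] by simp
  have ker': "{u. h u = \<zero>} = Q" using ker by blast
  obtain Fs where Fs: "length (hpoly F # Fs) = n" "set (hpoly F # Fs) \<subseteq> carrier ?M"
    "carrier ?M = generate_ring ?M (indexed_const ` carrier R \<union> set (hpoly F # Fs))"
    using c unfolding coordinate_def by blast
  let ?G = "hpoly F # Fs"
  have n: "0 < n" using Fs(1) by simp
  have G: "?G ! j \<in> carrier ?M" if "j < n" for j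
    using Fs(1,2) that nth_mem[of j ?G] by blast
  have "\<exists>s p. s \<in> ?S \<and> only_below n p \<and> hpoly p = hpoly (Const s) \<otimes>\<^bsub>?M\<^esub> ?G ! j" if "j < n" for j
    using clear_denominators[OF frac' S G[OF that]] .
  then obtain sG f where f: "\<And>j. j < n \<Longrightarrow> sG j \<in> ?S \<and> only_below n (f j) \<and>
      hpoly (f j) = hpoly (Const (sG j)) \<otimes>\<^bsub>?M\<^esub> ?G ! j" by metis
  define f' where "f' j = (if j = 0 then F else if j < n then f j else Var j)" for j
  \<comment> \<open>\<open>F\<close> comes from the base and must be the component at 0 itself, so
    its denominator is 1.\<close>
  define s' where "s' j = (if j = 0 then 1 else sG j)" for j :: nat
  have f': "s' j \<in> ?S" "only_below n (f' j)" "hpoly (f' j) = hpoly (Const (s' j)) \<otimes>\<^bsub>?M\<^esub> ?G ! j" if "j < n" for j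
  proof -
    show "s' j \<in> ?S" using f[OF that] S(1) by (simp add: s'_def)
    show "only_below n (f' j)" using f[OF that] F that by (simp add: f'_def)
    show "hpoly (f' j) = hpoly (Const (s' j)) \<otimes>\<^bsub>?M\<^esub> ?G ! j"
      using f[OF that] hpoly_carrier[OF F] that
      by (auto simp: f'_def s'_def mpoly_ring_hpoly(3)[of "{..<n}"])
  qed
  have cC: "hpoly (Const s) \<in> carrier ?M" for s by (intro hpoly_carrier only_below_Const)
  have ob: "only_below n (psubst f' q)" if "only_below n q" for q
  proof -
    have "psubst (\<lambda>i. psubst (below n) (f' i)) q = psubst f' q"
      by (rule only_below_psubst[OF that]) (use f'(2) in \<open>simp add: only_below_def\<close>)
    then show ?thesis by (simp add: only_below_def psubst_psubst)
  qed
  note hM = mpoly_ring_hpoly[where J = "{..<n}"]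
  have gen: "P \<in> carrier ?M \<and> (\<exists>s q. s \<in> ?S \<and> only_below n q \<and> hpoly (psubst f' q) = hpoly (Const s) \<otimes>\<^bsub>?M\<^esub> P)"
    if "P \<in> generate_ring ?M (indexed_const ` carrier R \<union> set ?G)" for P
    using that
  proof induction
    case one
    have "hpoly (psubst f' (Const 1)) = hpoly (Const 1) \<otimes>\<^bsub>?M\<^esub> \<one>\<^bsub>?M\<^esub>"
      using cC[of 1] by (simp only: psubst_Const M.r_one)
    then show ?case using S(1) only_below_Const by blast
  next
    case (incl P)
    then consider x where "x \<in> carrier R" "P = indexed_const x" | j where "j < n" "P = ?G ! j"
      using Fs(1) by (metis Un_iff imageE in_set_conv_nth)
    then show ?case
    proof cases
      case 1
      then obtain s u where su: "s \<in> ?S" "h s \<otimes> x = h u" using frac' by blast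
      have P: "P \<in> carrier ?M" using 1 by (simp add: mpoly_ring_def indexed_pset.indexed_const)
      have "hpoly (Const u) = hpoly (Const s) \<otimes>\<^bsub>?M\<^esub> P"
        using 1 su by (auto simp: mpoly_ring_def hpoly_Const mpoly_mult_const const_coeff) (auto simp: indexed_const_def)
      then have "hpoly (psubst f' (Const u)) = hpoly (Const s) \<otimes>\<^bsub>?M\<^esub> P" by simp
      with P su(1) only_below_Const show ?thesis by blast
    next
      case 2
      have "hpoly (psubst f' (Var j)) = hpoly (Const (s' j)) \<otimes>\<^bsub>?M\<^esub> P" using f'(3)[OF 2(1)] 2 by simp
      then show ?thesis using G[OF 2(1)] 2 f'(1)[OF 2(1)] only_below_Var[OF 2(1)] by blast
    qed
  next
    case (a_inv P)
    then obtain s q where *: "P \<in> carrier ?M" "s \<in> ?S" "only_below n q"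
      "hpoly (psubst f' q) = hpoly (Const s) \<otimes>\<^bsub>?M\<^esub> P" by blast
    have q: "only_below n (- q)" using *(3) by (simp add: only_below_def psubst_uminus)
    have "hpoly (psubst f' (- q)) \<oplus>\<^bsub>?M\<^esub> hpoly (psubst f' q) = \<zero>\<^bsub>?M\<^esub>"
      by (simp add: psubst_uminus flip: hM)
    then have "hpoly (psubst f' (- q)) = \<ominus>\<^bsub>?M\<^esub> hpoly (psubst f' q)"
      by (metis M.minus_equality hpoly_carrier ob *(3) q)
    also have "\<dots> = hpoly (Const s) \<otimes>\<^bsub>?M\<^esub> (\<ominus>\<^bsub>?M\<^esub> P)" using *(1,4) cC M.r_minus by simp
    finally show ?case using * q M.a_inv_closed by blast
  next
    case (eng_add P P')
    then obtain s q t q' where *: "P \<in> carrier ?M" "s \<in> ?S" "only_below n q"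
      "hpoly (psubst f' q) = hpoly (Const s) \<otimes>\<^bsub>?M\<^esub> P" "P' \<in> carrier ?M" "t \<in> ?S" "only_below n q'"
      "hpoly (psubst f' q') = hpoly (Const t) \<otimes>\<^bsub>?M\<^esub> P'" by blast
    have "hpoly (psubst f' (Const t * q + Const s * q')) =
        hpoly (Const t) \<otimes>\<^bsub>?M\<^esub> (hpoly (Const s) \<otimes>\<^bsub>?M\<^esub> P) \<oplus>\<^bsub>?M\<^esub> hpoly (Const s) \<otimes>\<^bsub>?M\<^esub> (hpoly (Const t) \<otimes>\<^bsub>?M\<^esub> P')"
      by (simp add: psubst_add psubst_mult hM * del: M.m_assoc)
    also have "\<dots> = hpoly (Const (s * t)) \<otimes>\<^bsub>?M\<^esub> (P \<oplus>\<^bsub>?M\<^esub> P')"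
      unfolding Const_mult hM using * cC[of s] cC[of t] by (simp add: M.r_distr M.m_assoc M.m_lcomm)
    finally have "hpoly (psubst f' (Const t * q + Const s * q')) = hpoly (Const (s * t)) \<otimes>\<^bsub>?M\<^esub> (P \<oplus>\<^bsub>?M\<^esub> P')" .
    moreover have "only_below n (Const t * q + Const s * q')"
      by (intro only_below_add only_below_mult only_below_Const *)
    ultimately show ?case using * S(2) M.a_closed by blast
  next
    case (eng_mult P P')
    then obtain s q t q' where *: "P \<in> carrier ?M" "s \<in> ?S" "only_below n q"
      "hpoly (psubst f' q) = hpoly (Const s) \<otimes>\<^bsub>?M\<^esub> P" "P' \<in> carrier ?M" "t \<in> ?S" "only_below n q'"
      "hpoly (psubst f' q') = hpoly (Const t) \<otimes>\<^bsub>?M\<^esub> P'" by blast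
    have "hpoly (psubst f' (q * q')) =
        (hpoly (Const s) \<otimes>\<^bsub>?M\<^esub> P) \<otimes>\<^bsub>?M\<^esub> (hpoly (Const t) \<otimes>\<^bsub>?M\<^esub> P')"
      by (simp add: psubst_mult hM * del: M.m_assoc)
    also have "\<dots> = hpoly (Const (s * t)) \<otimes>\<^bsub>?M\<^esub> (P \<otimes>\<^bsub>?M\<^esub> P')"
      unfolding Const_mult hM using * cC[of s] cC[of t] by (simp add: M.m_assoc M.m_lcomm)
    finally have "hpoly (psubst f' (q * q')) = hpoly (Const (s * t)) \<otimes>\<^bsub>?M\<^esub> (P \<otimes>\<^bsub>?M\<^esub> P')" .
    moreover have "only_below n (q * q')" by (intro only_below_mult *)
    ultimately show ?case using * S(2) M.m_closed by blast
  qed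
  have "\<exists>s q. s \<in> ?S \<and> only_below n q \<and> psubst f' q - Const s * Var i \<in> ext Q" if i: "i < n" for i
  proof -
    have "hpoly (Var i) \<in> carrier ?M" using i by (intro hpoly_carrier only_below_Var)
    then obtain s q where "s \<in> ?S" "only_below n q" "hpoly (psubst f' q) = hpoly (Const s) \<otimes>\<^bsub>?M\<^esub> hpoly (Var i)"
      using gen Fs(3) by blast
    then show ?thesis using hpoly_eq_iff[of "psubst f' q" "Const s * Var i"] ker' hM(2) by auto
  qed
  then obtain s q where sq: "\<And>i. i < n \<Longrightarrow> s i \<in> ?S" "\<And>i. i < n \<Longrightarrow> only_below n (q i)"
    "\<And>i. i < n \<Longrightarrow> psubst f' (q i) - Const (s i) * Var i \<in> ext Q" by metis
  define t where "t = (\<Prod>i<n. s i)"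
  have t: "t \<notin> Q" unfolding t_def using prime_prod[of "{..<n}" Q s] Q sq(1) by auto
  \<comment> \<open>The denominators of the other variables are multiplied in, so that all variables
    share the factor \<open>t\<close>.\<close>
  define g where "g i = (if i < n then Const (\<Prod>j\<in>{..<n} - {i}. s j) * q i else Const t * Var i)" for i
  note E = ext_ideal[OF prime_ideal[OF Q], where ?'v = nat]
  have "gen_inverse Q n t f' g"
    unfolding gen_inverse_def
  proof (intro conjI allI impI)
    fix i assume i: "i < n"
    show "only_below n (f' i)" by (rule f'(2)[OF i])
    show "only_below n (g i)" using i sq(2) by (simp add: g_def only_below_mult only_below_Const)
    have "psubst f' (g i) - Const t * Var i =
        Const (\<Prod>j\<in>{..<n} - {i}. s j) * (psubst f' (q i) - Const (s i) * Var i)"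
      using i prod.remove[of "{..<n}" i s]
      by (simp add: g_def t_def psubst_mult Const_mult algebra_simps)
    then show "psubst f' (g i) - Const t * Var i \<in> ext Q" using ideal_mult[OF E sq(3)[OF i]] by simp
  qed (use t n in \<open>auto simp: f'_def g_def\<close>)
  moreover have "f' 0 - F \<in> ext Q" by (simp add: f'_def ideal_zero[OF E])
  ultimately show ?thesis using n unfolding gen_coord_def by blast
qed

text \<open>Every polynomial is \<open>\<sigma>\<close> applied to its image under
  \<open>\<tau>\<close>, hence a polynomial expression in the components of
  \<open>\<sigma>\<close>.\<close>

lemma coordinate_of_coord:
  assumes surj: "h ` UNIV = carrier R" and F: "only_below N F" and c: "coord {u. h u = \<zero>} N F"
  shows "coordinate R N (hpoly F)"
proof -
  let ?M = "mpoly_ring R {..<N}" and ?I = "{u. h u = \<zero>}"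
  interpret M: cring ?M by (rule mpoly_ring_cring)
  note I = kernel_ideal
  have N: "0 < N" using c by (simp add: coord_def)
  obtain \<sigma> \<tau> where st: "inverse_pair ?I N \<sigma> \<tau>" "\<And>i. i < N \<Longrightarrow> only_below N (\<sigma> i)"
    "\<And>i. i < N \<Longrightarrow> only_below N (\<tau> i)" "\<sigma> 0 - F \<in> ext ?I"
    using c F N inverse_pair_below[OF I] unfolding coord_def by metis
  define Fs where "Fs = map (\<lambda>i. hpoly (\<sigma> i)) [1..<N]"
  have F0: "hpoly F = hpoly (\<sigma> 0)" using st(4) hpoly_eq_iff[of "\<sigma> 0" F] by simp
  have "hpoly F # Fs = map (\<lambda>i. hpoly (\<sigma> i)) [0..<N]"
    using N by (simp add: Fs_def F0 upt_conv_Cons)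
  then have G: "set (hpoly F # Fs) = (\<lambda>i. hpoly (\<sigma> i)) ` {..<N}" by (simp add: atLeast0LessThan)
  let ?H = "indexed_const ` carrier R \<union> set (hpoly F # Fs)"
  have sub: "set (hpoly F # Fs) \<subseteq> carrier ?M" unfolding G using st(2) hpoly_carrier by blast
  moreover have "carrier ?M = generate_ring ?M ?H"
  proof
    have "?H \<subseteq> carrier ?M" using sub by (auto simp: mpoly_ring_def indexed_pset.indexed_const)
    then show "generate_ring ?M ?H \<subseteq> carrier ?M" by (rule M.generate_ring_incl)
    have C: "hpoly (Const c) \<in> generate_ring ?M ?H" for c
      by (intro generate_ring.incl) (simp add: hpoly_Const)
    have gen: "hpoly (psubst (\<lambda>i. if i < N then \<sigma> i else 0) q) \<in> generate_ring ?M ?H" for q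
    proof (induction q rule: mpol_induct)
      case (Const c)
      show ?case using C by simp
    next
      case (add p q)
      then show ?case unfolding psubst_add mpoly_ring_hpoly(1)[of _ _ "{..<N}"] by (rule generate_ring.eng_add)
    next
      case (Var p i)
      have "hpoly (if i < N then \<sigma> i else 0) \<in> generate_ring ?M ?H"
      proof (cases "i < N")
        case True
        then show ?thesis using G by (intro generate_ring.incl) auto
      next
        case False
        then show ?thesis using C[of 0] by simp
      qed
      with Var show ?case
        unfolding psubst_mult mpoly_ring_hpoly(2)[of _ _ "{..<N}"] psubst_Var by (rule generate_ring.eng_mult)
    qed
    show "carrier ?M \<subseteq> generate_ring ?M ?H"
    proof
      fix P assume "P \<in> carrier ?M"
      then obtain p where p: "only_below N p" "hpoly p = P" using hpoly_surj[OF surj] by blast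
      have "psubst (\<lambda>i. psubst (below N) (\<tau> i)) p = psubst \<tau> p"
        by (rule only_below_psubst[OF p(1)]) (use st(3) in \<open>simp add: only_below_def\<close>)
      then have b: "only_below N (psubst \<tau> p)" by (simp add: only_below_def psubst_psubst)
      have "hpoly (psubst \<sigma> (psubst \<tau> p)) = P"
        using inverse_pair_apply[OF I st(1), of p] hpoly_eq_iff p(2) by metis
      moreover have "psubst \<sigma> (psubst \<tau> p) = psubst (\<lambda>i. if i < N then \<sigma> i else 0) (psubst \<tau> p)"
        by (rule only_below_psubst[OF b]) simp
      ultimately show "P \<in> generate_ring ?M ?H" using gen[of "psubst \<tau> p"] by (simp only:)
    qed
  qed
  moreover have "length (hpoly F # Fs) = N" using N by (simp add: Fs_def)
  ultimately show ?thesis unfolding coordinate_def by blast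
qed

lemma prime_image:
  assumes surj: "h ` UNIV = carrier R" and Q: "is_prime Q" "{u. h u = \<zero>} \<subseteq> Q"
  shows "primeideal (h ` Q) R" and "h u \<in> h ` Q \<longleftrightarrow> u \<in> Q"
proof -
  note Q' = prime_ideal[OF Q(1)]
  show mem: "h u \<in> h ` Q \<longleftrightarrow> u \<in> Q" for u
  proof
    assume "h u \<in> h ` Q"
    then obtain q where q: "q \<in> Q" "h u = h q" by blast
    then have "u - q \<in> Q" using Q(2) h_diff_0[of u q] by blast
    then show "u \<in> Q" using q(1) ideal_cong_mem[OF Q'] by blast
  qed blast
  have ex: "\<exists>u. x = h u" if "x \<in> carrier R" for x using that surj by blast
  show "primeideal (h ` Q) R"
  proof (rule primeidealI)
    show "ideal (h ` Q) R"
    proof (rule idealI)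
      show "ring R" by (rule ring_axioms)
      show "subgroup (h ` Q) (add_monoid R)"
      proof (rule add.subgroupI)
        show "h ` Q \<subseteq> carrier R" by auto
        show "h ` Q \<noteq> {}" using ideal_zero[OF Q'] by blast
        show "\<ominus> a \<in> h ` Q" if "a \<in> h ` Q" for a
          using that ideal_uminus[OF Q'] by (auto simp flip: h_uminus)
        show "a \<oplus> b \<in> h ` Q" if "a \<in> h ` Q" "b \<in> h ` Q" for a b
          using that ideal_add[OF Q'] by (auto simp flip: h_add)
      qed
      show "x \<otimes> a \<in> h ` Q" if "a \<in> h ` Q" "x \<in> carrier R" for a x
        using that ex[OF that(2)] ideal_mult[OF Q'] by (auto simp flip: h_mult)
      show "a \<otimes> x \<in> h ` Q" if "a \<in> h ` Q" "x \<in> carrier R" for a x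
        using that ex[OF that(2)] ideal_mult'[OF Q'] by (auto simp flip: h_mult)
    qed
    show "cring R" by (rule is_cring)
    show "carrier R \<noteq> h ` Q" using mem[of 1] Q(1) h_closed[of 1] by (auto simp: is_prime_def)
    show "a \<in> h ` Q \<or> b \<in> h ` Q" if ab: "a \<in> carrier R" "b \<in> carrier R" "a \<otimes> b \<in> h ` Q" for a b
    proof -
      obtain u v where "a = h u" "b = h v" using ex[OF ab(1)] ex[OF ab(2)] by blast
      moreover from this have "u * v \<in> Q" using ab(3) mem[of "u * v"] by (simp only: h_mult)
      ultimately show ?thesis using Q(1) mem[of u] mem[of v] by (auto simp: is_prime_def)
    qed
  qed
qed

end

section \<open>Every commutative ring is an image of a ring in the class\<close>

text \<open>A polynomial ring over a type class needs a whole type of coefficients. We use the free ring on the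
  elements of the type, of which the carrier of \<open>R\<close> is a quotient once the elements outside the carrier
  are sent to \<open>1\<close>.\<close>

context cring
begin

text \<open>The test on \<open>x\<close> makes these operations commute on the whole type, as
  folding over a multiset requires.\<close>

definition mon_op :: "'a \<Rightarrow> 'a \<Rightarrow> 'a"
  where "mon_op a x = (if a \<in> carrier R \<and> x \<in> carrier R then a \<otimes> x else x)"

definition eval_mon :: "'a multiset \<Rightarrow> 'a"
  where "eval_mon m = fold_mset mon_op \<one> m"

definition eval_free :: "('a, int) mpol \<Rightarrow> 'a"
  where "eval_free p = (\<Oplus>m\<in>Poly_Mapping.keys p. [Poly_Mapping.lookup p m] \<cdot> eval_mon m)"

lemma mon_op_commute: "comp_fun_commute mon_op"
  by (rule comp_fun_commute.intro) (auto simp: fun_eq_iff mon_op_def m_lcomm)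

lemma eval_mon_empty: "eval_mon {#} = \<one>"
  by (simp add: eval_mon_def)

lemma eval_mon_add: "eval_mon (add_mset a m) = mon_op a (eval_mon m)"
  by (simp add: eval_mon_def comp_fun_commute.fold_mset_add_mset[OF mon_op_commute])

lemma eval_mon_closed: "eval_mon m \<in> carrier R"
  by (induction m) (auto simp: eval_mon_empty eval_mon_add mon_op_def)

lemma eval_mon_union: "eval_mon (m + n) = eval_mon m \<otimes> eval_mon n"
  by (induction m) (auto simp: eval_mon_empty eval_mon_add mon_op_def eval_mon_closed m_assoc)

lemma add_pow_int_closed: "x \<in> carrier R \<Longrightarrow> add_pow R (k::int) x \<in> carrier R"
  by (rule add.int_pow_closed)

lemma add_pow_int_0: "add_pow R (0::int) x = \<zero>"
  by (simp add: add_pow_def)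

lemma eval_free_superset:
  assumes "finite A" "Poly_Mapping.keys p \<subseteq> A"
  shows "eval_free p = (\<Oplus>m\<in>A. [Poly_Mapping.lookup p m] \<cdot> eval_mon m)"
  unfolding eval_free_def
  by (rule add.finprod_mono_neutral_cong_left)
    (use assms in \<open>auto simp: not_in_keys_iff_lookup_eq_zero add_pow_int_closed eval_mon_closed add_pow_int_0\<close>)

lemma eval_free_add: "eval_free (p + q) = eval_free p \<oplus> eval_free q"
proof -
  let ?A = "Poly_Mapping.keys p \<union> Poly_Mapping.keys q"
  have A: "finite ?A" "Poly_Mapping.keys (p + q) \<subseteq> ?A" by (auto simp: Poly_Mapping.keys_add)
  have "eval_free (p + q) = (\<Oplus>m\<in>?A. [Poly_Mapping.lookup p m] \<cdot> eval_mon m \<oplus> [Poly_Mapping.lookup q m] \<cdot> eval_mon m)"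
    unfolding eval_free_superset[OF A]
    by (intro finsum_cong') (auto simp: lookup_add add.int_pow_mult eval_mon_closed add_pow_int_closed)
  also have "\<dots> = eval_free p \<oplus> eval_free q"
    using eval_free_superset[of ?A p] eval_free_superset[of ?A q]
    by (subst finsum_addf) (auto simp: eval_mon_closed add_pow_int_closed)
  finally show ?thesis .
qed

lemma eval_free_single: "eval_free (Poly_Mapping.single m c) = [c] \<cdot> eval_mon m"
  using eval_free_superset[of "{m}" "Poly_Mapping.single m c"]
  by (simp add: eval_mon_closed add_pow_int_closed)

lemma eval_free_closed: "eval_free p \<in> carrier R"
  unfolding eval_free_def by (intro finsum_closed) (auto simp: eval_mon_closed add_pow_int_closed)

lemma eval_free_mult: "eval_free (p * q) = eval_free p \<otimes> eval_free q"
proof -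
  have z: "eval_free 0 = \<zero>" by (simp add: eval_free_def)
  have ss: "eval_free (Poly_Mapping.single m c * Poly_Mapping.single l d) =
      eval_free (Poly_Mapping.single m c) \<otimes> eval_free (Poly_Mapping.single l d)" for m c l d
  proof -
    have "eval_free (Poly_Mapping.single m c) \<otimes> eval_free (Poly_Mapping.single l d) =
        [d] \<cdot> ([c] \<cdot> (eval_mon m \<otimes> eval_mon l))"
      by (simp add: eval_free_single add_pow_ldistr_int add_pow_rdistr_int eval_mon_closed add_pow_int_closed)
    also have "\<dots> = [(c * d)] \<cdot> (eval_mon m \<otimes> eval_mon l)"
      by (rule add.int_pow_pow) (simp add: eval_mon_closed)
    finally show ?thesis by (simp only: mult_single eval_free_single eval_mon_union)
  qed
  have sq: "eval_free (Poly_Mapping.single m c * q) = eval_free (Poly_Mapping.single m c) \<otimes> eval_free q" for m c q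
  proof -
    have "finite A \<Longrightarrow> eval_free (Poly_Mapping.single m c * (\<Sum>l\<in>A. Poly_Mapping.single l (f l))) =
        eval_free (Poly_Mapping.single m c) \<otimes> eval_free (\<Sum>l\<in>A. Poly_Mapping.single l (f l))" for A f
      by (induction A rule: finite_induct)
        (auto simp: z distrib_left eval_free_add ss r_distr eval_free_closed)
    from this[OF finite_keys] show ?thesis using mpol_sum_single[of q] by metis
  qed
  have "finite A \<Longrightarrow> eval_free ((\<Sum>l\<in>A. Poly_Mapping.single l (f l)) * q) =
        eval_free (\<Sum>l\<in>A. Poly_Mapping.single l (f l)) \<otimes> eval_free q" for A f
    by (induction A rule: finite_induct)
      (auto simp: z distrib_right eval_free_add sq l_distr eval_free_closed)
  from this[OF finite_keys] show ?thesis using mpol_sum_single[of p] by metis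
qed

lemma eval_free_class_hom: "class_hom R eval_free"
proof (unfold_locales)
  have "eval_free (Poly_Mapping.single {#} 1) = \<one>"
    by (simp only: eval_free_single eval_mon_empty add.int_pow_1 one_closed)
  then show "eval_free 1 = \<one>" by simp
qed (simp_all add: eval_free_closed eval_free_add eval_free_mult)

lemma eval_free_surj: "eval_free ` UNIV = carrier R"
proof -
  have "eval_free (Var a) = a" if "a \<in> carrier R" for a
    using that by (simp add: Var_def eval_free_single eval_mon_add eval_mon_empty mon_op_def)
  then show ?thesis using eval_free_closed by (metis image_subset_iff rangeI subsetI subset_antisym)
qed

section \<open>Residue fields\<close>

lemma residue_map_hom:
  assumes P: "primeideal P R"
  shows "a \<in> carrier R \<Longrightarrow> residue_map R P a \<in> carrier (residue_field R P)"
    and "a \<in> carrier R \<Longrightarrow> b \<in> carrier R \<Longrightarrow>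
      residue_map R P (a \<oplus> b) = residue_map R P a \<oplus>\<^bsub>residue_field R P\<^esub> residue_map R P b"
    and "a \<in> carrier R \<Longrightarrow> b \<in> carrier R \<Longrightarrow>
      residue_map R P (a \<otimes> b) = residue_map R P a \<otimes>\<^bsub>residue_field R P\<^esub> residue_map R P b"
    and "residue_map R P \<one> = \<one>\<^bsub>residue_field R P\<^esub>"
    and "a \<in> carrier R \<Longrightarrow> residue_map R P a = \<zero>\<^bsub>residue_field R P\<^esub> \<longleftrightarrow> a \<in> P"
    and "x \<in> carrier (residue_field R P) \<Longrightarrow> \<exists>s\<in>carrier R. \<exists>a\<in>carrier R. s \<notin> P \<and>
      residue_map R P s \<otimes>\<^bsub>residue_field R P\<^esub> x = residue_map R P a"
proof -
  interpret P: primeideal P R by fact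
  define S where "S = carrier R - P"
  have subm: "submonoid S R" using prime_complement_submonoid[OF P] by (simp add: S_def)
  interpret S: submonoid S R by fact
  have SR: "s \<in> carrier R" if "s \<in> S" for s using that by (simp add: S_def)
  let ?L = "local_ring_at R P" and ?E = "extended_ideal R P"
  have L: "?L = localization R S" by (simp add: local_ring_at_def S_def)
  interpret Lo: cring ?L unfolding L by (rule localization_cring[OF subm])
  interpret E: maximalideal ?E ?L by (rule extended_ideal_eq(2)[OF P])
  have rho: "residue_map R P a = ?E +>\<^bsub>?L\<^esub> fraction R S a \<one>" for a
    by (simp add: residue_map_def S_def)
  have fc: "fraction R S a s \<in> carrier ?L" if "a \<in> carrier R" "s \<in> S" for a s
    unfolding L by (rule fraction_closed[OF that])
  have hom: "(+>\<^bsub>?L\<^esub>) ?E \<in> Ring.ring_hom ?L (residue_field R P)"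
    unfolding residue_field_def by (rule E.rcos_ring_hom)
  have one: "\<one>\<^bsub>?L\<^esub> = fraction R S \<one> \<one>" by (simp add: L localization_def)
  show "residue_map R P a \<in> carrier (residue_field R P)" if "a \<in> carrier R"
    unfolding rho by (intro ring_hom_closed[OF hom] fc that) simp
  show "residue_map R P (a \<oplus> b) = residue_map R P a \<oplus>\<^bsub>residue_field R P\<^esub> residue_map R P b"
    if "a \<in> carrier R" "b \<in> carrier R"
  proof -
    have "fraction R S a \<one> \<oplus>\<^bsub>?L\<^esub> fraction R S b \<one> = fraction R S (a \<oplus> b) \<one>"
      unfolding L using that by (simp add: fraction_add[OF subm])
    then show ?thesis
      unfolding rho using ring_hom_add[OF hom fc fc, of a \<one> b \<one>] that by simp
  qed
  show mult: "residue_map R P (a \<otimes> b) = residue_map R P a \<otimes>\<^bsub>residue_field R P\<^esub> residue_map R P b"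
    if "a \<in> carrier R" "b \<in> carrier R" for a b
  proof -
    have "fraction R S a \<one> \<otimes>\<^bsub>?L\<^esub> fraction R S b \<one> = fraction R S (a \<otimes> b) \<one>"
      unfolding L using that by (simp add: fraction_mult[OF subm])
    then show ?thesis
      unfolding rho using ring_hom_mult[OF hom fc fc, of a \<one> b \<one>] that by simp
  qed
  show "residue_map R P \<one> = \<one>\<^bsub>residue_field R P\<^esub>"
    unfolding rho using ring_hom_one[OF hom] one by simp
  have E_eq: "?E = {fraction R S a s |a s. a \<in> P \<and> s \<in> S}"
    using extended_ideal_eq(1)[OF P] by (simp add: S_def)
  show "residue_map R P a = \<zero>\<^bsub>residue_field R P\<^esub> \<longleftrightarrow> a \<in> P" if a: "a \<in> carrier R"
  proof -
    have "residue_map R P a = \<zero>\<^bsub>residue_field R P\<^esub> \<longleftrightarrow> fraction R S a \<one> \<in> ?E"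
    proof -
      have z: "\<zero>\<^bsub>residue_field R P\<^esub> = ?E" by (simp add: residue_field_def FactRing_def)
      have "fraction R S a \<one> \<in> ?E +>\<^bsub>?L\<^esub> fraction R S a \<one>"
        using E.a_rcos_self[OF fc[OF a]] by simp
      moreover have "?E +>\<^bsub>?L\<^esub> x = ?E" if "x \<in> ?E" for x
        using E.a_rcos_const[OF that] .
      ultimately show ?thesis unfolding rho z by blast
    qed
    also have "\<dots> \<longleftrightarrow> a \<in> P"
    proof
      assume "fraction R S a \<one> \<in> ?E"
      then obtain b s where bs: "b \<in> P" "s \<in> S" "fraction R S a \<one> = fraction R S b s" using E_eq by blast
      have bR: "b \<in> carrier R" using bs(1) P.a_subset by blast
      obtain u where u: "u \<in> S" "u \<otimes> (s \<otimes> a \<ominus> \<one> \<otimes> b) = \<zero>"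
        using bs(3) fraction_eq_iff[OF subm a S.one_closed bR bs(2)] by blast
      have "u \<otimes> s \<otimes> a = u \<otimes> (s \<otimes> a \<ominus> \<one> \<otimes> b) \<oplus> u \<otimes> b"
        using SR[OF u(1)] SR[OF bs(2)] a bR by algebra
      also have "\<dots> = u \<otimes> b" using u SR bR by simp
      also have "\<dots> \<in> P" using bs(1) SR[OF u(1)] by (rule P.I_l_closed)
      finally have "u \<otimes> s \<otimes> a \<in> P" .
      moreover have us: "u \<otimes> s \<in> S" using u bs by simp
      ultimately have "u \<otimes> s \<in> P \<or> a \<in> P" using P.I_prime[OF SR[OF us] a] by blast
      then show "a \<in> P" using us unfolding S_def by blast
    next
      assume "a \<in> P"
      then show "fraction R S a \<one> \<in> ?E" unfolding E_eq using S.one_closed by blast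
    qed
    finally show ?thesis .
  qed
  show "\<exists>s\<in>carrier R. \<exists>a\<in>carrier R. s \<notin> P \<and>
      residue_map R P s \<otimes>\<^bsub>residue_field R P\<^esub> x = residue_map R P a"
    if x: "x \<in> carrier (residue_field R P)"
  proof -
    obtain y where y: "y \<in> carrier ?L" "x = ?E +>\<^bsub>?L\<^esub> y"
      using x unfolding residue_field_def FactRing_def A_RCOSETS_def' by auto
    obtain a s where as: "a \<in> carrier R" "s \<in> S" "y = fraction R S a s"
      using y(1) unfolding L by (rule localization_carrierE)
    have "fraction R S (s \<otimes> a) (\<one> \<otimes> s) = fraction R S a \<one>"
      by (rule fraction_eqI[OF subm]) (use as SR in auto)
    then have "fraction R S s \<one> \<otimes>\<^bsub>?L\<^esub> y = fraction R S a \<one>"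
      unfolding L as(3) using as SR by (simp add: fraction_mult[OF subm])
    then have "residue_map R P s \<otimes>\<^bsub>residue_field R P\<^esub> x = residue_map R P a"
      unfolding rho y(2) using ring_hom_mult[OF hom fc[of s \<one>] y(1)] SR[OF as(2)] by simp
    then show ?thesis using as SR[OF as(2)] by (auto simp: S_def)
  qed
qed

end

section \<open>Residual coordinates are stable\<close>

text \<open>Writing \<open>d\<close>, \<open>n\<close> and the power of two as successors shows that
  the subtractions of natural numbers are never truncated.\<close>

lemma coordinate_count:
  fixes d n :: nat
  assumes "1 \<le> d" "1 \<le> n"
  shows "(2 ^ d - 1) * n - 2 ^ (d - 1) * (n - 1) = 2 ^ (d - 1) * (n + 1) - n"
    and "n + (2 ^ (d - 1) * (n + 1) - n) = 2 ^ (d - 1) * Suc n"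
proof -
  obtain e m where d: "d = Suc e" and n: "n = Suc m" using assms by (cases d; cases n) auto
  obtain a where a: "(2::nat) ^ e = Suc a" using not0_implies_Suc[of "2 ^ e"] by auto
  show "(2 ^ d - 1) * n - 2 ^ (d - 1) * (n - 1) = 2 ^ (d - 1) * (n + 1) - n"
    by (simp add: d n a algebra_simps)
  show "n + (2 ^ (d - 1) * (n + 1) - n) = 2 ^ (d - 1) * Suc n"
    by (simp add: d n a algebra_simps)
qed

lemma residual_stable:
  fixes k :: "('k, 's) ring_scheme" and R :: "('k, 'a, 't) module_scheme"
  assumes k: "algebraically_closed k" and char: "\<forall>m::nat. m > 0 \<longrightarrow> [m] \<cdot>\<^bsub>k\<^esub> \<one>\<^bsub>k\<^esub> \<noteq> \<zero>\<^bsub>k\<^esub>"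
    and R: "fin_gen_algebra k R" and dim: "krull_dim R = enat (Suc d)" and n: "1 \<le> n"
    and F: "residual_coordinate R n F"
  shows "coordinate R (2 ^ d * Suc n) F"
proof -
  interpret k: algebraically_closed k by fact
  have alg: "algebra k R" using R by (simp add: fin_gen_algebra_def)
  have "cring R" using alg by (simp add: algebra_def)
  then interpret R: cring R .
  interpret A: algebra k R by fact
  obtain S where S: "finite S" "S \<subseteq> carrier R"
    "carrier R = generate_ring R ((\<lambda>c. c \<odot>\<^bsub>R\<^esub> \<one>\<^bsub>R\<^esub>) ` carrier k \<union> S)"
    using R unfolding fin_gen_algebra_def by blast
  define \<pi> where "\<pi> = R.eval_free"
  interpret \<pi>: class_hom R \<pi> unfolding \<pi>_def by (rule R.eval_free_class_hom)
  have surj: "\<pi> ` UNIV = carrier R" unfolding \<pi>_def by (rule R.eval_free_surj)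
  have ex: "\<exists>u. \<pi> u = x" if "x \<in> carrier R" for x
  proof -
    from that have "x \<in> range \<pi>" by (simp only: surj)
    then show ?thesis by blast
  qed
  define \<iota> where "\<iota> c = c \<odot>\<^bsub>R\<^esub> \<one>\<^bsub>R\<^esub>" for c
  have \<iota>c: "\<iota> c \<in> carrier R" if "c \<in> carrier k" for c using that by (simp add: \<iota>_def)
  have \<iota>_add: "\<iota> (a \<oplus>\<^bsub>k\<^esub> b) = \<iota> a \<oplus>\<^bsub>R\<^esub> \<iota> b" if "a \<in> carrier k" "b \<in> carrier k" for a b
    using that by (simp add: \<iota>_def A.smult_l_distr)
  have \<iota>_mult: "\<iota> (a \<otimes>\<^bsub>k\<^esub> b) = \<iota> a \<otimes>\<^bsub>R\<^esub> \<iota> b" if "a \<in> carrier k" "b \<in> carrier k" for a b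
    using that by (simp add: \<iota>_def A.smult_assoc1 A.smult_assoc2)
  have \<iota>_1: "\<iota> \<one>\<^bsub>k\<^esub> = \<one>\<^bsub>R\<^esub>" by (simp add: \<iota>_def A.smult_one)
  have \<iota>_0: "\<iota> \<zero>\<^bsub>k\<^esub> = \<zero>\<^bsub>R\<^esub>"
    using \<iota>_add[of "\<zero>\<^bsub>k\<^esub>" "\<zero>\<^bsub>k\<^esub>"] \<iota>c[of "\<zero>\<^bsub>k\<^esub>"] by (metis R.add.r_cancel_one k.l_zero k.zero_closed)
  have \<iota>_minus: "\<iota> (\<ominus>\<^bsub>k\<^esub> a) = \<ominus>\<^bsub>R\<^esub> \<iota> a" if "a \<in> carrier k" for a
    using that \<iota>_add[of "\<ominus>\<^bsub>k\<^esub> a" a] \<iota>c by (simp add: k.l_neg \<iota>_0 R.minus_equality)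
  \<comment> \<open>The quotient by \<open>I\<close> is the algebra, and \<open>K\<close> is the
    preimage of the scalars.\<close>
  define I where "I = {u. \<pi> u = \<zero>\<^bsub>R\<^esub>}"
  define K where "K = {u. \<pi> u \<in> \<iota> ` carrier k}"
  \<comment> \<open>The zero ring has \<open>krull_dim\<close> 0, but the dimension here is
    positive.\<close>
  have one_zero: "\<one>\<^bsub>R\<^esub> \<noteq> \<zero>\<^bsub>R\<^esub>"
  proof
    assume z: "\<one>\<^bsub>R\<^esub> = \<zero>\<^bsub>R\<^esub>"
    have "\<not> primeideal P R" for P
    proof
      assume "primeideal P R"
      then interpret P: primeideal P R .
      have "\<one>\<^bsub>R\<^esub> \<in> P" using z P.zero_closed by simp
      then show False using P.one_imp_carrier P.I_notcarr by blast
    qed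
    then have "{l. \<exists>p. (\<forall>i\<le>l. primeideal (p i) R) \<and> (\<forall>i<l. p i \<subset> p (Suc i))} = {}" by blast
    then have "krull_dim R = 0" by (simp only: krull_dim_def image_empty Sup_empty bot_enat_def)
    with dim show False by (simp add: enat_0_iff)
  qed
  have \<iota>_inj: "\<iota> c \<noteq> \<zero>\<^bsub>R\<^esub>" if c: "c \<in> carrier k" "c \<noteq> \<zero>\<^bsub>k\<^esub>" for c
  proof
    assume z: "\<iota> c = \<zero>\<^bsub>R\<^esub>"
    have u: "c \<in> Units k" using c k.field_Units by blast
    have "\<iota> (c \<otimes>\<^bsub>k\<^esub> inv\<^bsub>k\<^esub> c) = \<zero>\<^bsub>R\<^esub>"
      using \<iota>_mult[OF c(1) k.Units_inv_closed[OF u]] \<iota>c[OF k.Units_inv_closed[OF u]] z by simp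
    with u show False using one_zero by (simp add: \<iota>_1)
  qed
  have \<pi>_nat: "\<pi> (of_nat m) = \<iota> ([m] \<cdot>\<^bsub>k\<^esub> \<one>\<^bsub>k\<^esub>)" for m
    by (induction m) (simp_all add: \<pi>.h_0 \<iota>_0 \<pi>.h_add \<pi>.h_1 \<iota>_add \<iota>_1 R.a_comm \<iota>c)
  have KI: "field_mod K I"
  proof
    show "is_subring K"
      unfolding is_subring_def K_def
    proof (intro conjI ballI CollectI)
      show "\<pi> 0 \<in> \<iota> ` carrier k" "\<pi> 1 \<in> \<iota> ` carrier k"
        using imageI[OF k.zero_closed, of \<iota>] imageI[OF k.one_closed, of \<iota>]
        by (simp_all add: \<pi>.h_0 \<pi>.h_1 \<iota>_0 \<iota>_1)
      fix x y assume "x \<in> {u. \<pi> u \<in> \<iota> ` carrier k}" "y \<in> {u. \<pi> u \<in> \<iota> ` carrier k}"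
      then obtain a b where ab: "a \<in> carrier k" "b \<in> carrier k" "\<pi> x = \<iota> a" "\<pi> y = \<iota> b" by auto
      have "\<pi> (x - y) = \<iota> (a \<oplus>\<^bsub>k\<^esub> \<ominus>\<^bsub>k\<^esub> b)"
        using ab \<pi>.h_add[of x "- y"] by (simp add: \<pi>.h_uminus \<iota>_add \<iota>_minus)
      then show "\<pi> (x - y) \<in> \<iota> ` carrier k" using ab by auto
      show "\<pi> (x * y) \<in> \<iota> ` carrier k" using ab by (auto simp: \<pi>.h_mult simp flip: \<iota>_mult)
    qed
    show "is_ideal I" unfolding I_def by (rule \<pi>.kernel_ideal)
    show "I \<subseteq> K" using \<iota>_0 by (auto simp: I_def K_def intro!: image_eqI[of _ _ "\<zero>\<^bsub>k\<^esub>"])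
    show "1 \<notin> I" using one_zero by (simp add: I_def \<pi>.h_1)
    show "\<exists>c'\<in>K. c * c' - 1 \<in> I" if c: "c \<in> K" "c \<notin> I" for c
    proof -
      obtain a where a: "a \<in> carrier k" "\<pi> c = \<iota> a" using c(1) by (auto simp: K_def)
      then have "a \<noteq> \<zero>\<^bsub>k\<^esub>" using c(2) \<iota>_0 by (auto simp: I_def)
      then have u: "a \<in> Units k" using a k.field_Units by blast
      then have ia: "inv\<^bsub>k\<^esub> a \<in> carrier k" by simp
      obtain c' where c': "\<pi> c' = \<iota> (inv\<^bsub>k\<^esub> a)" using ex[OF \<iota>c[OF ia]] by blast
      have "\<pi> (c * c') = \<pi> 1" using a u ia c' by (simp add: \<pi>.h_mult \<pi>.h_1 \<iota>_1 flip: \<iota>_mult)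
      then have "c * c' - 1 \<in> I" by (simp add: I_def \<pi>.h_diff_0)
      moreover have "c' \<in> K" using c' ia by (simp add: K_def)
      ultimately show ?thesis by blast
    qed
    show "of_nat m \<notin> I" if "0 < m" for m
      using that char by (simp add: I_def \<pi>_nat \<iota>_inj)
    show "\<exists>x\<in>K. poly f x \<in> I" if f: "f \<in> polys_over K" "0 < Polynomial.degree f"
      "Polynomial.coeff f (Polynomial.degree f) \<notin> I" for f
    proof -
      have "\<exists>a. a \<in> carrier k \<and> \<pi> (Polynomial.coeff f i) = \<iota> a" for i
        using f(1) by (auto simp: polys_over_def K_def)
      then obtain a where a: "\<And>i. a i \<in> carrier k" "\<And>i. \<pi> (Polynomial.coeff f i) = \<iota> (a i)" by metis
      let ?d = "Polynomial.degree f"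
      \<comment> \<open>Lists in \<open>poly_ring\<close> begin with the leading
        coefficient.\<close>
      define p where "p = map a (rev [0..<Suc ?d])"
      have ad: "a ?d \<noteq> \<zero>\<^bsub>k\<^esub>" using f(3) a(2)[of ?d] \<iota>_0 by (auto simp: I_def)
      have p: "p \<in> carrier (poly_ring k)"
        unfolding sym[OF univ_poly_carrier] polynomial_def using a(1) ad by (auto simp: p_def)
      have len: "length p = Suc ?d" by (simp add: p_def)
      have "size (k.roots p) = ?d" using k.roots_over_carrier[OF p] len by (simp add: k.splitted_def)
      then have "k.roots p \<noteq> {#}" using f(2) by auto
      then obtain z where "z \<in># k.roots p" by blast
      then have z: "z \<in> carrier k" "k.eval p z = \<zero>\<^bsub>k\<^esub>"
        using k.roots_mem_iff_is_root[OF p] by (auto simp: k.is_root_def)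
      obtain x where x: "\<pi> x = \<iota> z" using ex[OF \<iota>c[OF z(1)]] by blast
      have pow: "\<pi> (x ^ j) = \<iota> (z [^]\<^bsub>k\<^esub> j)" for j
        by (induction j) (use z x in \<open>simp_all add: \<pi>.h_1 \<iota>_1 \<pi>.h_mult \<iota>_mult R.m_comm \<iota>c\<close>)
      have "k.eval (map a (rev [0..<m])) z \<in> carrier k \<and>
          \<pi> (\<Sum>i<m. Polynomial.coeff f i * x ^ i) = \<iota> (k.eval (map a (rev [0..<m])) z)" for m
      proof (induction m)
        case (Suc m)
        then show ?case
          using a z by (simp add: \<pi>.h_add \<pi>.h_mult pow \<iota>_add \<iota>_mult R.a_comm \<iota>c)
      qed (simp add: \<pi>.h_0 \<iota>_0)
      from this[of "Suc ?d"] have "\<pi> (poly f x) = \<zero>\<^bsub>R\<^esub>"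
        using z(2) by (simp add: poly_altdef lessThan_Suc_atMost \<iota>_0 flip: p_def del: upt_Suc)
      then show ?thesis using x z(1) by (auto simp: I_def K_def)
    qed
  qed
  then interpret KI: field_mod K I .
  obtain xs where xs: "set xs = S" using S(1) finite_list by blast
  have "\<exists>u. \<pi> u = s" if "s \<in> S" for s using ex S(2) that by blast
  then obtain v where v: "\<And>s. s \<in> S \<Longrightarrow> \<pi> (v s) = s" by metis
  let ?A = "foldl poly_ext K (map v xs)"
  have A_sub: "is_subring B \<Longrightarrow> is_subring (foldl poly_ext B ts) \<and> B \<union> set ts \<subseteq> foldl poly_ext B ts" for B ts
  proof (induction ts arbitrary: B)
    case (Cons t ts)
    have "is_subring (poly_ext B t)" "B \<subseteq> poly_ext B t" "t \<in> poly_ext B t"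
      using Cons.prems by (auto intro: poly_ext_subring poly_ext_self dest: poly_ext_super)
    with Cons.IH[of "poly_ext B t"] show ?case by auto
  qed simp
  have A: "is_subring ?A" "K \<subseteq> ?A" "v ` S \<subseteq> ?A" using A_sub[OF KI.K, of "map v xs"] xs by auto
  have lift: "\<exists>u\<in>?A. \<pi> u = r" if "r \<in> generate_ring R ((\<lambda>c. c \<odot>\<^bsub>R\<^esub> \<one>\<^bsub>R\<^esub>) ` carrier k \<union> S)" for r
    using that
  proof induction
    case one
    show ?case using subring_1[OF A(1)] \<pi>.h_1 by blast
  next
    case (incl r)
    show ?case
    proof (cases "r \<in> S")
      case True
      then show ?thesis using v A(3) by blast
    next
      case False
      then obtain c where c: "c \<in> carrier k" "r = \<iota> c" using incl by (auto simp: \<iota>_def)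
      then obtain u where "\<pi> u = r" using ex \<iota>c by blast
      then have "u \<in> K" using c by (simp add: K_def)
      then show ?thesis using \<open>\<pi> u = r\<close> A(2) by blast
    qed
  next
    case (a_inv r)
    then show ?case using subring_uminus[OF A(1)] \<pi>.h_uminus by metis
  next
    case (eng_add r r')
    then show ?case using subring_add[OF A(1)] \<pi>.h_add by metis
  next
    case (eng_mult r r')
    then show ?case using subring_mult[OF A(1)] \<pi>.h_mult by metis
  qed
  have "?A = UNIV"
  proof -
    have "u \<in> ?A" for u
    proof -
      \<comment> \<open>Lifting through the generators reaches \<open>u\<close> up to an element of
        \<open>I\<close>, and \<open>I\<close> lies in \<open>K\<close>.\<close>
      obtain w where w: "w \<in> ?A" "\<pi> w = \<pi> u" using lift[of "\<pi> u"] S(3) \<pi>.h_closed[of u] by auto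
      then have "u - w \<in> ?A" using KI.IK A(2) \<pi>.h_diff_0[of u w] by (auto simp: I_def)
      from subring_add[OF A(1) this w(1)] show ?thesis by simp
    qed
    then show ?thesis by blast
  qed
  then interpret affine_mod K I "map v xs" by unfold_locales
  have FR: "F \<in> carrier (mpoly_ring R {..<n})"
    and res: "\<And>P. primeideal P R \<Longrightarrow> coordinate (residue_field R P) n (residue_map R P \<circ> F)"
    using F by (auto simp: residual_coordinate_def)
  obtain G where G: "only_below n G" "\<pi>.hpoly G = F" using \<pi>.hpoly_surj[OF surj FR] by blast
  have gen: "gen_coord Q n G" if Q: "is_prime Q" "I \<subseteq> Q" for Q
  proof -
    have P: "primeideal (\<pi> ` Q) R" and mem: "\<And>u. \<pi> u \<in> \<pi> ` Q \<longleftrightarrow> u \<in> Q"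
      using \<pi>.prime_image[OF surj Q(1)] Q(2) unfolding I_def by blast+
    let ?P = "\<pi> ` Q"
    interpret L: field "residue_field R ?P" by (rule R.residue_field_field[OF P])
    note hom = R.residue_map_hom[OF P]
    \<comment> \<open>The composite with the residue map has kernel \<open>Q\<close>, and each
      element of the residue field is a fraction of its values.\<close>
    interpret \<rho>: class_hom "residue_field R ?P" "\<lambda>u. residue_map R ?P (\<pi> u)"
      by unfold_locales (simp_all add: hom(1-4) \<pi>.h_add \<pi>.h_mult \<pi>.h_1)
    have "\<rho>.hpoly G = residue_map R ?P \<circ> F"
      unfolding G(2)[symmetric] by (auto simp: \<rho>.hpoly_def \<pi>.hpoly_def)
    then have c: "coordinate (residue_field R ?P) n (\<rho>.hpoly G)" using res[OF P] by simp
    show ?thesis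
    proof (rule \<rho>.gen_coord_of_coordinate[OF _ Q(1) _ G(1) c])
      show "residue_map R ?P (\<pi> u) = \<zero>\<^bsub>residue_field R ?P\<^esub> \<longleftrightarrow> u \<in> Q" for u
        by (simp add: hom(5) mem)
      show "\<exists>s u. s \<notin> Q \<and> residue_map R ?P (\<pi> s) \<otimes>\<^bsub>residue_field R ?P\<^esub> x = residue_map R ?P (\<pi> u)"
        if x: "x \<in> carrier (residue_field R ?P)" for x
      proof -
        obtain s a where sa: "s \<in> carrier R" "a \<in> carrier R" "s \<notin> ?P"
          "residue_map R ?P s \<otimes>\<^bsub>residue_field R ?P\<^esub> x = residue_map R ?P a" using hom(6)[OF x] by blast
        obtain s' u where "\<pi> s' = s" "\<pi> u = a" using ex sa by blast
        with sa mem show ?thesis by blast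
      qed
    qed
  qed
  \<comment> \<open>The dimension is \<open>Suc d\<close> in this lemma, so that \<open>d\<close>
    counts the doublings after dimension 1.\<close>
  have no_chain: "\<not> prime_chain I (Suc (Suc d))"
  proof
    assume "prime_chain I (Suc (Suc d))"
    then obtain p where p: "\<And>i. i \<le> Suc (Suc d) \<Longrightarrow> is_prime (p i)" "\<And>i. i \<le> Suc (Suc d) \<Longrightarrow> I \<subseteq> p i"
      "\<And>i. i < Suc (Suc d) \<Longrightarrow> p i \<subset> p (Suc i)" unfolding prime_chain_def by blast
    have im: "primeideal (\<pi> ` p i) R" "\<And>u. \<pi> u \<in> \<pi> ` p i \<longleftrightarrow> u \<in> p i" if "i \<le> Suc (Suc d)" for i
      using \<pi>.prime_image[OF surj p(1)[OF that]] p(2)[OF that] unfolding I_def by blast+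
    have "\<pi> ` p i \<subset> \<pi> ` p (Suc i)" if i: "i < Suc (Suc d)" for i
    proof -
      obtain u where "u \<in> p (Suc i)" "u \<notin> p i" using p(3)[OF i] by blast
      then have "\<pi> u \<in> \<pi> ` p (Suc i)" "\<pi> u \<notin> \<pi> ` p i" using im(2)[of i] i by auto
      moreover have "\<pi> ` p i \<subseteq> \<pi> ` p (Suc i)" using p(3)[OF i] by blast
      ultimately show ?thesis by blast
    qed
    then have "enat (Suc (Suc d)) \<le> krull_dim R"
      unfolding krull_dim_def using im(1) by (intro SUP_upper CollectI exI[of _ "\<lambda>i. \<pi> ` p i"]) simp
    with dim show False by simp
  qed
  have "coord {u. \<pi> u = \<zero>\<^bsub>R\<^esub>} (2 ^ d * Suc n) G"
    unfolding I_def[symmetric]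
    using n by (intro coord_dim[OF _ G(1) gen KI.I order_refl no_chain]) auto
  moreover have "n \<le> 2 ^ d * Suc n" using mult_le_mono[of 1 "2 ^ d" n "Suc n"] by simp
  then have "only_below (2 ^ d * Suc n) G" by (rule only_below_mono[OF G(1)])
  ultimately show ?thesis unfolding G(2)[symmetric] by (intro \<pi>.coordinate_of_coord[OF surj])
qed

theorem theorem3p7:
  fixes k :: "('k, 's) ring_scheme"
    and R :: "('k, 'a, 't) module_scheme"
    and d n r :: nat
  assumes "algebraically_closed k"
    and "\<forall>m::nat. m > 0 \<longrightarrow> [m] \<cdot>\<^bsub>k\<^esub> \<one>\<^bsub>k\<^esub> \<noteq> \<zero>\<^bsub>k\<^esub>"
    and "fin_gen_algebra k R"
    and "krull_dim R = enat d"
    and "d \<ge> 1"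
    and "n \<ge> 1"
    and "r = (2 ^ d - 1) * n - 2 ^ (d - 1) * (n - 1)"
  shows "r = 2 ^ (d - 1) * (n + 1) - n \<and>
    (\<forall>F. residual_coordinate R n F \<longrightarrow> stable_coordinate R n r F)"
proof (intro conjI allI impI)
  show r: "r = 2 ^ (d - 1) * (n + 1) - n" using coordinate_count(1)[OF assms(5,6)] assms(7) by simp
  fix F assume F: "residual_coordinate R n F"
  obtain e where e: "d = Suc e" using assms(5) by (cases d) auto
  have "n + r = 2 ^ e * Suc n" using coordinate_count(2)[OF assms(5,6)] r e by simp
  moreover have "coordinate R (2 ^ e * Suc n) F"
    using residual_stable[OF assms(1-3) _ assms(6) F] assms(4) e by simp
  ultimately show "stable_coordinate R n r F"
    using F by (simp add: stable_coordinate_def residual_coordinate_def)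
qed

end
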